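(* Let $G$ be a connected complex linear algebraic group and $\mathfrak{g}=\operatorname{Lie}(G)$ its Lie algebra. Then the set of annihilators of simple Poisson $\mathbb{C}[\mathfrak{g}^*]$-modules lies in natural bijection with the set $\mathfrak{g}^*/G$ of coadjoint orbits.
   Context: $\mathbb{C}[\mathfrak{g}^*]=S(\mathfrak{g})$ carries the Lie–Poisson bracket, the unique Poisson bracket extending the Lie bracket of $\mathfrak{g}$. For a complex Poisson algebra $Z$, a Poisson $Z$-module is a $Z$-module $M$ with a linear map $\nabla:Z\to\operatorname{End}_{\mathbb{C}}(M)$ such that for all $x,y,a\in Z$, $m\in M$: (i) $\nabla(xy)m=x\nabla(y)m+y\nabla(x)m$; (ii) $\{x,a\}m=[\nabla(x),a]m$; (iii) $\nabla(\{x,y\})m=[\nabla(x),\nabla(y)]m$. It is simple if it is non-zero and has no proper non-zero $\nabla(Z)$-stable $Z$-submodule. The annihilator of $M$ is $\{z\in Z:zM=0\}$. *)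

theory Defs
  imports
    "HOL-Analysis.Analysis"
    "HOL-Algebra.Module"
    "HOL-Algebra.Group_Action"
begin

section \<open>Poisson algebras and Poisson modules\<close>

definition complex_field :: "complex ring"
  where "complex_field = \<lparr>carrier = UNIV, mult = (*), one = 1, zero = 0, add = (+)\<rparr>"

locale poisson_algebra = algebra complex_field Z
  for Z :: "(complex, 'z) module" (structure) +
  fixes br :: "'z \<Rightarrow> 'z \<Rightarrow> 'z"
  assumes br_closed: "\<lbrakk>x \<in> carrier Z; y \<in> carrier Z\<rbrakk> \<Longrightarrow> br x y \<in> carrier Z"
    and br_add: "\<lbrakk>x \<in> carrier Z; y \<in> carrier Z; z \<in> carrier Z\<rbrakk>
      \<Longrightarrow> br (x \<oplus> y) z = br x z \<oplus> br y z"
    and br_smult: "\<lbrakk>x \<in> carrier Z; y \<in> carrier Z\<rbrakk> \<Longrightarrow> br (c \<odot> x) y = c \<odot> br x y"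
    and br_antisym: "\<lbrakk>x \<in> carrier Z; y \<in> carrier Z\<rbrakk> \<Longrightarrow> br x y = \<ominus> br y x"
    and br_jacobi: "\<lbrakk>x \<in> carrier Z; y \<in> carrier Z; z \<in> carrier Z\<rbrakk>
      \<Longrightarrow> br x (br y z) \<oplus> br y (br z x) \<oplus> br z (br x y) = \<zero>"
    and br_leibniz: "\<lbrakk>x \<in> carrier Z; y \<in> carrier Z; z \<in> carrier Z\<rbrakk>
      \<Longrightarrow> br (x \<otimes> y) z = x \<otimes> br y z \<oplus> y \<otimes> br x z"

text \<open>The complex scalar \<open>c\<close> acts on a \<open>Z\<close>-module \<open>M\<close> as the element \<open>c \<odot> \<one>\<close> of \<open>Z\<close>; this is
  the vector space structure with respect to which \<open>nabla\<close> is linear.\<close>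

locale poisson_module = poisson_algebra Z br + M: module Z M
  for Z :: "(complex, 'z) module" (structure)
    and br :: "'z \<Rightarrow> 'z \<Rightarrow> 'z"
    and M :: "('z, 'm) module" +
  fixes nabla :: "'z \<Rightarrow> 'm \<Rightarrow> 'm"
  assumes nabla_closed: "\<lbrakk>x \<in> carrier Z; m \<in> carrier M\<rbrakk> \<Longrightarrow> nabla x m \<in> carrier M"
    and nabla_end_add: "\<lbrakk>x \<in> carrier Z; m \<in> carrier M; n \<in> carrier M\<rbrakk>
      \<Longrightarrow> nabla x (m \<oplus>\<^bsub>M\<^esub> n) = nabla x m \<oplus>\<^bsub>M\<^esub> nabla x n"
    and nabla_end_smult: "\<lbrakk>x \<in> carrier Z; m \<in> carrier M\<rbrakk>
      \<Longrightarrow> nabla x ((c \<odot> \<one>) \<odot>\<^bsub>M\<^esub> m) = (c \<odot> \<one>) \<odot>\<^bsub>M\<^esub> nabla x m"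
    and nabla_add: "\<lbrakk>x \<in> carrier Z; y \<in> carrier Z; m \<in> carrier M\<rbrakk>
      \<Longrightarrow> nabla (x \<oplus> y) m = nabla x m \<oplus>\<^bsub>M\<^esub> nabla y m"
    and nabla_smult: "\<lbrakk>x \<in> carrier Z; m \<in> carrier M\<rbrakk>
      \<Longrightarrow> nabla (c \<odot> x) m = (c \<odot> \<one>) \<odot>\<^bsub>M\<^esub> nabla x m"
    and nabla_mult: "\<lbrakk>x \<in> carrier Z; y \<in> carrier Z; m \<in> carrier M\<rbrakk>
      \<Longrightarrow> nabla (x \<otimes> y) m = x \<odot>\<^bsub>M\<^esub> nabla y m \<oplus>\<^bsub>M\<^esub> y \<odot>\<^bsub>M\<^esub> nabla x m"
    and nabla_br_smult: "\<lbrakk>x \<in> carrier Z; a \<in> carrier Z; m \<in> carrier M\<rbrakk>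
      \<Longrightarrow> br x a \<odot>\<^bsub>M\<^esub> m = nabla x (a \<odot>\<^bsub>M\<^esub> m) \<ominus>\<^bsub>M\<^esub> a \<odot>\<^bsub>M\<^esub> nabla x m"
    and nabla_br: "\<lbrakk>x \<in> carrier Z; y \<in> carrier Z; m \<in> carrier M\<rbrakk>
      \<Longrightarrow> nabla (br x y) m = nabla x (nabla y m) \<ominus>\<^bsub>M\<^esub> nabla y (nabla x m)"

definition simple_poisson_module ::
    "(complex, 'z) module \<Rightarrow> ('z \<Rightarrow> 'z \<Rightarrow> 'z) \<Rightarrow> ('z, 'm) module \<Rightarrow> ('z \<Rightarrow> 'm \<Rightarrow> 'm) \<Rightarrow> bool"
  where "simple_poisson_module Z br M nabla \<longleftrightarrow>
    poisson_module Z br M nabla \<and> carrier M \<noteq> {\<zero>\<^bsub>M\<^esub>} \<and>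
    (\<forall>N. submodule N Z M \<and> (\<forall>x\<in>carrier Z. \<forall>m\<in>N. nabla x m \<in> N)
      \<longrightarrow> N = {\<zero>\<^bsub>M\<^esub>} \<or> N = carrier M)"

definition annihilator :: "(complex, 'z) module \<Rightarrow> ('z, 'm) module \<Rightarrow> 'z set"
  where "annihilator Z M = {z \<in> carrier Z. \<forall>m\<in>carrier M. z \<odot>\<^bsub>M\<^esub> m = \<zero>\<^bsub>M\<^esub>}"

text \<open>HOL cannot collect modules over all types at once, so the type \<open>'m\<close> of module elements is a
  parameter. Carriers are arbitrary subsets of it, so a sufficiently large \<open>'m\<close> realises every
  annihilator that occurs over any type.\<close>

definition simple_annihilators ::
    "'m itself \<Rightarrow> (complex, 'z) module \<Rightarrow> ('z \<Rightarrow> 'z \<Rightarrow> 'z) \<Rightarrow> 'z set set"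
  where "simple_annihilators _ Z br =
    {annihilator Z M | (M :: ('z, 'm) module) nabla. simple_poisson_module Z br M nabla}"


section \<open>Polynomial functions\<close>

text \<open>The functions on \<open>D\<close> that are polynomials in the members of \<open>L\<close>. They are taken to be
  extensional, so that equality of elements is equality of functions on \<open>D\<close>.\<close>

inductive_set polyfuns :: "'v set \<Rightarrow> ('v \<Rightarrow> complex) set \<Rightarrow> ('v \<Rightarrow> complex) set"
  for D L where
  const: "(\<lambda>v\<in>D. c) \<in> polyfuns D L"
| coord: "l \<in> L \<Longrightarrow> (\<lambda>v\<in>D. l v) \<in> polyfuns D L"
| add: "\<lbrakk>p \<in> polyfuns D L; q \<in> polyfuns D L\<rbrakk> \<Longrightarrow> (\<lambda>v\<in>D. p v + q v) \<in> polyfuns D L"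
| mult: "\<lbrakk>p \<in> polyfuns D L; q \<in> polyfuns D L\<rbrakk> \<Longrightarrow> (\<lambda>v\<in>D. p v * q v) \<in> polyfuns D L"

definition polyfun_algebra :: "'v set \<Rightarrow> ('v \<Rightarrow> complex) set \<Rightarrow> (complex, 'v \<Rightarrow> complex) module"
  where "polyfun_algebra D L =
    \<lparr>carrier = polyfuns D L, mult = (\<lambda>p q. \<lambda>v\<in>D. p v * q v), one = (\<lambda>v\<in>D. 1),
     zero = (\<lambda>v\<in>D. 0), add = (\<lambda>p q. \<lambda>v\<in>D. p v + q v), smult = (\<lambda>c p. \<lambda>v\<in>D. c * p v)\<rparr>"


section \<open>Linear algebraic groups and their Lie algebras\<close>

type_synonym 'n cmat = "complex^'n^'n"

definition matrix_polys :: "('n::finite cmat \<Rightarrow> complex) set"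
  where "matrix_polys = polyfuns UNIV {\<lambda>A. A $ i $ j | i j. True}"

definition zariski :: "'n::finite cmat topology"
  where "zariski = topology (\<lambda>U. \<exists>P \<subseteq> matrix_polys. U = - {A. \<forall>p\<in>P. p A = 0})"

definition GL :: "'n::finite cmat monoid"
  where "GL = \<lparr>carrier = {A. invertible A}, mult = (**), one = mat 1\<rparr>"

definition linear_algebraic_group :: "'n::finite cmat set \<Rightarrow> bool"
  where "linear_algebraic_group G \<longleftrightarrow>
    subgroup G GL \<and> closedin (subtopology zariski (carrier GL)) G"

definition cscale :: "complex \<Rightarrow> 'n::finite cmat \<Rightarrow> 'n cmat"
  where "cscale c X = (\<chi> i j. c * X $ i $ j)"

definition commutator :: "'n::finite cmat \<Rightarrow> 'n cmat \<Rightarrow> 'n cmat"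
  where "commutator X Y = X ** Y - Y ** X"

text \<open>The tangent space of \<open>G\<close> at the identity, cut out by the differentials of all polynomials
  vanishing on \<open>G\<close>; its Lie bracket is the commutator.\<close>

definition Lie :: "'n::finite cmat set \<Rightarrow> 'n cmat set"
  where "Lie G = {X. \<forall>p\<in>matrix_polys. (\<forall>A\<in>G. p A = 0) \<longrightarrow>
    ((\<lambda>t. p (mat 1 + cscale t X)) has_field_derivative 0) (at 0)}"


section \<open>The dual of a Lie algebra of matrices\<close>

definition dual :: "'n::finite cmat set \<Rightarrow> ('n cmat \<Rightarrow> complex) set"
  where "dual L = {\<phi> \<in> extensional L.
    (\<forall>X\<in>L. \<forall>Y\<in>L. \<phi> (X + Y) = \<phi> X + \<phi> Y) \<and> (\<forall>c. \<forall>X\<in>L. \<phi> (cscale c X) = c * \<phi> X)}"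

definition lin :: "'n::finite cmat set \<Rightarrow> 'n cmat \<Rightarrow> ('n cmat \<Rightarrow> complex) \<Rightarrow> complex"
  where "lin L X = (\<lambda>\<phi>\<in>dual L. \<phi> X)"

text \<open>An element \<open>X\<close> of \<open>L\<close> is identified with the linear function \<open>lin L X\<close> on \<open>dual L\<close>, so that
  \<open>coord_algebra L\<close> is the symmetric algebra of \<open>L\<close>.\<close>

definition coord_algebra ::
    "'n::finite cmat set \<Rightarrow> (complex, ('n cmat \<Rightarrow> complex) \<Rightarrow> complex) module"
  where "coord_algebra L = polyfun_algebra (dual L) (lin L ` L)"

text \<open>This property determines \<open>br\<close> on the carrier, as the functions \<open>lin L X\<close> generate the algebra.\<close>

definition lie_poisson_bracket ::
    "'n::finite cmat set \<Rightarrow>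
     ((('n cmat \<Rightarrow> complex) \<Rightarrow> complex) \<Rightarrow> (('n cmat \<Rightarrow> complex) \<Rightarrow> complex) \<Rightarrow>
      (('n cmat \<Rightarrow> complex) \<Rightarrow> complex)) \<Rightarrow> bool"
  where "lie_poisson_bracket L br \<longleftrightarrow>
    poisson_algebra (coord_algebra L) br \<and>
    (\<forall>X\<in>L. \<forall>Y\<in>L. br (lin L X) (lin L Y) = lin L (commutator X Y))"

definition coadjoint ::
    "'n::finite cmat set \<Rightarrow> 'n cmat \<Rightarrow> ('n cmat \<Rightarrow> complex) \<Rightarrow> ('n cmat \<Rightarrow> complex)"
  where "coadjoint L g \<phi> = (\<lambda>X\<in>L. \<phi> (matrix_inv g ** X ** g))"

definition coadjoint_orbits :: "'n::finite cmat set \<Rightarrow> ('n cmat \<Rightarrow> complex) set set"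
  where "coadjoint_orbits G = orbits (GL\<lparr>carrier := G\<rparr>) (dual (Lie G)) (coadjoint (Lie G))"

definition vanishing_ideal ::
    "'n::finite cmat set \<Rightarrow> ('n cmat \<Rightarrow> complex) set \<Rightarrow> (('n cmat \<Rightarrow> complex) \<Rightarrow> complex) set"
  where "vanishing_ideal L S = {f \<in> carrier (coord_algebra L). \<forall>\<phi>\<in>S. f \<phi> = 0}"

end

theory Submission
  imports Defs "HOL-Library.Function_Algebras" "HOL-Computational_Algebra.Fundamental_Theorem_Algebra"
begin

text \<open>Let \<open>core \<phi>\<close> be the largest Poisson ideal inside the maximal ideal of \<open>\<phi>\<close>.

  Every \<open>core \<phi>\<close> annihilates a simple module, the one spanned by the iterated Hamiltonian derivatives of the
  delta distribution at \<open>\<phi>\<close>. Conversely, a simple module \<open>M\<close> has countable dimension, so Amitsur's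
  trick yields Schur's lemma over \<open>\<complex>\<close> and a Nullstellensatz in which countably many functions can be kept
  nonzero. Choose \<open>v \<in> M\<close> whose annihilator \<open>J\<close> is maximal, hence prime, and a point \<open>\<phi>\<close> of its zero set
  that avoids the countably many pivots arising when elements of \<open>S(\<gg>)\<close>, linearly independent modulo \<open>Ann M\<close>,
  are separated by their iterated brackets modulo \<open>J\<close>; then \<open>Ann M = core \<phi>\<close>.

  The ideal \<open>core \<phi>\<close> is the ideal of the orbit of \<open>\<phi>\<close>. The latter is a Poisson ideal, since the
  Hamiltonian vector field of a linear function is an infinitesimal coadjoint action. Conversely, the pullback
  of \<open>f \<in> core \<phi>\<close> to \<open>G\<close> has vanishing iterated derivatives at \<open>1\<close>, so it vanishes by Krull's intersection
  theorem, because the coordinate ring of a connected group is a domain. Finally, let two orbits have the same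
  ideal. By generic freeness of the functions on \<open>G\<close> over those on the common closure, there are countably many
  nonzero functions such that every point of the closure where none of them vanishes is on the first orbit; the
  second orbit contains such a point.\<close>

subsection \<open>Noetherian rings\<close>

text \<open>In both halves one open condition is not enough. No finite set of brackets is known to
  detect membership in \<open>Ann M\<close>, and generic freeness controls only finitely many
  functions on \<open>G\<close> at a time. Each finite stage yields one nonzero function to avoid;
  the uncountability of \<open>\<complex>\<close> provides points that avoid all of them, hence a
  Nullstellensatz with a countable multiplicative set. Independence modulo \<open>Ann M\<close>
  survives the passage to the larger prime \<open>J\<close> because all iterated brackets are tested
  at once: the solution spaces are then Poisson stable, and simplicity acts as in Jacobson's density
  theorem. The curves \<open>mat 1 + cscale t X\<close> leave \<open>G\<close>, so derivatives are
  taken on functionals of all matrices, and \<open>proj\<close> extends elements of the dual to such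
  functionals. Rings are kept as functions on whole types, where the type class supplies pointwise
  operations; restriction to \<open>D\<close> links them to the extensional coordinate algebra.
  Connectedness enters through primality: derivatives at the identity say nothing about other
  components.\<close>

definition is_subring :: "'a::comm_ring_1 set \<Rightarrow> bool" where
  "is_subring R \<longleftrightarrow> 0 \<in> R \<and> 1 \<in> R \<and> (\<forall>x\<in>R. \<forall>y\<in>R. x + y \<in> R \<and> x * y \<in> R) \<and> (\<forall>x\<in>R. - x \<in> R)"

lemma is_subringD:
  assumes "is_subring R"
  shows "0 \<in> R" "1 \<in> R" "x \<in> R \<Longrightarrow> y \<in> R \<Longrightarrow> x + y \<in> R" "x \<in> R \<Longrightarrow> y \<in> R \<Longrightarrow> x * y \<in> R"
    "x \<in> R \<Longrightarrow> - x \<in> R" "x \<in> R \<Longrightarrow> y \<in> R \<Longrightarrow> x - y \<in> R" "x \<in> R \<Longrightarrow> x ^ n \<in> R"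
proof -
  show *: "0 \<in> R" "1 \<in> R" "x \<in> R \<Longrightarrow> y \<in> R \<Longrightarrow> x + y \<in> R" "x \<in> R \<Longrightarrow> y \<in> R \<Longrightarrow> x * y \<in> R"
    "x \<in> R \<Longrightarrow> - x \<in> R" for x y
    using assms by (auto simp: is_subring_def)
  show "x \<in> R \<Longrightarrow> y \<in> R \<Longrightarrow> x - y \<in> R"
    using *(3)[of x "- y"] *(5)[of y] by simp
  show "x \<in> R \<Longrightarrow> x ^ n \<in> R"
    by (induction n) (auto intro: *)
qed

lemma subring_sum:
  assumes "is_subring R" "\<And>i. i \<in> A \<Longrightarrow> f i \<in> R"
  shows "sum f A \<in> R"
  using assms(2) by (induction A rule: infinite_finite_induct) (auto intro: is_subringD[OF assms(1)])

text \<open>The ascending chain condition, for the ideals generated by the initial segments of a sequence.\<close>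

definition noeth :: "'a::comm_ring_1 set \<Rightarrow> bool" where
  "noeth R \<longleftrightarrow> (\<forall>h. (\<forall>k::nat. h k \<in> R) \<longrightarrow> (\<exists>n r. (\<forall>k. r k \<in> R) \<and> h n = (\<Sum>k<n. r k * h k)))"

definition adjoin :: "'a::comm_ring_1 set \<Rightarrow> 'a \<Rightarrow> 'a set" where
  "adjoin R x = {\<Sum>i<n. r i * x ^ i | n r. \<forall>i. r i \<in> R}"

lemma adjoinI: "(\<And>i. r i \<in> R) \<Longrightarrow> f = (\<Sum>i<n. r i * x ^ i) \<Longrightarrow> f \<in> adjoin R x"
  unfolding adjoin_def by blast

text \<open>Counts coefficients, so it is the degree plus one of a shortest representation; on
  \<open>adjoin R x\<close> it is 0 only at 0.\<close>

definition adeg :: "'a::comm_ring_1 set \<Rightarrow> 'a \<Rightarrow> 'a \<Rightarrow> nat" where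
  "adeg R x f = (LEAST n. \<exists>r. (\<forall>i. r i \<in> R) \<and> f = (\<Sum>i<n. r i * x ^ i))"

lemma adeg_repr:
  assumes "f \<in> adjoin R x"
  obtains r where "\<And>i. r i \<in> R" "f = (\<Sum>i<adeg R x f. r i * x ^ i)"
proof -
  have "\<exists>n r. (\<forall>i. r i \<in> R) \<and> f = (\<Sum>i<n. r i * x ^ i)"
    using assms by (auto simp: adjoin_def)
  from LeastI_ex[OF this] show ?thesis
    using that unfolding adeg_def by blast
qed

lemma adeg_le: "(\<And>i. r i \<in> R) \<Longrightarrow> adeg R x (\<Sum>i<n. r i * x ^ i) \<le> n"
  unfolding adeg_def by (rule Least_le) blast

text \<open>Hilbert's basis theorem. As \<open>x\<close> may be algebraic over \<open>R\<close>, the smallest degree of a representing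
  polynomial, \<open>adeg\<close>, takes the place of the degree.\<close>

lemma noeth_adjoin:
  fixes R :: "'a::comm_ring_1 set"
  assumes R: "is_subring R" and N: "noeth R" and AR: "is_subring (adjoin R x)"
  shows "noeth (adjoin R x)"
proof (rule ccontr)
  let ?S = "adjoin R x"
  note Rs = is_subringD[OF R]
  note Ss = is_subringD[OF AR]
  define gen where "gen h n = {\<Sum>k<n. r k * h k | r. \<forall>k. r k \<in> ?S}" for h :: "nat \<Rightarrow> 'a" and n :: nat
  have RS: "R \<subseteq> ?S"
  proof
    fix r assume "r \<in> R"
    then show "r \<in> ?S" by (intro adjoinI[where n = 1 and r = "\<lambda>_. r"]) auto
  qed
  have xS: "x \<in> ?S"
    by (rule adjoinI[where n = 2 and r = "\<lambda>i. if i = 1 then 1 else 0"]) (auto simp: Rs numeral_2_eq_2)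
  have genI: "a \<in> gen h n" if "\<And>k. r k \<in> ?S" "a = (\<Sum>k<n. r k * h k)" for a h n r
    using that unfolding gen_def by blast
  have gen0: "0 \<in> gen h n" for h n
    by (rule genI[where r = "\<lambda>_. 0"]) (simp_all add: Ss)
  have gen_add: "a + b \<in> gen h n" if "a \<in> gen h n" "b \<in> gen h n" for a b h n
  proof -
    from that obtain r s where "a = (\<Sum>k<n. r k * h k)" "\<forall>k. r k \<in> ?S"
      "b = (\<Sum>k<n. s k * h k)" "\<forall>k. s k \<in> ?S" by (auto simp: gen_def)
    then show ?thesis
      by (intro genI[where r = "\<lambda>k. r k + s k"]) (simp_all add: sum.distrib distrib_right Ss)
  qed
  have gen_mult: "c * a \<in> gen h n" if "a \<in> gen h n" "c \<in> ?S" for a c h n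
  proof -
    from that obtain r where "a = (\<Sum>k<n. r k * h k)" "\<forall>k. r k \<in> ?S"
       by (auto simp: gen_def)
    then show ?thesis using that
      by (intro genI[where r = "\<lambda>k. c * r k"]) (simp_all add: sum_distrib_left mult.assoc Ss)
  qed
  have gen_mem: "h k \<in> gen h n" if "k < n" for h n k
  proof (rule genI[where r = "\<lambda>j. if j = k then 1 else 0"])
    have "(\<Sum>j<n. (if j = k then 1 else 0) * h j) = (\<Sum>j<n. if j = k then h j else 0)"
      by (intro sum.cong) auto
    then show "h k = (\<Sum>j<n. (if j = k then 1 else 0) * h j)" using that by simp
  qed (use Ss(1,2) in auto)
  have gen_sum: "(\<Sum>k<m. c k * f k) \<in> gen h n" if "\<And>k. k < m \<Longrightarrow> f k \<in> gen h n" "\<And>k. c k \<in> ?S" for c f h n and m :: nat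
    using that by (induction m) (auto intro!: gen0 gen_add gen_mult)
  assume "\<not> noeth ?S"
  then obtain h where hS: "\<And>k. h k \<in> ?S" and hn: "\<And>n. h n \<notin> gen h n"
    unfolding noeth_def gen_def by blast
  \<comment> \<open>The ideal generated by the whole sequence. Any finite list in it lies in one
    \<open>gen h N\<close>, which misses \<open>h N\<close>, so it is not finitely
    generated.\<close>
  define I where "I = (\<Union>n. gen h n)"
  have genS: "gen h n \<subseteq> ?S" if "\<And>k. h k \<in> ?S" for h n
    using that unfolding gen_def by (auto intro!: subring_sum[OF AR] Ss)
  have gen_mono: "gen h m \<subseteq> gen h n" if "m \<le> n" for m n h
  proof
    fix a assume "a \<in> gen h m"
    then obtain r where "a = (\<Sum>k<m. r k * h k)" "\<forall>k. r k \<in> ?S" by (auto simp: gen_def)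
    then show "a \<in> gen h n" using that by (auto intro!: gen_sum gen_mem)
  qed
  have IS: "I \<subseteq> ?S" using genS[of h, OF hS] unfolding I_def by blast
  have I_add: "a + b \<in> I" if "a \<in> I" "b \<in> I" for a b
  proof -
    from that obtain m n where "a \<in> gen h m" "b \<in> gen h n" by (auto simp: I_def)
    then have "a \<in> gen h (max m n)" "b \<in> gen h (max m n)"
      using gen_mono[of m "max m n"] gen_mono[of n "max m n"] by auto
    then have "a + b \<in> gen h (max m n)" by (rule gen_add)
    then show ?thesis unfolding I_def by blast
  qed
  have I_mult: "c * a \<in> I" if "a \<in> I" "c \<in> ?S" for a c
    using that gen_mult[of a h _ c] unfolding I_def by blast
  have I0: "0 \<in> I" using gen0[of h 0] unfolding I_def by blast
  have I_sum: "(\<Sum>k<m. c k * f k) \<in> I" if "\<And>k. k < m \<Longrightarrow> f k \<in> I" "\<And>k. k < m \<Longrightarrow> c k \<in> ?S" for c f and m :: nat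
    using that by (induction m) (auto intro!: I0 I_add I_mult)
  have ex: "\<exists>g. g \<in> I \<and> g \<notin> gen f m" if f: "\<And>k. k < m \<Longrightarrow> f k \<in> I" for f and m :: nat
  proof -
    have "\<exists>N. \<forall>k<m. f k \<in> gen h N" using f
    proof (induction m)
      case (Suc m)
      then obtain N N' where "\<forall>k<m. f k \<in> gen h N" "f m \<in> gen h N'"
        unfolding I_def by (metis UN_E less_Suc_eq)
      then have "\<forall>k<Suc m. f k \<in> gen h (max N N')"
        using gen_mono[of N "max N N'" h] gen_mono[of N' "max N N'" h] by (auto simp: less_Suc_eq)
      then show ?case ..
    qed simp
    then obtain N where N: "\<And>k. k < m \<Longrightarrow> f k \<in> gen h N" by blast
    have "gen f m \<subseteq> gen h N"
    proof
      fix a assume "a \<in> gen f m"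
      then obtain r where "a = (\<Sum>k<m. r k * f k)" "\<forall>k. r k \<in> ?S" by (auto simp: gen_def)
      then show "a \<in> gen h N" using N by (auto intro!: gen_sum)
    qed
    then have "h N \<in> I \<and> h N \<notin> gen f m"
      using hn[of N] gen_mem[of N "Suc N" h] by (auto simp: I_def)
    then show ?thesis ..
  qed
  \<comment> \<open>Each choice depends on all earlier ones, so the choices are accumulated in the
    list \<open>F n\<close>; \<open>f n\<close> has least \<open>adeg\<close> among the elements of
    \<open>I\<close> outside the ideal of its predecessors.\<close>
  define pick where "pick fs = (ARG_MIN (adeg R x) g. g \<in> I \<and> g \<notin> gen (\<lambda>k. fs ! k) (length fs))" for fs
  define F where "F n = ((\<lambda>fs. fs @ [pick fs]) ^^ n) []" for n :: nat
  have F_Suc: "F (Suc n) = F n @ [pick (F n)]" for n by (simp add: F_def)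
  have lenF: "length (F n) = n" for n by (induction n) (auto simp: F_Suc, simp add: F_def)
  define f where "f n = pick (F n)" for n
  have F_nth: "F n ! k = f k" if "k < n" for n k
    using that by (induction n) (auto simp: F_Suc nth_append lenF f_def less_Suc_eq)
  have gen_cong: "gen f n = gen g n" if "\<And>k. k < n \<Longrightarrow> f k = g k" for f g n
  proof -
    have "(\<Sum>k<n. r k * f k) = (\<Sum>k<n. r k * g k)" for r by (intro sum.cong) (auto simp: that)
    then show ?thesis by (simp add: gen_def)
  qed
  have f_def': "f n = (ARG_MIN (adeg R x) g. g \<in> I \<and> g \<notin> gen f n)" for n
  proof -
    have g: "gen (\<lambda>k. F n ! k) n = gen f n" by (rule gen_cong) (rule F_nth)
    have "f n = pick (F n)" by (simp add: f_def)
    then show ?thesis by (simp only: pick_def lenF g)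
  qed
  have f_I: "f n \<in> I \<and> f n \<notin> gen f n" and f_min: "\<And>g. g \<in> I \<Longrightarrow> g \<notin> gen f n \<Longrightarrow> adeg R x (f n) \<le> adeg R x g" for n
  proof -
    have *: "f n \<in> I \<and> f n \<notin> gen f n \<and> (\<forall>g. g \<in> I \<and> g \<notin> gen f n \<longrightarrow> adeg R x (f n) \<le> adeg R x g)" for n
    proof (induction n rule: less_induct)
      case (less n)
      then obtain g where "g \<in> I \<and> g \<notin> gen f n" using ex[of n f] by blast
      then show ?case
        using arg_min_natI[of "\<lambda>g. g \<in> I \<and> g \<notin> gen f n" g "adeg R x"]
          arg_min_nat_le[of "\<lambda>g. g \<in> I \<and> g \<notin> gen f n" _ "adeg R x"] f_def'[of n]
        by auto
    qed
    show "f n \<in> I \<and> f n \<notin> gen f n" using * by blast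
    show "\<And>g. g \<in> I \<Longrightarrow> g \<notin> gen f n \<Longrightarrow> adeg R x (f n) \<le> adeg R x g" using * by blast
  qed
  define d where "d n = adeg R x (f n)" for n
  have "\<exists>r. (\<forall>i. r i \<in> R) \<and> f n = (\<Sum>i<d n. r i * x ^ i)" for n
  proof -
    have "f n \<in> adjoin R x" using f_I IS by blast
    from adeg_repr[OF this] show ?thesis unfolding d_def by blast
  qed
  then obtain r where r: "\<And>n i. r n i \<in> R" "\<And>n. f n = (\<Sum>i<d n. r n i * x ^ i)" by metis
  have dpos: "d n > 0" for n
  proof (rule ccontr)
    assume "\<not> d n > 0"
    then have "f n = 0" using r(2)[of n] by simp
    then show False using f_I[of n] gen0 by metis
  qed
  \<comment> \<open>\<open>f n\<close> was already a candidate when \<open>f k\<close> was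
    chosen.\<close>
  have dmono: "d k \<le> d n" if "k \<le> n" for k n
    unfolding d_def using f_min[of "f n" k] f_I[of n] gen_mono[OF that, of f] by blast
  \<comment> \<open>The top coefficients. By \<open>noeth R\<close> one of them, \<open>a n\<close>,
    is a combination of its predecessors.\<close>
  define a where "a n = r n (d n - 1)" for n
  have fa: "f n = a n * x ^ (d n - 1) + (\<Sum>i<d n - 1. r n i * x ^ i)" for n
    using r(2)[of n] dpos[of n] unfolding a_def
    by (cases "d n") (auto simp: add.commute)
  obtain n c where c: "\<And>k. c k \<in> R" "a n = (\<Sum>k<n. c k * a k)"
    using N[unfolded noeth_def, rule_format, of a] r(1) by (auto simp: a_def)
  \<comment> \<open>Cancels the top coefficient of \<open>f n\<close>. As the subtracted sum lies in
    \<open>gen f n\<close>, the difference stays outside it, but its smaller \<open>adeg\<close>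
    contradicts the choice of \<open>f n\<close>.\<close>
  define g where "g = f n - (\<Sum>k<n. (c k * x ^ (d n - d k)) * f k)"
  have cS: "c k * x ^ (d n - d k) \<in> ?S" for k using c(1) RS xS by (auto intro!: Ss)
  have sumI: "(\<Sum>k<n. (c k * x ^ (d n - d k)) * f k) \<in> I"
    using f_I cS by (intro I_sum) auto
  have sumg: "(\<Sum>k<n. (c k * x ^ (d n - d k)) * f k) \<in> gen f n"
    using cS by (intro genI[where r = "\<lambda>k. c k * x ^ (d n - d k)"]) auto
  have gI: "g \<in> I" unfolding g_def
    using I_add[of "f n" "-1 * (\<Sum>k<n. (c k * x ^ (d n - d k)) * f k)"] I_mult[OF sumI, of "-1"] f_I Ss by auto
  have gn: "g \<notin> gen f n"
    using gen_add[OF _ sumg, of g] f_I[of n] by (auto simp: g_def)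
  have "\<exists>s. (\<forall>i. s i \<in> R) \<and> g = (\<Sum>i<d n - 1. s i * x ^ i)"
  proof -
    \<comment> \<open>Multiplication by \<open>x ^ (d n - d k)\<close> moves the top coefficient of
      \<open>f k\<close> to exponent \<open>d n - 1\<close>; the remaining terms have smaller
      exponents.\<close>
    have 1: "(c k * x ^ (d n - d k)) * f k = c k * a k * x ^ (d n - 1)
      + (\<Sum>i<d n - 1. (if d n - d k \<le> i then c k * r k (i - (d n - d k)) else 0) * x ^ i)" if "k < n" for k
    proof -
      have dk: "d k \<le> d n" "d k > 0" "d n > 0" using dmono[of k n] that dpos by auto
      have e: "d n - 1 = (d n - d k) + (d k - 1)" using dk by simp
      have "(\<Sum>i<d n - 1. (if d n - d k \<le> i then c k * r k (i - (d n - d k)) else 0) * x ^ i)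
        = (\<Sum>i\<in>{d n - d k..<d n - 1}. c k * r k (i - (d n - d k)) * x ^ i)"
        by (rule sum.mono_neutral_cong_right) auto
      also have "\<dots> = (\<Sum>i<d k - 1. c k * r k i * x ^ (i + (d n - d k)))"
        by (rule sum.reindex_bij_witness[of _ "\<lambda>i. i + (d n - d k)" "\<lambda>i. i - (d n - d k)"]) (use dk in auto)
      also have "\<dots> = (c k * x ^ (d n - d k)) * (\<Sum>i<d k - 1. r k i * x ^ i)"
        by (simp add: sum_distrib_left power_add algebra_simps)
      finally have eq: "(\<Sum>i<d n - 1. (if d n - d k \<le> i then c k * r k (i - (d n - d k)) else 0) * x ^ i)
        = (c k * x ^ (d n - d k)) * (\<Sum>i<d k - 1. r k i * x ^ i)" .
      have pw: "x ^ (d n - 1) = x ^ (d n - d k) * x ^ (d k - 1)"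
        unfolding power_add[symmetric] e[symmetric] ..
      show ?thesis unfolding eq fa[of k] pw
        by (simp only: distrib_left mult_ac)
    qed
    have "(\<Sum>k<n. (c k * x ^ (d n - d k)) * f k) = (\<Sum>k<n. c k * a k * x ^ (d n - 1)) +
       (\<Sum>k<n. \<Sum>i<d n - 1. (if d n - d k \<le> i then c k * r k (i - (d n - d k)) else 0) * x ^ i)"
      using 1 by (simp add: sum.distrib)
    also have "(\<Sum>k<n. c k * a k * x ^ (d n - 1)) = a n * x ^ (d n - 1)"
      by (simp add: c(2) sum_distrib_right)
    also have "(\<Sum>k<n. \<Sum>i<d n - 1. (if d n - d k \<le> i then c k * r k (i - (d n - d k)) else 0) * x ^ i)
      = (\<Sum>i<d n - 1. (\<Sum>k<n. if d n - d k \<le> i then c k * r k (i - (d n - d k)) else 0) * x ^ i)"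
      by (subst sum.swap) (simp add: sum_distrib_right)
    finally have "g = (\<Sum>i<d n - 1. (r n i - (\<Sum>k<n. if d n - d k \<le> i then c k * r k (i - (d n - d k)) else 0)) * x ^ i)"
      unfolding g_def fa[of n] by (simp add: sum_subtractf left_diff_distrib)
    moreover have "r n i - (\<Sum>k<n. if d n - d k \<le> i then c k * r k (i - (d n - d k)) else 0) \<in> R" for i
      using c(1) r(1) by (auto intro!: Rs subring_sum[OF R])
    ultimately show ?thesis
      by (intro exI[of _ "\<lambda>i. r n i - (\<Sum>k<n. if d n - d k \<le> i then c k * r k (i - (d n - d k)) else 0)"]) blast
  qed
  then have "adeg R x g \<le> d n - 1" using adeg_le by blast
  moreover have "d n \<le> adeg R x g" using f_min[OF gI gn] by (simp add: d_def)
  ultimately show False using dpos[of n] by simp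
qed

subsection \<open>Polynomial functions\<close>

lemma polyfuns_ops:
  shows polyfuns_const: "(\<lambda>_. c) \<in> polyfuns UNIV X"
    and polyfuns_coord: "l \<in> X \<Longrightarrow> l \<in> polyfuns UNIV X"
    and polyfuns_add: "p \<in> polyfuns UNIV X \<Longrightarrow> q \<in> polyfuns UNIV X \<Longrightarrow> (\<lambda>v. p v + q v) \<in> polyfuns UNIV X"
    and polyfuns_mult: "p \<in> polyfuns UNIV X \<Longrightarrow> q \<in> polyfuns UNIV X \<Longrightarrow> (\<lambda>v. p v * q v) \<in> polyfuns UNIV X"
  using polyfuns.const[where c=c and D=UNIV and L=X] polyfuns.coord[where D=UNIV and L=X and l=l]
    polyfuns.add[where D=UNIV and L=X and p=p and q=q] polyfuns.mult[where D=UNIV and L=X and p=p and q=q]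
  by (auto simp: restrict_UNIV)

lemma polyfuns_UNIV_induct [consumes 1, case_names const coord add mult]:
  assumes "p \<in> polyfuns UNIV X"
    and "\<And>c. P (\<lambda>_. c)" "\<And>l. l \<in> X \<Longrightarrow> P l"
    and "\<And>p q. p \<in> polyfuns UNIV X \<Longrightarrow> q \<in> polyfuns UNIV X \<Longrightarrow> P p \<Longrightarrow> P q \<Longrightarrow> P (\<lambda>v. p v + q v)"
    and "\<And>p q. p \<in> polyfuns UNIV X \<Longrightarrow> q \<in> polyfuns UNIV X \<Longrightarrow> P p \<Longrightarrow> P q \<Longrightarrow> P (\<lambda>v. p v * q v)"
  shows "P p"
  using assms(1) by (induction rule: polyfuns.induct) (auto simp: restrict_UNIV intro: assms(2-))

lemma subring_polyfuns: "is_subring (polyfuns UNIV X)"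
proof -
  have "- p \<in> polyfuns UNIV X" if "p \<in> polyfuns UNIV X" for p
    using polyfuns_mult[OF polyfuns_const[of "-1"] that] by (simp add: fun_Compl_def)
  then show ?thesis
    using polyfuns_const[of 0 X] polyfuns_const[of 1 X]
    by (auto simp: is_subring_def zero_fun_def one_fun_def plus_fun_def times_fun_def intro: polyfuns_ops)
qed

lemma polyfuns_mono: "X \<subseteq> Y \<Longrightarrow> p \<in> polyfuns UNIV X \<Longrightarrow> p \<in> polyfuns UNIV Y"
  by (rotate_tac, induction rule: polyfuns_UNIV_induct) (auto intro: polyfuns_ops)

lemma polyfuns_sum: "(\<And>i. i \<in> A \<Longrightarrow> f i \<in> polyfuns UNIV X) \<Longrightarrow> (\<lambda>v. \<Sum>i\<in>A. f i v) \<in> polyfuns UNIV X"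
  by (induction A rule: infinite_finite_induct) (auto intro: polyfuns_ops)

lemma polyfuns_prod: "(\<And>i. i \<in> A \<Longrightarrow> f i \<in> polyfuns UNIV X) \<Longrightarrow> (\<lambda>v. \<Prod>i\<in>A. f i v) \<in> polyfuns UNIV X"
  by (induction A rule: infinite_finite_induct) (auto intro: polyfuns_ops)

lemma polyfuns_power: "p \<in> polyfuns UNIV X \<Longrightarrow> (\<lambda>v. p v ^ n) \<in> polyfuns UNIV X"
  by (induction n) (auto intro: polyfuns_ops)

lemma polyfuns_diff: "p \<in> polyfuns UNIV X \<Longrightarrow> q \<in> polyfuns UNIV X \<Longrightarrow> (\<lambda>v. p v - q v) \<in> polyfuns UNIV X"
  using is_subringD(6)[OF subring_polyfuns] by (simp add: fun_diff_def)

lemma polyfuns_minus: "p \<in> polyfuns UNIV X \<Longrightarrow> (\<lambda>v. - p v) \<in> polyfuns UNIV X"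
  using is_subringD(5)[OF subring_polyfuns] by (simp add: fun_Compl_def)

text \<open>Rewrites inductively generated functions as polynomials in one generator with
  coefficients from the others, the shape needed to iterate Hilbert's basis theorem over the
  generators.\<close>

lemma polyfuns_insert: "polyfuns UNIV (insert x X) = adjoin (polyfuns UNIV X) x"
proof
  note S = is_subringD[OF subring_polyfuns[of X]]
  let ?R = "polyfuns UNIV X"
  show "adjoin ?R x \<subseteq> polyfuns UNIV (insert x X)"
  proof
    fix p assume "p \<in> adjoin ?R x"
    then obtain n r where r: "p = (\<Sum>i<n. r i * x ^ i)" "\<forall>i. r i \<in> ?R" by (auto simp: adjoin_def)
    show "p \<in> polyfuns UNIV (insert x X)" unfolding r(1)
    proof (intro subring_sum[OF subring_polyfuns] is_subringD(4)[OF subring_polyfuns] is_subringD(7)[OF subring_polyfuns])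
      show "r i \<in> polyfuns UNIV (insert x X)" for i using r(2) polyfuns_mono[of X "insert x X"] by blast
      show "x \<in> polyfuns UNIV (insert x X)" by (rule polyfuns_coord) simp
    qed
  qed
  show "polyfuns UNIV (insert x X) \<subseteq> adjoin ?R x"
  proof
    have base: "p \<in> adjoin ?R x" if "p \<in> ?R" for p
    proof -
      show ?thesis using that by (intro adjoinI[where n = 1 and r = "\<lambda>_. p"]) auto
    qed
    \<comment> \<open>Representations are padded with zero coefficients up to a prescribed length,
      so that two of them can be added termwise.\<close>
    have ext: "\<exists>m r'. m \<ge> n \<and> p = (\<Sum>i<m. r' i * x ^ i) \<and> (\<forall>i. r' i \<in> ?R) \<and> (\<forall>i\<ge>m. r' i = 0)"
      if "p \<in> adjoin ?R x" for p n
    proof -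
      from that obtain m r where r: "p = (\<Sum>i<m. r i * x ^ i)" "\<forall>i. r i \<in> ?R"
        by (auto simp: adjoin_def)
      have "(\<Sum>i<max m n. (if i < m then r i else 0) * x ^ i) = p"
        unfolding r(1) by (rule sum.mono_neutral_cong_right) auto
      then show ?thesis using r(2) S(1)
        by (intro exI[of _ "max m n"] exI[of _ "\<lambda>i. if i < m then r i else 0"]) auto
    qed
    have add': "p + q \<in> adjoin ?R x" if p: "p \<in> adjoin ?R x" and q: "q \<in> adjoin ?R x" for p q
    proof -
      from ext[OF p, of 0] obtain m r where r: "p = (\<Sum>i<m. r i * x ^ i)" "\<forall>i. r i \<in> ?R" "\<forall>i\<ge>m. r i = 0"
        by blast
      from ext[OF q, of m] obtain m' r' where r': "m' \<ge> m" "q = (\<Sum>i<m'. r' i * x ^ i)" "\<forall>i. r' i \<in> ?R"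
        by blast
      have "p = (\<Sum>i<m'. r i * x ^ i)"
        unfolding r(1) by (rule sum.mono_neutral_left) (use r r' in auto)
      then show ?thesis using r r' S(3)
        by (intro adjoinI[where n = m' and r = "\<lambda>i. r i + r' i"]) (auto simp: sum.distrib distrib_right)
    qed
    have smul: "c * p \<in> adjoin ?R x" if "p \<in> adjoin ?R x" "c \<in> ?R" for c p
    proof -
      from that obtain m r where r: "p = (\<Sum>i<m. r i * x ^ i)" "\<forall>i. r i \<in> ?R"
        by (auto simp: adjoin_def)
      then show ?thesis using that S(4)
        by (intro adjoinI[where n = m and r = "\<lambda>i. c * r i"]) (auto simp: sum_distrib_left mult.assoc)
    qed
    have xmul: "x * p \<in> adjoin ?R x" if "p \<in> adjoin ?R x" for p
    proof -
      from that obtain m r where r: "p = (\<Sum>i<m. r i * x ^ i)" "\<forall>i. r i \<in> ?R"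
        by (auto simp: adjoin_def)
      have "x * p = (\<Sum>i<Suc m. (case i of 0 \<Rightarrow> 0 | Suc j \<Rightarrow> r j) * x ^ i)"
        unfolding r(1) by (subst sum.lessThan_Suc_shift) (simp add: sum_distrib_left algebra_simps)
      then show ?thesis using r S(1)
        by (intro adjoinI[where n = "Suc m" and r = "case_nat 0 r"]) (auto split: nat.split)
    qed
    have mult': "p * q \<in> adjoin ?R x" if p: "p \<in> adjoin ?R x" and q: "q \<in> adjoin ?R x" for p q
    proof -
      from p obtain m r where r: "p = (\<Sum>i<m. r i * x ^ i)" "\<forall>i. r i \<in> ?R"
        by (auto simp: adjoin_def)
      have pw: "x ^ i * q \<in> adjoin ?R x" for i
      proof (induction i)
        case (Suc i)
        then show ?case using xmul[of "x ^ i * q"] by (simp only: power_Suc mult.assoc)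
      qed (use q in simp)
      have "(\<Sum>i<m. r i * (x ^ i * q)) \<in> adjoin ?R x"
        using r(2) by (induction m) (auto intro: base S(1) add' smul pw)
      then show ?thesis unfolding r(1) by (simp add: sum_distrib_right mult.assoc)
    qed
    fix p assume "p \<in> polyfuns UNIV (insert x X)"
    then show "p \<in> adjoin ?R x"
    proof (induction rule: polyfuns_UNIV_induct)
      case (coord l)
      then show ?case
        using base[OF polyfuns_coord[of l X]] xmul[OF base[OF S(2)]] by auto
    next
      case (add p q) then show ?case using add'[of p q] by (simp add: plus_fun_def)
    next
      case (mult p q) then show ?case using mult'[of p q] by (simp add: times_fun_def)
    qed (auto intro: base polyfuns_const)
  qed
qed

lemma polyfuns_empty: "p \<in> polyfuns UNIV {} \<Longrightarrow> \<exists>c. p = (\<lambda>_. c)"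
  by (induction rule: polyfuns_UNIV_induct) auto

theorem noeth_polyfuns:
  assumes "finite X"
  shows "noeth (polyfuns UNIV X)"
  using assms
proof (induction X rule: finite_induct)
  case empty
  show ?case unfolding noeth_def
  proof (intro allI impI)
    fix h :: "nat \<Rightarrow> 'a \<Rightarrow> complex" assume h: "\<forall>k. h k \<in> polyfuns UNIV {}"
    define c where "c k = h k undefined" for k
    have c: "h k = (\<lambda>_. c k)" for k
      using polyfuns_empty[of "h k"] h by (auto simp: c_def)
    show "\<exists>n r. (\<forall>k. r k \<in> polyfuns UNIV {}) \<and> h n = (\<Sum>k<n. r k * h k)"
    \<comment> \<open>The base ring is the field of constants: either \<open>h 0\<close> is the
      empty combination, or \<open>h 1\<close> is a multiple of \<open>h 0\<close>.\<close>
    proof (cases "c 0 = 0")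
      case True
      show ?thesis
        by (rule exI[of _ 0], rule exI[of _ "\<lambda>_ _. 0"]) (auto simp: c True polyfuns_const zero_fun_def)
    next
      case False
      show ?thesis
        by (rule exI[of _ 1], rule exI[of _ "\<lambda>_ _. c 1 / c 0"]) (auto simp: c False polyfuns_const times_fun_def)
    qed
  qed
next
  case (insert x X)
  then show ?case
    using noeth_adjoin[OF subring_polyfuns insert.IH, of x] subring_polyfuns[of "insert x X"]
    by (simp add: polyfuns_insert)
qed

subsection \<open>Linear dependencies in countable dimension\<close>

text \<open>Gaussian elimination: a pivot \<open>p\<close> in equation \<open>l\<close> expresses
  the unknown at \<open>p\<close> by the others, which leaves one equation and one unknown
  less.\<close>

lemma homogeneous_system:
  fixes A :: "'i \<Rightarrow> 'e \<Rightarrow> complex"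
  assumes "finite E" "finite I" "card E < card I"
  shows "\<exists>\<alpha>. (\<exists>i\<in>I. \<alpha> i \<noteq> 0) \<and> (\<forall>l\<in>E. (\<Sum>i\<in>I. \<alpha> i * A i l) = 0)"
  using assms
proof (induction E arbitrary: I A rule: finite_induct)
  case empty
  then obtain i where "i \<in> I" by fastforce
  then show ?case by (intro exI[of _ "\<lambda>_. 1"]) auto
next
  case (insert l E)
  show ?case
  proof (cases "\<forall>i\<in>I. A i l = 0")
    case True
    obtain \<alpha> where "\<exists>i\<in>I. \<alpha> i \<noteq> 0" "\<forall>l\<in>E. (\<Sum>i\<in>I. \<alpha> i * A i l) = 0"
      using insert.IH[of I A] insert.prems insert.hyps by auto
    then show ?thesis using True by auto
  next
    case False
    then obtain p where p: "p \<in> I" "A p l \<noteq> 0" by blast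
    let ?I = "I - {p}"
    have cI: "card E < card ?I" using insert.prems insert.hyps p by (simp add: card_Diff_singleton)
    obtain \<alpha> where \<alpha>: "\<exists>i\<in>?I. \<alpha> i \<noteq> 0"
      "\<And>k. k \<in> E \<Longrightarrow> (\<Sum>i\<in>?I. \<alpha> i * (A i k - A i l / A p l * A p k)) = 0"
      using insert.IH[of ?I "\<lambda>i k. A i k - A i l / A p l * A p k"] insert.prems cI by auto
    \<comment> \<open>The value at \<open>p\<close> is forced by equation \<open>l\<close>.\<close>
    define \<beta> where "\<beta> = \<alpha>(p := - (\<Sum>i\<in>?I. \<alpha> i * (A i l / A p l)))"
    have sum: "(\<Sum>i\<in>I. \<beta> i * A i k) = - (\<Sum>i\<in>?I. \<alpha> i * (A i l / A p l)) * A p k + (\<Sum>i\<in>?I. \<alpha> i * A i k)" for k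
    proof -
      have "(\<Sum>i\<in>I. \<beta> i * A i k) = \<beta> p * A p k + (\<Sum>i\<in>?I. \<beta> i * A i k)"
        using p insert.prems by (simp add: sum.remove)
      also have "(\<Sum>i\<in>?I. \<beta> i * A i k) = (\<Sum>i\<in>?I. \<alpha> i * A i k)"
        by (rule sum.cong) (auto simp: \<beta>_def)
      finally show ?thesis by (simp add: \<beta>_def)
    qed
    have "(\<Sum>i\<in>I. \<beta> i * A i k) = 0" if "k \<in> insert l E" for k
    proof (cases "k = l")
      case True
      then show ?thesis unfolding sum using p by (simp add: sum_distrib_right)
    next
      case False
      then have "k \<in> E" using that by simp
      from \<alpha>(2)[OF this] show ?thesis unfolding sum
        by (simp add: sum_distrib_right right_diff_distrib sum_subtractf mult.assoc)
    qed
    moreover have "\<exists>i\<in>I. \<beta> i \<noteq> 0" using \<alpha>(1) by (auto simp: \<beta>_def)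
    ultimately show ?thesis by blast
  qed
qed

text \<open>A family that is indexed by an uncountable set and expanded in a countable set \<open>B\<close> of vectors
  contains more members than vectors in a common finite expansion.\<close>

lemma uncountable_dependency:
  fixes f :: "complex \<Rightarrow> (complex \<times> 'w) list"
  assumes E: "uncountable E" and B: "countable B"
    and f: "\<And>c. c \<in> E \<Longrightarrow> set (map snd (f c)) \<subseteq> B"
  obtains F \<alpha> ws where "finite F" "F \<subseteq> E" "\<And>c. c \<in> F \<Longrightarrow> map snd (f c) = ws"
    "\<exists>c\<in>F. \<alpha> c \<noteq> (0::complex)" "\<And>l. l < length ws \<Longrightarrow> (\<Sum>c\<in>F. \<alpha> c * fst (f c ! l)) = 0"
proof -
  have cl: "countable (lists B)" using B by simp
  have "\<exists>ws\<in>lists B. infinite {c\<in>E. map snd (f c) = ws}"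
  proof (rule ccontr)
    assume "\<not> ?thesis"
    then have "countable (\<Union>ws\<in>lists B. {c\<in>E. map snd (f c) = ws})"
      using cl by (intro countable_UN) (auto intro: countable_finite)
    moreover have "E \<subseteq> (\<Union>ws\<in>lists B. {c\<in>E. map snd (f c) = ws})"
      using f by (fastforce simp: in_lists_conv_set image_subset_iff)
    ultimately show False using E countable_subset by blast
  qed
  then obtain ws where ws: "infinite {c\<in>E. map snd (f c) = ws}" by blast
  obtain F where F: "finite F" "card F = Suc (length ws)" "F \<subseteq> {c\<in>E. map snd (f c) = ws}"
    using infinite_arbitrarily_large[OF ws] by blast
  obtain \<alpha> where \<alpha>: "\<exists>c\<in>F. \<alpha> c \<noteq> 0" "\<forall>l\<in>{..<length ws}. (\<Sum>c\<in>F. \<alpha> c * fst (f c ! l)) = 0"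
    using homogeneous_system[of "{..<length ws}" F "\<lambda>c l. fst (f c ! l)"] F by auto
  show ?thesis using that[of F ws \<alpha>] F \<alpha> by auto
qed

lemma sum_fun_apply: "sum f A v = (\<Sum>i\<in>A. f i v)" for f :: "'i \<Rightarrow> 'v \<Rightarrow> 'b::comm_monoid_add"
  by (induction A rule: infinite_finite_induct) auto

text \<open>Numerator of the partial fraction sum of \<open>\<alpha> c / (x - c)\<close> over
  \<open>F\<close>, with common denominator the product of all \<open>x - d\<close>.\<close>

definition resolvent_poly :: "complex set \<Rightarrow> (complex \<Rightarrow> complex) \<Rightarrow> complex poly" where
  "resolvent_poly F \<alpha> = (\<Sum>c\<in>F. Polynomial.smult (\<alpha> c) (\<Prod>d\<in>F - {c}. [:- d, 1:]))"

text \<open>At the point \<open>c\<close> every summand other than that of \<open>c\<close> contains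
  the factor \<open>c - c\<close>.\<close>

lemma resolvent_poly_nonzero:
  assumes F: "finite F" and c: "c \<in> F" "\<alpha> c \<noteq> 0"
  shows "resolvent_poly F \<alpha> \<noteq> 0"
proof -
  have "poly (resolvent_poly F \<alpha>) c = (\<Sum>b\<in>F. \<alpha> b * (\<Prod>d\<in>F - {b}. c - d))"
    by (simp add: resolvent_poly_def poly_sum poly_prod)
  also have "\<dots> = (\<Sum>b\<in>{c}. \<alpha> b * (\<Prod>d\<in>F - {b}. c - d))"
    using F c by (intro sum.mono_neutral_right) (auto simp: prod_zero_iff)
  also have "\<dots> \<noteq> 0" using F c by (auto simp: prod_zero_iff)
  finally show ?thesis by auto
qed

text \<open>Over \<open>\<complex>\<close> every nonconstant \<open>q\<close> has a root, and the
  hypothesis on \<open>K\<close> allows the corresponding linear factor to be dropped. In the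
  applications \<open>K\<close> consists of the polynomials in an operator that kill a given
  element, and the hypothesis says that the operator minus \<open>c\<close> is injective.\<close>

lemma poly_kernel_constant:
  assumes "q \<in> K" "q \<noteq> (0::complex poly)" and K: "\<And>c p. p * [:- c, 1:] \<in> K \<Longrightarrow> p \<in> K"
  shows "\<exists>a. a \<noteq> 0 \<and> [:a:] \<in> K"
  using assms(1,2)
proof (induction "degree q" arbitrary: q rule: less_induct)
  case less
  show ?case
  proof (cases "degree q = 0")
    case True
    then obtain a where "q = [:a:]" by (metis degree_0_id)
    then show ?thesis using less.prems by auto
  next
    case False
    then have "\<not> constant (poly q)" by (simp add: constant_degree)
    then obtain z where "poly q z = 0" using fundamental_theorem_of_algebra by blast
    then obtain p where p: "q = p * [:- z, 1:]" by (metis dvd_def mult.commute poly_eq_0_iff_dvd)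
    then have "p \<noteq> 0" using less.prems by auto
    moreover have "degree p < degree q" using \<open>p \<noteq> 0\<close> unfolding p by (subst degree_mult_eq) auto
    ultimately show ?thesis using less.hyps[of p] K[of p z] less.prems p by blast
  qed
qed

subsection \<open>Nullstellensatz for algebras of countable dimension\<close>

definition lcomb :: "(complex \<times> ('v \<Rightarrow> complex)) list \<Rightarrow> 'v \<Rightarrow> complex" where
  "lcomb xs = (\<lambda>v. \<Sum>(c, b)\<leftarrow>xs. c * b v)"

lemma lcomb_nth: "lcomb xs v = (\<Sum>i<length xs. fst (xs ! i) * snd (xs ! i) v)"
  unfolding lcomb_def by (simp add: sum_list_sum_nth case_prod_unfold atLeast0LessThan)

lemma lcomb_simps [simp]: "lcomb [] = (\<lambda>_. 0)" "lcomb (x # xs) = (\<lambda>v. fst x * snd x v + lcomb xs v)"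
  by (auto simp: lcomb_def case_prod_unfold)

lemma lcomb_append: "lcomb (xs @ ys) = (\<lambda>v. lcomb xs v + lcomb ys v)"
  by (auto simp: lcomb_def)

definition countably_spanned :: "('v \<Rightarrow> complex) set \<Rightarrow> bool" where
  "countably_spanned R \<longleftrightarrow> (\<exists>B\<subseteq>R. countable B \<and> (\<forall>r\<in>R. \<exists>xs. snd ` set xs \<subseteq> B \<and> r = lcomb xs))"

text \<open>Monomials in \<open>X\<close>, encoded as products of lists, form a countable set that
  is closed under products and spans.\<close>

lemma countably_spanned_polyfuns:
  assumes X: "countable X"
  shows "countably_spanned (polyfuns UNIV X)"
proof -
  define B where "B = prod_list ` lists X"
  have B1: "(\<lambda>_. 1) \<in> B" unfolding B_def by (rule image_eqI[of _ _ "[]"]) (auto simp: one_fun_def)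
  have BX: "x \<in> B" if "x \<in> X" for x unfolding B_def using that by (intro image_eqI[of _ _ "[x]"]) auto
  have Bm: "(\<lambda>v. x v * y v) \<in> B" if "x \<in> B" "y \<in> B" for x y
  proof -
    from that obtain xs ys where "x = prod_list xs" "y = prod_list ys" "xs \<in> lists X" "ys \<in> lists X"
      by (auto simp: B_def)
    then show ?thesis unfolding B_def
      by (intro image_eqI[of _ _ "xs @ ys"]) (auto simp: times_fun_def)
  qed
  have ex: "\<exists>xs. snd ` set xs \<subseteq> B \<and> r = lcomb xs" if "r \<in> polyfuns UNIV X" for r
    using that
  proof (induction rule: polyfuns_UNIV_induct)
    case (const c)
    show ?case using B1 by (intro exI[of _ "[(c, \<lambda>_. 1)]"]) auto
  next
    case (coord l)
    then show ?case using BX by (intro exI[of _ "[(1, l)]"]) auto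
  next
    case (add p q)
    then obtain xs ys where "snd ` set xs \<subseteq> B" "p = lcomb xs" "snd ` set ys \<subseteq> B" "q = lcomb ys" by blast
    then show ?case by (intro exI[of _ "xs @ ys"]) (auto simp: lcomb_append)
  next
    case (mult p q)
    then obtain xs ys where xy: "snd ` set xs \<subseteq> B" "p = lcomb xs" "snd ` set ys \<subseteq> B" "q = lcomb ys" by blast
    have one: "\<exists>zs. snd ` set zs \<subseteq> B \<and> (\<lambda>v. c * b v * lcomb ys v) = lcomb zs"
      if "b \<in> B" "snd ` set ys \<subseteq> B" for c b ys
      using that(2)
    proof (induction ys)
      case Nil
      show ?case by (intro exI[of _ "[]"]) auto
    next
      case (Cons y ys)
      then obtain zs where "snd ` set zs \<subseteq> B" "(\<lambda>v. c * b v * lcomb ys v) = lcomb zs" by auto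
      then show ?case using Bm[OF that(1), of "snd y"] Cons.prems
        by (intro exI[of _ "(c * fst y, \<lambda>v. b v * snd y v) # zs"]) (auto simp: fun_eq_iff algebra_simps)
    qed
    have "\<exists>zs. snd ` set zs \<subseteq> B \<and> (\<lambda>v. lcomb xs v * lcomb ys v) = lcomb zs"
      using xy(1)
    proof (induction xs)
      case Nil
      show ?case by (intro exI[of _ "[]"]) auto
    next
      case (Cons x xs)
      then obtain zs where zs: "snd ` set zs \<subseteq> B" "(\<lambda>v. lcomb xs v * lcomb ys v) = lcomb zs" by auto
      obtain zs' where zs': "snd ` set zs' \<subseteq> B" "(\<lambda>v. fst x * snd x v * lcomb ys v) = lcomb zs'"
        using one[of "snd x" ys "fst x"] Cons.prems xy(3) by auto
      show ?case using zs zs'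
        by (intro exI[of _ "zs' @ zs"]) (auto simp: fun_eq_iff lcomb_append distrib_right)
    qed
    then show ?case using xy by simp
  qed
  have BR: "B \<subseteq> polyfuns UNIV X"
  proof -
    have "prod_list xs \<in> polyfuns UNIV X" if "xs \<in> lists X" for xs
      using that by (induction xs) (auto intro: is_subringD[OF subring_polyfuns] polyfuns_coord polyfuns_const polyfuns_mult)
    then show ?thesis by (auto simp: B_def)
  qed
  have "countable B" using X by (auto simp: B_def)
  then show ?thesis unfolding countably_spanned_def using BR ex by blast
qed

definition is_ideal :: "'a::comm_ring_1 set \<Rightarrow> 'a set \<Rightarrow> bool" where
  "is_ideal R I \<longleftrightarrow> I \<subseteq> R \<and> 0 \<in> I \<and> (\<forall>x\<in>I. \<forall>y\<in>I. x + y \<in> I) \<and> (\<forall>r\<in>R. \<forall>x\<in>I. r * x \<in> I)"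

lemma is_idealD:
  assumes "is_ideal R I"
  shows "I \<subseteq> R" "0 \<in> I" "x \<in> I \<Longrightarrow> y \<in> I \<Longrightarrow> x + y \<in> I" "r \<in> R \<Longrightarrow> x \<in> I \<Longrightarrow> r * x \<in> I"
  using assms by (auto simp: is_ideal_def)

lemma is_ideal_minus: "is_ideal R I \<Longrightarrow> is_subring R \<Longrightarrow> x \<in> I \<Longrightarrow> - x \<in> I"
  using is_idealD(4)[of R I "-1" x] is_subringD(2,5)[of R] by simp

lemma is_ideal_diff: "is_ideal R I \<Longrightarrow> is_subring R \<Longrightarrow> x \<in> I \<Longrightarrow> y \<in> I \<Longrightarrow> x - y \<in> I"
  using is_idealD(3)[of R I x "- y"] is_ideal_minus[of R I y] by simp

lemma is_ideal_sum: "is_ideal R I \<Longrightarrow> (\<And>i. i \<in> A \<Longrightarrow> f i \<in> I) \<Longrightarrow> sum f A \<in> I"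
  by (induction A rule: infinite_finite_induct) (auto intro: is_idealD)

text \<open>Without a maximal member there is a strictly ascending sequence of ideals; elements
  \<open>h k\<close> taken from consecutive differences violate \<open>noeth\<close>.\<close>

lemma noeth_maximal:
  assumes N: "noeth R" and K: "K \<noteq> {}" "\<And>I. I \<in> K \<Longrightarrow> is_ideal R I"
  obtains I where "I \<in> K" "\<And>I'. I' \<in> K \<Longrightarrow> I \<subseteq> I' \<Longrightarrow> I' = I"
proof (rule ccontr)
  assume no: "\<not> thesis"
  note pick = that
  have step: "\<exists>I'. I' \<in> K \<and> I \<subset> I'" if "I \<in> K" for I
    using no that pick[of I] by blast
  obtain I0 where "I0 \<in> K" using K(1) by blast
  then obtain I where I: "\<And>n::nat. I n \<in> K" "\<And>n. I n \<subset> I (Suc n)"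
    using dependent_nat_choice[of "\<lambda>_ I. I \<in> K" "\<lambda>_ I I'. I \<subset> I'"] step by metis
  have "\<exists>h. h \<in> I (Suc k) \<and> h \<notin> I k" for k using I(2) by blast
  then obtain h where h: "\<And>k. h k \<in> I (Suc k)" "\<And>k. h k \<notin> I k" by metis
  have hR: "h k \<in> R" for k using h(1)[of k] is_idealD(1)[OF K(2)[OF I(1)]] by blast
  obtain n r where nr: "\<And>k. r k \<in> R" "h n = (\<Sum>k<n. r k * h k)"
    using N hR unfolding noeth_def by metis
  have mono: "I j \<subseteq> I k" if "j \<le> k" for j k
    using lift_Suc_mono_le[of I] I(2) that by blast
  have "h n \<in> I n"
    unfolding nr(2)
  proof (intro is_ideal_sum[OF K(2)[OF I(1)]] is_idealD(4)[OF K(2)[OF I(1)]] nr(1))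
    show "h k \<in> I n" if "k \<in> {..<n}" for k using mono[of "Suc k" n] h(1)[of k] that by auto
  qed
  then show False using h(2) by blast
qed

text \<open>A homomorphism of \<open>\<complex>\<close>-algebras: scalars are constant functions, so
  the last clause covers both the unit and linearity.\<close>

definition char_of :: "('v \<Rightarrow> complex) set \<Rightarrow> (('v \<Rightarrow> complex) \<Rightarrow> complex) \<Rightarrow> bool" where
  "char_of R \<eta> \<longleftrightarrow> (\<forall>a\<in>R. \<forall>b\<in>R. \<eta> (a + b) = \<eta> a + \<eta> b \<and> \<eta> (a * b) = \<eta> a * \<eta> b) \<and> (\<forall>c. \<eta> (\<lambda>_. c) = c)"

lemma char_ofD:
  assumes "char_of R \<eta>"
  shows "a \<in> R \<Longrightarrow> b \<in> R \<Longrightarrow> \<eta> (a + b) = \<eta> a + \<eta> b" "a \<in> R \<Longrightarrow> b \<in> R \<Longrightarrow> \<eta> (a * b) = \<eta> a * \<eta> b"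
    "\<eta> (\<lambda>_. c) = c"
  using assms by (auto simp: char_of_def)

text \<open>Amitsur's trick: if \<open>x - c\<close> were never in a maximal ideal \<open>I\<close> avoiding \<open>S\<close>, then
  uncountably many quotients \<open>s / (x - c)\<close> would be linearly independent modulo \<open>I\<close>.\<close>

theorem countable_nullstellensatz:
  fixes R :: "('v \<Rightarrow> complex) set"
  assumes R: "is_subring R" and const: "\<And>c. (\<lambda>_. c) \<in> R" and R_span: "countably_spanned R"
    and J: "is_ideal R J" and S: "countable S" "S \<subseteq> R" "1 \<in> S" "\<And>s t. s \<in> S \<Longrightarrow> t \<in> S \<Longrightarrow> s * t \<in> S"
    and JS: "J \<inter> S = {}"
  obtains \<eta> where "char_of R \<eta>" "\<And>x. x \<in> J \<Longrightarrow> \<eta> x = 0" "\<And>s. s \<in> S \<Longrightarrow> \<eta> s \<noteq> 0"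
proof -
  note Rs = is_subringD[OF R]
  \<comment> \<open>Zorn's lemma gives an ideal that is maximal among those containing
    \<open>J\<close> and avoiding \<open>S\<close>. It is prime; that its quotient is
    \<open>\<complex>\<close> takes the rest of the proof.\<close>
  define \<I> where "\<I> = {I. is_ideal R I \<and> J \<subseteq> I \<and> I \<inter> S = {}}"
  have "\<exists>M\<in>\<I>. \<forall>X\<in>\<I>. M \<subseteq> X \<longrightarrow> X = M"
  proof (rule subset_Zorn_nonempty)
    show "\<I> \<noteq> {}" using J JS by (auto simp: \<I>_def)
    fix C assume C: "C \<noteq> {}" "subset.chain \<I> C"
    have CI: "\<And>I. I \<in> C \<Longrightarrow> is_ideal R I \<and> J \<subseteq> I \<and> I \<inter> S = {}" and
      Cc: "\<And>I I'. I \<in> C \<Longrightarrow> I' \<in> C \<Longrightarrow> I \<subseteq> I' \<or> I' \<subseteq> I"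
      using C(2) by (auto simp: \<I>_def subset_chain_def)
    have "is_ideal R (\<Union>C)"
      unfolding is_ideal_def
    proof (intro conjI ballI)
      show "\<Union>C \<subseteq> R" using CI is_idealD(1) by blast
      show "0 \<in> \<Union>C" using C(1) CI is_idealD(2) by blast
      show "x + y \<in> \<Union>C" if "x \<in> \<Union>C" "y \<in> \<Union>C" for x y
      proof -
        from that obtain I I' where "I \<in> C" "I' \<in> C" "x \<in> I" "y \<in> I'" by blast
        then show ?thesis using Cc[of I I'] CI[of I] CI[of I'] is_idealD(3)[of R I x y] is_idealD(3)[of R I' x y]
          by blast
      qed
      show "r * x \<in> \<Union>C" if "r \<in> R" "x \<in> \<Union>C" for r x
        using that CI is_idealD(4) by blast
    qed
    then show "\<Union>C \<in> \<I>" using CI C(1) by (auto simp: \<I>_def)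
  qed
  then obtain I where I\<I>: "I \<in> \<I>" and I_max: "\<And>X. X \<in> \<I> \<Longrightarrow> I \<subseteq> X \<Longrightarrow> X = I" by blast
  have I: "is_ideal R I" "J \<subseteq> I" "I \<inter> S = {}" using I\<I> by (auto simp: \<I>_def)
  note Is = is_idealD[OF I(1)] is_ideal_minus[OF I(1) R] is_ideal_diff[OF I(1) R]
  \<comment> \<open>By maximality the ideal generated by \<open>I\<close> and \<open>x\<close> meets
    \<open>S\<close>, so \<open>x\<close> divides an element of \<open>S\<close> modulo
    \<open>I\<close>.\<close>
  have meet: "\<exists>y\<in>R. \<exists>i\<in>I. x * y + i \<in> S" if x: "x \<in> R" "x \<notin> I" for x
  proof (rule ccontr)
    assume no: "\<not> ?thesis"
    define I' where "I' = {x * y + i | y i. y \<in> R \<and> i \<in> I}"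
    have "is_ideal R I'"
      unfolding is_ideal_def
    proof (intro conjI ballI)
      show "I' \<subseteq> R" using x Is(1) by (auto simp: I'_def intro!: Rs)
      show "0 \<in> I'" unfolding I'_def using Rs(1) Is(2) by (auto intro!: exI[of _ 0])
      show "a + b \<in> I'" if ab: "a \<in> I'" "b \<in> I'" for a b
      proof -
        from ab obtain y i y' i' where "a = x * y + i" "b = x * y' + i'" "y \<in> R" "y' \<in> R" "i \<in> I" "i' \<in> I"
          by (auto simp: I'_def)
        then have "a + b = x * (y + y') + (i + i')" "y + y' \<in> R" "i + i' \<in> I"
          by (auto simp: algebra_simps intro: Rs Is)
        then show ?thesis unfolding I'_def by blast
      qed
      show "r * a \<in> I'" if ra: "r \<in> R" "a \<in> I'" for r a
      proof -
        from ra obtain y i where "a = x * y + i" "y \<in> R" "i \<in> I" by (auto simp: I'_def)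
        moreover from this have "r * a = x * (r * y) + r * i" by (simp add: algebra_simps)
        moreover have "r * y \<in> R" "r * i \<in> I" using calculation ra by (auto intro: Rs Is)
        ultimately show ?thesis unfolding I'_def by blast
      qed
    qed
    moreover have II': "I \<subseteq> I'"
    proof
      fix i assume "i \<in> I"
      then have "i = x * 0 + i \<and> 0 \<in> R \<and> i \<in> I" using Rs(1) by simp
      then show "i \<in> I'" unfolding I'_def by blast
    qed
    moreover have "I' \<inter> S = {}" using no by (auto simp: I'_def)
    ultimately have "I' = I" using I_max[of I'] I(2) by (auto simp: \<I>_def)
    moreover have "x = x * 1 + 0 \<and> 1 \<in> R \<and> 0 \<in> I" using Rs(2) Is(2) by simp
    then have "x \<in> I'" unfolding I'_def by blast
    ultimately show False using x by simp
  qed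
  have prime: "x \<in> I" if xy: "x \<in> R" "y \<in> R" "x * y \<in> I" "y \<notin> I" for x y
  proof (rule ccontr)
    assume "x \<notin> I"
    obtain a i where a: "a \<in> R" "i \<in> I" "x * a + i \<in> S" using meet[of x] \<open>x \<notin> I\<close> xy by blast
    obtain b j where b: "b \<in> R" "j \<in> I" "y * b + j \<in> S" using meet[of y] xy by blast
    have "(x * a + i) * (y * b + j) = (a * b) * (x * y) + (x * a) * j + (y * b + j) * i"
      by (simp add: algebra_simps)
    moreover have "(a * b) * (x * y) + (x * a) * j + (y * b + j) * i \<in> I"

    proof (rule Is(3)[OF Is(3)[OF Is(4) Is(4)] Is(4)])
      show "y * b + j \<in> R" using b S(2) by blast
    qed (use xy a b in \<open>auto intro: Rs\<close>)
    ultimately show False using S(4)[OF a(3) b(3)] I(3) by auto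
  qed
  \<comment> \<open>Every element of \<open>R\<close> is constant modulo \<open>I\<close>. Otherwise
    each \<open>x - c\<close> divides some element of \<open>S\<close> modulo \<open>I\<close>,
    which supplies the quotients \<open>y c\<close>.\<close>
  have ex: "\<exists>c. x - (\<lambda>_. c) \<in> I" if x: "x \<in> R" for x
  proof (rule ccontr)
    assume no: "\<not> ?thesis"
    have xc: "x - (\<lambda>_. c) \<in> R" for c using x const by (intro Rs)
    have "\<exists>y i. y \<in> R \<and> i \<in> I \<and> (x - (\<lambda>_. c)) * y + i \<in> S" for c
      using meet[OF xc[of c]] no by blast
    then obtain y i where yi: "\<And>c. y c \<in> R" "\<And>c. i c \<in> I" "\<And>c. (x - (\<lambda>_. c)) * y c + i c \<in> S" by metis
    \<comment> \<open>\<open>S\<close> is countable, so uncountably many \<open>c\<close> share the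
      numerator \<open>s\<close>.\<close>
    have "\<exists>s\<in>S. uncountable {c. (x - (\<lambda>_. c)) * y c + i c = s}"
    proof (rule ccontr)
      assume "\<not> ?thesis"
      then have "countable (\<Union>s\<in>S. {c. (x - (\<lambda>_. c)) * y c + i c = s})"
        using S(1) by (intro countable_UN) auto
      moreover have "(\<Union>s\<in>S. {c. (x - (\<lambda>_. c)) * y c + i c = s}) = UNIV" using yi by auto
      ultimately show False using uncountable_UNIV_complex by simp
    qed
    then obtain s where s: "s \<in> S" "uncountable {c. (x - (\<lambda>_. c)) * y c + i c = s}" by blast
    obtain B where B: "countable B" "\<And>r. r \<in> R \<Longrightarrow> \<exists>xs. snd ` set xs \<subseteq> B \<and> r = lcomb xs"
      using R_span unfolding countably_spanned_def by blast
    have "\<exists>xs. snd ` set xs \<subseteq> B \<and> y c = lcomb xs" for c using B(2)[OF yi(1)] .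
    then obtain f where f: "\<And>c. snd ` set (f c) \<subseteq> B" "\<And>c. y c = lcomb (f c)" by metis
    obtain F \<alpha> ws where F: "finite F" "F \<subseteq> {c. (x - (\<lambda>_. c)) * y c + i c = s}"
      "\<And>c. c \<in> F \<Longrightarrow> map snd (f c) = ws"
      "\<exists>c\<in>F. \<alpha> c \<noteq> 0" "\<And>l. l < length ws \<Longrightarrow> (\<Sum>c\<in>F. \<alpha> c * fst (f c ! l)) = 0"
    proof -
      have "set (map snd (f c)) \<subseteq> B" for c using f(1) by simp
      from uncountable_dependency[OF s(2) B(1) this] show ?thesis using that .
    qed
    have dep: "(\<Sum>c\<in>F. \<alpha> c * y c v) = 0" for v
    proof -
      have "y c v = (\<Sum>l<length ws. fst (f c ! l) * (ws ! l) v)" if "c \<in> F" for c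
        using F(3)[OF that, symmetric] by (simp add: f(2) lcomb_nth)
      then have "(\<Sum>c\<in>F. \<alpha> c * y c v) = (\<Sum>c\<in>F. \<Sum>l<length ws. \<alpha> c * fst (f c ! l) * (ws ! l) v)"
        by (simp add: sum_distrib_left mult.assoc)
      also have "\<dots> = (\<Sum>l<length ws. (\<Sum>c\<in>F. \<alpha> c * fst (f c ! l)) * (ws ! l) v)"
        by (subst sum.swap) (simp add: sum_distrib_right)
      also have "\<dots> = 0" using F(5) by simp
      finally show ?thesis .
    qed
    define ev where "ev p = (\<lambda>v. poly p (x v))" for p
    have evR: "ev p \<in> R" for p
    proof (induction p)
      case 0 then show ?case using const[of 0] by (simp add: ev_def)
    next
      case (pCons a p)
      have "ev (pCons a p) = (\<lambda>_. a) + x * ev p" by (auto simp: ev_def fun_eq_iff)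
      then show ?case by (simp only:) (intro Rs(3,4) pCons.IH x const)
    qed
    define K where "K = {p. ev p * s \<in> I}"
    \<comment> \<open>Modulo \<open>I\<close>, \<open>s\<close> equals \<open>(x - c) * y c\<close>;
      the factor \<open>x - c\<close> completes each product to the full one over \<open>F\<close>,
      which then factors out of the vanishing combination of the \<open>y c\<close>.\<close>
    have "resolvent_poly F \<alpha> \<in> K"
    proof -
      have "ev (resolvent_poly F \<alpha>) * s = (\<Sum>c\<in>F. (\<lambda>_. \<alpha> c) * ev (\<Prod>d\<in>F - {c}. [:- d, 1:]) * s)"
        by (rule ext) (simp add: ev_def resolvent_poly_def poly_sum sum_distrib_right sum_fun_apply)
      also have "\<dots> = (\<Sum>c\<in>F. (\<lambda>_. \<alpha> c) * ev (\<Prod>d\<in>F - {c}. [:- d, 1:]) * i c)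
         + (\<Sum>c\<in>F. (\<lambda>_. \<alpha> c) * ev (\<Prod>d\<in>F - {c}. [:- d, 1:]) * ((x - (\<lambda>_. c)) * y c))"
      proof -
        have "s = i c + (x - (\<lambda>_. c)) * y c" if "c \<in> F" for c
          using F(2) that by (auto simp: add.commute)
        then have "w * s = w * i c + w * ((x - (\<lambda>_. c)) * y c)" if "c \<in> F" for c w
          using that by (metis distrib_left)
        then show ?thesis by (simp only: sum.distrib[symmetric] cong: sum.cong)
      qed
      also have "(\<Sum>c\<in>F. (\<lambda>_. \<alpha> c) * ev (\<Prod>d\<in>F - {c}. [:- d, 1:]) * ((x - (\<lambda>_. c)) * y c)) = 0"
      proof
        fix v
        have P: "(\<Prod>d\<in>F. x v - d) = (\<Prod>d\<in>F - {c}. x v - d) * (x v - c)" if "c \<in> F" for c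
          using that F(1) by (simp add: prod.remove mult.commute)
        have "(\<Sum>c\<in>F. \<alpha> c * (\<Prod>d\<in>F - {c}. x v - d) * ((x v - c) * y c v)) =
           (\<Sum>c\<in>F. (\<Prod>d\<in>F. x v - d) * (\<alpha> c * y c v))"
        proof (intro sum.cong refl)
          fix c assume "c \<in> F"
          show "\<alpha> c * (\<Prod>d\<in>F - {c}. x v - d) * ((x v - c) * y c v) = (\<Prod>d\<in>F. x v - d) * (\<alpha> c * y c v)"
            unfolding P[OF \<open>c \<in> F\<close>] by (simp only: mult_ac)
        qed
        also have "\<dots> = 0" using dep[of v] by (simp add: sum_distrib_left[symmetric])
        finally show "(\<Sum>c\<in>F. (\<lambda>_. \<alpha> c) * ev (\<Prod>d\<in>F - {c}. [:- d, 1:]) * ((x - (\<lambda>_. c)) * y c)) v = 0 v"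
          by (simp add: sum_fun_apply ev_def poly_prod)
      qed
      finally have "ev (resolvent_poly F \<alpha>) * s = (\<Sum>c\<in>F. (\<lambda>_. \<alpha> c) * ev (\<Prod>d\<in>F - {c}. [:- d, 1:]) * i c)"
        by (simp only: add_0_right)
      also have "\<dots> \<in> I"
        by (intro is_ideal_sum[OF I(1)] Is(4) yi Rs const evR)
      finally show ?thesis by (simp add: K_def)
    qed
    moreover have "resolvent_poly F \<alpha> \<noteq> 0" using F resolvent_poly_nonzero by metis
    \<comment> \<open>\<open>I\<close> is prime and contains no \<open>x - c\<close>, so this factor
      cancels.\<close>
    moreover have "p \<in> K" if "p * [:- c, 1:] \<in> K" for c p
    proof -
      have "ev (p * [:- c, 1:]) * s = (ev p * s) * (x - (\<lambda>_. c))"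
        by (simp add: ev_def fun_eq_iff algebra_simps)
      then have "(ev p * s) * (x - (\<lambda>_. c)) \<in> I" using that by (simp add: K_def)
      then have "ev p * s \<in> I"
        using prime[of "ev p * s" "x - (\<lambda>_. c)"] evR s S xc[of c] no by (auto intro: Rs)
      then show ?thesis by (simp add: K_def)
    qed
    ultimately obtain a where a: "a \<noteq> 0" "[:a:] \<in> K" using poly_kernel_constant by blast
    have "(\<lambda>_. 1 / a) * (ev [:a:] * s) = s" using a by (simp add: ev_def fun_eq_iff)
    then have "s \<in> I" using Is(4)[OF const[of "1 / a"], of "ev [:a:] * s"] a by (simp add: K_def)
    then show False using s I(3) by blast
  qed
  have const_I: "c = 0" if "(\<lambda>_. c) \<in> I" for c
  proof (rule ccontr)
    assume "c \<noteq> 0"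
    then have "(\<lambda>_. 1 / c) * (\<lambda>_. c) = (1 :: 'v \<Rightarrow> complex)" by (simp add: fun_eq_iff)
    then show False using Is(4)[OF const[of "1 / c"] that] I(3) S(3) by auto
  qed
  define \<eta> where "\<eta> x = (SOME c. x - (\<lambda>_. c) \<in> I)" for x
  have \<eta>: "x - (\<lambda>_. \<eta> x) \<in> I" if "x \<in> R" for x
    unfolding \<eta>_def using ex[OF that] by (rule someI_ex)
  have \<eta>I: "\<eta> x = c" if "x \<in> R" "x - (\<lambda>_. c) \<in> I" for x c
  proof -
    have "(x - (\<lambda>_. c)) - (x - (\<lambda>_. \<eta> x)) \<in> I" by (rule Is(6)[OF that(2) \<eta>[OF that(1)]])
    also have "(x - (\<lambda>_. c)) - (x - (\<lambda>_. \<eta> x)) = (\<lambda>_. \<eta> x - c)" by (simp add: fun_eq_iff)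
    finally show ?thesis using const_I by fastforce
  qed
  show ?thesis
  proof (rule that)
    show "char_of R \<eta>" unfolding char_of_def
    proof (intro conjI ballI allI)
      show "\<eta> (\<lambda>_. c) = c" for c
        using Is(2) by (intro \<eta>I const) (simp add: fun_diff_def zero_fun_def)
      fix a b assume ab: "a \<in> R" "b \<in> R"
      have "(a - (\<lambda>_. \<eta> a)) + (b - (\<lambda>_. \<eta> b)) \<in> I" using ab by (intro Is(3) \<eta>)
      also have "(a - (\<lambda>_. \<eta> a)) + (b - (\<lambda>_. \<eta> b)) = (a + b) - (\<lambda>_. \<eta> a + \<eta> b)" by (simp add: fun_eq_iff)
      finally show "\<eta> (a + b) = \<eta> a + \<eta> b" using ab by (intro \<eta>I Rs)
      have "b * (a - (\<lambda>_. \<eta> a)) + (\<lambda>_. \<eta> a) * (b - (\<lambda>_. \<eta> b)) \<in> I" using ab by (intro Is(3,4) \<eta> const)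
      also have "b * (a - (\<lambda>_. \<eta> a)) + (\<lambda>_. \<eta> a) * (b - (\<lambda>_. \<eta> b)) = (a * b) - (\<lambda>_. \<eta> a * \<eta> b)"
        by (simp add: fun_eq_iff algebra_simps)
      finally show "\<eta> (a * b) = \<eta> a * \<eta> b" using ab by (intro \<eta>I Rs)
    qed
    show "\<eta> x = 0" if "x \<in> J" for x
    proof -
      have "x - (\<lambda>_. 0) = x" by (simp add: fun_eq_iff)
      then show ?thesis using that I(2) Is(1) by (intro \<eta>I) auto
    qed
    show "\<eta> s \<noteq> 0" if "s \<in> S" for s
    proof
      assume "\<eta> s = 0"
      then have "s \<in> I" using \<eta>[of s] that S(2) by (auto simp: fun_diff_def)
      then show False using that I(3) by blast
    qed
  qed
qed

subsection \<open>Generic linear independence\<close>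

text \<open>Gaussian elimination over the domain \<open>R / J\<close>; the product of the pivots is \<open>d\<close>.\<close>

lemma independence_at_generic_character:
  fixes R :: "('v \<Rightarrow> complex) set" and T :: "nat \<Rightarrow> 'u \<Rightarrow> 'v \<Rightarrow> complex"
  assumes R: "is_subring R" and const: "\<And>c. (\<lambda>_. c) \<in> R" and J: "is_ideal R J" and J1: "1 \<notin> J"
    and prime: "\<And>x y. x \<in> R \<Longrightarrow> y \<in> R \<Longrightarrow> x * y \<in> J \<Longrightarrow> x \<in> J \<or> y \<in> J"
    and T: "\<And>j u. u \<in> U \<Longrightarrow> T j u \<in> R"
    and indep: "\<And>r. (\<And>j. r j \<in> R) \<Longrightarrow> (\<And>u. u \<in> U \<Longrightarrow> (\<Sum>j<n. r j * T j u) \<in> J) \<Longrightarrow> \<forall>j<n. r j \<in> J"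
  shows "\<exists>d\<in>R. d \<notin> J \<and> (\<forall>\<eta>. char_of R \<eta> \<longrightarrow> (\<forall>x\<in>J. \<eta> x = 0) \<longrightarrow> \<eta> d \<noteq> 0 \<longrightarrow>
    (\<forall>c. (\<forall>u\<in>U. (\<Sum>j<n. c j * \<eta> (T j u)) = 0) \<longrightarrow> (\<forall>j<n. c j = 0)))"
  using T indep
proof (induction n arbitrary: T)
  case 0
  show ?case using J1 is_subringD(2)[OF R] by blast
next
  case (Suc n)
  note Rs = is_subringD[OF R]
  note Js = is_idealD[OF J]
  \<comment> \<open>If row \<open>n\<close> were zero modulo \<open>J\<close>, the coefficients 0,
    ..., 0, 1 would be a forbidden relation.\<close>
  have "\<exists>u\<in>U. T n u \<notin> J"
  proof (rule ccontr)
    assume no: "\<not> ?thesis"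
    define r where "r j = (if j = n then 1 else 0 :: 'v \<Rightarrow> complex)" for j
    have "(\<Sum>j<Suc n. r j * T j u) = T n u" for u by (simp add: r_def)
    then have "\<forall>j<Suc n. r j \<in> J" using no Rs(1,2) by (intro Suc.prems(2)) (auto simp: r_def)
    then show False using J1 by (auto simp: r_def)
  qed
  then obtain p where p: "p \<in> U" "T n p \<notin> J" by blast
  define e where "e = T n p"
  have eR: "e \<in> R" unfolding e_def using Suc.prems(1) p by blast
  \<comment> \<open>One elimination step with the pivot \<open>T n p\<close>: column
    \<open>p\<close> becomes zero.\<close>
  define T' where "T' j u = e * T j u - T j p * T n u" for j u
  have T'R: "T' j u \<in> R" if "u \<in> U" for j u
    unfolding T'_def using Suc.prems(1) p eR that by (auto intro!: Rs)
  have indep': "\<forall>j<n. r j \<in> J" if r: "\<And>j. r j \<in> R" "\<And>u. u \<in> U \<Longrightarrow> (\<Sum>j<n. r j * T' j u) \<in> J" for r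
  proof -
    \<comment> \<open>A relation among the rows \<open>T'\<close> becomes one among the rows
      \<open>T\<close>, with the coefficient of row \<open>n\<close> collecting what the elimination
      subtracted.\<close>
    define r' where "r' j = (if j < n then r j * e else - (\<Sum>i<n. r i * T i p))" for j
    have r'R: "r' j \<in> R" for j
      unfolding r'_def using r eR Suc.prems(1)[OF p(1)] by (auto intro!: Rs subring_sum[OF R])
    have eq: "(\<Sum>j<Suc n. r' j * T j u) = (\<Sum>j<n. r j * T' j u)" for u
    proof -
      have "(\<Sum>j<Suc n. r' j * T j u) = (\<Sum>j<n. r j * e * T j u) - (\<Sum>i<n. r i * T i p) * T n u"
        unfolding r'_def by (simp del: mult_minus_left add: minus_mult_left[symmetric])
      also have "\<dots> = (\<Sum>j<n. r j * T' j u)"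
        unfolding T'_def by (simp add: sum_distrib_right sum_subtractf[symmetric] right_diff_distrib mult.assoc)
      finally show ?thesis .
    qed
    have "\<forall>j<Suc n. r' j \<in> J"
      by (rule Suc.prems(2)[OF r'R]) (unfold eq, rule r(2))
    then have "r j * e \<in> J" if "j < n" for j using that by (auto simp: r'_def dest!: spec[of _ j])
    then show ?thesis using prime r(1) eR p by (auto simp: e_def)
  qed
  from Suc.IH[of T', OF T'R indep'] obtain d where d: "d \<in> R" "d \<notin> J"
    "\<And>\<eta> c. char_of R \<eta> \<Longrightarrow> \<forall>x\<in>J. \<eta> x = 0 \<Longrightarrow> \<eta> d \<noteq> 0 \<Longrightarrow>
      \<forall>u\<in>U. (\<Sum>j<n. c j * \<eta> (T' j u)) = 0 \<Longrightarrow> \<forall>j<n. c j = 0"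
    by blast
  show ?case
  proof (intro bexI[of _ "e * d"] conjI allI impI)
    show "e * d \<in> R" using eR d by (auto intro: Rs)
    show "e * d \<notin> J" using prime[OF eR d(1)] d(2) p by (auto simp: e_def)
    fix \<eta> c j
    assume \<eta>: "char_of R \<eta>" "\<forall>x\<in>J. \<eta> x = 0" "\<eta> (e * d) \<noteq> 0"
      and c: "\<forall>u\<in>U. (\<Sum>j<Suc n. c j * \<eta> (T j u)) = 0" and j: "j < Suc n"
    note \<eta>s = char_ofD[OF \<eta>(1)]
    have ed: "\<eta> e \<noteq> 0" "\<eta> d \<noteq> 0" using \<eta>(3) \<eta>s(2)[OF eR d(1)] by auto
    have \<eta>T': "\<eta> (T' i u) = \<eta> e * \<eta> (T i u) - \<eta> (T i p) * \<eta> (T n u)" if u: "u \<in> U" for i u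
    proof -
      have R1: "T i p * T n u \<in> R" "T' i u \<in> R" "T i p \<in> R" "T n u \<in> R" "T i u \<in> R"
        using Suc.prems(1) p u T'R by (auto intro!: Rs)
      have "\<eta> (e * T i u) = \<eta> (T' i u + T i p * T n u)" by (simp add: T'_def)
      then show ?thesis using R1 eR by (simp add: \<eta>s)
    qed
    have cp: "(\<Sum>j<n. c j * \<eta> (T j p)) = - c n * \<eta> e"
      using c p(1) by (auto simp: e_def add_eq_0_iff2)
    have "(\<Sum>j<n. c j * \<eta> (T' j u)) = 0" if u: "u \<in> U" for u
    proof -
      have "(\<Sum>j<n. c j * \<eta> (T' j u)) = \<eta> e * (\<Sum>j<n. c j * \<eta> (T j u)) - (\<Sum>j<n. c j * \<eta> (T j p)) * \<eta> (T n u)"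
        unfolding \<eta>T'[OF u] by (simp add: sum_distrib_left sum_distrib_right sum_subtractf algebra_simps)
      also have "\<dots> = \<eta> e * (\<Sum>j<Suc n. c j * \<eta> (T j u))" unfolding cp by (simp add: algebra_simps)
      finally show ?thesis using c u by simp
    qed
    then have cj: "\<forall>j<n. c j = 0" using d(3)[OF \<eta>(1,2) ed(2)] by blast
    then have "c n * \<eta> e = 0" using cp by simp
    then show "c j = 0" using cj j ed by (auto simp: less_Suc_eq)
  qed
qed

subsection \<open>Schur's lemma for Poisson modules\<close>

context poisson_algebra
begin

fun zcomb :: "(complex \<times> 'z) list \<Rightarrow> 'z" where
  "zcomb [] = \<zero>"
| "zcomb (x # xs) = fst x \<odot> snd x \<oplus> zcomb xs"

lemma complex_scalar [simp]: "c \<in> carrier complex_field"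
  by (simp add: complex_field_def)

lemma complex_field_ops: "c \<otimes>\<^bsub>complex_field\<^esub> d = c * d" "c \<oplus>\<^bsub>complex_field\<^esub> d = c + d"
  "\<one>\<^bsub>complex_field\<^esub> = 1" "\<zero>\<^bsub>complex_field\<^esub> = 0"
  by (simp_all add: complex_field_def)

lemma zcomb_closed: "snd ` set xs \<subseteq> carrier Z \<Longrightarrow> zcomb xs \<in> carrier Z"
  by (induction xs) auto

lemma scalar_add: "x \<in> carrier Z \<Longrightarrow> (c + d) \<odot> x = c \<odot> x \<oplus> d \<odot> x"
  using smult_l_distr[of c d x] by (simp add: complex_field_ops)

lemma scalar_mult: "x \<in> carrier Z \<Longrightarrow> (c * d) \<odot> x = c \<odot> (d \<odot> x)"
  using smult_assoc1[of c d x] by (simp add: complex_field_ops)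

lemma scalar_one: "x \<in> carrier Z \<Longrightarrow> 1 \<odot> x = x"
  using smult_one[of x] by (simp add: complex_field_ops)

lemma scalar_zero: "x \<in> carrier Z \<Longrightarrow> 0 \<odot> x = \<zero>"
  using smult_l_null[of x] by (simp add: complex_field_ops)

lemma scalar_conv: "x \<in> carrier Z \<Longrightarrow> c \<odot> x = (c \<odot> \<one>) \<otimes> x"
  using smult_assoc2[of c \<one> x] by simp

end

context poisson_module
begin

definition sc :: "complex \<Rightarrow> 'm \<Rightarrow> 'm" where "sc c m = (c \<odot> \<one>) \<odot>\<^bsub>M\<^esub> m"

lemma sc_closed [simp]: "m \<in> carrier M \<Longrightarrow> sc c m \<in> carrier M"
  by (simp add: sc_def)

lemma sc_add: "m \<in> carrier M \<Longrightarrow> n \<in> carrier M \<Longrightarrow> sc c (m \<oplus>\<^bsub>M\<^esub> n) = sc c m \<oplus>\<^bsub>M\<^esub> sc c n"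
  by (simp add: sc_def M.smult_r_distr)

lemma sc_add2: "m \<in> carrier M \<Longrightarrow> sc (c + d) m = sc c m \<oplus>\<^bsub>M\<^esub> sc d m"
  by (simp add: sc_def scalar_add M.smult_l_distr)

lemma sc_mult: "m \<in> carrier M \<Longrightarrow> sc (c * d) m = sc c (sc d m)"
  by (simp add: sc_def scalar_mult M.smult_assoc1[symmetric] scalar_conv[of "d \<odot> \<one>" c, symmetric])

lemma sc_one [simp]: "m \<in> carrier M \<Longrightarrow> sc 1 m = m"
  by (simp add: sc_def scalar_one)

lemma sc_zero [simp]: "m \<in> carrier M \<Longrightarrow> sc 0 m = \<zero>\<^bsub>M\<^esub>"
  by (simp add: sc_def scalar_zero)

lemma sc_null [simp]: "sc c \<zero>\<^bsub>M\<^esub> = \<zero>\<^bsub>M\<^esub>"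
  by (simp add: sc_def)

lemma sc_smult: "z \<in> carrier Z \<Longrightarrow> m \<in> carrier M \<Longrightarrow> z \<odot>\<^bsub>M\<^esub> sc c m = sc c (z \<odot>\<^bsub>M\<^esub> m)"
  by (simp add: sc_def M.smult_assoc1[symmetric] m_comm)

lemma smult_sc: "z \<in> carrier Z \<Longrightarrow> m \<in> carrier M \<Longrightarrow> (c \<odot> z) \<odot>\<^bsub>M\<^esub> m = sc c (z \<odot>\<^bsub>M\<^esub> m)"
  by (simp add: sc_def M.smult_assoc1[symmetric] scalar_conv[symmetric])

lemma nabla_sc: "z \<in> carrier Z \<Longrightarrow> m \<in> carrier M \<Longrightarrow> nabla z (sc c m) = sc c (nabla z m)"
  by (simp add: sc_def nabla_end_smult)

lemma nabla_scalar: "z \<in> carrier Z \<Longrightarrow> m \<in> carrier M \<Longrightarrow> nabla (c \<odot> z) m = sc c (nabla z m)"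
  by (simp add: sc_def nabla_smult)

lemma sc_minus: "m \<in> carrier M \<Longrightarrow> sc (- 1) m = \<ominus>\<^bsub>M\<^esub> m"
proof -
  assume m: "m \<in> carrier M"
  have "sc (- 1) m \<oplus>\<^bsub>M\<^esub> m = sc (- 1 + 1) m" using m by (simp only: sc_add2 sc_one)
  then show ?thesis using m by (simp add: M.minus_equality)
qed

lemma nabla_null [simp]: "z \<in> carrier Z \<Longrightarrow> nabla z \<zero>\<^bsub>M\<^esub> = \<zero>\<^bsub>M\<^esub>"
  using nabla_sc[of z "\<zero>\<^bsub>M\<^esub>" 0] nabla_closed[of z "\<zero>\<^bsub>M\<^esub>"] by simp

lemma nabla_zero: "m \<in> carrier M \<Longrightarrow> nabla \<zero> m = \<zero>\<^bsub>M\<^esub>"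
  using nabla_scalar[of \<zero> m 0] nabla_closed[of \<zero> m] by (simp add: scalar_zero)

definition stable :: "'m set \<Rightarrow> bool" where
  "stable N \<longleftrightarrow> N \<subseteq> carrier M \<and> \<zero>\<^bsub>M\<^esub> \<in> N \<and> (\<forall>m\<in>N. \<forall>n\<in>N. m \<oplus>\<^bsub>M\<^esub> n \<in> N) \<and>
    (\<forall>z\<in>carrier Z. \<forall>m\<in>N. z \<odot>\<^bsub>M\<^esub> m \<in> N \<and> nabla z m \<in> N)"

lemma stable_submodule:
  assumes "stable N"
  shows "submodule N Z M \<and> (\<forall>x\<in>carrier Z. \<forall>m\<in>N. nabla x m \<in> N)"
proof
  have neg: "\<ominus>\<^bsub>M\<^esub> m \<in> N" if "m \<in> N" for m
  proof -
    have "sc (- 1) m \<in> N" using assms that by (auto simp: stable_def sc_def)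
    then show ?thesis using assms that by (auto simp: stable_def sc_minus subset_iff)
  qed
  show "submodule N Z M"
    by (rule M.submoduleI) (use assms neg in \<open>auto simp: stable_def\<close>)
qed (use assms in \<open>auto simp: stable_def\<close>)

end

locale simple_module = poisson_module Z br M nabla
  for Z :: "(complex, 'z) module" (structure)
    and br :: "'z \<Rightarrow> 'z \<Rightarrow> 'z"
    and M :: "('z, 'm) module"
    and nabla :: "'z \<Rightarrow> 'm \<Rightarrow> 'm" +
  assumes simple: "simple_poisson_module Z br M nabla"
begin

lemma stable_cases: "stable N \<Longrightarrow> N = {\<zero>\<^bsub>M\<^esub>} \<or> N = carrier M"
  using simple stable_submodule unfolding simple_poisson_module_def by blast

lemma nontrivial: obtains v where "v \<in> carrier M" "v \<noteq> \<zero>\<^bsub>M\<^esub>"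
proof -
  have "carrier M \<noteq> {\<zero>\<^bsub>M\<^esub>}" using simple by (simp add: simple_poisson_module_def)
  then obtain v where "v \<in> carrier M" "v \<noteq> \<zero>\<^bsub>M\<^esub>" using M.zero_closed by auto
  then show ?thesis by (rule that)
qed

text \<open>Keeps the list of vectors apart from the coefficients, so that combinations over a
  common list add coefficientwise.\<close>

fun lvec :: "(nat \<Rightarrow> complex) \<Rightarrow> 'm list \<Rightarrow> 'm" where
  "lvec a [] = \<zero>\<^bsub>M\<^esub>"
| "lvec a (w # ws) = sc (a 0) w \<oplus>\<^bsub>M\<^esub> lvec (\<lambda>i. a (Suc i)) ws"

fun mcomb :: "(complex \<times> 'm) list \<Rightarrow> 'm" where
  "mcomb [] = \<zero>\<^bsub>M\<^esub>"
| "mcomb (x # xs) = sc (fst x) (snd x) \<oplus>\<^bsub>M\<^esub> mcomb xs"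

lemma lvec_closed [simp]: "set ws \<subseteq> carrier M \<Longrightarrow> lvec a ws \<in> carrier M"
  by (induction ws arbitrary: a) auto

lemma mcomb_closed [simp]: "snd ` set xs \<subseteq> carrier M \<Longrightarrow> mcomb xs \<in> carrier M"
  by (induction xs) auto

lemma mcomb_lvec: "mcomb xs = lvec (\<lambda>l. fst (xs ! l)) (map snd xs)"
  by (induction xs) auto

lemma lvec_add: "set ws \<subseteq> carrier M \<Longrightarrow> lvec (\<lambda>l. a l + b l) ws = lvec a ws \<oplus>\<^bsub>M\<^esub> lvec b ws"
  by (induction ws arbitrary: a b) (auto simp: sc_add2 M.a_ac)

lemma lvec_sc: "set ws \<subseteq> carrier M \<Longrightarrow> lvec (\<lambda>l. c * a l) ws = sc c (lvec a ws)"
  by (induction ws arbitrary: a) (auto simp: sc_mult sc_add)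

lemma lvec_zero: "set ws \<subseteq> carrier M \<Longrightarrow> (\<And>l. l < length ws \<Longrightarrow> a l = 0) \<Longrightarrow> lvec a ws = \<zero>\<^bsub>M\<^esub>"
proof (induction ws arbitrary: a)
  case (Cons w ws)
  then have "lvec (\<lambda>i. a (Suc i)) ws = \<zero>\<^bsub>M\<^esub>" "a 0 = 0" by auto
  then show ?case using Cons.prems by simp
qed simp

lemma mcomb_append: "snd ` set xs \<subseteq> carrier M \<Longrightarrow> snd ` set ys \<subseteq> carrier M \<Longrightarrow>
    mcomb (xs @ ys) = mcomb xs \<oplus>\<^bsub>M\<^esub> mcomb ys"
  by (induction xs) (auto simp: M.a_assoc)

text \<open>Words in multiplications and \<open>nabla\<close>s by members of \<open>B\<close>,
  applied to one nonzero vector, span a stable subspace; by simplicity it is everything.\<close>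

lemma countable_module:
  assumes B: "countable B" "B \<subseteq> carrier Z" "\<And>z. z \<in> carrier Z \<Longrightarrow> \<exists>xs. snd ` set xs \<subseteq> B \<and> z = zcomb xs"
  obtains W where "countable W" "W \<subseteq> carrier M" "\<And>m. m \<in> carrier M \<Longrightarrow> \<exists>xs. snd ` set xs \<subseteq> W \<and> m = mcomb xs"
proof -
  obtain v where v: "v \<in> carrier M" "v \<noteq> \<zero>\<^bsub>M\<^esub>" by (rule nontrivial)
  define wd where "wd = foldr (\<lambda>(f, b) m. if f then b \<odot>\<^bsub>M\<^esub> m else nabla b m)"
  define W where "W = (\<lambda>l. wd l v) ` lists (UNIV \<times> B)"
  have W_count: "countable W" unfolding W_def using B(1) by (intro countable_image countable_lists countable_SIGMA) auto
  have wd_M: "wd l v \<in> carrier M" if "l \<in> lists (UNIV \<times> B)" for l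
    using that B(2) v(1) by (induction l) (auto simp: wd_def nabla_closed subset_iff)
  then have WM: "W \<subseteq> carrier M" by (auto simp: W_def)
  have Wb: "b \<odot>\<^bsub>M\<^esub> w \<in> W" "nabla b w \<in> W" if "w \<in> W" "b \<in> B" for b w
  proof -
    from that obtain l where l: "l \<in> lists (UNIV \<times> B)" "w = wd l v" by (auto simp: W_def)
    show "b \<odot>\<^bsub>M\<^esub> w \<in> W" unfolding W_def
      by (rule image_eqI[of _ _ "(True, b) # l"]) (use l that in \<open>auto simp: wd_def\<close>)
    show "nabla b w \<in> W" unfolding W_def
      by (rule image_eqI[of _ _ "(False, b) # l"]) (use l that in \<open>auto simp: wd_def\<close>)
  qed
  have vW: "v \<in> W" unfolding W_def by (rule image_eqI[of _ _ "[]"]) (auto simp: wd_def)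
  define N where "N = mcomb ` {xs. snd ` set xs \<subseteq> W}"
  have NM: "N \<subseteq> carrier M" using WM by (auto simp: N_def)
  have N0: "\<zero>\<^bsub>M\<^esub> \<in> N" unfolding N_def by (rule image_eqI[of _ _ "[]"]) auto
  have Nadd: "m \<oplus>\<^bsub>M\<^esub> n \<in> N" if "m \<in> N" "n \<in> N" for m n
  proof -
    from that obtain xs ys where xy: "m = mcomb xs" "n = mcomb ys" "snd ` set xs \<subseteq> W" "snd ` set ys \<subseteq> W"
      by (auto simp: N_def)
    moreover have "mcomb (xs @ ys) = mcomb xs \<oplus>\<^bsub>M\<^esub> mcomb ys" using xy WM by (intro mcomb_append) auto
    ultimately show ?thesis unfolding N_def by (intro image_eqI[of _ _ "xs @ ys"]) auto
  qed
  have Nsc: "sc c w \<in> N" if "w \<in> W" for c w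
    unfolding N_def by (rule image_eqI[of _ _ "[(c, w)]"]) (use that WM in auto)
  have Nsc': "sc c m \<in> N" if m: "m \<in> N" for c m
  proof -
    from m obtain xs where xs: "m = mcomb xs" "snd ` set xs \<subseteq> W" by (auto simp: N_def)
    have "sc c (mcomb xs) \<in> N" using xs(2)
    proof (induction xs)
      case (Cons x xs)
      then have "snd ` set xs \<subseteq> carrier M" "snd x \<in> carrier M" using WM by auto
      then show ?case using Cons by (auto simp: sc_add sc_mult[symmetric] intro!: Nadd Nsc)
    qed (use N0 in simp)
    then show ?thesis using xs by simp
  qed
  have Nb: "b \<odot>\<^bsub>M\<^esub> m \<in> N \<and> nabla b m \<in> N" if m: "m \<in> N" and b: "b \<in> B" for b m
  proof -
    from m obtain xs where xs: "m = mcomb xs" "snd ` set xs \<subseteq> W" by (auto simp: N_def)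
    have bZ: "b \<in> carrier Z" using B(2) b by blast
    have "b \<odot>\<^bsub>M\<^esub> mcomb xs \<in> N \<and> nabla b (mcomb xs) \<in> N" using xs(2)
    proof (induction xs)
      case (Cons x xs)
      then have "snd ` set xs \<subseteq> carrier M" "snd x \<in> carrier M" "snd x \<in> W" using WM by auto
      then show ?case using Cons bZ b Wb[of "snd x" b]
        by (auto simp: M.smult_r_distr nabla_end_add sc_smult nabla_sc intro!: Nadd Nsc)
    qed (use N0 bZ in simp)
    then show ?thesis using xs by simp
  qed
  have Nz: "z \<odot>\<^bsub>M\<^esub> m \<in> N \<and> nabla z m \<in> N" if m: "m \<in> N" and z: "z \<in> carrier Z" for z m
  proof -
    from B(3)[OF z] obtain zs where zs: "z = zcomb zs" "snd ` set zs \<subseteq> B" by auto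
    have mM: "m \<in> carrier M" using m NM by blast
    have "zcomb zs \<odot>\<^bsub>M\<^esub> m \<in> N \<and> nabla (zcomb zs) m \<in> N" using zs(2)
    proof (induction zs)
      case (Cons x xs)
      then have "snd x \<in> carrier Z" "zcomb xs \<in> carrier Z" using B(2) by (auto intro!: zcomb_closed)
      then show ?case using Cons mM Nb[OF m, of "snd x"]
        by (auto simp: M.smult_l_distr nabla_add smult_sc nabla_scalar intro!: Nadd Nsc')
    qed (use N0 mM in \<open>simp add: nabla_zero\<close>)
    then show ?thesis using zs by simp
  qed
  have "stable N" unfolding stable_def using NM N0 Nadd Nz by blast
  moreover have "v \<in> N" using Nsc[OF vW, of 1] v by simp
  ultimately have "N = carrier M" using stable_cases v by blast
  then show ?thesis using that[OF W_count WM] unfolding N_def by blast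
qed

end

context simple_module
begin

text \<open>Horner evaluation of the operator \<open>p(\<theta>)\<close> at
  \<open>w\<close>.\<close>

definition peval :: "('m \<Rightarrow> 'm) \<Rightarrow> 'm \<Rightarrow> complex poly \<Rightarrow> 'm" where
  "peval \<theta> w p = fold_coeffs (\<lambda>a m. sc a w \<oplus>\<^bsub>M\<^esub> \<theta> m) p \<zero>\<^bsub>M\<^esub>"

lemma peval_0 [simp]: "peval \<theta> w 0 = \<zero>\<^bsub>M\<^esub>"
  by (simp add: peval_def)

lemma peval_pCons:
  assumes "\<theta> \<zero>\<^bsub>M\<^esub> = \<zero>\<^bsub>M\<^esub>" "w \<in> carrier M"
  shows "peval \<theta> w (pCons a p) = sc a w \<oplus>\<^bsub>M\<^esub> \<theta> (peval \<theta> w p)"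
proof (cases "a = 0 \<and> p = 0")
  case False
  then show ?thesis
    unfolding peval_def by (cases "p = 0") (simp_all add: fold_coeffs_pCons_not_0_0_eq fold_coeffs_pCons_coeff_not_0_eq)
qed (use assms in simp)

definition endo :: "('m \<Rightarrow> 'm) \<Rightarrow> bool" where
  "endo \<theta> \<longleftrightarrow> (\<forall>m\<in>carrier M. \<theta> m \<in> carrier M) \<and>
    (\<forall>m\<in>carrier M. \<forall>n\<in>carrier M. \<theta> (m \<oplus>\<^bsub>M\<^esub> n) = \<theta> m \<oplus>\<^bsub>M\<^esub> \<theta> n) \<and>
    (\<forall>z\<in>carrier Z. \<forall>m\<in>carrier M. \<theta> (z \<odot>\<^bsub>M\<^esub> m) = z \<odot>\<^bsub>M\<^esub> \<theta> m \<and> \<theta> (nabla z m) = nabla z (\<theta> m))"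

lemma endoD:
  assumes "endo \<theta>"
  shows "m \<in> carrier M \<Longrightarrow> \<theta> m \<in> carrier M"
    "m \<in> carrier M \<Longrightarrow> n \<in> carrier M \<Longrightarrow> \<theta> (m \<oplus>\<^bsub>M\<^esub> n) = \<theta> m \<oplus>\<^bsub>M\<^esub> \<theta> n"
    "z \<in> carrier Z \<Longrightarrow> m \<in> carrier M \<Longrightarrow> \<theta> (z \<odot>\<^bsub>M\<^esub> m) = z \<odot>\<^bsub>M\<^esub> \<theta> m"
    "z \<in> carrier Z \<Longrightarrow> m \<in> carrier M \<Longrightarrow> \<theta> (nabla z m) = nabla z (\<theta> m)"
    "m \<in> carrier M \<Longrightarrow> \<theta> (sc c m) = sc c (\<theta> m)"
    "\<theta> \<zero>\<^bsub>M\<^esub> = \<zero>\<^bsub>M\<^esub>"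
proof -
  show *: "z \<in> carrier Z \<Longrightarrow> m \<in> carrier M \<Longrightarrow> \<theta> (z \<odot>\<^bsub>M\<^esub> m) = z \<odot>\<^bsub>M\<^esub> \<theta> m"
    "m \<in> carrier M \<Longrightarrow> \<theta> m \<in> carrier M" for z m
    using assms by (auto simp: endo_def)
  show "\<theta> \<zero>\<^bsub>M\<^esub> = \<zero>\<^bsub>M\<^esub>"
    using *(1)[of \<zero> "\<zero>\<^bsub>M\<^esub>"] *(2)[of "\<zero>\<^bsub>M\<^esub>"] by simp
qed (use assms in \<open>auto simp: endo_def sc_def\<close>)

context
  fixes \<theta> :: "'m \<Rightarrow> 'm"
  assumes \<theta>: "endo \<theta>"
begin

lemma peval_closed [simp]: "w \<in> carrier M \<Longrightarrow> peval \<theta> w p \<in> carrier M"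
  by (induction p) (auto simp: peval_pCons endoD[OF \<theta>])

lemma peval_add: "w \<in> carrier M \<Longrightarrow> peval \<theta> w (p + q) = peval \<theta> w p \<oplus>\<^bsub>M\<^esub> peval \<theta> w q"
proof (induction p arbitrary: q)
  case (pCons a p)
  show ?case
    using pCons by (cases q) (simp add: peval_pCons endoD[OF \<theta>] sc_add2 M.a_ac)
qed simp

lemma peval_sc: "w \<in> carrier M \<Longrightarrow> peval \<theta> w (Polynomial.smult c p) = sc c (peval \<theta> w p)"
  by (induction p) (simp_all add: peval_pCons endoD[OF \<theta>] sc_mult sc_add)

lemma peval_add2: "w \<in> carrier M \<Longrightarrow> w' \<in> carrier M \<Longrightarrow> peval \<theta> (w \<oplus>\<^bsub>M\<^esub> w') p = peval \<theta> w p \<oplus>\<^bsub>M\<^esub> peval \<theta> w' p"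
  by (induction p) (simp_all add: peval_pCons endoD[OF \<theta>] sc_add M.a_ac)

lemma sc_comm: "w \<in> carrier M \<Longrightarrow> sc c (sc d w) = sc d (sc c w)"
  by (simp add: sc_mult[symmetric] mult.commute)

lemma peval_sc2: "w \<in> carrier M \<Longrightarrow> peval \<theta> (sc c w) p = sc c (peval \<theta> w p)"
  by (induction p) (simp_all add: peval_pCons endoD[OF \<theta>] sc_add sc_comm)

lemma peval_endo: "w \<in> carrier M \<Longrightarrow> peval \<theta> (\<theta> w) p = \<theta> (peval \<theta> w p)"
  by (induction p) (simp_all add: peval_pCons endoD[OF \<theta>])

lemma peval_null [simp]: "peval \<theta> \<zero>\<^bsub>M\<^esub> p = \<zero>\<^bsub>M\<^esub>"
  by (induction p) (simp_all add: peval_pCons endoD[OF \<theta>])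

definition shift :: "complex \<Rightarrow> 'm \<Rightarrow> 'm" where "shift c m = \<theta> m \<oplus>\<^bsub>M\<^esub> sc (- c) m"

lemma peval_shift:
  assumes "w \<in> carrier M"
  shows "peval \<theta> w (p * [:- c, 1:]) = shift c (peval \<theta> w p)" "peval \<theta> w (p * [:- c, 1:]) = peval \<theta> (shift c w) p"
proof -
  have "p * [:- c, 1:] = pCons 0 p + Polynomial.smult (- c) p" by simp
  then show "peval \<theta> w (p * [:- c, 1:]) = shift c (peval \<theta> w p)"
    using assms by (simp only: peval_add peval_sc peval_pCons endoD[OF \<theta>] shift_def peval_closed) (simp add: endoD[OF \<theta>])
  then show "peval \<theta> w (p * [:- c, 1:]) = peval \<theta> (shift c w) p"
    using assms by (simp add: shift_def peval_add2 peval_sc2 peval_endo endoD[OF \<theta>])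
qed

lemma shift_closed: "m \<in> carrier M \<Longrightarrow> shift c m \<in> carrier M"
  by (simp add: shift_def endoD[OF \<theta>])

lemma shift_stable:
  shows "stable {m \<in> carrier M. shift c m = \<zero>\<^bsub>M\<^esub>}" "stable (shift c ` carrier M)"
proof -
  have add: "shift c (m \<oplus>\<^bsub>M\<^esub> n) = shift c m \<oplus>\<^bsub>M\<^esub> shift c n" if "m \<in> carrier M" "n \<in> carrier M" for m n
    using that by (simp add: shift_def endoD[OF \<theta>] sc_add M.a_ac)
  have z: "shift c (z \<odot>\<^bsub>M\<^esub> m) = z \<odot>\<^bsub>M\<^esub> shift c m" "shift c (nabla z m) = nabla z (shift c m)"
    if "m \<in> carrier M" "z \<in> carrier Z" for m z
    using that by (simp_all add: shift_def endoD[OF \<theta>] sc_smult nabla_sc nabla_closed M.smult_r_distr nabla_end_add)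
  have zero: "shift c \<zero>\<^bsub>M\<^esub> = \<zero>\<^bsub>M\<^esub>" by (simp add: shift_def endoD[OF \<theta>])
  show "stable {m \<in> carrier M. shift c m = \<zero>\<^bsub>M\<^esub>}"
    unfolding stable_def using add z zero by (auto simp: nabla_closed)
  show "stable (shift c ` carrier M)"
    unfolding stable_def
  proof (intro conjI ballI)
    show "shift c ` carrier M \<subseteq> carrier M" using shift_closed by auto
    show "\<zero>\<^bsub>M\<^esub> \<in> shift c ` carrier M" by (rule image_eqI[of _ _ "\<zero>\<^bsub>M\<^esub>"]) (simp_all add: zero)
    show "m \<oplus>\<^bsub>M\<^esub> n \<in> shift c ` carrier M" if mn: "m \<in> shift c ` carrier M" "n \<in> shift c ` carrier M" for m n
    proof -
      from mn obtain m' n' where "m = shift c m'" "n = shift c n'" "m' \<in> carrier M" "n' \<in> carrier M" by auto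
      then show ?thesis by (intro image_eqI[of _ _ "m' \<oplus>\<^bsub>M\<^esub> n'"]) (simp_all add: add)
    qed
    fix y m assume y: "y \<in> carrier Z" and "m \<in> shift c ` carrier M"
    then obtain m' where m': "m = shift c m'" "m' \<in> carrier M" by auto
    show "y \<odot>\<^bsub>M\<^esub> m \<in> shift c ` carrier M"
      by (rule image_eqI[of _ _ "y \<odot>\<^bsub>M\<^esub> m'"]) (use m' y z in simp_all)
    show "nabla y m \<in> shift c ` carrier M"
      by (rule image_eqI[of _ _ "nabla y m'"]) (use m' y z in \<open>simp_all add: nabla_closed\<close>)
  qed
qed

text \<open>Amitsur's trick again, now for the resolvents \<open>(\<theta> - c)\<^sup>-\<^sup>1 v\<close>.\<close>

lemma schur:
  assumes W: "countable W" "W \<subseteq> carrier M" "\<And>m. m \<in> carrier M \<Longrightarrow> \<exists>xs. snd ` set xs \<subseteq> W \<and> m = mcomb xs"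
  obtains c where "\<And>m. m \<in> carrier M \<Longrightarrow> \<theta> m = sc c m"
proof -
  have "\<exists>c. \<forall>m\<in>carrier M. shift c m = \<zero>\<^bsub>M\<^esub>"
  proof (rule ccontr)
    assume no: "\<not> ?thesis"
    obtain v where v: "v \<in> carrier M" "v \<noteq> \<zero>\<^bsub>M\<^esub>" by (rule nontrivial)
    \<comment> \<open>Kernel and image of each \<open>\<theta> - c\<close> are stable, so unless
      some \<open>\<theta> - c\<close> is zero all of them are bijective; \<open>w c\<close> will be
      the preimage of \<open>v\<close>.\<close>
    have ker: "{m \<in> carrier M. shift c m = \<zero>\<^bsub>M\<^esub>} = {\<zero>\<^bsub>M\<^esub>}" for c
      using stable_cases[OF shift_stable(1)[of c]] no by blast
    have "shift c ` carrier M = carrier M" for c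
    proof -
      have "shift c ` carrier M \<noteq> {\<zero>\<^bsub>M\<^esub>}" using no by blast
      then show ?thesis using stable_cases[OF shift_stable(2)[of c]] by blast
    qed
    then have "\<exists>w\<in>carrier M. shift c w = v" for c using v(1) by (metis imageE)
    then obtain w where w: "\<And>c. w c \<in> carrier M" "\<And>c. shift c (w c) = v" by metis
    have "\<exists>xs. snd ` set xs \<subseteq> W \<and> w c = mcomb xs" for c using W(3)[OF w(1)] .
    then obtain f where f: "\<And>c. snd ` set (f c) \<subseteq> W" "\<And>c. w c = mcomb (f c)" by metis
    have fW: "set (map snd (f c)) \<subseteq> W" for c using f(1) by simp
    obtain F \<alpha> ws where F: "finite F" "F \<subseteq> UNIV" "\<And>c. c \<in> F \<Longrightarrow> map snd (f c) = ws"
      "\<exists>c\<in>F. \<alpha> c \<noteq> 0" "\<And>l. l < length ws \<Longrightarrow> (\<Sum>c\<in>F. \<alpha> c * fst (f c ! l)) = 0"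
    proof -
      from uncountable_dependency[OF uncountable_UNIV_complex W(1) fW] show ?thesis using that .
    qed
    have wsM: "set ws \<subseteq> carrier M" using F(3,4) fW W(2) by (metis order.trans)
    define Q where "Q c = (\<Prod>d\<in>F - {c}. [:- d, 1:])" for c
    \<comment> \<open>With \<open>P\<close> the product of all \<open>\<theta> - d\<close>, the
      operator \<open>Q c\<close> applied to \<open>v\<close> is \<open>P\<close> applied to
      \<open>w c\<close>. Stated for subsets of \<open>F\<close> to allow induction on them.\<close>
    have key: "peval \<theta> v (\<Sum>c\<in>F'. Polynomial.smult (\<alpha> c) (Q c)) =
        peval \<theta> (lvec (\<lambda>l. \<Sum>c\<in>F'. \<alpha> c * fst (f c ! l)) ws) (\<Prod>d\<in>F. [:- d, 1:])" if "F' \<subseteq> F" for F'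
      using finite_subset[OF that F(1)] that
    proof (induction F' rule: finite_induct)
      case empty
      have "lvec (\<lambda>l. 0) ws = \<zero>\<^bsub>M\<^esub>" using wsM by (intro lvec_zero) auto
      then show ?case by simp
    next
      case (insert c F')
      have cF: "c \<in> F" using insert by auto
      have Qc: "Q c * [:- c, 1:] = (\<Prod>d\<in>F. [:- d, 1:])"
        unfolding Q_def prod.remove[OF F(1) cF] by (rule mult.commute)
      have wc: "w c = lvec (\<lambda>l. fst (f c ! l)) ws" unfolding f(2) mcomb_lvec F(3)[OF cF] ..
      have 1: "peval \<theta> v (Q c) = peval \<theta> (w c) (\<Prod>d\<in>F. [:- d, 1:])"
        using peval_shift(2)[OF w(1)[of c], of "Q c" c] unfolding Qc w(2) by simp
      have "peval \<theta> v (\<Sum>c\<in>insert c F'. Polynomial.smult (\<alpha> c) (Q c)) =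
         sc (\<alpha> c) (peval \<theta> v (Q c)) \<oplus>\<^bsub>M\<^esub> peval \<theta> v (\<Sum>c\<in>F'. Polynomial.smult (\<alpha> c) (Q c))"
        using insert.hyps v by (simp add: peval_add peval_sc)
      also have "\<dots> = peval \<theta> (sc (\<alpha> c) (w c) \<oplus>\<^bsub>M\<^esub> lvec (\<lambda>l. \<Sum>c\<in>F'. \<alpha> c * fst (f c ! l)) ws) (\<Prod>d\<in>F. [:- d, 1:])"
        using insert wsM w(1) unfolding 1 by (subst peval_add2) (auto simp: peval_sc2)
      also have "sc (\<alpha> c) (w c) \<oplus>\<^bsub>M\<^esub> lvec (\<lambda>l. \<Sum>c\<in>F'. \<alpha> c * fst (f c ! l)) ws =
         lvec (\<lambda>l. \<Sum>c\<in>insert c F'. \<alpha> c * fst (f c ! l)) ws"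
        unfolding wc using wsM insert.hyps by (simp add: lvec_sc[symmetric] lvec_add[symmetric])
      finally show ?case .
    qed
    have "peval \<theta> v (resolvent_poly F \<alpha>) = \<zero>\<^bsub>M\<^esub>"
    proof -
      have "lvec (\<lambda>l. \<Sum>c\<in>F. \<alpha> c * fst (f c ! l)) ws = \<zero>\<^bsub>M\<^esub>"
        using wsM F(5) by (intro lvec_zero) auto
      then show ?thesis using key[of F] by (simp add: resolvent_poly_def Q_def)
    qed
    moreover have "resolvent_poly F \<alpha> \<noteq> 0" using F resolvent_poly_nonzero by metis
    \<comment> \<open>\<open>\<theta> - c\<close> is injective, so a linear factor can be
      cancelled.\<close>
    moreover have "p \<in> {p. peval \<theta> v p = \<zero>\<^bsub>M\<^esub>}" if "p * [:- c, 1:] \<in> {p. peval \<theta> v p = \<zero>\<^bsub>M\<^esub>}" for c p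
    proof -
      have "shift c (peval \<theta> v p) = \<zero>\<^bsub>M\<^esub>" using that peval_shift(1)[OF v(1), of p c] by simp
      then have "peval \<theta> v p \<in> {m \<in> carrier M. shift c m = \<zero>\<^bsub>M\<^esub>}" using v by simp
      then show ?thesis unfolding ker by simp
    qed
    ultimately obtain a where a: "a \<noteq> 0" "peval \<theta> v [:a:] = \<zero>\<^bsub>M\<^esub>"
      using poly_kernel_constant[of "resolvent_poly F \<alpha>" "{p. peval \<theta> v p = \<zero>\<^bsub>M\<^esub>}"] by blast
    have "sc a v = \<zero>\<^bsub>M\<^esub>" using a v by (simp add: peval_pCons endoD[OF \<theta>])
    then have "sc (1 / a) (sc a v) = \<zero>\<^bsub>M\<^esub>" by simp
    then show False using a v by (simp add: sc_mult[symmetric])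
  qed
  then obtain c where c: "\<And>m. m \<in> carrier M \<Longrightarrow> shift c m = \<zero>\<^bsub>M\<^esub>" by blast
  have "\<theta> m = sc c m" if m: "m \<in> carrier M" for m
  proof -
    have "\<theta> m \<oplus>\<^bsub>M\<^esub> sc (- c) m = sc (c + - c) m" using c[OF m] m by (simp add: shift_def)
    also have "\<dots> = sc c m \<oplus>\<^bsub>M\<^esub> sc (- c) m" using m by (simp only: sc_add2)
    finally show ?thesis using m by (simp add: endoD[OF \<theta>])
  qed
  then show ?thesis by (rule that)
qed

end

subsection \<open>Linear independence and iterated brackets\<close>

definition wbr :: "'z list \<Rightarrow> 'z \<Rightarrow> 'z" where "wbr us a = foldr br us a"

lemma wbr_closed [simp]: "us \<in> lists (carrier Z) \<Longrightarrow> a \<in> carrier Z \<Longrightarrow> wbr us a \<in> carrier Z"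
  by (induction us) (auto simp: wbr_def br_closed)

primrec msum :: "(nat \<Rightarrow> 'm) \<Rightarrow> nat \<Rightarrow> 'm" where
  "msum f 0 = \<zero>\<^bsub>M\<^esub>"
| "msum f (Suc n) = msum f n \<oplus>\<^bsub>M\<^esub> f n"

lemma msum_closed [simp]: "(\<And>j. j < n \<Longrightarrow> f j \<in> carrier M) \<Longrightarrow> msum f n \<in> carrier M"
  by (induction n) auto

lemma msum_cong: "(\<And>j. j < n \<Longrightarrow> f j = g j) \<Longrightarrow> msum f n = msum g n"
  by (induction n) auto

lemma msum_add: "(\<And>j. j < n \<Longrightarrow> f j \<in> carrier M) \<Longrightarrow> (\<And>j. j < n \<Longrightarrow> g j \<in> carrier M) \<Longrightarrow>
   msum (\<lambda>j. f j \<oplus>\<^bsub>M\<^esub> g j) n = msum f n \<oplus>\<^bsub>M\<^esub> msum g n"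
  by (induction n) (auto simp: M.a_ac)

lemma msum_additive:
  assumes "\<And>m n. m \<in> carrier M \<Longrightarrow> n \<in> carrier M \<Longrightarrow> h (m \<oplus>\<^bsub>M\<^esub> n) = h m \<oplus>\<^bsub>M\<^esub> h n" "h \<zero>\<^bsub>M\<^esub> = \<zero>\<^bsub>M\<^esub>"
    "\<And>j. j < n \<Longrightarrow> f j \<in> carrier M"
  shows "h (msum f n) = msum (\<lambda>j. h (f j)) n"
  using assms(3) by (induction n) (auto simp: assms(1,2))

primrec zsum :: "(nat \<Rightarrow> complex) \<Rightarrow> (nat \<Rightarrow> 'z) \<Rightarrow> nat \<Rightarrow> 'z" where
  "zsum c a 0 = \<zero>"
| "zsum c a (Suc n) = zsum c a n \<oplus> c n \<odot> a n"

lemma zsum_closed [simp]: "(\<And>j. j < n \<Longrightarrow> a j \<in> carrier Z) \<Longrightarrow> zsum c a n \<in> carrier Z"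
  by (induction n) auto

text \<open>Imposing the relation for all iterated brackets of the \<open>a j\<close>, not only for
  the \<open>a j\<close> themselves, is what makes the solutions closed under
  \<open>nabla\<close>.\<close>

definition sol :: "nat \<Rightarrow> (nat \<Rightarrow> 'z) \<Rightarrow> (nat \<Rightarrow> 'm) \<Rightarrow> bool" where
  "sol n a m \<longleftrightarrow> (\<forall>j<n. m j \<in> carrier M) \<and>
    (\<forall>us\<in>lists (carrier Z). msum (\<lambda>j. wbr us (a j) \<odot>\<^bsub>M\<^esub> m j) n = \<zero>\<^bsub>M\<^esub>)"

context
  fixes a :: "nat \<Rightarrow> 'z"
  assumes a: "\<And>j. a j \<in> carrier Z"
begin

lemma sol_add:
  assumes "sol n a m" "sol n a m'"
  shows "sol n a (\<lambda>j. m j \<oplus>\<^bsub>M\<^esub> m' j)"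
proof -
  have "msum (\<lambda>j. wbr us (a j) \<odot>\<^bsub>M\<^esub> (m j \<oplus>\<^bsub>M\<^esub> m' j)) n = \<zero>\<^bsub>M\<^esub>" if us: "us \<in> lists (carrier Z)" for us
  proof -
    have "msum (\<lambda>j. wbr us (a j) \<odot>\<^bsub>M\<^esub> (m j \<oplus>\<^bsub>M\<^esub> m' j)) n
      = msum (\<lambda>j. wbr us (a j) \<odot>\<^bsub>M\<^esub> m j \<oplus>\<^bsub>M\<^esub> wbr us (a j) \<odot>\<^bsub>M\<^esub> m' j) n"
      using assms us a by (intro msum_cong) (auto simp: sol_def M.smult_r_distr)
    also have "\<dots> = msum (\<lambda>j. wbr us (a j) \<odot>\<^bsub>M\<^esub> m j) n \<oplus>\<^bsub>M\<^esub> msum (\<lambda>j. wbr us (a j) \<odot>\<^bsub>M\<^esub> m' j) n"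
      using assms us a by (intro msum_add) (auto simp: sol_def)
    finally show ?thesis using assms us by (simp add: sol_def)
  qed
  then show ?thesis using assms by (auto simp: sol_def)
qed

lemma sol_smult:
  assumes "sol n a m" "z \<in> carrier Z"
  shows "sol n a (\<lambda>j. z \<odot>\<^bsub>M\<^esub> m j)"
proof -
  have "msum (\<lambda>j. wbr us (a j) \<odot>\<^bsub>M\<^esub> (z \<odot>\<^bsub>M\<^esub> m j)) n = \<zero>\<^bsub>M\<^esub>" if us: "us \<in> lists (carrier Z)" for us
  proof -
    have "msum (\<lambda>j. wbr us (a j) \<odot>\<^bsub>M\<^esub> (z \<odot>\<^bsub>M\<^esub> m j)) n = msum (\<lambda>j. z \<odot>\<^bsub>M\<^esub> (wbr us (a j) \<odot>\<^bsub>M\<^esub> m j)) n"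
      using assms us a by (intro msum_cong) (auto simp: sol_def M.smult_assoc1[symmetric] m_comm)
    also have "\<dots> = z \<odot>\<^bsub>M\<^esub> msum (\<lambda>j. wbr us (a j) \<odot>\<^bsub>M\<^esub> m j) n"
      using assms us a by (intro msum_additive[symmetric]) (auto simp: sol_def M.smult_r_distr)
    finally show ?thesis using assms us by (simp add: sol_def)
  qed
  then show ?thesis using assms by (auto simp: sol_def)
qed

text \<open>\<open>nabla z\<close> applied to the relation for \<open>us\<close> produces the
  relation for \<open>z # us\<close>, which holds by assumption, plus the relation for
  \<open>us\<close> with \<open>nabla z (m j)\<close> in place of \<open>m j\<close>.\<close>

lemma sol_nabla:
  assumes "sol n a m" "z \<in> carrier Z"
  shows "sol n a (\<lambda>j. nabla z (m j))"
proof -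
  have "msum (\<lambda>j. wbr us (a j) \<odot>\<^bsub>M\<^esub> nabla z (m j)) n = \<zero>\<^bsub>M\<^esub>" if us: "us \<in> lists (carrier Z)" for us
  proof -
    have zus: "z # us \<in> lists (carrier Z)" using us assms by simp
    have "nabla z (wbr us (a j) \<odot>\<^bsub>M\<^esub> m j) = wbr (z # us) (a j) \<odot>\<^bsub>M\<^esub> m j \<oplus>\<^bsub>M\<^esub> wbr us (a j) \<odot>\<^bsub>M\<^esub> nabla z (m j)"
      if "j < n" for j
    proof -
      have mj: "m j \<in> carrier M" using assms that by (simp add: sol_def)
      have "wbr (z # us) (a j) \<odot>\<^bsub>M\<^esub> m j =
        nabla z (wbr us (a j) \<odot>\<^bsub>M\<^esub> m j) \<ominus>\<^bsub>M\<^esub> wbr us (a j) \<odot>\<^bsub>M\<^esub> nabla z (m j)"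
        using nabla_br_smult[OF assms(2) wbr_closed[OF us a] mj] by (simp add: wbr_def)
      then show ?thesis using mj assms us a
        by (simp add: M.minus_eq M.a_assoc nabla_closed M.l_neg)
    qed
    then have "msum (\<lambda>j. nabla z (wbr us (a j) \<odot>\<^bsub>M\<^esub> m j)) n =
      msum (\<lambda>j. wbr (z # us) (a j) \<odot>\<^bsub>M\<^esub> m j \<oplus>\<^bsub>M\<^esub> wbr us (a j) \<odot>\<^bsub>M\<^esub> nabla z (m j)) n"
      by (rule msum_cong)
    also have "\<dots> = msum (\<lambda>j. wbr (z # us) (a j) \<odot>\<^bsub>M\<^esub> m j) n \<oplus>\<^bsub>M\<^esub> msum (\<lambda>j. wbr us (a j) \<odot>\<^bsub>M\<^esub> nabla z (m j)) n"
      using assms us zus a by (intro msum_add) (auto simp: sol_def nabla_closed simp del: in_lists_conv_set intro!: M.smult_closed wbr_closed)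
    also have "msum (\<lambda>j. wbr (z # us) (a j) \<odot>\<^bsub>M\<^esub> m j) n = \<zero>\<^bsub>M\<^esub>" using assms zus by (simp add: sol_def)
    also have "msum (\<lambda>j. nabla z (wbr us (a j) \<odot>\<^bsub>M\<^esub> m j)) n = nabla z (msum (\<lambda>j. wbr us (a j) \<odot>\<^bsub>M\<^esub> m j) n)"
      using assms us a by (intro msum_additive[symmetric]) (auto simp: sol_def nabla_end_add)
    also have "msum (\<lambda>j. wbr us (a j) \<odot>\<^bsub>M\<^esub> m j) n = \<zero>\<^bsub>M\<^esub>" using assms us by (simp add: sol_def)
    finally show ?thesis using assms us a by (simp add: sol_def nabla_closed)
  qed
  then show ?thesis using assms by (auto simp: sol_def nabla_closed)
qed

lemma sol_zero: "sol n a (\<lambda>_. \<zero>\<^bsub>M\<^esub>)"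
proof -
  have "msum (\<lambda>j. wbr us (a j) \<odot>\<^bsub>M\<^esub> \<zero>\<^bsub>M\<^esub>) n = \<zero>\<^bsub>M\<^esub>" if us: "us \<in> lists (carrier Z)" for us
    using us a by (induction n) auto
  then show ?thesis by (simp add: sol_def)
qed

lemma sol_Suc: "sol (Suc n) a m \<Longrightarrow> m n = \<zero>\<^bsub>M\<^esub> \<Longrightarrow> sol n a m"
  using a by (auto simp: sol_def)

text \<open>Induction as in Jacobson's density theorem. The last components of solutions form a
  stable submodule. If it is zero, the shorter relation applies. If it is all of \<open>M\<close>,
  every component is a function of the last one that commutes with all actions, hence a scalar by
  Schur's lemma; the scalars give an annihilating combination of the \<open>a j\<close> in which the
  last coefficient acts as the identity, although independence makes it 0.\<close>

theorem sol_trivial: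
  assumes W: "countable W" "W \<subseteq> carrier M" "\<And>m. m \<in> carrier M \<Longrightarrow> \<exists>xs. snd ` set xs \<subseteq> W \<and> m = mcomb xs"
    and indep: "\<And>c. zsum c a n \<in> annihilator Z M \<Longrightarrow> \<forall>j<n. c j = 0"
    and m: "sol n a m"
  shows "\<forall>j<n. m j = \<zero>\<^bsub>M\<^esub>"
  using indep m
proof (induction n arbitrary: m)
  case (Suc n)
  have indep': "\<forall>j<n. c j = 0" if "zsum c a n \<in> annihilator Z M" for c
  proof -
    have cong: "zsum c a n = zsum (c(n := 0)) a n"
    proof -
      have "zsum c a k = zsum (c(n := 0)) a k" if "k \<le> n" for k
        using that by (induction k) auto
      then show ?thesis by simp
    qed
    have "zsum (c(n := 0)) a (Suc n) = zsum c a n"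
      using a by (simp add: scalar_zero cong[symmetric])
    then have "\<forall>j<Suc n. (c(n := 0)) j = 0" using Suc.prems(1)[of "c(n := 0)"] that by metis
    then show ?thesis by (metis fun_upd_apply less_Suc_eq nat_less_le)
  qed
  have IH: "\<forall>j<n. m j = \<zero>\<^bsub>M\<^esub>" if "sol n a m" for m
    using Suc.IH indep' that by blast
  \<comment> \<open>The difference of two such solutions is a solution of length \<open>n\<close>,
    hence zero by induction; so the last component determines the others.\<close>
  have uniq: "\<forall>j\<le>n. m j = m' j" if s: "sol (Suc n) a m" "sol (Suc n) a m'" "m n = m' n" for m m'
  proof -
    have c: "m j \<in> carrier M" "m' j \<in> carrier M" if "j \<le> n" for j using s that by (auto simp: sol_def)
    define d where "d j = m j \<oplus>\<^bsub>M\<^esub> (\<ominus> \<one>) \<odot>\<^bsub>M\<^esub> m' j" for j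
    have dj: "d j = m j \<ominus>\<^bsub>M\<^esub> m' j" if "j \<le> n" for j
      using c[OF that] by (simp add: d_def M.smult_l_minus M.minus_eq)
    have "sol (Suc n) a d" unfolding d_def using s by (intro sol_add sol_smult) auto
    moreover have "d n = \<zero>\<^bsub>M\<^esub>" using dj[of n] c[of n] s by (simp add: M.r_neg M.minus_eq)
    ultimately have "\<forall>j<n. d j = \<zero>\<^bsub>M\<^esub>" using sol_Suc IH by blast
    then have "m j = m' j" if "j < n" for j
    proof -
      have "m j = (m j \<ominus>\<^bsub>M\<^esub> m' j) \<oplus>\<^bsub>M\<^esub> m' j"
        using c[of j] that by (simp add: M.minus_eq M.a_assoc M.l_neg)
      also have "m j \<ominus>\<^bsub>M\<^esub> m' j = \<zero>\<^bsub>M\<^esub>" using \<open>\<forall>j<n. d j = \<zero>\<^bsub>M\<^esub>\<close> dj[of j] that by simp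
      finally show ?thesis using c[of j] that by simp
    qed
    then show ?thesis using s(3) by (auto simp: le_less)
  qed
  define N where "N = {m n | m. sol (Suc n) a m}"
  have Nmem: "m n \<in> N" if "sol (Suc n) a m" for m using that by (auto simp: N_def)
  have "stable N"
    unfolding stable_def
  proof (intro conjI ballI)
    show "N \<subseteq> carrier M" by (auto simp: N_def sol_def)
    show "\<zero>\<^bsub>M\<^esub> \<in> N" using Nmem[OF sol_zero] .
    show "x \<oplus>\<^bsub>M\<^esub> y \<in> N" if "x \<in> N" "y \<in> N" for x y
      using that Nmem[OF sol_add] by (auto simp: N_def)
    fix z x assume "z \<in> carrier Z" "x \<in> N"
    then show "z \<odot>\<^bsub>M\<^esub> x \<in> N" "nabla z x \<in> N"
      using Nmem[OF sol_smult] Nmem[OF sol_nabla] by (auto simp: N_def)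
  qed
  then consider "N = {\<zero>\<^bsub>M\<^esub>}" | "N = carrier M" using stable_cases by blast
  then show ?case
  proof cases
    case 1
    then have "m n = \<zero>\<^bsub>M\<^esub>" using Nmem[OF Suc.prems(2)] by blast
    then show ?thesis using uniq[OF Suc.prems(2) sol_zero] by (simp add: less_Suc_eq_le)
  next
    case 2
    have "\<exists>s. sol (Suc n) a s \<and> s n = y" if "y \<in> carrier M" for y
    proof -
      have "y \<in> N" using that 2 by simp
      then show ?thesis unfolding N_def by blast
    qed
    then obtain s where s: "\<And>y. y \<in> carrier M \<Longrightarrow> sol (Suc n) a (s y)" "\<And>y. y \<in> carrier M \<Longrightarrow> s y n = y"
      by metis
    \<comment> \<open>Uniqueness makes each component an endomorphism of the Poisson module in terms
      of the last one.\<close>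
    have endo: "endo (\<lambda>y. s y j)" if j: "j \<le> n" for j
      unfolding endo_def
    proof (intro conjI ballI)
      show "s y j \<in> carrier M" if "y \<in> carrier M" for y using s(1)[OF that] j by (simp add: sol_def)
      show "s (x \<oplus>\<^bsub>M\<^esub> y) j = s x j \<oplus>\<^bsub>M\<^esub> s y j" if "x \<in> carrier M" "y \<in> carrier M" for x y
        using uniq[OF s(1)[of "x \<oplus>\<^bsub>M\<^esub> y"] sol_add[OF s(1)[of x] s(1)[of y]]] that s(2) j by simp
      fix z y assume zy: "z \<in> carrier Z" "y \<in> carrier M"
      show "s (z \<odot>\<^bsub>M\<^esub> y) j = z \<odot>\<^bsub>M\<^esub> s y j"
        using uniq[OF s(1)[of "z \<odot>\<^bsub>M\<^esub> y"] sol_smult[OF s(1)[of y]]] zy s(2) j by simp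
      show "s (nabla z y) j = nabla z (s y j)"
        using uniq[OF s(1)[of "nabla z y"] sol_nabla[OF s(1)[of y]]] zy s(2) j by (simp add: nabla_closed)
    qed
    have "\<exists>c. \<forall>y\<in>carrier M. s y j = sc c y" if "j \<le> n" for j
      using schur[OF endo[OF that] W] by metis
    then obtain c where c: "\<And>j y. j \<le> n \<Longrightarrow> y \<in> carrier M \<Longrightarrow> s y j = sc (c j) y" by metis
    have act: "zsum c a k \<odot>\<^bsub>M\<^esub> y = msum (\<lambda>j. a j \<odot>\<^bsub>M\<^esub> sc (c j) y) k" if "y \<in> carrier M" for k y
      using that a by (induction k) (auto simp: M.smult_l_distr smult_sc sc_smult)
    have "zsum c a (Suc n) \<odot>\<^bsub>M\<^esub> y = \<zero>\<^bsub>M\<^esub>" if y: "y \<in> carrier M" for y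
    proof -
      \<comment> \<open>The empty word gives the relation for the \<open>a j\<close>
        themselves.\<close>
      have "msum (\<lambda>j. wbr [] (a j) \<odot>\<^bsub>M\<^esub> s y j) (Suc n) = \<zero>\<^bsub>M\<^esub>"
        using s(1)[OF y] unfolding sol_def by (metis lists.Nil)
      also have "msum (\<lambda>j. wbr [] (a j) \<odot>\<^bsub>M\<^esub> s y j) (Suc n) = msum (\<lambda>j. a j \<odot>\<^bsub>M\<^esub> sc (c j) y) (Suc n)"
        using c y by (intro msum_cong) (auto simp: wbr_def)
      finally show ?thesis by (simp only: act[OF y])
    qed
    then have "zsum c a (Suc n) \<in> annihilator Z M"
      using a by (auto simp: annihilator_def simp del: zsum.simps)
    then have "c n = 0" using Suc.prems(1) by blast
    obtain v where v: "v \<in> carrier M" "v \<noteq> \<zero>\<^bsub>M\<^esub>" by (rule nontrivial)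
    have "v = \<zero>\<^bsub>M\<^esub>" using c[of n v] s(2)[of v] v \<open>c n = 0\<close> by simp
    then show ?thesis using v by simp
  qed
qed simp

end

end

section \<open>Annihilators of simple modules are Poisson cores of points\<close>

lemma polyfun_algebra_simps:
  "carrier (polyfun_algebra D L) = polyfuns D L"
  "x \<otimes>\<^bsub>polyfun_algebra D L\<^esub> y = (\<lambda>v\<in>D. x v * y v)"
  "x \<oplus>\<^bsub>polyfun_algebra D L\<^esub> y = (\<lambda>v\<in>D. x v + y v)"
  "\<one>\<^bsub>polyfun_algebra D L\<^esub> = (\<lambda>v\<in>D. 1)"
  "\<zero>\<^bsub>polyfun_algebra D L\<^esub> = (\<lambda>v\<in>D. 0)"
  "c \<odot>\<^bsub>polyfun_algebra D L\<^esub> x = (\<lambda>v\<in>D. c * x v)"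
  by (simp_all add: polyfun_algebra_def)

context poisson_algebra
begin

lemma br_add_right:
  assumes "x \<in> carrier Z" "y \<in> carrier Z" "z \<in> carrier Z"
  shows "br x (y \<oplus> z) = br x y \<oplus> br x z"
  using assms by (simp add: br_antisym[of x] br_add br_closed minus_add)

lemma br_smult_right:
  assumes "x \<in> carrier Z" "y \<in> carrier Z"
  shows "br x (c \<odot> y) = c \<odot> br x y"
  using assms by (simp add: br_antisym[of x] br_smult br_closed smult_r_minus)

lemma br_leibniz_right:
  assumes "x \<in> carrier Z" "y \<in> carrier Z" "z \<in> carrier Z"
  shows "br x (y \<otimes> z) = y \<otimes> br x z \<oplus> z \<otimes> br x y"
  using assms by (simp add: br_antisym[of x] br_leibniz br_closed minus_add r_minus)

lemma foldr_br_closed: "us \<in> lists (carrier Z) \<Longrightarrow> a \<in> carrier Z \<Longrightarrow> foldr br us a \<in> carrier Z"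
  by (induction us) (auto simp: br_closed)

lemma foldr_br_add: "us \<in> lists (carrier Z) \<Longrightarrow> a \<in> carrier Z \<Longrightarrow> b \<in> carrier Z \<Longrightarrow>
    foldr br us (a \<oplus> b) = foldr br us a \<oplus> foldr br us b"
proof (induction us)
  case (Cons u us)
  then have "foldr br us a \<in> carrier Z" "foldr br us b \<in> carrier Z" by (auto intro: foldr_br_closed)
  then show ?case using Cons by (simp add: br_add_right)
qed simp

lemma foldr_br_smult: "us \<in> lists (carrier Z) \<Longrightarrow> a \<in> carrier Z \<Longrightarrow>
    foldr br us (c \<odot> a) = c \<odot> foldr br us a"
proof (induction us)
  case (Cons u us)
  then have "foldr br us a \<in> carrier Z" by (auto intro: foldr_br_closed)
  then show ?case using Cons by (simp add: br_smult_right)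
qed simp

end

context poisson_module
begin

text \<open>\<open>br x z\<close> acts as the commutator of \<open>nabla x\<close> and
  \<open>z\<close>, so the annihilator is a Poisson ideal.\<close>

lemma annihilator_br:
  assumes "z \<in> annihilator Z M" "x \<in> carrier Z"
  shows "br x z \<in> annihilator Z M"
proof -
  have z: "z \<in> carrier Z" "\<And>m. m \<in> carrier M \<Longrightarrow> z \<odot>\<^bsub>M\<^esub> m = \<zero>\<^bsub>M\<^esub>"
    using assms by (auto simp: annihilator_def)
  have "nabla x \<zero>\<^bsub>M\<^esub> = \<zero>\<^bsub>M\<^esub>" using assms(2) by simp
  then have "br x z \<odot>\<^bsub>M\<^esub> m = \<zero>\<^bsub>M\<^esub>" if "m \<in> carrier M" for m
    using nabla_br_smult[OF assms(2) z(1) that] z(2)[OF that] z(2)[OF nabla_closed[OF assms(2) that]]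
    by (simp add: M.minus_eq)
  then show ?thesis using br_closed assms z by (simp add: annihilator_def)
qed

lemma annihilator_foldr_br:
  "us \<in> lists (carrier Z) \<Longrightarrow> z \<in> annihilator Z M \<Longrightarrow> foldr br us z \<in> annihilator Z M"
  by (induction us) (auto intro: annihilator_br)

end

text \<open>\<open>brackets_vanish\<close> is the Poisson core of the maximal ideal of \<open>\<phi>\<close>.\<close>

definition brackets_vanish ::
    "(complex, 'v \<Rightarrow> complex) module \<Rightarrow> (('v \<Rightarrow> complex) \<Rightarrow> ('v \<Rightarrow> complex) \<Rightarrow> ('v \<Rightarrow> complex)) \<Rightarrow> 'v \<Rightarrow> ('v \<Rightarrow> complex) set" where
  "brackets_vanish Z br \<phi> = {z \<in> carrier Z. \<forall>us\<in>lists (carrier Z). foldr br us z \<phi> = 0}"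

text \<open>\<open>Z\<close> holds extensional functions on \<open>D\<close>, whereas
  \<open>R\<close> holds functions on the whole type, where the ring operations are those of the
  type class. The last assumption identifies the characters of \<open>R\<close> that factor through
  restriction to \<open>D\<close> with evaluations at points of \<open>D\<close>.\<close>

locale affine_simple_module = simple_module "polyfun_algebra D L" br M nabla
  for D :: "'v set" and L :: "('v \<Rightarrow> complex) set"
    and br :: "('v \<Rightarrow> complex) \<Rightarrow> ('v \<Rightarrow> complex) \<Rightarrow> ('v \<Rightarrow> complex)"
    and M :: "('v \<Rightarrow> complex, 'm) module"
    and nabla :: "('v \<Rightarrow> complex) \<Rightarrow> 'm \<Rightarrow> 'm" +
  fixes X :: "('v \<Rightarrow> complex) set"
  assumes fin_X: "finite X"
    and restr: "polyfuns D L = (\<lambda>f. restrict f D) ` polyfuns UNIV X"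
    and points: "\<And>\<eta>. char_of (polyfuns UNIV X) \<eta> \<Longrightarrow>
      (\<And>f. f \<in> polyfuns UNIV X \<Longrightarrow> (\<And>v. v \<in> D \<Longrightarrow> f v = 0) \<Longrightarrow> \<eta> f = 0) \<Longrightarrow>
      \<exists>\<phi>\<in>D. \<forall>f\<in>polyfuns UNIV X. \<eta> f = f \<phi>"
begin

abbreviation "Z \<equiv> polyfun_algebra D L"
abbreviation "R \<equiv> polyfuns UNIV X"
abbreviation "rs f \<equiv> restrict f D"

lemma R: "is_subring R" by (rule subring_polyfuns)

lemma rs_closed: "f \<in> R \<Longrightarrow> rs f \<in> carrier Z"
  using restr by (auto simp: polyfun_algebra_simps)

lemma rs_ops: "rs (f + g) = rs f \<oplus>\<^bsub>Z\<^esub> rs g" "rs (f * g) = rs f \<otimes>\<^bsub>Z\<^esub> rs g"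
  "rs (\<lambda>_. c) = c \<odot>\<^bsub>Z\<^esub> \<one>\<^bsub>Z\<^esub>" "rs (\<lambda>v. c * f v) = c \<odot>\<^bsub>Z\<^esub> rs f" "rs 0 = \<zero>\<^bsub>Z\<^esub>" "rs 1 = \<one>\<^bsub>Z\<^esub>"
  by (auto simp: polyfun_algebra_simps restrict_def fun_eq_iff)

lemma lift:
  assumes "z \<in> carrier Z" obtains f where "f \<in> R" "rs f = z"
  using assms restr by (auto simp: polyfun_algebra_simps)

definition act :: "('v \<Rightarrow> complex) \<Rightarrow> 'm \<Rightarrow> 'm" where "act f m = rs f \<odot>\<^bsub>M\<^esub> m"

lemma act_closed [simp]: "f \<in> R \<Longrightarrow> m \<in> carrier M \<Longrightarrow> act f m \<in> carrier M"
  by (simp add: act_def rs_closed)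

lemma act_add: "f \<in> R \<Longrightarrow> g \<in> R \<Longrightarrow> m \<in> carrier M \<Longrightarrow> act (f + g) m = act f m \<oplus>\<^bsub>M\<^esub> act g m"
  by (simp only: act_def rs_ops M.smult_l_distr rs_closed)

lemma act_mult: "f \<in> R \<Longrightarrow> g \<in> R \<Longrightarrow> m \<in> carrier M \<Longrightarrow> act (f * g) m = act f (act g m)"
  by (simp only: act_def rs_ops M.smult_assoc1 rs_closed)

lemma act_zero: "m \<in> carrier M \<Longrightarrow> act 0 m = \<zero>\<^bsub>M\<^esub>"
  by (simp only: act_def rs_ops M.smult_l_null)

lemma act_one: "m \<in> carrier M \<Longrightarrow> act 1 m = m"
  by (simp only: act_def rs_ops M.smult_one)

lemma act_null: "f \<in> R \<Longrightarrow> act f \<zero>\<^bsub>M\<^esub> = \<zero>\<^bsub>M\<^esub>"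
  by (simp add: act_def rs_closed)

definition Ann :: "'m \<Rightarrow> ('v \<Rightarrow> complex) set" where "Ann v = {f \<in> R. act f v = \<zero>\<^bsub>M\<^esub>}"

lemma ideal_Ann: "v \<in> carrier M \<Longrightarrow> is_ideal R (Ann v)"
  unfolding is_ideal_def Ann_def
  using is_subringD[OF R] by (auto simp: act_add act_mult act_zero act_null)

text \<open>The chain condition applies to annihilators of nonzero vectors. A maximal one is an
  associated prime of \<open>M\<close>; its primality is a consequence of the maximality stated
  here.\<close>

lemma maximal_Ann:
  obtains v where "v \<in> carrier M" "v \<noteq> \<zero>\<^bsub>M\<^esub>"
    "\<forall>w\<in>carrier M. w \<noteq> \<zero>\<^bsub>M\<^esub> \<longrightarrow> Ann v \<subseteq> Ann w \<longrightarrow> Ann w = Ann v"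
proof -
  let ?K = "Ann ` {v \<in> carrier M. v \<noteq> \<zero>\<^bsub>M\<^esub>}"
  obtain v0 where "v0 \<in> carrier M" "v0 \<noteq> \<zero>\<^bsub>M\<^esub>" by (rule nontrivial)
  then have K0: "?K \<noteq> {}" by blast
  have K: "is_ideal R I" if "I \<in> ?K" for I using that ideal_Ann by blast
  obtain I where I: "I \<in> ?K" "\<And>I'. I' \<in> ?K \<Longrightarrow> I \<subseteq> I' \<Longrightarrow> I' = I"
    by (rule noeth_maximal[OF noeth_polyfuns[OF fin_X] K0 K], assumption) (rule that)
  from I(1) obtain v where v: "v \<in> carrier M" "v \<noteq> \<zero>\<^bsub>M\<^esub>" "I = Ann v" by blast
  have "Ann w = Ann v" if "w \<in> carrier M" "w \<noteq> \<zero>\<^bsub>M\<^esub>" "Ann v \<subseteq> Ann w" for w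
    using I(2)[of "Ann w"] that v(3) by blast
  then show ?thesis using that v(1,2) by blast
qed

definition AnnR :: "('v \<Rightarrow> complex) set" where "AnnR = {f \<in> R. rs f \<in> annihilator Z M}"

lemma ideal_AnnR: "is_ideal R AnnR"
proof -
  have eq: "AnnR = {f \<in> R. \<forall>m\<in>carrier M. act f m = \<zero>\<^bsub>M\<^esub>}"
    by (auto simp: AnnR_def annihilator_def act_def rs_closed)
  show ?thesis unfolding is_ideal_def eq
    using is_subringD[OF R] by (auto simp: act_add act_mult act_zero act_null)
qed

definition lincomb :: "(nat \<Rightarrow> complex) \<Rightarrow> (nat \<Rightarrow> 'v \<Rightarrow> complex) \<Rightarrow> nat \<Rightarrow> 'v \<Rightarrow> complex" where
  "lincomb c a n = (\<lambda>v. \<Sum>j<n. c j * a j v)"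

lemma lincomb_simps: "lincomb c a 0 = 0" "lincomb c a (Suc n) = lincomb c a n + (\<lambda>v. c n * a n v)"
  by (auto simp: lincomb_def fun_eq_iff)

lemma lincomb_closed: "(\<And>j. a j \<in> R) \<Longrightarrow> lincomb c a n \<in> R"
  unfolding lincomb_def by (intro polyfuns_sum polyfuns_mult polyfuns_const)

lemma rs_lincomb: "rs (lincomb c a n) = zsum c (\<lambda>j. rs (a j)) n"
proof (induction n)
  case 0
  show ?case unfolding lincomb_simps rs_ops by simp
next
  case (Suc n)
  then show ?case unfolding lincomb_simps rs_ops zsum.simps by (simp only:)
qed

definition independent :: "(nat \<Rightarrow> 'v \<Rightarrow> complex) \<Rightarrow> nat \<Rightarrow> bool" where
  "independent a n \<longleftrightarrow> (\<forall>c. lincomb c a n \<in> AnnR \<longrightarrow> (\<forall>j<n. c j = 0))"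

lemma AnnR_scale: "f \<in> AnnR \<Longrightarrow> (\<lambda>v. c * f v) \<in> AnnR"
  using is_idealD(4)[OF ideal_AnnR polyfuns_const, of f c] by (simp add: times_fun_def)

text \<open>Greedy choice of a basis: \<open>b N\<close> is appended unless it already lies in the
  span modulo \<open>AnnR\<close>.\<close>

lemma independent_spanning:
  assumes b: "\<And>i::nat. b i \<in> R"
  shows "\<exists>a n. (\<forall>j. a j \<in> R) \<and> independent a n \<and> (\<forall>i<N. \<exists>c. b i - lincomb c a n \<in> AnnR)"
proof (induction N)
  case 0
  show ?case by (rule exI[of _ b], rule exI[of _ 0]) (use b in \<open>auto simp: independent_def\<close>)
next
  case (Suc N)
  then obtain a n where a: "\<And>j. a j \<in> R" "independent a n" "\<And>i. i < N \<Longrightarrow> \<exists>c. b i - lincomb c a n \<in> AnnR"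
    by blast
  show ?case
  proof (cases "\<exists>c. b N - lincomb c a n \<in> AnnR")
    case True
    then have "\<forall>i<Suc N. \<exists>c. b i - lincomb c a n \<in> AnnR" using a(3) by (metis less_Suc_eq)
    then show ?thesis using a(1,2) by blast
  next
    case False
    define a' where "a' = a(n := b N)"
    have a'R: "a' j \<in> R" for j using a b by (simp add: a'_def)
    have lin: "lincomb c a' (Suc n) = lincomb c a n + (\<lambda>v. c n * b N v)" for c
    proof -
      have "lincomb c a' n = lincomb c a n" by (simp add: lincomb_def a'_def fun_eq_iff)
      then show ?thesis unfolding lincomb_simps by (simp add: a'_def)
    qed
    have "independent a' (Suc n)"
      unfolding independent_def
    proof (intro allI impI)
      fix c j assume c: "lincomb c a' (Suc n) \<in> AnnR" and j: "j < Suc n"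
      have cn: "c n = 0"
      proof (rule ccontr)
        assume "c n \<noteq> 0"
        have "(\<lambda>v. 1 / c n * lincomb c a' (Suc n) v) = b N - lincomb (\<lambda>j. - c j / c n) a n"
        proof
          fix v
          have "(\<Sum>j<n. - c j / c n * a j v) = - (\<Sum>j<n. c j * a j v) / c n"
            by (simp add: sum_negf[symmetric] sum_divide_distrib)
          then show "1 / c n * lincomb c a' (Suc n) v = (b N - lincomb (\<lambda>j. - c j / c n) a n) v"
            using \<open>c n \<noteq> 0\<close> unfolding lin by (simp add: lincomb_def field_simps)
        qed
        then show False using False AnnR_scale[OF c, of "1 / c n"] by metis
      qed
      then have "lincomb c a n \<in> AnnR" using c unfolding lin by (simp add: plus_fun_def)
      then show "c j = 0" using a(2) cn j by (auto simp: independent_def less_Suc_eq)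
    qed
    moreover have "\<exists>c. b i - lincomb c a' (Suc n) \<in> AnnR" if i: "i < Suc N" for i
    proof (cases "i = N")
      case True
      have "b i - lincomb (\<lambda>j. if j = n then 1 else 0) a' (Suc n) = 0"
        unfolding lin using True by (auto simp: fun_eq_iff lincomb_def)
      then show ?thesis using is_idealD(2)[OF ideal_AnnR] by metis
    next
      case False
      then obtain c where c: "b i - lincomb c a n \<in> AnnR" using a(3)[of i] i by auto
      have "lincomb (c(n := 0)) a' (Suc n) = lincomb c a n"
        unfolding lin by (auto simp: fun_eq_iff lincomb_def)
      then show ?thesis using c by metis
    qed
    ultimately show ?thesis using a'R by blast
  qed
qed

text \<open>\<open>Ann M\<close> is a Poisson ideal whose lifts lie in \<open>J\<close>, so its
  members vanish at \<open>\<phi>\<close> with all their brackets. Conversely, write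
  \<open>z\<close> modulo \<open>Ann M\<close> in the independent elements of a finite stage; if all
  brackets of \<open>z\<close> vanish at \<open>\<phi>\<close>, the same combination of the rows
  \<open>T\<close> vanishes there, and genericity of \<open>\<phi>\<close> kills the
  coefficients.\<close>

theorem annihilator_is_core: "\<exists>\<phi>\<in>D. annihilator Z M = brackets_vanish Z br \<phi>"
proof -
  note Rs = is_subringD[OF R]
  obtain B where B: "B \<subseteq> R" "countable B" "\<And>f. f \<in> R \<Longrightarrow> \<exists>xs. snd ` set xs \<subseteq> B \<and> f = lcomb xs"
    using countably_spanned_polyfuns[of X] fin_X unfolding countably_spanned_def
    by (auto simp: countable_finite)
  have rs_lcomb: "rs (lcomb xs) = zcomb (map (\<lambda>(c, f). (c, rs f)) xs)" for xs
  proof (induction xs)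
    case (Cons x xs)
    obtain c f where x: "x = (c, f)" by (cases x)
    have "lcomb (x # xs) = (\<lambda>v. c * f v) + lcomb xs" by (simp add: x fun_eq_iff)
    then show ?case unfolding x
      by (simp only: rs_ops Cons.IH list.map case_prod_conv zcomb.simps fst_conv snd_conv)
  qed (simp add: polyfun_algebra_simps)
  obtain W where W: "countable W" "W \<subseteq> carrier M"
    "\<And>m. m \<in> carrier M \<Longrightarrow> \<exists>xs. snd ` set xs \<subseteq> W \<and> m = mcomb xs"
  proof (rule countable_module[of "rs ` B"])
    show "\<exists>xs. snd ` set xs \<subseteq> rs ` B \<and> z = zcomb xs" if z: "z \<in> carrier Z" for z
    proof -
      obtain f where f: "f \<in> R" "rs f = z" by (rule lift[OF z])
      obtain xs where xs: "snd ` set xs \<subseteq> B" "f = lcomb xs" using B(3)[OF f(1)] by blast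
      show ?thesis using xs f rs_lcomb[of xs]
        by (intro exI[of _ "map (\<lambda>(c, f). (c, rs f)) xs"]) (auto simp: image_subset_iff)
    qed
  qed (use B rs_closed in auto)
  obtain v where v: "v \<in> carrier M" "v \<noteq> \<zero>\<^bsub>M\<^esub>"
    "\<forall>w\<in>carrier M. w \<noteq> \<zero>\<^bsub>M\<^esub> \<longrightarrow> Ann v \<subseteq> Ann w \<longrightarrow> Ann w = Ann v"
    by (rule maximal_Ann)
  define J where "J = Ann v"
  have J: "is_ideal R J" unfolding J_def by (rule ideal_Ann[OF v(1)])
  have J1: "1 \<notin> J" using v act_one by (simp add: J_def Ann_def)
  \<comment> \<open>\<open>act y v\<close> is nonzero and its annihilator contains
    \<open>Ann v\<close>, so both annihilators agree by maximality.\<close>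
  have Jprime: "x \<in> J \<or> y \<in> J" if xy: "x \<in> R" "y \<in> R" "x * y \<in> J" for x y
  proof (rule disjCI)
    assume y: "y \<notin> J"
    have "Ann v \<subseteq> Ann (act y v)"
    proof
      fix f assume f: "f \<in> Ann v"
      then have fR: "f \<in> R" by (simp add: Ann_def)
      have "y * f \<in> Ann v" by (rule is_idealD(4)[OF ideal_Ann[OF v(1)] xy(2) f])
      then have "act (f * y) v = \<zero>\<^bsub>M\<^esub>" by (simp add: Ann_def mult.commute)
      then show "f \<in> Ann (act y v)" using fR act_mult[OF fR xy(2) v(1)] by (simp add: Ann_def)
    qed
    then have "Ann (act y v) = Ann v" using v y xy by (auto simp: J_def Ann_def)
    moreover have "x \<in> Ann (act y v)"
      using xy act_mult[OF xy(1,2) v(1)] by (simp add: J_def Ann_def)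
    ultimately show "x \<in> J" by (simp add: J_def)
  qed
  have "1 \<in> R" by (rule Rs)
  then have B0: "B \<noteq> {}" using B(3)[of 1]
  proof -
    obtain xs where "snd ` set xs \<subseteq> B" "1 = lcomb xs" using B(3)[OF \<open>1 \<in> R\<close>] by blast
    then show ?thesis by (cases xs) (auto simp: fun_eq_iff)
  qed
  define b where "b = from_nat_into B"
  have bR: "b i \<in> R" for i using from_nat_into[OF B0] B(1) unfolding b_def by blast
  \<comment> \<open>Stage \<open>N\<close> handles the span of the first \<open>N\<close> members of
    a countable spanning set; each stage will contribute one element to avoid.\<close>
  have "\<exists>a n. (\<forall>j. a j \<in> R) \<and> independent a n \<and> (\<forall>i<N. \<exists>c. b i - lincomb c a n \<in> AnnR)" for N
    by (rule independent_spanning[OF bR])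
  then obtain a n where a: "\<And>N j. a N j \<in> R" "\<And>N. independent (a N) (n N)"
    "\<And>N i. i < N \<Longrightarrow> \<exists>c. b i - lincomb c (a N) (n N) \<in> AnnR" by metis
  define U where "U = lists (carrier Z)"
  define lf where "lf z = (SOME f. f \<in> R \<and> rs f = z)" for z
  have lf: "lf z \<in> R" "rs (lf z) = z" if "z \<in> carrier Z" for z
    using someI_ex[of "\<lambda>f. f \<in> R \<and> rs f = z"] lift[OF that] unfolding lf_def by metis+
  \<comment> \<open>A matrix over \<open>R\<close> with rows \<open>j\<close> and columns the words
    \<open>us\<close>: lifts of the iterated brackets of the basis elements.\<close>
  define T where "T N j us = lf (foldr br us (rs (a N j)))" for N j us
  have fold_closed: "foldr br us (rs (a N j)) \<in> carrier Z" if "us \<in> U" for us N j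
    using that rs_closed[OF a(1)] by (auto simp: U_def intro: foldr_br_closed)
  have TR: "T N j us \<in> R" if "us \<in> U" for N j us
    unfolding T_def by (rule lf[OF fold_closed[OF that]])
  \<comment> \<open>A relation among the rows modulo \<open>J = Ann v\<close> says that the vectors
    \<open>act (r j) v\<close> solve all bracket relations, so they vanish and every
    \<open>r j\<close> lies in \<open>J\<close>.\<close>
  have indep: "\<forall>j<n N. r j \<in> J"
    if r: "\<And>j. r j \<in> R" "\<And>u. u \<in> U \<Longrightarrow> (\<Sum>j<n N. r j * T N j u) \<in> J" for N r
  proof -
    have "sol (n N) (\<lambda>j. rs (a N j)) (\<lambda>j. act (r j) v)"
      unfolding sol_def
    proof (intro conjI allI impI ballI)
      show "act (r j) v \<in> carrier M" for j using r v by simp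
      fix us assume us: "us \<in> lists (carrier Z)"
      have *: "msum (\<lambda>j. wbr us (rs (a N j)) \<odot>\<^bsub>M\<^esub> act (r j) v) k = act (\<Sum>j<k. r j * T N j us) v" for k
      proof (induction k)
        case 0
        show ?case by (simp only: msum.simps lessThan_0 sum.empty act_zero[OF v(1)])
      next
        case (Suc k)
        have T: "T N k us \<in> R" using TR us by (simp add: U_def)
        have "wbr us (rs (a N k)) \<odot>\<^bsub>M\<^esub> act (r k) v = act (T N k us * r k) v"
          using us T r v lf(2)[OF fold_closed[of us N k]]
          by (simp add: act_mult U_def) (simp add: act_def wbr_def T_def)
        also have "T N k us * r k = r k * T N k us" by (rule mult.commute)
        finally have "msum (\<lambda>j. wbr us (rs (a N j)) \<odot>\<^bsub>M\<^esub> act (r j) v) (Suc k) =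
          act (\<Sum>j<k. r j * T N j us) v \<oplus>\<^bsub>M\<^esub> act (r k * T N k us) v"
          unfolding msum.simps Suc.IH by (simp only:)
        also have "\<dots> = act ((\<Sum>j<k. r j * T N j us) + r k * T N k us) v"
          using TR us r v by (intro act_add[symmetric] subring_sum[OF R] Rs(4)) (auto simp: U_def)
        finally show ?case by (simp only: sum.lessThan_Suc)
      qed
      show "msum (\<lambda>j. wbr us (rs (a N j)) \<odot>\<^bsub>M\<^esub> act (r j) v) (n N) = \<zero>\<^bsub>M\<^esub>"
        unfolding * using r(2)[of us] us by (simp add: U_def J_def Ann_def)
    qed
    then have "\<forall>j<n N. act (r j) v = \<zero>\<^bsub>M\<^esub>"
    proof (intro sol_trivial[OF _ W])
      fix c assume "zsum c (\<lambda>j. rs (a N j)) (n N) \<in> annihilator Z M"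
      then have "lincomb c (a N) (n N) \<in> AnnR"
        using lincomb_closed[of "a N"] a(1) rs_lincomb[of c "a N" "n N"] by (simp add: AnnR_def)
      then show "\<forall>j<n N. c j = 0" using a(2)[of N] by (simp add: independent_def)
    qed (use rs_closed a(1) in auto)
    then show ?thesis using r by (simp add: J_def Ann_def)
  qed
  define good where "good N d \<longleftrightarrow> (\<forall>\<eta>. char_of R \<eta> \<longrightarrow> (\<forall>x\<in>J. \<eta> x = 0) \<longrightarrow> \<eta> d \<noteq> 0 \<longrightarrow>
    (\<forall>c. (\<forall>u\<in>U. (\<Sum>j<n N. c j * \<eta> (T N j u)) = 0) \<longrightarrow> (\<forall>j<n N. c j = 0)))" for N d
  have "\<forall>N. \<exists>d. d \<in> R \<and> d \<notin> J \<and> good N d"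
  proof
    fix N
    have "\<exists>d\<in>R. d \<notin> J \<and> good N d"
      unfolding good_def
    proof (rule independence_at_generic_character[where T = "T N" and n = "n N" and U = U and R = R and J = J])
      show "T N j u \<in> R" if "u \<in> U" for j u by (rule TR[OF that])
      show "\<forall>j<n N. r j \<in> J" if "\<And>j. r j \<in> R" "\<And>u. u \<in> U \<Longrightarrow> (\<Sum>j<n N. r j * T N j u) \<in> J" for r
        using that by (rule indep)
      show "x \<in> J \<or> y \<in> J" if "x \<in> R" "y \<in> R" "x * y \<in> J" for x y using that by (rule Jprime)
    qed (rule R polyfuns_const J J1)+
    then show "\<exists>d. d \<in> R \<and> d \<notin> J \<and> good N d" by blast
  qed
  from choice[OF this] obtain d where d: "\<And>N. d N \<in> R" "\<And>N. d N \<notin> J" "\<And>N. good N (d N)" by blast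
  \<comment> \<open>Multiplicative set generated by the pivots; it avoids \<open>J\<close> because
    \<open>J\<close> is prime.\<close>
  define S where "S = prod_list ` lists (range d)"
  have S: "countable S" "S \<subseteq> R" "1 \<in> S" "\<And>s t. s \<in> S \<Longrightarrow> t \<in> S \<Longrightarrow> s * t \<in> S" "J \<inter> S = {}"
  proof -
    show "countable S" unfolding S_def by (intro countable_image countable_lists) auto
    have "prod_list l \<in> R \<and> prod_list l \<notin> J" if "l \<in> lists (range d)" for l
      using that
    proof (induction l)
      case Nil show ?case using J1 Rs(2) by (simp only: prod_list.Nil simp_thms)
    next
      case (Cons x l)
      then have "x \<in> R" "x \<notin> J" "prod_list l \<in> R" "prod_list l \<notin> J" using d by auto
      then have "x * prod_list l \<in> R" "x * prod_list l \<notin> J" using Rs(4) Jprime by blast+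
      then show ?case by (simp only: prod_list.Cons simp_thms)
    qed
    then show "S \<subseteq> R" "J \<inter> S = {}" by (auto simp: S_def)
    show "1 \<in> S" unfolding S_def by (rule image_eqI[of _ _ "[]"]) (simp_all only: prod_list.Nil lists.Nil)
    show "s * t \<in> S" if st: "s \<in> S" "t \<in> S" for s t
    proof -
      from st obtain k l where "s = prod_list k" "t = prod_list l" "k \<in> lists (range d)" "l \<in> lists (range d)"
        by (auto simp: S_def)
      then show ?thesis unfolding S_def by (intro image_eqI[of _ _ "k @ l"]) (simp_all only: prod_list.append append_in_lists_conv simp_thms)
    qed
  qed
  have dS: "d N \<in> S" for N
    unfolding S_def by (rule image_eqI[of _ _ "[d N]"]) simp_all
  obtain \<eta> where \<eta>: "char_of R \<eta>" "\<And>x. x \<in> J \<Longrightarrow> \<eta> x = 0" "\<And>s. s \<in> S \<Longrightarrow> \<eta> s \<noteq> 0"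
    by (rule countable_nullstellensatz[OF R polyfuns_const countably_spanned_polyfuns J S(1-4,5)])
      (use fin_X in \<open>auto simp: countable_finite\<close>)
  obtain \<phi> where \<phi>: "\<phi> \<in> D" "\<And>f. f \<in> R \<Longrightarrow> \<eta> f = f \<phi>"
  proof -
    \<comment> \<open>A function that is zero on \<open>D\<close> acts as zero on \<open>M\<close>,
      hence lies in \<open>J\<close>.\<close>
    have "\<eta> f = 0" if f: "f \<in> R" "\<And>v. v \<in> D \<Longrightarrow> f v = 0" for f
    proof (rule \<eta>(2))
      have "rs f = \<zero>\<^bsub>Z\<^esub>" using f(2) by (auto simp: polyfun_algebra_simps fun_eq_iff)
      then show "f \<in> J" using f(1) v by (simp add: J_def Ann_def act_def)
    qed
    from points[OF \<eta>(1) this] show ?thesis using that by blast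
  qed
  have val: "\<eta> (lf z) = z \<phi>" if "z \<in> carrier Z" for z
    using \<phi>(2)[OF lf(1)[OF that]] lf(2)[OF that] \<phi>(1) by (metis restrict_apply')
  have ann_zero: "z \<phi> = 0" if z: "z \<in> annihilator Z M" for z
  proof -
    have zZ: "z \<in> carrier Z" using z by (simp add: annihilator_def)
    then have "lf z \<in> J" using lf[OF zZ] z v by (simp add: J_def Ann_def act_def annihilator_def)
    then show ?thesis using \<eta>(2) val[OF zZ] by simp
  qed
  have "annihilator Z M = brackets_vanish Z br \<phi>"
  proof (intro equalityI subsetI)
    fix z assume z: "z \<in> annihilator Z M"
    have "foldr br us z \<phi> = 0" if "us \<in> lists (carrier Z)" for us
      using ann_zero annihilator_foldr_br[OF that z] by blast
    then show "z \<in> brackets_vanish Z br \<phi>" using z by (auto simp: brackets_vanish_def annihilator_def)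
  next
    fix z assume z: "z \<in> brackets_vanish Z br \<phi>"
    then have zZ: "z \<in> carrier Z" and zv: "\<And>us. us \<in> U \<Longrightarrow> foldr br us z \<phi> = 0"
      by (auto simp: brackets_vanish_def U_def)
    obtain xs where xs: "snd ` set xs \<subseteq> B" "lf z = lcomb xs" using B(3)[OF lf(1)[OF zZ]] by blast
    \<comment> \<open>The lift of \<open>z\<close> involves finitely many members of
      \<open>B\<close>, so a single stage suffices.\<close>
    have "\<exists>N. \<forall>f\<in>snd ` set xs. \<exists>i<N. f = b i"
    proof -
      have "\<exists>i. f = b i" if "f \<in> snd ` set xs" for f
        using that xs(1) B(2) unfolding b_def by (metis from_nat_into_surj subsetD)
      then obtain i where i: "\<And>f. f \<in> snd ` set xs \<Longrightarrow> f = b (i f)" by metis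
      have "i f < Suc (Max (i ` snd ` set xs))" if "f \<in> snd ` set xs" for f
        using that by (intro le_imp_less_Suc Max_ge) auto
      then show ?thesis using i by blast
    qed
    then obtain N where N: "\<And>f. f \<in> snd ` set xs \<Longrightarrow> \<exists>i<N. f = b i" by blast
    have "\<exists>c. lcomb ys - lincomb c (a N) (n N) \<in> AnnR" if "snd ` set ys \<subseteq> snd ` set xs" for ys
      using that
    proof (induction ys)
      case Nil
      have "lcomb [] - lincomb (\<lambda>_. 0) (a N) (n N) = 0" by (simp add: fun_eq_iff lincomb_def)
      then show ?case using is_idealD(2)[OF ideal_AnnR] by metis
    next
      case (Cons y ys)
      have "snd ` set ys \<subseteq> snd ` set xs" "snd y \<in> snd ` set xs" using Cons.prems by auto
      from Cons.IH[OF this(1)] obtain c where c: "lcomb ys - lincomb c (a N) (n N) \<in> AnnR" by blast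
      obtain c' where c': "snd y - lincomb c' (a N) (n N) \<in> AnnR"
        using N[OF \<open>snd y \<in> snd ` set xs\<close>] a(3) by metis
      have "(\<lambda>v. fst y * (snd y - lincomb c' (a N) (n N)) v) + (lcomb ys - lincomb c (a N) (n N)) \<in> AnnR"
        by (rule is_idealD(3)[OF ideal_AnnR AnnR_scale[OF c'] c])
      also have "(\<lambda>v. fst y * (snd y - lincomb c' (a N) (n N)) v) + (lcomb ys - lincomb c (a N) (n N))
        = lcomb (y # ys) - lincomb (\<lambda>j. fst y * c' j + c j) (a N) (n N)"
        by (simp add: fun_eq_iff lincomb_def sum.distrib sum_distrib_left algebra_simps)
      finally show ?case by blast
    qed
    from this[OF subset_refl] obtain c where c: "lf z - lincomb c (a N) (n N) \<in> AnnR" unfolding xs(2) by blast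
    define p where "p = lf z - lincomb c (a N) (n N)"
    define q where "q = zsum c (\<lambda>j. rs (a N j)) (n N)"
    have qZ: "q \<in> carrier Z" unfolding q_def using rs_closed[OF a(1)] by (intro zsum_closed) auto
    have pZ: "rs p \<in> annihilator Z M" "rs p \<in> carrier Z" using c by (auto simp: p_def AnnR_def annihilator_def)
    have zpq: "z = rs p \<oplus>\<^bsub>Z\<^esub> q"
    proof -
      have "z = rs (p + lincomb c (a N) (n N))" using lf(2)[OF zZ] by (simp add: p_def)
      then show ?thesis by (simp only: rs_ops rs_lincomb q_def)
    qed
    have at: "(x \<oplus>\<^bsub>Z\<^esub> y) \<phi> = x \<phi> + y \<phi>" "(k \<odot>\<^bsub>Z\<^esub> x) \<phi> = k * x \<phi>" "\<zero>\<^bsub>Z\<^esub> \<phi> = 0" for x y k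
      using \<phi>(1) by (simp_all add: polyfun_algebra_def)
    have evq: "foldr br us (zsum c (\<lambda>j. rs (a N j)) k) \<phi> = (\<Sum>j<k. c j * \<eta> (T N j us))" if us: "us \<in> U" for us k
    proof (induction k)
      case 0
      have "foldr br us (0 \<odot>\<^bsub>Z\<^esub> \<zero>\<^bsub>Z\<^esub>) = 0 \<odot>\<^bsub>Z\<^esub> foldr br us \<zero>\<^bsub>Z\<^esub>"
        using us unfolding U_def by (intro foldr_br_smult zero_closed)
      then have "foldr br us \<zero>\<^bsub>Z\<^esub> = \<zero>\<^bsub>Z\<^esub>"
        using scalar_zero[OF zero_closed] scalar_zero[OF foldr_br_closed[OF us[unfolded U_def] zero_closed]] by metis
      then show ?case by (simp only: zsum.simps lessThan_0 sum.empty at)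
    next
      case (Suc k)
      have aZ: "rs (a N k) \<in> carrier Z" by (rule rs_closed[OF a(1)])
      have "foldr br us (zsum c (\<lambda>j. rs (a N j)) (Suc k)) =
        foldr br us (zsum c (\<lambda>j. rs (a N j)) k) \<oplus>\<^bsub>Z\<^esub> c k \<odot>\<^bsub>Z\<^esub> foldr br us (rs (a N k))"
        using us rs_closed[OF a(1)] aZ
        by (simp only: zsum.simps) (subst foldr_br_add, auto simp: U_def foldr_br_smult)
      then show ?case by (simp only: at Suc.IH sum.lessThan_Suc T_def val[OF fold_closed[OF us]])
    qed
    have "(\<Sum>j<n N. c j * \<eta> (T N j us)) = 0" if us: "us \<in> U" for us
    proof -
      have "foldr br us z = foldr br us (rs p) \<oplus>\<^bsub>Z\<^esub> foldr br us q"
        unfolding zpq using us pZ qZ by (intro foldr_br_add) (auto simp: U_def)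
      moreover have "foldr br us (rs p) \<phi> = 0"
        using ann_zero annihilator_foldr_br[OF _ pZ(1)] us by (simp add: U_def)
      ultimately show ?thesis using zv[OF us] evq[OF us, of "n N"] by (simp add: at q_def)
    qed
    then have cj: "\<forall>j<n N. c j = 0" using d(3)[of N, unfolded good_def, rule_format, OF \<eta>(1), of c] \<eta>(2,3) dS by blast
    have "lincomb c (a N) (n N) = 0" unfolding lincomb_def using cj by (auto simp: fun_eq_iff)
    then have "lf z \<in> AnnR" using c by (simp only: diff_0_right)
    then show "z \<in> annihilator Z M" using lf[OF zZ] by (simp add: AnnR_def)
  qed
  then show ?thesis using \<phi>(1) by blast
qed

end

subsection \<open>The simple module supported at a point\<close>

text \<open>The linear dual of \<open>Z\<close> is a Poisson module, with \<open>Z\<close> and \<open>nabla\<close> acting through the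
  transposes of multiplication and of \<open>- br x\<close>; \<open>delta_module\<close> is the submodule generated by a
  character, a module of iterated derivatives of a delta distribution.\<close>

locale poisson_character = poisson_algebra Z br
  for Z :: "(complex, 'z) module" (structure) and br :: "'z \<Rightarrow> 'z \<Rightarrow> 'z" +
  fixes \<xi> :: "'z \<Rightarrow> complex"
  assumes \<xi>_add: "x \<in> carrier Z \<Longrightarrow> y \<in> carrier Z \<Longrightarrow> \<xi> (x \<oplus> y) = \<xi> x + \<xi> y"
    and \<xi>_mult: "x \<in> carrier Z \<Longrightarrow> y \<in> carrier Z \<Longrightarrow> \<xi> (x \<otimes> y) = \<xi> x * \<xi> y"
    and \<xi>_smult: "x \<in> carrier Z \<Longrightarrow> \<xi> (c \<odot> x) = c * \<xi> x"
    and \<xi>_one: "\<xi> \<one> = 1"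
begin

definition functional :: "('z \<Rightarrow> complex) \<Rightarrow> bool" where
  "functional F \<longleftrightarrow> (\<forall>x\<in>carrier Z. \<forall>y\<in>carrier Z. F (x \<oplus> y) = F x + F y) \<and>
    (\<forall>c. \<forall>x\<in>carrier Z. F (c \<odot> x) = c * F x) \<and> (\<forall>x. x \<notin> carrier Z \<longrightarrow> F x = 0)"

definition ac :: "'z \<Rightarrow> ('z \<Rightarrow> complex) \<Rightarrow> 'z \<Rightarrow> complex" where
  "ac z F = (\<lambda>w. if w \<in> carrier Z then F (z \<otimes> w) else 0)"

text \<open>Transposition reverses composition; the minus sign restores the order demanded of
  \<open>nabla (br x y)\<close>.\<close>

definition nb :: "'z \<Rightarrow> ('z \<Rightarrow> complex) \<Rightarrow> 'z \<Rightarrow> complex" where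
  "nb x F = (\<lambda>w. if w \<in> carrier Z then - F (br x w) else 0)"

definition delta :: "'z \<Rightarrow> complex" where
  "delta = (\<lambda>w. if w \<in> carrier Z then \<xi> w else 0)"

inductive_set deltas :: "('z \<Rightarrow> complex) set" where
  delta: "delta \<in> deltas"
| add: "F \<in> deltas \<Longrightarrow> G \<in> deltas \<Longrightarrow> (\<lambda>w. F w + G w) \<in> deltas"
| ac: "z \<in> carrier Z \<Longrightarrow> F \<in> deltas \<Longrightarrow> ac z F \<in> deltas"
| nb: "x \<in> carrier Z \<Longrightarrow> F \<in> deltas \<Longrightarrow> nb x F \<in> deltas"

definition delta_module :: "('z, 'z \<Rightarrow> complex) module" where
  "delta_module = \<lparr>carrier = deltas, mult = (\<lambda>F G. F), one = delta, zero = (\<lambda>_. 0),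
     add = (\<lambda>F G w. F w + G w), smult = ac\<rparr>"

lemma delta_module_simps:
  "carrier delta_module = deltas" "\<zero>\<^bsub>delta_module\<^esub> = (\<lambda>_. 0)"
  "F \<oplus>\<^bsub>delta_module\<^esub> G = (\<lambda>w. F w + G w)" "z \<odot>\<^bsub>delta_module\<^esub> F = ac z F"
  by (simp_all add: delta_module_def)

lemma functionalD:
  assumes "functional F"
  shows "x \<in> carrier Z \<Longrightarrow> y \<in> carrier Z \<Longrightarrow> F (x \<oplus> y) = F x + F y"
    "x \<in> carrier Z \<Longrightarrow> F (c \<odot> x) = c * F x" "x \<notin> carrier Z \<Longrightarrow> F x = 0"
    "F \<zero> = 0" "x \<in> carrier Z \<Longrightarrow> F (\<ominus> x) = - F x"
proof -
  show *: "x \<in> carrier Z \<Longrightarrow> y \<in> carrier Z \<Longrightarrow> F (x \<oplus> y) = F x + F y"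
    "x \<in> carrier Z \<Longrightarrow> F (c \<odot> x) = c * F x" "x \<notin> carrier Z \<Longrightarrow> F x = 0" for x y c
    using assms by (auto simp: functional_def)
  show z: "F \<zero> = 0" using *(1)[of \<zero> \<zero>] by simp
  show "F (\<ominus> x) = - F x" if "x \<in> carrier Z"
    using *(1)[of x "\<ominus> x"] that z by (simp add: r_neg add_eq_0_iff)
qed

lemma functional_delta: "functional delta"
  by (auto simp: functional_def delta_def \<xi>_add \<xi>_smult)

lemma functional_add: "functional F \<Longrightarrow> functional G \<Longrightarrow> functional (\<lambda>w. F w + G w)"
  unfolding functional_def by (auto simp: algebra_simps)

lemma functional_ac: "functional F \<Longrightarrow> z \<in> carrier Z \<Longrightarrow> functional (ac z F)"
proof -
  assume F: "functional F" and z: "z \<in> carrier Z"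
  have c: "z \<otimes> (c \<odot> x) = c \<odot> (z \<otimes> x)" if "x \<in> carrier Z" for c x
    using smult_assoc2[of c x z] z that by (simp add: m_comm)
  show ?thesis using z unfolding functional_def
    by (auto simp: ac_def r_distr c functionalD[OF F])
qed

lemma functional_nb: "functional F \<Longrightarrow> x \<in> carrier Z \<Longrightarrow> functional (nb x F)"
  unfolding functional_def[of "nb x F"]
  by (auto simp: nb_def br_add_right br_smult_right functionalD br_closed)

lemma functional_deltas: "F \<in> deltas \<Longrightarrow> functional F"
  by (induction rule: deltas.induct) (auto intro: functional_delta functional_add functional_ac functional_nb)

lemma ac_minus_one: "functional F \<Longrightarrow> ac (\<ominus> \<one>) F = (\<lambda>w. - F w)"
  by (auto simp: ac_def fun_eq_iff l_minus functionalD)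

lemma deltas_zero: "(\<lambda>_. 0) \<in> deltas"
proof -
  have "ac \<zero> delta = (\<lambda>_. 0)" by (auto simp: ac_def fun_eq_iff functionalD[OF functional_delta])
  then show ?thesis using deltas.ac[OF zero_closed deltas.delta] by simp
qed

lemma deltas_minus: "F \<in> deltas \<Longrightarrow> (\<lambda>w. - F w) \<in> deltas"
  using deltas.ac[of "\<ominus> \<one>" F] ac_minus_one[OF functional_deltas] by simp

lemma delta_module_group: "abelian_group delta_module"
proof (rule abelian_groupI)
  show "\<exists>G\<in>carrier delta_module. G \<oplus>\<^bsub>delta_module\<^esub> F = \<zero>\<^bsub>delta_module\<^esub>" if "F \<in> carrier delta_module" for F
    using that deltas_minus[of F] by (intro bexI[of _ "\<lambda>w. - F w"]) (auto simp: delta_module_simps)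
qed (auto simp: delta_module_simps fun_eq_iff deltas_zero intro: deltas.add)

lemma delta_module_minus:
  assumes "F \<in> deltas" "G \<in> deltas"
  shows "F \<ominus>\<^bsub>delta_module\<^esub> G = (\<lambda>w. F w - G w)"
proof -
  interpret A: abelian_group delta_module by (rule delta_module_group)
  have "\<ominus>\<^bsub>delta_module\<^esub> G = (\<lambda>w. - G w)"
    by (rule A.minus_equality) (use assms deltas_minus in \<open>auto simp: delta_module_simps\<close>)
  then show ?thesis by (simp add: A.minus_eq delta_module_simps)
qed

lemma delta_module_module: "module Z delta_module"
proof (rule moduleI)
  show "cring Z" by (rule is_cring)
  show "abelian_group delta_module" by (rule delta_module_group)
  show "a \<odot>\<^bsub>delta_module\<^esub> F \<in> carrier delta_module" if "a \<in> carrier Z" "F \<in> carrier delta_module" for a F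
    using that by (auto simp: delta_module_simps intro: deltas.ac)
  show "(a \<oplus> b) \<odot>\<^bsub>delta_module\<^esub> F = a \<odot>\<^bsub>delta_module\<^esub> F \<oplus>\<^bsub>delta_module\<^esub> b \<odot>\<^bsub>delta_module\<^esub> F"
    if "a \<in> carrier Z" "b \<in> carrier Z" "F \<in> carrier delta_module" for a b F
    using that by (auto simp: delta_module_simps ac_def fun_eq_iff l_distr functionalD[OF functional_deltas])
  show "a \<odot>\<^bsub>delta_module\<^esub> (F \<oplus>\<^bsub>delta_module\<^esub> G) = a \<odot>\<^bsub>delta_module\<^esub> F \<oplus>\<^bsub>delta_module\<^esub> a \<odot>\<^bsub>delta_module\<^esub> G" for a F G
    by (auto simp: delta_module_simps ac_def fun_eq_iff)
  show "(a \<otimes> b) \<odot>\<^bsub>delta_module\<^esub> F = a \<odot>\<^bsub>delta_module\<^esub> (b \<odot>\<^bsub>delta_module\<^esub> F)"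
    if "a \<in> carrier Z" "b \<in> carrier Z" for a b F
    using that by (auto simp: delta_module_simps ac_def fun_eq_iff m_ac)
  show "\<one> \<odot>\<^bsub>delta_module\<^esub> F = F" if "F \<in> carrier delta_module" for F
    using that by (auto simp: delta_module_simps ac_def fun_eq_iff functionalD[OF functional_deltas])
qed

text \<open>Transpose of the Leibniz rule; it becomes the axiom \<open>nabla_br_smult\<close> for
  the delta module.\<close>

lemma ac_nb:
  assumes F: "functional F" and x: "x \<in> carrier Z" and a: "a \<in> carrier Z"
  shows "ac (br x a) F = (\<lambda>w. nb x (ac a F) w - ac a (nb x F) w)"
proof
  fix w
  show "ac (br x a) F w = nb x (ac a F) w - ac a (nb x F) w"
  proof (cases "w \<in> carrier Z")
    case True
    have "F (br x (a \<otimes> w)) = F (a \<otimes> br x w) + F (w \<otimes> br x a)"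
      using x a True by (simp add: br_leibniz_right functionalD[OF F] br_closed)
    then show ?thesis using x a True by (simp add: ac_def nb_def br_closed m_comm)
  qed (simp add: ac_def nb_def)
qed

lemma delta_module_poisson: "poisson_module Z br delta_module nb"
proof -
  interpret DM: module Z delta_module by (rule delta_module_module)
  show ?thesis
  proof
    fix x y F G c assume x: "x \<in> carrier Z" and F': "F \<in> carrier delta_module"
    then have F: "F \<in> deltas" by (simp add: delta_module_simps)
    note f = functionalD[OF functional_deltas[OF F]]
    have cw: "(c \<odot> \<one>) \<otimes> w = c \<odot> w" if "w \<in> carrier Z" for w by (rule scalar_conv[symmetric, OF that])
    show "nb x F \<in> carrier delta_module" using x F by (auto simp: delta_module_simps intro: deltas.nb)
    show "nb x (F \<oplus>\<^bsub>delta_module\<^esub> G) = nb x F \<oplus>\<^bsub>delta_module\<^esub> nb x G"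
      by (auto simp: delta_module_simps nb_def fun_eq_iff)
    show "nb x ((c \<odot> \<one>) \<odot>\<^bsub>delta_module\<^esub> F) = (c \<odot> \<one>) \<odot>\<^bsub>delta_module\<^esub> nb x F"
      using x by (auto simp: delta_module_simps nb_def ac_def fun_eq_iff cw br_closed f br_smult_right)
    show "nb (c \<odot> x) F = (c \<odot> \<one>) \<odot>\<^bsub>delta_module\<^esub> nb x F"
      using x by (auto simp: delta_module_simps nb_def ac_def fun_eq_iff cw br_closed f br_smult_right br_smult)
    assume y: "y \<in> carrier Z"
    show "nb (x \<oplus> y) F = nb x F \<oplus>\<^bsub>delta_module\<^esub> nb y F"
      using x y by (auto simp: delta_module_simps nb_def fun_eq_iff br_add br_closed f)
    show "nb (x \<otimes> y) F = x \<odot>\<^bsub>delta_module\<^esub> nb y F \<oplus>\<^bsub>delta_module\<^esub> y \<odot>\<^bsub>delta_module\<^esub> nb x F"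
    proof
      fix w
      show "nb (x \<otimes> y) F w = (x \<odot>\<^bsub>delta_module\<^esub> nb y F \<oplus>\<^bsub>delta_module\<^esub> y \<odot>\<^bsub>delta_module\<^esub> nb x F) w"
      proof (cases "w \<in> carrier Z")
        case True
        \<comment> \<open>The Leibniz rule on the right-hand side leaves
          \<open>w \<otimes> br x y\<close> and \<open>w \<otimes> br y x\<close>, which
          cancel.\<close>
        have "F (w \<otimes> br x y) = - F (w \<otimes> br y x)"
          using x y True by (simp add: br_antisym[of x y] r_minus br_closed f)
        then show ?thesis using x y True
          by (simp add: delta_module_simps nb_def ac_def br_leibniz br_leibniz_right br_closed f)
      qed (simp add: delta_module_simps nb_def ac_def)
    qed
    show "br x y \<odot>\<^bsub>delta_module\<^esub> F = nb x (y \<odot>\<^bsub>delta_module\<^esub> F) \<ominus>\<^bsub>delta_module\<^esub> y \<odot>\<^bsub>delta_module\<^esub> nb x F"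
      unfolding delta_module_simps using ac_nb[OF functional_deltas[OF F] x y] x y F
      by (subst delta_module_minus) (auto intro: deltas.intros)
    have "nb (br x y) F = (\<lambda>w. nb x (nb y F) w - nb y (nb x F) w)"
    proof
      fix w
      show "nb (br x y) F w = nb x (nb y F) w - nb y (nb x F) w"
      proof (cases "w \<in> carrier Z")
        case True
        have "F (br x (br y w)) + F (br y (br w x)) + F (br w (br x y)) = F (br x (br y w) \<oplus> br y (br w x) \<oplus> br w (br x y))"
          using x y True by (simp add: f br_closed)
        also have "\<dots> = 0" using br_jacobi[OF x y True] by (simp add: f)
        finally have j: "F (br x (br y w)) + F (br y (br w x)) + F (br w (br x y)) = 0" .
        have "br y (br w x) = \<ominus> br y (br x w)"
        proof -
          have "br w x = \<ominus> \<one> \<otimes> br x w" using x True by (simp add: br_antisym[of w x] l_minus br_closed)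
          also have "\<dots> = (- 1) \<odot> br x w"
          proof -
            have "(- 1) \<odot> br x w \<oplus> br x w = (- 1 + 1) \<odot> br x w"
              using x True br_closed by (simp only: scalar_add scalar_one)
            then have "(- 1) \<odot> br x w = \<ominus> br x w"
              using x True br_closed[of x w] by (simp add: scalar_zero minus_equality)
            then show ?thesis using x True by (simp add: l_minus br_closed)
          qed
          finally have 1: "br w x = (- 1) \<odot> br x w" .
          have 2: "br y (br x w) \<in> carrier Z" using x y True by (simp add: br_closed)
          have "(- 1) \<odot> br y (br x w) \<oplus> br y (br x w) = (- 1 + 1) \<odot> br y (br x w)"
            using 2 by (simp only: scalar_add scalar_one)
          then have "(- 1) \<odot> br y (br x w) = \<ominus> br y (br x w)"
            using 2 by (simp add: scalar_zero minus_equality)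
          then show ?thesis unfolding 1 using x y True by (simp add: br_smult_right br_closed)
        qed
        moreover have "br w (br x y) = \<ominus> br (br x y) w" using x y True by (intro br_antisym br_closed)
        ultimately have "F (br x (br y w)) - F (br y (br x w)) = F (br (br x y) w)"
          using j x y True by (simp add: f br_closed)
        then have "- F (br (br x y) w) = F (br y (br x w)) - F (br x (br y w))" by (metis minus_diff_eq)
        then show ?thesis using x y True by (simp add: nb_def br_closed)
      qed (simp add: nb_def)
    qed
    then show "nb (br x y) F = nb x (nb y F) \<ominus>\<^bsub>delta_module\<^esub> nb y (nb x F)"
      using x y F by (subst delta_module_minus) (auto intro: deltas.intros)
  qed
qed

text \<open>Functionals that vanish on the \<open>k\<close>-th power of the kernel of
  \<open>\<xi>\<close>, that is, distributions at the point of order less than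
  \<open>k\<close>.\<close>

primrec order_le :: "nat \<Rightarrow> ('z \<Rightarrow> complex) set" where
  "order_le 0 = {\<lambda>_. 0}"
| "order_le (Suc k) = {F. functional F \<and> (\<forall>z\<in>carrier Z. \<xi> z = 0 \<longrightarrow> ac z F \<in> order_le k)}"

lemma functional_zero: "functional (\<lambda>_. 0)" by (simp add: functional_def)

lemma order_le_functional: "F \<in> order_le k \<Longrightarrow> functional F"
  by (cases k) (auto simp: functional_zero)

lemma order_le_zero: "(\<lambda>_. 0) \<in> order_le k"
proof (induction k)
  case (Suc k)
  have "ac z (\<lambda>_. 0) = (\<lambda>_. 0)" for z by (simp add: ac_def fun_eq_iff)
  then show ?case using Suc by (simp add: functional_zero)
qed simp

lemma order_le_Suc: "F \<in> order_le k \<Longrightarrow> F \<in> order_le (Suc k)"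
proof (induction k arbitrary: F)
  case 0
  then show ?case using order_le_zero[of "Suc 0"] by (metis order_le.simps(1) singletonD)
next
  case (Suc k)
  then have "functional F" "\<And>z. z \<in> carrier Z \<Longrightarrow> \<xi> z = 0 \<Longrightarrow> ac z F \<in> order_le (Suc k)" by auto
  then show ?case by (subst order_le.simps(2)) blast
qed

lemma order_le_mono: "j \<le> k \<Longrightarrow> F \<in> order_le j \<Longrightarrow> F \<in> order_le k"
  by (induction k) (auto simp: le_Suc_eq simp del: order_le.simps intro: order_le_Suc)

lemma order_le_add: "F \<in> order_le k \<Longrightarrow> G \<in> order_le k \<Longrightarrow> (\<lambda>w. F w + G w) \<in> order_le k"
proof (induction k arbitrary: F G)
  case (Suc k)
  have "ac z (\<lambda>w. F w + G w) = (\<lambda>w. ac z F w + ac z G w)" for z by (auto simp: ac_def)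
  then show ?case using Suc by (auto intro: functional_add)
qed simp

lemma ac_ac: "functional F \<Longrightarrow> y \<in> carrier Z \<Longrightarrow> z \<in> carrier Z \<Longrightarrow> ac z (ac y F) = ac y (ac z F)"
  by (auto simp: ac_def fun_eq_iff m_ac)

lemma order_le_ac: "F \<in> order_le k \<Longrightarrow> y \<in> carrier Z \<Longrightarrow> ac y F \<in> order_le k"
proof (induction k arbitrary: F)
  case 0
  then show ?case by (auto simp: ac_def)
next
  case (Suc k)
  then have F: "functional F" "\<And>z. z \<in> carrier Z \<Longrightarrow> \<xi> z = 0 \<Longrightarrow> ac z F \<in> order_le k" by auto
  then show ?case using Suc ac_ac[OF F(1) Suc.prems(2)] by (auto intro: functional_ac)
qed

text \<open>The commutator of \<open>ac z\<close> and \<open>nb x\<close> is an \<open>ac\<close>,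
  so \<open>nb x\<close> raises the order by at most one.\<close>

lemma order_le_nb: "F \<in> order_le k \<Longrightarrow> x \<in> carrier Z \<Longrightarrow> nb x F \<in> order_le (Suc k)"
proof (induction k arbitrary: F)
  case 0
  then have "nb x F = (\<lambda>_. 0)" by (auto simp: nb_def)
  then show ?case using order_le_zero[of "Suc 0"] by metis
next
  case (Suc k)
  then have F: "functional F" "\<And>z. z \<in> carrier Z \<Longrightarrow> \<xi> z = 0 \<Longrightarrow> ac z F \<in> order_le k" by auto
  have "ac z (nb x F) \<in> order_le (Suc k)" if z: "z \<in> carrier Z" "\<xi> z = 0" for z
  proof -
    have "ac z (nb x F) = (\<lambda>w. nb x (ac z F) w + ac (\<ominus> \<one>) (ac (br x z) F) w)"
    proof -
      have 1: "ac (\<ominus> \<one>) (ac (br x z) F) = (\<lambda>w. - ac (br x z) F w)"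
        using F(1) Suc.prems z by (intro ac_minus_one functional_ac br_closed)
      show ?thesis unfolding 1 using ac_nb[OF F(1) Suc.prems(2) z(1)] by (simp add: fun_eq_iff)
    qed
    moreover have 2: "nb x (ac z F) \<in> order_le (Suc k)" using Suc.IH F(2)[OF z] Suc.prems by blast
    moreover have 3: "ac (\<ominus> \<one>) (ac (br x z) F) \<in> order_le (Suc k)"
      using Suc.prems z by (intro order_le_ac br_closed) auto
    ultimately show ?thesis using order_le_add[OF 2 3] by (simp only:)
  qed
  then show ?case using functional_nb[OF F(1) Suc.prems(2)] by (subst order_le.simps(2)) blast
qed

lemma deltas_order: "F \<in> deltas \<Longrightarrow> \<exists>k. F \<in> order_le k"
proof (induction rule: deltas.induct)
  case delta
  have "ac z delta = (\<lambda>_. 0)" if "z \<in> carrier Z" "\<xi> z = 0" for z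
    using that by (auto simp: ac_def delta_def \<xi>_mult)
  then have "delta \<in> order_le (Suc 0)" using functional_delta by simp
  then show ?case ..
next
  case (add F G)
  then obtain j k where "F \<in> order_le j" "G \<in> order_le k" by blast
  then have "F \<in> order_le (max j k)" "G \<in> order_le (max j k)"
    using order_le_mono[of j "max j k"] order_le_mono[of k "max j k"] by auto
  then show ?case using order_le_add by blast
qed (use order_le_ac order_le_nb in blast)+

text \<open>A nonzero element of least order in a submodule is killed by the kernel of
  \<open>\<xi>\<close>, hence is a multiple of \<open>delta\<close>, which generates the
  module.\<close>

lemma delta_module_simple: "simple_poisson_module Z br delta_module nb"
  unfolding simple_poisson_module_def
proof (intro conjI allI impI)
  show "poisson_module Z br delta_module nb" by (rule delta_module_poisson)
  interpret DM: module Z delta_module by (rule delta_module_module)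
  have d1: "delta \<one> = 1" by (simp add: delta_def \<xi>_one)
  then have "delta \<noteq> (\<lambda>_. 0)" by auto
  then show "carrier delta_module \<noteq> {\<zero>\<^bsub>delta_module\<^esub>}"
    using deltas.delta by (auto simp: delta_module_simps)
  fix N assume N: "submodule N Z delta_module \<and> (\<forall>x\<in>carrier Z. \<forall>m\<in>N. nb x m \<in> N)"
  have Nsub: "N \<subseteq> deltas" using DM.submoduleE(1) N by (auto simp: delta_module_simps)
  have Nac: "ac z F \<in> N" if "z \<in> carrier Z" "F \<in> N" for z F
    using DM.submoduleE(4)[of N z F] N that by (auto simp: delta_module_simps)
  have Nadd: "(\<lambda>w. F w + G w) \<in> N" if "F \<in> N" "G \<in> N" for F G
    using DM.submoduleE(5)[of N F G] N that by (auto simp: delta_module_simps)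
  have Nne: "N \<noteq> {}" using DM.submoduleE(2) N by blast
  show "N = {\<zero>\<^bsub>delta_module\<^esub>} \<or> N = carrier delta_module"
  proof (rule disjCI)
    assume not: "N \<noteq> carrier delta_module"
    show "N = {\<zero>\<^bsub>delta_module\<^esub>}"
    proof (rule ccontr)
      assume "N \<noteq> {\<zero>\<^bsub>delta_module\<^esub>}"
      then obtain F0 where "F0 \<in> N" "F0 \<noteq> (\<lambda>_. 0)" using Nne by (auto simp: delta_module_simps)
      then have ex: "\<exists>k. \<exists>F\<in>N. F \<noteq> (\<lambda>_. 0) \<and> F \<in> order_le k" using deltas_order Nsub by blast
      define k where "k = (LEAST k. \<exists>F\<in>N. F \<noteq> (\<lambda>_. 0) \<and> F \<in> order_le k)"
      obtain F where F: "F \<in> N" "F \<noteq> (\<lambda>_. 0)" "F \<in> order_le k"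
        using LeastI_ex[OF ex] unfolding k_def by blast
      have least: "G = (\<lambda>_. 0)" if "G \<in> N" "G \<in> order_le j" "j < k" for G j
        using not_less_Least[of j] that unfolding k_def by blast
      obtain k' where k': "k = Suc k'" using F by (cases k) auto
      have kill: "ac z F = (\<lambda>_. 0)" if "z \<in> carrier Z" "\<xi> z = 0" for z
        using F(3) that Nac[OF _ F(1)] unfolding k' by (intro least[of _ k']) (auto simp: k')
      have f: "functional F" using order_le_functional F by blast
      \<comment> \<open>\<open>w\<close> minus its value at the point lies in the kernel of
        \<open>\<xi>\<close>.\<close>
      have Fw: "F w = F \<one> * \<xi> w" if w: "w \<in> carrier Z" for w
      proof -
        let ?m = "w \<oplus> (- \<xi> w) \<odot> \<one>"
        have "\<xi> ?m = 0" using w by (simp add: \<xi>_add \<xi>_smult \<xi>_one)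
        then have "ac ?m F \<one> = 0" using kill[of ?m] w by simp
        then have "F ?m = 0" using w by (simp add: ac_def)
        then show ?thesis using w by (simp add: functionalD[OF f])
      qed
      have "F \<one> \<noteq> 0"
      proof
        assume "F \<one> = 0"
        then have "F w = 0" for w using Fw[of w] functionalD(3)[OF f, of w] by (cases "w \<in> carrier Z") auto
        then have "F = (\<lambda>_. 0)" by (rule ext)
        then show False using F by simp
      qed
      have "ac ((1 / F \<one>) \<odot> \<one>) F w = delta w" for w
      proof (cases "w \<in> carrier Z")
        case True
        then have "ac ((1 / F \<one>) \<odot> \<one>) F w = 1 / F \<one> * F w"
          by (simp add: ac_def scalar_conv[symmetric] functionalD(2)[OF f])
        also have "\<dots> = delta w" unfolding Fw[OF True] using \<open>F \<one> \<noteq> 0\<close> True by (simp add: delta_def)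
        finally show ?thesis .
      qed (simp add: ac_def delta_def)
      then have "ac ((1 / F \<one>) \<odot> \<one>) F = delta" by (rule ext)
      then have dN: "delta \<in> N" using Nac[of "(1 / F \<one>) \<odot> \<one>" F] F by simp
      have "G \<in> N" if "G \<in> deltas" for G
        using that by (induction rule: deltas.induct) (use dN Nac Nadd N in auto)
      then have "N = carrier delta_module" using Nsub by (auto simp: delta_module_simps)
      then show False using not by blast
    qed
  qed
qed

text \<open>If \<open>z\<close> annihilates, so do its iterated brackets; applied to
  \<open>delta\<close> and evaluated at \<open>\<one>\<close> they give the values of
  \<open>\<xi>\<close>. Conversely, induct over \<open>deltas\<close> for all such \<open>z\<close>
  simultaneously: the case \<open>nb x F\<close> needs the hypothesis for \<open>br x z\<close> as
  well.\<close>

lemma annihilator_delta_module: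
  "annihilator Z delta_module = {z \<in> carrier Z. \<forall>us\<in>lists (carrier Z). \<xi> (foldr br us z) = 0}"
proof -
  interpret poisson_module Z br delta_module nb by (rule delta_module_poisson)
  show ?thesis
  proof (intro equalityI subsetI)
    fix z assume z: "z \<in> annihilator Z delta_module"
    have "\<xi> (foldr br us z) = 0" if us: "us \<in> lists (carrier Z)" for us
    proof -
      have y: "foldr br us z \<in> annihilator Z delta_module" by (rule annihilator_foldr_br[OF us z])
      then have "ac (foldr br us z) delta = (\<lambda>_. 0)"
        using deltas.delta by (auto simp: annihilator_def delta_module_simps)
      then have "ac (foldr br us z) delta \<one> = 0" by metis
      then show ?thesis using y by (simp add: ac_def delta_def annihilator_def)
    qed
    then show "z \<in> {z \<in> carrier Z. \<forall>us\<in>lists (carrier Z). \<xi> (foldr br us z) = 0}"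
      using z by (auto simp: annihilator_def)
  next
    fix z assume z: "z \<in> {z \<in> carrier Z. \<forall>us\<in>lists (carrier Z). \<xi> (foldr br us z) = 0}"
    have "ac z F = (\<lambda>_. 0)" if "F \<in> deltas"
        "z \<in> carrier Z" "\<And>us. us \<in> lists (carrier Z) \<Longrightarrow> \<xi> (foldr br us z) = 0" for F z
      using that
    proof (induction F arbitrary: z rule: deltas.induct)
      case delta
      then show ?case using delta(2)[of "[]"] by (auto simp: ac_def delta_def \<xi>_mult)
    next
      case (add F G)
      then have "ac z F = (\<lambda>_. 0)" "ac z G = (\<lambda>_. 0)" by blast+
      moreover have "ac z (\<lambda>w. F w + G w) = (\<lambda>w. ac z F w + ac z G w)" by (auto simp: ac_def)
      ultimately show ?case by simp
    next
      case (ac y F)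
      then have "ac z F = (\<lambda>_. 0)" by blast
      then have "ac y (ac z F) = (\<lambda>_. 0)" by (simp add: ac_def fun_eq_iff)
      then show ?case using ac_ac[OF functional_deltas[OF ac.hyps(2)] ac.hyps(1) ac.prems(1)] by simp
    next
      case (nb x F)
      have "ac z F = (\<lambda>_. 0)" using nb.IH[OF nb.prems(1)] nb.prems(2) by blast
      moreover have "ac (br x z) F = (\<lambda>_. 0)"
      proof (rule nb.IH)
        show "br x z \<in> carrier Z" using nb by (intro br_closed)
        show "\<xi> (foldr br us (br x z)) = 0" if "us \<in> lists (carrier Z)" for us
          using nb.prems(2)[of "us @ [x]"] that nb.hyps by simp
      qed
      moreover have "nb x (\<lambda>_. 0) = (\<lambda>_. 0)" by (auto simp: nb_def)
      ultimately have "(\<lambda>_. 0) = (\<lambda>w. 0 - ac z (nb x F) w)"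
        using ac_nb[OF functional_deltas[OF nb.hyps(2)] nb.hyps(1) nb.prems(1)] by simp
      then have "0 - ac z (nb x F) w = 0" for w by metis
      then show ?case by (auto simp: fun_eq_iff)
    qed
    then show "z \<in> annihilator Z delta_module"
      using z by (auto simp: annihilator_def delta_module_simps)
  qed
qed

end

subsection \<open>Polynomial functions on matrices and their derivatives\<close>

definition entries :: "('n::finite cmat \<Rightarrow> complex) set" where
  "entries = {\<lambda>A. A $ i $ j | i j. True}"

lemma matrix_polys_eq: "matrix_polys = polyfuns UNIV entries"
  by (simp add: matrix_polys_def entries_def)

lemma finite_entries: "finite (entries :: ('n::finite cmat \<Rightarrow> complex) set)"
proof -
  have eq: "entries = (\<lambda>(i, j). \<lambda>A::'n cmat. A $ i $ j) ` UNIV" by (auto simp: entries_def)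
  show ?thesis unfolding eq by (intro finite_imageI finite)
qed

lemma subring_matrix_polys: "is_subring matrix_polys"
  unfolding matrix_polys_eq by (rule subring_polyfuns)

lemma noeth_matrix_polys: "noeth matrix_polys"
  unfolding matrix_polys_eq by (rule noeth_polyfuns[OF finite_entries])

lemma matrix_polys_intros:
  "(\<lambda>_. c) \<in> matrix_polys" "(\<lambda>A. A $ i $ j) \<in> matrix_polys"
  "p \<in> matrix_polys \<Longrightarrow> q \<in> matrix_polys \<Longrightarrow> (\<lambda>A. p A + q A) \<in> matrix_polys"
  "p \<in> matrix_polys \<Longrightarrow> q \<in> matrix_polys \<Longrightarrow> (\<lambda>A. p A - q A) \<in> matrix_polys"
  "p \<in> matrix_polys \<Longrightarrow> q \<in> matrix_polys \<Longrightarrow> (\<lambda>A. p A * q A) \<in> matrix_polys"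
  "p \<in> matrix_polys \<Longrightarrow> (\<lambda>A. - p A) \<in> matrix_polys"
  "p \<in> matrix_polys \<Longrightarrow> (\<lambda>A. p A ^ n) \<in> matrix_polys"
  "(\<And>i. i \<in> S \<Longrightarrow> f i \<in> matrix_polys) \<Longrightarrow> (\<lambda>A. \<Sum>i\<in>S. f i A) \<in> matrix_polys"
  "(\<And>i. i \<in> S \<Longrightarrow> f i \<in> matrix_polys) \<Longrightarrow> (\<lambda>A. \<Prod>i\<in>S. f i A) \<in> matrix_polys"
  unfolding matrix_polys_eq
  by (auto simp: entries_def intro!: polyfuns_const polyfuns_add polyfuns_diff polyfuns_mult polyfuns_minus
      polyfuns_power polyfuns_sum polyfuns_prod intro: polyfuns_coord)

lemma matrix_polys_induct [consumes 1, case_names const entry add mult]: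
  assumes "p \<in> matrix_polys" "\<And>c. P (\<lambda>_. c)" "\<And>i j. P (\<lambda>A. A $ i $ j)"
    "\<And>p q. p \<in> matrix_polys \<Longrightarrow> q \<in> matrix_polys \<Longrightarrow> P p \<Longrightarrow> P q \<Longrightarrow> P (\<lambda>A. p A + q A)"
    "\<And>p q. p \<in> matrix_polys \<Longrightarrow> q \<in> matrix_polys \<Longrightarrow> P p \<Longrightarrow> P q \<Longrightarrow> P (\<lambda>A. p A * q A)"
  shows "P p"
  using assms(1) unfolding matrix_polys_eq
  by (induction rule: polyfuns_UNIV_induct) (auto simp: entries_def matrix_polys_eq intro: assms(2-)[unfolded matrix_polys_eq])

lemma polyfuns_compose:
  assumes "p \<in> matrix_polys" "\<And>i j. (\<lambda>w. F w $ i $ j) \<in> polyfuns UNIV Y"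
  shows "(\<lambda>w. p (F w)) \<in> polyfuns UNIV Y"
  using assms(1) by (induction rule: matrix_polys_induct) (auto intro: polyfuns_ops assms(2))

lemma matrix_polys_compose:
  "p \<in> matrix_polys \<Longrightarrow> (\<And>i j. (\<lambda>A. F A $ i $ j) \<in> matrix_polys) \<Longrightarrow> (\<lambda>A. p (F A)) \<in> matrix_polys"
  unfolding matrix_polys_eq by (rule polyfuns_compose[unfolded matrix_polys_eq])

lemma matrix_mult_polys:
  assumes "\<And>i j. (\<lambda>w. F w $ i $ j) \<in> polyfuns UNIV Y" "\<And>i j. (\<lambda>w. H w $ i $ j) \<in> polyfuns UNIV Y"
  shows "(\<lambda>w. (F w ** H w) $ i $ j) \<in> polyfuns UNIV Y"
  using assms by (auto simp: matrix_matrix_mult_def intro!: polyfuns_sum polyfuns_mult)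

lemma matrix_polys_rmult: "p \<in> matrix_polys \<Longrightarrow> (\<lambda>A. p (A ** B)) \<in> matrix_polys"
  by (erule matrix_polys_compose)
    (auto simp: matrix_polys_eq entries_def intro!: matrix_mult_polys polyfuns_const intro: polyfuns_coord)

lemma matrix_polys_lmult: "p \<in> matrix_polys \<Longrightarrow> (\<lambda>A. p (B ** A)) \<in> matrix_polys"
  by (erule matrix_polys_compose)
    (auto simp: matrix_polys_eq entries_def intro!: matrix_mult_polys polyfuns_const intro: polyfuns_coord)

lemma det_matrix_polys: "(det :: 'n::finite cmat \<Rightarrow> complex) \<in> matrix_polys"
proof -
  have eq: "det = (\<lambda>A :: 'n cmat. \<Sum>p\<in>{p. p permutes UNIV}. of_int (sign p) * (\<Prod>i\<in>UNIV. A $ i $ p i))"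
    by (simp add: fun_eq_iff det_def)
  show ?thesis unfolding eq by (intro matrix_polys_intros)
qed

lemma cscale_simps [simp]: "cscale c X $ i $ j = c * X $ i $ j"
  by (simp add: cscale_def)

lemma cscale_ops:
  "cscale c X ** A = cscale c (X ** A)" "A ** cscale c X = cscale c (A ** X)"
  "cscale c (X + Y) = cscale c X + cscale c Y" "cscale c (X - Y) = cscale c X - cscale c Y"
  "cscale (c + d) X = cscale c X + cscale d X" "cscale (c * d) X = cscale c (cscale d X)" "cscale 1 X = X" "cscale 0 X = 0"
  by (simp_all add: vec_eq_iff matrix_matrix_mult_def sum_distrib_left algebra_simps)

lemma matrix_add_ldistrib': "A ** (B + C) = A ** B + A ** C" for A B C :: "'n::finite cmat"
  by (simp add: vec_eq_iff matrix_matrix_mult_def distrib_left sum.distrib)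

lemma matrix_add_rdistrib': "(A + B) ** C = A ** C + B ** C" for A B C :: "'n::finite cmat"
  by (simp add: vec_eq_iff matrix_matrix_mult_def distrib_right sum.distrib)

text \<open>The \<open>r i j\<close> are the partial derivatives; that they are polynomials makes
  vector fields act on \<open>matrix_polys\<close>.\<close>

lemma matrix_polys_gradient:
  fixes p :: "'n::finite cmat \<Rightarrow> complex"
  assumes "p \<in> matrix_polys"
  obtains r where "\<And>i j. r i j \<in> matrix_polys"
    "\<And>A Y. ((\<lambda>t. p (A + cscale t Y)) has_field_derivative (\<Sum>i\<in>UNIV. \<Sum>j\<in>UNIV. r i j A * Y $ i $ j)) (at 0)"
proof -
  have "\<exists>r. (\<forall>i j. r i j \<in> matrix_polys) \<and>
    (\<forall>A Y. ((\<lambda>t. p (A + cscale t Y)) has_field_derivative (\<Sum>i\<in>UNIV. \<Sum>j\<in>UNIV. r i j A * Y $ i $ j)) (at 0))"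
    using assms
  proof (induction rule: matrix_polys_induct)
    case (const c)
    show ?case by (intro exI[of _ "\<lambda>_ _ _. 0"]) (auto intro: matrix_polys_intros)
  next
    case (entry k l)
    have "(\<Sum>i\<in>UNIV. \<Sum>j\<in>UNIV. (if i = k \<and> j = l then 1 else 0) * Y $ i $ j) = Y $ k $ l" for Y :: "'n cmat"
    proof -
      have "(\<Sum>j\<in>UNIV. (if i = k \<and> j = l then 1 else 0) * Y $ i $ j) = (if i = k then Y $ k $ l else 0)" for i
      proof -
        have "(\<Sum>j\<in>UNIV. (if i = k \<and> j = l then 1 else 0) * Y $ i $ j) = (\<Sum>j\<in>UNIV. if j = l then (if i = k then Y $ k $ l else 0) else 0)"
          by (intro sum.cong) auto
        then show ?thesis by simp
      qed
      then show ?thesis by simp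
    qed
    then have "((\<lambda>t. (A + cscale t Y) $ k $ l) has_field_derivative
        (\<Sum>i\<in>UNIV. \<Sum>j\<in>UNIV. (if i = k \<and> j = l then 1 else 0) * Y $ i $ j)) (at 0)" for A Y
      by (auto intro!: derivative_eq_intros)
    then show ?case
      by (intro exI[of _ "\<lambda>i j _. if i = k \<and> j = l then 1 else 0"]) (auto intro: matrix_polys_intros)
  next
    case (add p q)
    then obtain r s where r: "\<forall>i j. r i j \<in> matrix_polys" "\<forall>i j. s i j \<in> matrix_polys"
      "\<And>A Y. ((\<lambda>t. p (A + cscale t Y)) has_field_derivative (\<Sum>i\<in>UNIV. \<Sum>j\<in>UNIV. r i j A * Y $ i $ j)) (at 0)"
      "\<And>A Y. ((\<lambda>t. q (A + cscale t Y)) has_field_derivative (\<Sum>i\<in>UNIV. \<Sum>j\<in>UNIV. s i j A * Y $ i $ j)) (at 0)"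
      by blast
    have "((\<lambda>t. p (A + cscale t Y) + q (A + cscale t Y)) has_field_derivative
      (\<Sum>i\<in>UNIV. \<Sum>j\<in>UNIV. (r i j A + s i j A) * Y $ i $ j)) (at 0)" for A Y
      using DERIV_add[OF r(3,4)[of A Y]] by (simp add: sum.distrib distrib_right)
    then show ?case using r(1,2) by (intro exI[of _ "\<lambda>i j A. r i j A + s i j A"]) (auto intro: matrix_polys_intros)
  next
    case (mult p q)
    then obtain r s where r: "\<forall>i j. r i j \<in> matrix_polys" "\<forall>i j. s i j \<in> matrix_polys"
      "\<And>A Y. ((\<lambda>t. p (A + cscale t Y)) has_field_derivative (\<Sum>i\<in>UNIV. \<Sum>j\<in>UNIV. r i j A * Y $ i $ j)) (at 0)"
      "\<And>A Y. ((\<lambda>t. q (A + cscale t Y)) has_field_derivative (\<Sum>i\<in>UNIV. \<Sum>j\<in>UNIV. s i j A * Y $ i $ j)) (at 0)"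
      by blast
    have "((\<lambda>t. p (A + cscale t Y) * q (A + cscale t Y)) has_field_derivative
      (\<Sum>i\<in>UNIV. \<Sum>j\<in>UNIV. (r i j A * q A + s i j A * p A) * Y $ i $ j)) (at 0)" for A Y
    proof -
      have "((\<lambda>t. p (A + cscale t Y) * q (A + cscale t Y)) has_field_derivative
        (\<Sum>i\<in>UNIV. \<Sum>j\<in>UNIV. r i j A * Y $ i $ j) * q A + (\<Sum>i\<in>UNIV. \<Sum>j\<in>UNIV. s i j A * Y $ i $ j) * p A) (at 0)"
        using DERIV_mult[OF r(3,4)[of A Y]] by (simp add: cscale_ops)
      also have "(\<Sum>i\<in>UNIV. \<Sum>j\<in>UNIV. r i j A * Y $ i $ j) * q A + (\<Sum>i\<in>UNIV. \<Sum>j\<in>UNIV. s i j A * Y $ i $ j) * p A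
        = (\<Sum>i\<in>UNIV. \<Sum>j\<in>UNIV. (r i j A * q A + s i j A * p A) * Y $ i $ j)"
        by (simp only: sum_distrib_right sum.distrib[symmetric]) (intro sum.cong refl, simp add: algebra_simps)
      finally show ?thesis .
    qed
    then show ?case using r(1,2) mult.hyps
      by (intro exI[of _ "\<lambda>i j A. r i j A * q A + s i j A * p A"]) (auto intro!: matrix_polys_intros)
  qed
  then show ?thesis using that by blast
qed

definition grad :: "('n::finite cmat \<Rightarrow> complex) \<Rightarrow> 'n cmat \<Rightarrow> 'n cmat \<Rightarrow> complex" where
  "grad p A Y = deriv (\<lambda>t. p (A + cscale t Y)) 0"

lemma grad_eq:
  assumes "((\<lambda>t. p (A + cscale t Y)) has_field_derivative d) (at 0)"
  shows "grad p A Y = d"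
  unfolding grad_def by (rule DERIV_imp_deriv[OF assms])

lemma grad_DERIV:
  assumes "p \<in> matrix_polys"
  shows "((\<lambda>t. p (A + cscale t Y)) has_field_derivative grad p A Y) (at 0)"
proof (rule matrix_polys_gradient[OF assms])
  fix r assume d: "\<And>A Y. ((\<lambda>t. p (A + cscale t Y)) has_field_derivative (\<Sum>i\<in>UNIV. \<Sum>j\<in>UNIV. r i j A * Y $ i $ j)) (at 0)"
  show ?thesis using d[of A Y] by (simp only: grad_eq[OF d[of A Y]])
qed

lemma grad_repr:
  assumes "p \<in> matrix_polys"
  obtains r where "\<And>i j. r i j \<in> matrix_polys" "\<And>A Y. grad p A Y = (\<Sum>i\<in>UNIV. \<Sum>j\<in>UNIV. r i j A * Y $ i $ j)"
proof (rule matrix_polys_gradient[OF assms])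
  fix r assume r: "\<And>i j. r i j \<in> matrix_polys"
    and d: "\<And>A Y. ((\<lambda>t. p (A + cscale t Y)) has_field_derivative (\<Sum>i\<in>UNIV. \<Sum>j\<in>UNIV. r i j A * Y $ i $ j)) (at 0)"
  show thesis by (rule that[of r]) (rule r, rule grad_eq[OF d])
qed

lemma grad_linear:
  assumes "p \<in> matrix_polys"
  shows "grad p A (X + Y) = grad p A X + grad p A Y" "grad p A (cscale c X) = c * grad p A X"
proof -
  obtain r where "\<And>i j. r i j \<in> matrix_polys"
    and r: "\<And>A Y. grad p A Y = (\<Sum>i\<in>UNIV. \<Sum>j\<in>UNIV. r i j A * Y $ i $ j)"

  proof -
    from grad_repr[OF assms] show ?thesis using that .
  qed
  show "grad p A (X + Y) = grad p A X + grad p A Y" by (simp add: r sum.distrib distrib_left)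
  show "grad p A (cscale c X) = c * grad p A X" by (simp add: r sum_distrib_left mult_ac)
qed

text \<open>The right-invariant vector field of \<open>X\<close>.\<close>

definition vf :: "'n::finite cmat \<Rightarrow> ('n cmat \<Rightarrow> complex) \<Rightarrow> 'n cmat \<Rightarrow> complex" where
  "vf X p A = grad p A (X ** A)"

lemma vf_closed:
  assumes "p \<in> matrix_polys"
  shows "vf X p \<in> matrix_polys"
proof -
  obtain r where r: "\<And>i j. r i j \<in> matrix_polys" "\<And>A Y. grad p A Y = (\<Sum>i\<in>UNIV. \<Sum>j\<in>UNIV. r i j A * Y $ i $ j)"

  proof -
    from grad_repr[OF assms] show ?thesis using that .
  qed
  have "vf X p = (\<lambda>A. \<Sum>i\<in>UNIV. \<Sum>j\<in>UNIV. r i j A * (\<Sum>k\<in>UNIV. X $ i $ k * A $ k $ j))"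
    by (simp add: fun_eq_iff vf_def r(2) matrix_matrix_mult_def)
  then show ?thesis using r(1) by (auto intro!: matrix_polys_intros)
qed

lemma vf_DERIV:
  assumes "p \<in> matrix_polys"
  shows "((\<lambda>t. p ((mat 1 + cscale t X) ** A)) has_field_derivative vf X p A) (at 0)"
  using grad_DERIV[OF assms, of A "X ** A"] by (simp add: vf_def matrix_add_rdistrib' cscale_ops)

lemma vf_unique:
  assumes "p \<in> matrix_polys" "((\<lambda>t. p ((mat 1 + cscale t X) ** A)) has_field_derivative d) (at 0)"
  shows "vf X p A = d"
  using DERIV_unique[OF vf_DERIV[OF assms(1)] assms(2)] .

lemma mat1_zero [simp]: "(mat 1 + cscale 0 X) ** A = A"
  by (simp add: cscale_ops)

lemma vf_add: "p \<in> matrix_polys \<Longrightarrow> q \<in> matrix_polys \<Longrightarrow> vf X (\<lambda>A. p A + q A) = (\<lambda>A. vf X p A + vf X q A)"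
  by (rule ext, rule vf_unique) (auto intro: matrix_polys_intros DERIV_add vf_DERIV)

lemma vf_mult:
  assumes "p \<in> matrix_polys" "q \<in> matrix_polys"
  shows "vf X (\<lambda>A. p A * q A) = (\<lambda>A. vf X p A * q A + p A * vf X q A)"
proof (rule ext, rule vf_unique)
  fix A
  show "((\<lambda>t. p ((mat 1 + cscale t X) ** A) * q ((mat 1 + cscale t X) ** A)) has_field_derivative
      (vf X p A * q A + p A * vf X q A)) (at 0)"
    using DERIV_mult[OF vf_DERIV[OF assms(1), of X A] vf_DERIV[OF assms(2), of X A]] by (simp add: mult_ac)
qed (use assms in \<open>auto intro: matrix_polys_intros\<close>)

lemma vf_const: "vf X (\<lambda>_. c) = (\<lambda>_. 0)"
  by (rule ext, rule vf_unique) (auto intro: matrix_polys_intros)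

lemma vf_entry: "vf X (\<lambda>A. A $ i $ j) = (\<lambda>A. (X ** A) $ i $ j)"
  by (rule ext, rule vf_unique) (auto simp: matrix_add_rdistrib' cscale_ops intro!: matrix_polys_intros derivative_eq_intros)

lemma vf_diff:
  assumes "p \<in> matrix_polys" "q \<in> matrix_polys"
  shows "vf X (\<lambda>A. p A - q A) = (\<lambda>A. vf X p A - vf X q A)"
  by (rule ext, rule vf_unique) (use assms in \<open>auto intro: matrix_polys_intros DERIV_diff vf_DERIV\<close>)

subsection \<open>Conjugation\<close>

lemma matrix_inv:
  fixes A :: "'n::finite cmat"
  assumes "invertible A"
  shows "A ** matrix_inv A = mat 1" "matrix_inv A ** A = mat 1"
proof -
  have "\<exists>B. A ** B = mat 1 \<and> B ** A = mat 1" using assms by (simp add: invertible_def)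
  from someI_ex[OF this] show "A ** matrix_inv A = mat 1" "matrix_inv A ** A = mat 1"
    by (auto simp: matrix_inv_def)
qed

lemma matrix_inv_unique':
  fixes A :: "'n::finite cmat"
  assumes "A ** B = mat 1" "B ** A = mat 1"
  shows "matrix_inv A = B"
proof -
  have "invertible A" using assms by (auto simp: invertible_def)
  then have "matrix_inv A ** (A ** B) = B" using matrix_inv(2)[of A] by (simp add: matrix_mul_assoc)
  then show ?thesis using assms by simp
qed

lemma matrix_inv_mult:
  fixes A B :: "'n::finite cmat"
  assumes "invertible A" "invertible B"
  shows "matrix_inv (A ** B) = matrix_inv B ** matrix_inv A"
proof (rule matrix_inv_unique')
  have "A ** B ** (matrix_inv B ** matrix_inv A) = A ** (B ** matrix_inv B) ** matrix_inv A"
    by (simp add: matrix_mul_assoc)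
  then show "A ** B ** (matrix_inv B ** matrix_inv A) = mat 1" using assms by (simp add: matrix_inv)
  have "matrix_inv B ** matrix_inv A ** (A ** B) = matrix_inv B ** (matrix_inv A ** A) ** B"
    by (simp add: matrix_mul_assoc)
  then show "matrix_inv B ** matrix_inv A ** (A ** B) = mat 1" using assms by (simp add: matrix_inv)
qed

text \<open>Cramer's rule applied to the columns of the inverse.\<close>

lemma cofactors:
  obtains c :: "'n::finite \<Rightarrow> 'n \<Rightarrow> 'n cmat \<Rightarrow> complex"
  where "\<And>i j. c i j \<in> matrix_polys" "\<And>A i j. invertible A \<Longrightarrow> matrix_inv A $ i $ j = c i j A / det A"
proof -
  define c where "c i j A = det (\<chi> k l. if l = i then (axis j 1 :: complex^'n) $ k else A $ k $ l)" for i j and A :: "'n cmat"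
  have "c i j \<in> matrix_polys" for i j
  proof -
    have "(\<lambda>A::'n cmat. (\<chi> k l. if l = i then (axis j 1 :: complex^'n) $ k else A $ k $ l) $ a $ b) \<in> matrix_polys" for a b
      by (cases "b = i") (auto intro: matrix_polys_intros)
    from matrix_polys_compose[OF det_matrix_polys this] show ?thesis by (simp add: c_def[abs_def])
  qed
  moreover have "matrix_inv A $ i $ j = c i j A / det A" if A: "invertible A" for A i j
  proof -
    have d: "det A \<noteq> 0" using A by (simp add: invertible_det_nz)
    have "A *v column j (matrix_inv A) = axis j 1"
    proof -
      have "(A *v column j (matrix_inv A)) $ k = (A ** matrix_inv A) $ k $ j" for k
        by (simp add: matrix_vector_mult_def column_def matrix_matrix_mult_def)
      then show ?thesis using matrix_inv(1)[OF A] by (simp add: vec_eq_iff mat_def axis_def)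
    qed
    then have "column j (matrix_inv A) = (\<chi> k. det (\<chi> i l. if l = k then (axis j 1 :: complex^'n) $ i else A $ i $ l) / det A)"
      using cramer[OF d] by blast
    then have "column j (matrix_inv A) $ i = c i j A / det A" by (simp add: c_def)
    then show ?thesis by (simp add: column_def)
  qed
  ultimately show ?thesis by (rule that)
qed

lemma near_identity_invertible:
  "\<forall>\<^sub>F t in nhds 0. invertible (mat 1 + cscale t X)"
proof -
  have "((\<lambda>t. det (mat 1 + cscale t X)) has_field_derivative grad det (mat 1) X) (at 0)"
    by (rule grad_DERIV[OF det_matrix_polys])
  then have "isCont (\<lambda>t. det (mat 1 + cscale t X)) 0" by (rule DERIV_isCont)
  then have "(\<lambda>t. det (mat 1 + cscale t X)) \<midarrow>0\<rightarrow> 1" by (simp add: isCont_def cscale_ops)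
  then have "\<forall>\<^sub>F t in at 0. det (mat 1 + cscale t X) \<noteq> 0"
    by (rule tendsto_imp_eventually_ne) simp
  then show ?thesis by (simp add: eventually_nhds_conv_at invertible_det_nz cscale_ops)
qed

lemma DERIV_transform:
  "(f has_field_derivative d) (at x) \<Longrightarrow> \<forall>\<^sub>F t in nhds x. f t = g t \<Longrightarrow> (g has_field_derivative d) (at x)"
  using DERIV_cong_ev[of x x f g d d] by simp

text \<open>The entries of the inverse are differentiable as quotients of polynomials; the value of
  the derivative is then read off from \<open>E t ** W t = Y ** E t\<close>, so no formula for the
  derivative of the inverse is required.\<close>

lemma conjugation_DERIV:
  fixes X Y :: "'n::finite cmat"
  shows   "((\<lambda>t. (matrix_inv (mat 1 + cscale t X) ** Y ** (mat 1 + cscale t X)) $ i $ j)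
     has_field_derivative commutator Y X $ i $ j) (at 0)"
proof -
  obtain c :: "'n \<Rightarrow> 'n \<Rightarrow> 'n cmat \<Rightarrow> complex" where c: "\<And>i j. c i j \<in> matrix_polys"
    "\<And>A i j. invertible A \<Longrightarrow> matrix_inv A $ i $ j = c i j A / det A"
  proof -
    from cofactors show ?thesis using that .
  qed
  define E where "E t = mat 1 + cscale t X" for t
  have E0: "E 0 = mat 1" by (simp add: E_def cscale_ops)
  define W where "W t = matrix_inv (E t) ** Y ** E t" for t
  have inv: "\<exists>d. ((\<lambda>t. matrix_inv (E t) $ i $ j) has_field_derivative d) (at 0)" for i j
  proof -
    have "((\<lambda>t. c i j (E t) / det (E t)) has_field_derivative
       (grad (c i j) (mat 1) X * det (E 0) - c i j (E 0) * grad det (mat 1) X) / (det (E 0) * det (E 0))) (at 0)"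
      using grad_DERIV[OF c(1), of i j "mat 1" X] grad_DERIV[OF det_matrix_polys, of "mat 1" X]
      unfolding E_def[symmetric] by (rule DERIV_divide) (simp add: E0)
    moreover have "\<forall>\<^sub>F t in nhds 0. c i j (E t) / det (E t) = matrix_inv (E t) $ i $ j"
      using near_identity_invertible[of X] by eventually_elim (simp add: c(2) E_def)
    ultimately show ?thesis by (blast intro: DERIV_transform)
  qed
  have "\<exists>d. ((\<lambda>t. W t $ i $ j) has_field_derivative d) (at 0)" for i j
  proof -
    obtain d where d: "\<And>i j. ((\<lambda>t. matrix_inv (E t) $ i $ j) has_field_derivative d i j) (at 0)"
      using inv by metis
    have e: "((\<lambda>t. E t $ i $ j) has_field_derivative X $ i $ j) (at 0)" for i j
      unfolding E_def by (auto intro!: derivative_eq_intros)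
    have "((\<lambda>t. \<Sum>l\<in>UNIV. (\<Sum>k\<in>UNIV. matrix_inv (E t) $ i $ k * Y $ k $ l) * E t $ l $ j) has_field_derivative
      (\<Sum>l\<in>UNIV. (\<Sum>k\<in>UNIV. d i k * Y $ k $ l) * E 0 $ l $ j + X $ l $ j * (\<Sum>k\<in>UNIV. matrix_inv (E 0) $ i $ k * Y $ k $ l))) (at 0)"
      by (intro DERIV_sum DERIV_mult DERIV_cmult_right d e)
    then show ?thesis by (auto simp: W_def matrix_matrix_mult_def)
  qed
  then obtain w where w: "\<And>i j. ((\<lambda>t. W t $ i $ j) has_field_derivative w i j) (at 0)" by metis
  have "matrix_inv (mat 1 :: 'n cmat) = mat 1" by (rule matrix_inv_unique') auto
  then have W0: "W 0 = Y" by (simp add: W_def E0)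
  have "w i j = commutator Y X $ i $ j" for i j
  proof -
    \<comment> \<open>Left side of \<open>E t ** W t = Y ** E t\<close>, whose derivative at 0 is
      \<open>w\<close> plus \<open>X ** Y\<close>; the right side has derivative
      \<open>Y ** X\<close>.\<close>
    have "((\<lambda>t. W t $ i $ j + t * (\<Sum>k\<in>UNIV. X $ i $ k * W t $ k $ j)) has_field_derivative
      (w i j + (1 * (\<Sum>k\<in>UNIV. X $ i $ k * W 0 $ k $ j) + (\<Sum>k\<in>UNIV. X $ i $ k * w k j) * 0))) (at 0)"
      by (intro DERIV_add DERIV_mult DERIV_ident DERIV_sum DERIV_cmult w)
    moreover have "\<forall>\<^sub>F t in nhds 0. W t $ i $ j + t * (\<Sum>k\<in>UNIV. X $ i $ k * W t $ k $ j) = Y $ i $ j + t * (Y ** X) $ i $ j"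
      using near_identity_invertible[of X]
    proof eventually_elim
      case (elim t)
      have "E t ** W t = (E t ** matrix_inv (E t)) ** Y ** E t" by (simp add: W_def matrix_mul_assoc)
      also have "\<dots> = Y ** E t" using matrix_inv(1)[OF elim] by (simp add: E_def)
      finally have "W t + cscale t (X ** W t) = Y + cscale t (Y ** X)"
        by (simp add: E_def matrix_add_rdistrib' matrix_add_ldistrib' cscale_ops)
      then have "(W t + cscale t (X ** W t)) $ i $ j = (Y + cscale t (Y ** X)) $ i $ j" by simp
      then show ?case by (simp add: matrix_matrix_mult_def)
    qed
    ultimately have "((\<lambda>t. Y $ i $ j + t * (Y ** X) $ i $ j) has_field_derivative
      (w i j + (1 * (\<Sum>k\<in>UNIV. X $ i $ k * W 0 $ k $ j) + (\<Sum>k\<in>UNIV. X $ i $ k * w k j) * 0))) (at 0)"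
      by (rule DERIV_transform)
    moreover have "((\<lambda>t. Y $ i $ j + t * (Y ** X) $ i $ j) has_field_derivative (Y ** X) $ i $ j) (at 0)"
      by (auto intro!: derivative_eq_intros)
    ultimately have "w i j + (\<Sum>k\<in>UNIV. X $ i $ k * W 0 $ k $ j) = (Y ** X) $ i $ j"
      using DERIV_unique by fastforce
    then show ?thesis by (simp add: W0 commutator_def matrix_matrix_mult_def eq_diff_eq)
  qed
  then show ?thesis using w by (simp add: W_def E_def)
qed

subsection \<open>The Lie algebra of a linear algebraic group\<close>

locale alg_group =
  fixes G :: "'n::finite cmat set"
  assumes G: "linear_algebraic_group G"
begin

definition vanish :: "('n cmat \<Rightarrow> complex) set" where
  "vanish = {p \<in> matrix_polys. \<forall>A\<in>G. p A = 0}"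

lemma G_sub: "subgroup G GL" using G by (simp add: linear_algebraic_group_def)

lemma G_invertible: "A \<in> G \<Longrightarrow> invertible A"
  using subgroup.subset[OF G_sub] by (auto simp: GL_def)

lemma G_mult: "A \<in> G \<Longrightarrow> B \<in> G \<Longrightarrow> A ** B \<in> G"
  using subgroup.m_closed[OF G_sub, of A B] by (simp add: GL_def)

lemma G_one: "mat 1 \<in> G"
  using subgroup.one_closed[OF G_sub] by (simp add: GL_def)

lemma G_inv:
  assumes "A \<in> G"
  shows "matrix_inv A \<in> G"
proof -
  have A: "invertible A" by (rule G_invertible[OF assms])
  have "inv\<^bsub>GL\<^esub> A = matrix_inv A"
    unfolding m_inv_def
  proof (rule the_equality)
    show "matrix_inv A \<in> carrier GL \<and> A \<otimes>\<^bsub>GL\<^esub> matrix_inv A = \<one>\<^bsub>GL\<^esub> \<and> matrix_inv A \<otimes>\<^bsub>GL\<^esub> A = \<one>\<^bsub>GL\<^esub>"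
      using matrix_inv[OF A] by (auto simp: GL_def invertible_def)
    show "B = matrix_inv A" if "B \<in> carrier GL \<and> A \<otimes>\<^bsub>GL\<^esub> B = \<one>\<^bsub>GL\<^esub> \<and> B \<otimes>\<^bsub>GL\<^esub> A = \<one>\<^bsub>GL\<^esub>" for B
      using that matrix_inv_unique'[of A B] by (simp add: GL_def)
  qed
  then show ?thesis using subgroup.m_inv_closed[OF G_sub assms] by simp
qed

lemma Lie_iff: "X \<in> Lie G \<longleftrightarrow> (\<forall>p\<in>vanish. grad p (mat 1) X = 0)"
proof -
  have "((\<lambda>t. p (mat 1 + cscale t X)) has_field_derivative 0) (at 0) \<longleftrightarrow> grad p (mat 1) X = 0"
    if "p \<in> matrix_polys" for p
    using grad_DERIV[OF that, of "mat 1" X] grad_eq by metis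
  then show ?thesis by (auto simp: Lie_def vanish_def)
qed

lemma Lie_subspace: "X \<in> Lie G \<Longrightarrow> Y \<in> Lie G \<Longrightarrow> X + Y \<in> Lie G" "X \<in> Lie G \<Longrightarrow> cscale c X \<in> Lie G" "0 \<in> Lie G"
proof -
  show a: "X \<in> Lie G \<Longrightarrow> Y \<in> Lie G \<Longrightarrow> X + Y \<in> Lie G" "X \<in> Lie G \<Longrightarrow> cscale c X \<in> Lie G" for X Y c
    by (auto simp: Lie_iff grad_linear vanish_def)
  have "grad p (mat 1) 0 = 0" if "p \<in> matrix_polys" for p
    using grad_linear(2)[OF that, of "mat 1" 0 0] by (simp add: cscale_ops)
  then show "0 \<in> Lie G" by (auto simp: Lie_iff vanish_def)
qed

text \<open>Right translation by an element of \<open>G\<close> preserves \<open>vanish\<close>, so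
  tangency at the identity spreads to all of \<open>G\<close>.\<close>

lemma vf_vanish:
  assumes "p \<in> vanish" "X \<in> Lie G"
  shows "vf X p \<in> vanish"
proof -
  have p: "p \<in> matrix_polys" using assms by (simp add: vanish_def)
  have "vf X p A = 0" if A: "A \<in> G" for A
  proof -
    have q: "(\<lambda>B. p (B ** A)) \<in> vanish" using assms(1) A by (auto simp: vanish_def G_mult intro: matrix_polys_rmult)
    then have "((\<lambda>t. p ((mat 1 + cscale t X) ** A)) has_field_derivative 0) (at 0)"
      using assms(2) by (auto simp: Lie_def vanish_def)
    then show ?thesis by (rule vf_unique[OF p])
  qed
  then show ?thesis using vf_closed[OF p] by (simp add: vanish_def)
qed

lemma Ad_Lie:
  assumes g: "g \<in> G" and X: "X \<in> Lie G"
  shows "matrix_inv g ** X ** g \<in> Lie G"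
  unfolding Lie_iff
proof
  fix p assume p: "p \<in> vanish"
  have q: "(\<lambda>B. p (matrix_inv g ** B ** g)) \<in> vanish"
    using p g matrix_polys_lmult[OF matrix_polys_rmult[of p g], of "matrix_inv g"]
    by (auto simp: vanish_def G_mult G_inv)
  have e: "matrix_inv g ** (mat 1 + cscale t X) ** g = mat 1 + cscale t (matrix_inv g ** X ** g)" for t
    using matrix_inv(2)[OF G_invertible[OF g]] by (simp add: matrix_add_ldistrib' matrix_add_rdistrib' cscale_ops)
  have "((\<lambda>t. p (matrix_inv g ** (mat 1 + cscale t X) ** g)) has_field_derivative 0) (at 0)"
    using q X by (auto simp: Lie_def vanish_def)
  then show "grad p (mat 1) (matrix_inv g ** X ** g) = 0"
    unfolding e by (rule grad_eq)
qed

text \<open>For \<open>p\<close> in \<open>vanish\<close>, the differential of \<open>p\<close> at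
  the identity applied to the conjugates of \<open>Y\<close> becomes, after multiplication by
  \<open>det\<close>, a polynomial \<open>q\<close> that vanishes on \<open>G\<close> by
  \<open>Ad_Lie\<close>. Its derivative along \<open>X\<close> at the identity is the differential
  applied to the commutator.\<close>

lemma commutator_Lie:
  assumes X: "X \<in> Lie G" and Y: "Y \<in> Lie G"
  shows "commutator Y X \<in> Lie G"
  unfolding Lie_iff
proof
  fix p assume p: "p \<in> vanish"
  then have pm: "p \<in> matrix_polys" by (simp add: vanish_def)
  obtain r where "\<And>i j. r i j \<in> matrix_polys"
    and r: "\<And>A Y. grad p A Y = (\<Sum>i\<in>UNIV. \<Sum>j\<in>UNIV. r i j A * Y $ i $ j)"

  proof -
    from grad_repr[OF pm] show ?thesis using that .
  qed
  obtain c :: "'n \<Rightarrow> 'n \<Rightarrow> 'n cmat \<Rightarrow> complex" where c: "\<And>i j. c i j \<in> matrix_polys"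
    "\<And>A i j. invertible A \<Longrightarrow> matrix_inv A $ i $ j = c i j A / det A"
  proof -
    from cofactors show ?thesis using that .
  qed
  define q where "q A = (\<Sum>i\<in>UNIV. \<Sum>j\<in>UNIV. r i j (mat 1) * (\<Sum>l\<in>UNIV. (\<Sum>k\<in>UNIV. c i k A * Y $ k $ l) * A $ l $ j))" for A
  have qm: "q \<in> matrix_polys" unfolding q_def[abs_def] by (intro matrix_polys_intros c)
  have q: "q A = det A * grad p (mat 1) (matrix_inv A ** Y ** A)" if A: "invertible A" for A
  proof -
    have "det A \<noteq> 0" using A by (simp add: invertible_det_nz)
    then have "c i k A = det A * matrix_inv A $ i $ k" for i k using c(2)[OF A, of i k] by simp
    then show ?thesis
      by (simp add: q_def r matrix_matrix_mult_def sum_distrib_left sum_distrib_right mult_ac)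
  qed
  have "q \<in> vanish" using qm q Ad_Lie[OF _ Y] p G_invertible by (auto simp: vanish_def Lie_iff)
  then have "((\<lambda>t. q (mat 1 + cscale t X)) has_field_derivative 0) (at 0)"
    using X by (auto simp: Lie_def vanish_def)
  moreover have "((\<lambda>t. q (mat 1 + cscale t X)) has_field_derivative grad p (mat 1) (commutator Y X)) (at 0)"
  proof -
    define E where "E t = mat 1 + cscale t X" for t
    have E0: "E 0 = mat 1" by (simp add: E_def cscale_ops)
    have "((\<lambda>t. \<Sum>i\<in>UNIV. \<Sum>j\<in>UNIV. r i j (mat 1) * (matrix_inv (E t) ** Y ** E t) $ i $ j) has_field_derivative
       (\<Sum>i\<in>UNIV. \<Sum>j\<in>UNIV. r i j (mat 1) * commutator Y X $ i $ j)) (at 0)"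
      unfolding E_def by (intro DERIV_sum DERIV_cmult conjugation_DERIV)
    then have "((\<lambda>t. grad p (mat 1) (matrix_inv (E t) ** Y ** E t)) has_field_derivative grad p (mat 1) (commutator Y X)) (at 0)"
      by (simp add: r)
    from DERIV_mult[OF grad_DERIV[OF det_matrix_polys, of "mat 1" X, folded E_def] this]
    have "((\<lambda>t. det (E t) * grad p (mat 1) (matrix_inv (E t) ** Y ** E t)) has_field_derivative
      grad det (mat 1) X * grad p (mat 1) (matrix_inv (E 0) ** Y ** E 0) + grad p (mat 1) (commutator Y X) * det (E 0)) (at 0)" .
    \<comment> \<open>The derivative of \<open>det\<close> is multiplied by the differential of
      \<open>p\<close> at \<open>Y\<close>, which is zero.\<close>
    moreover have "grad p (mat 1) (matrix_inv (E 0) ** Y ** E 0) = 0"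
      using Ad_Lie[OF G_one Y] p by (simp add: E0 Lie_iff)
    ultimately have "((\<lambda>t. det (E t) * grad p (mat 1) (matrix_inv (E t) ** Y ** E t)) has_field_derivative
      grad p (mat 1) (commutator Y X)) (at 0)" by (simp add: E0)
    moreover have "\<forall>\<^sub>F t in nhds 0. det (E t) * grad p (mat 1) (matrix_inv (E t) ** Y ** E t) = q (E t)"
      using near_identity_invertible[of X] by eventually_elim (simp add: q E_def)
    ultimately have "((\<lambda>t. q (E t)) has_field_derivative grad p (mat 1) (commutator Y X)) (at 0)"
      by (rule DERIV_transform)
    then show ?thesis by (simp add: E_def)
  qed
  ultimately show "grad p (mat 1) (commutator Y X) = 0" using DERIV_unique by blast
qed

end

subsection \<open>Connected linear algebraic groups are irreducible\<close>

text \<open>\<open>zariski\<close> is given by its open sets, so these must be shown to form a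
  topology: products of equations give intersections, joined families of equations give
  unions.\<close>

lemma openin_zariski:
  fixes U :: "'n::finite cmat set"
  shows "openin zariski U \<longleftrightarrow> (\<exists>P \<subseteq> matrix_polys. U = - {A. \<forall>p\<in>P. p A = 0})"
proof -
  have "istopology (\<lambda>U::'n::finite cmat set. \<exists>P \<subseteq> matrix_polys. U = - {A. \<forall>p\<in>P. p A = 0})"
    unfolding istopology_def
  proof (intro conjI allI impI)
    fix S T :: "'n cmat set"
    assume "\<exists>P \<subseteq> matrix_polys. S = - {A. \<forall>p\<in>P. p A = 0}" "\<exists>P \<subseteq> matrix_polys. T = - {A. \<forall>p\<in>P. p A = 0}"
    then obtain P Q where P: "P \<subseteq> matrix_polys" "S = - {A. \<forall>p\<in>P. p A = 0}"
      and Q: "Q \<subseteq> matrix_polys" "T = - {A. \<forall>p\<in>Q. p A = 0}" by blast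
    have "S \<inter> T = - {A. \<forall>p\<in>{\<lambda>A. p A * q A | p q. p \<in> P \<and> q \<in> Q}. p A = 0}"
    proof -
      have "(\<forall>p\<in>{\<lambda>A. p A * q A | p q. p \<in> P \<and> q \<in> Q}. p A = 0) \<longleftrightarrow> (\<forall>p\<in>P. p A = 0) \<or> (\<forall>q\<in>Q. q A = 0)" for A
      proof
        assume *: "\<forall>p\<in>{\<lambda>A. p A * q A | p q. p \<in> P \<and> q \<in> Q}. p A = 0"
        have "p A * q A = 0" if "p \<in> P" "q \<in> Q" for p q
          using *[rule_format, of "\<lambda>A. p A * q A"] that by blast
        then show "(\<forall>p\<in>P. p A = 0) \<or> (\<forall>q\<in>Q. q A = 0)" by (metis mult_eq_0_iff)
      qed auto
      then show ?thesis unfolding P Q by auto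
    qed
    moreover have "{\<lambda>A. p A * q A | p q. p \<in> P \<and> q \<in> Q} \<subseteq> matrix_polys"
      using P Q by (auto intro!: matrix_polys_intros)
    ultimately show "\<exists>P \<subseteq> matrix_polys. S \<inter> T = - {A. \<forall>p\<in>P. p A = 0}" by blast
  next
    fix K :: "'n cmat set set"
    assume "\<forall>U\<in>K. \<exists>P \<subseteq> matrix_polys. U = - {A. \<forall>p\<in>P. p A = 0}"
    then have "\<forall>U\<in>K. \<exists>P. P \<subseteq> matrix_polys \<and> U = - {A. \<forall>p\<in>P. p A = 0}" by blast
    from bchoice[OF this] obtain f where f: "\<forall>U\<in>K. f U \<subseteq> matrix_polys \<and> U = - {A. \<forall>p\<in>f U. p A = 0}" by blast
    have "A \<in> U \<longleftrightarrow> (\<exists>p\<in>f U. p A \<noteq> 0)" if "U \<in> K" for A U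
    proof -
      have "U = - {A. \<forall>p\<in>f U. p A = 0}" using f that by blast
      then have "A \<in> U \<longleftrightarrow> A \<in> - {A. \<forall>p\<in>f U. p A = 0}" by (rule arg_cong)
      then show ?thesis by simp
    qed
    then have "\<Union>K = - {A. \<forall>p\<in>(\<Union>U\<in>K. f U). p A = 0}" by blast
    then show "\<exists>P \<subseteq> matrix_polys. \<Union>K = - {A. \<forall>p\<in>P. p A = 0}"
      using f(1) by (intro exI[of _ "\<Union>U\<in>K. f U"]) auto
  qed
  then show ?thesis unfolding zariski_def by (simp add: topology_inverse')
qed

lemma openin_zariski_basic: "T \<subseteq> matrix_polys \<Longrightarrow> openin zariski (\<Union>t\<in>T. {A. t A \<noteq> 0})"
  unfolding openin_zariski by (intro exI[of _ T]) auto

context alg_group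
begin

lemma vanish_rmult: "p \<in> vanish \<Longrightarrow> k \<in> G \<Longrightarrow> (\<lambda>A. p (A ** k)) \<in> vanish"
  by (auto simp: vanish_def G_mult intro: matrix_polys_rmult)

text \<open>Kernel of the map from \<open>matrix_polys\<close> to the local ring of \<open>G\<close>
  at \<open>g\<close>: polynomials that vanish on a neighbourhood of \<open>g\<close> in
  \<open>G\<close>.\<close>

definition local_vanish :: "'n cmat \<Rightarrow> ('n cmat \<Rightarrow> complex) set" where
  "local_vanish g = {p \<in> matrix_polys. \<exists>s\<in>matrix_polys. s g \<noteq> 0 \<and> (\<lambda>A. s A * p A) \<in> vanish}"

lemma local_vanish_translate:
  assumes k: "k \<in> G" and p: "p \<in> local_vanish (x ** k)"
  shows "(\<lambda>A. p (A ** k)) \<in> local_vanish x"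
proof -
  obtain s where s: "s \<in> matrix_polys" "s (x ** k) \<noteq> 0" "(\<lambda>A. s A * p A) \<in> vanish" "p \<in> matrix_polys"
    using p by (auto simp: local_vanish_def)
  show ?thesis unfolding local_vanish_def
    using s matrix_polys_rmult[of s k] matrix_polys_rmult[of p k] vanish_rmult[OF s(3) k]
    by (auto intro!: bexI[of _ "\<lambda>A. s (A ** k)"])
qed

lemma local_vanish_translate_iff:
  assumes k: "k \<in> G"
  shows "p \<in> local_vanish x \<longleftrightarrow> (\<lambda>A. p (A ** matrix_inv k)) \<in> local_vanish (x ** k)"
proof
  have e: "A ** k ** matrix_inv k = A" "A ** matrix_inv k ** k = A" for A :: "'n cmat"
    using matrix_inv[OF G_invertible[OF k]] by (simp_all add: matrix_mul_assoc[symmetric])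
  show "p \<in> local_vanish x \<Longrightarrow> (\<lambda>A. p (A ** matrix_inv k)) \<in> local_vanish (x ** k)"
    using local_vanish_translate[OF G_inv[OF k], of p "x ** k"] by (simp add: e)
  show "(\<lambda>A. p (A ** matrix_inv k)) \<in> local_vanish (x ** k) \<Longrightarrow> p \<in> local_vanish x"
    using local_vanish_translate[OF k, of "\<lambda>A. p (A ** matrix_inv k)" x] by (simp add: e)
qed

text \<open>A maximal quotient ideal of \<open>vanish\<close> is prime and equals \<open>local_vanish\<close> on an open set; by
  translation, \<open>local_vanish\<close> is locally constant, hence constant on a connected group.\<close>

theorem vanish_prime:
  assumes conn: "connectedin zariski G"
    and a: "a \<in> matrix_polys" and b: "b \<in> matrix_polys" and ab: "(\<lambda>A. a A * b A) \<in> vanish"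
  shows "a \<in> vanish \<or> b \<in> vanish"
proof -
  \<comment> \<open>The quotient ideal \<open>(vanish : s)\<close>.\<close>
  define Q where "Q s = {p \<in> matrix_polys. (\<lambda>A. s A * p A) \<in> vanish}" for s
  have Q_ideal: "is_ideal matrix_polys (Q s)" if s: "s \<in> matrix_polys" for s
  proof -
    have Q: "x \<in> Q s \<longleftrightarrow> x \<in> matrix_polys \<and> (\<forall>A\<in>G. s A * x A = 0)" for x
      using s by (auto simp: Q_def vanish_def intro: matrix_polys_intros)
    note S = is_subringD[OF subring_matrix_polys]
    show ?thesis unfolding is_ideal_def
    proof (intro conjI ballI)
      show "Q s \<subseteq> matrix_polys" using Q by blast
      show "0 \<in> Q s" unfolding Q using S(1) by simp
      show "x + y \<in> Q s" if "x \<in> Q s" "y \<in> Q s" for x y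
        using that S(3)[of x y] unfolding Q by (auto simp: distrib_left simp del: mult_eq_0_iff)
      show "r * x \<in> Q s" if "r \<in> matrix_polys" "x \<in> Q s" for r x
        using that S(4)[of r x] unfolding Q by auto
    qed
  qed
  have one: "(\<lambda>_. 1) \<in> matrix_polys - vanish" using G_one by (auto simp: vanish_def intro: matrix_polys_intros)
  obtain q where q: "q \<in> Q ` (matrix_polys - vanish)"
    "\<And>I'. I' \<in> Q ` (matrix_polys - vanish) \<Longrightarrow> q \<subseteq> I' \<Longrightarrow> I' = q"
  proof (rule noeth_maximal[OF noeth_matrix_polys])
    show "Q ` (matrix_polys - vanish) \<noteq> {}" using one by blast
    show "is_ideal matrix_polys I" if "I \<in> Q ` (matrix_polys - vanish)" for I using that Q_ideal by blast
  qed (rule that)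
  then obtain s where s: "s \<in> matrix_polys" "s \<notin> vanish" "q = Q s" by blast
  \<comment> \<open>If \<open>y\<close> is not in \<open>Q s\<close>, then \<open>s * y\<close> is
    again outside \<open>vanish\<close>; its quotient ideal contains \<open>Q s\<close>, hence
    equals it by maximality.\<close>
  have q_prime: "x \<in> q" if xy: "x \<in> matrix_polys" "y \<in> matrix_polys" "(\<lambda>A. x A * y A) \<in> q" "y \<notin> q" for x y
  proof -
    have sy: "(\<lambda>A. s A * y A) \<in> matrix_polys - vanish"
      using xy s by (auto simp: Q_def intro: matrix_polys_intros)
    have "q \<subseteq> Q (\<lambda>A. s A * y A)"
      using xy s(3) unfolding s(3) Q_def vanish_def by (auto intro!: matrix_polys_intros s)
    then have "Q (\<lambda>A. s A * y A) = q" using q(2) sy by blast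
    moreover have "x \<in> Q (\<lambda>A. s A * y A)"
      using xy unfolding s(3) Q_def by (simp add: mult_ac)
    ultimately show ?thesis by simp
  qed
  have vanish_q: "vanish \<subseteq> q" unfolding s(3) Q_def vanish_def by (auto intro!: matrix_polys_intros s)
  \<comment> \<open>Where \<open>s\<close> does not vanish, \<open>q\<close> lies in the local
    kernel by definition. Conversely, a denominator that is nonzero at \<open>h\<close> is outside
    \<open>q\<close>, which is prime.\<close>
  have loc_q: "local_vanish h = q" if h: "h \<in> G" "s h \<noteq> 0" for h
  proof
    show "q \<subseteq> local_vanish h" unfolding s(3) Q_def local_vanish_def using s h by blast
    show "local_vanish h \<subseteq> q"
    proof
      fix p assume "p \<in> local_vanish h"
      then obtain t where t: "t \<in> matrix_polys" "t h \<noteq> 0" "(\<lambda>A. t A * p A) \<in> vanish" "p \<in> matrix_polys"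
        by (auto simp: local_vanish_def)
      have "t \<notin> q" using h t by (auto simp: s(3) Q_def vanish_def)
      then show "p \<in> q" using q_prime[of p t] t vanish_q by (auto simp: mult.commute)
    qed
  qed
  obtain g where g: "g \<in> G" "s g \<noteq> 0" using s by (auto simp: vanish_def)
  \<comment> \<open>Right translation moves the neighbourhood of \<open>g\<close> on which
    \<open>s\<close> is nonzero to one of \<open>h\<close>.\<close>
  have "\<exists>t\<in>matrix_polys. t h \<noteq> 0 \<and> (\<forall>x\<in>G. t x \<noteq> 0 \<longrightarrow> local_vanish x = local_vanish h)" if h: "h \<in> G" for h
  proof -
    define k where "k = matrix_inv h ** g"
    have k: "k \<in> G" unfolding k_def using h g by (intro G_mult G_inv)
    have hk: "h ** k = g" using matrix_inv(1)[OF G_invertible[OF h]] by (simp add: k_def matrix_mul_assoc)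
    have "local_vanish x = local_vanish h" if x: "x \<in> G" "s (x ** k) \<noteq> 0" for x
    proof -
      have "local_vanish (x ** k) = q" using x k by (intro loc_q G_mult)
      moreover have "local_vanish (h ** k) = q" using hk g by (simp add: loc_q)
      ultimately show ?thesis using local_vanish_translate_iff[OF k] by blast
    qed
    then show ?thesis using s(1) g hk
      by (intro bexI[of _ "\<lambda>A. s (A ** k)"]) (auto intro: matrix_polys_rmult)
  qed
  then obtain t where t: "\<And>h. h \<in> G \<Longrightarrow> t h \<in> matrix_polys" "\<And>h. h \<in> G \<Longrightarrow> t h h \<noteq> 0"
    "\<And>h x. h \<in> G \<Longrightarrow> x \<in> G \<Longrightarrow> t h x \<noteq> 0 \<Longrightarrow> local_vanish x = local_vanish h"
    by metis
  \<comment> \<open>\<open>local_vanish\<close> is locally constant, so being equal to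
    \<open>q\<close> and being different from \<open>q\<close> are both open conditions on
    \<open>G\<close>.\<close>
  define E1 where "E1 = (\<Union>u\<in>t ` {h\<in>G. local_vanish h = q}. {A. u A \<noteq> 0})"
  define E2 where "E2 = (\<Union>u\<in>t ` {h\<in>G. local_vanish h \<noteq> q}. {A. u A \<noteq> 0})"
  have "openin zariski E1" "openin zariski E2"
    unfolding E1_def E2_def by (rule openin_zariski_basic, use t(1) in blast)+
  moreover have "G \<subseteq> E1 \<union> E2" using t(2) by (auto simp: E1_def E2_def)
  moreover have "E1 \<inter> E2 \<inter> G = {}"
  proof (rule ccontr)
    assume "E1 \<inter> E2 \<inter> G \<noteq> {}"
    then obtain x h h' where "x \<in> G" "h \<in> G" "h' \<in> G" "local_vanish h = q" "local_vanish h' \<noteq> q" "t h x \<noteq> 0" "t h' x \<noteq> 0"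
      by (auto simp: E1_def E2_def)
    then show False using t(3)[of h x] t(3)[of h' x] by simp
  qed
  moreover have "g \<in> E1" unfolding E1_def using g loc_q[OF g] t(2)[OF g(1)] by blast
  then have "E1 \<inter> G \<noteq> {}" using g by blast
  ultimately have "E2 \<inter> G = {}" using conn unfolding connectedin by blast
  then have all: "local_vanish h = q" if "h \<in> G" for h using that t(2)[OF that] by (auto simp: E2_def)
  \<comment> \<open>A member of \<open>q\<close> vanishes near every point of \<open>G\<close>, in
    particular at that point.\<close>
  have "q \<subseteq> vanish"
  proof
    fix p assume p: "p \<in> q"
    have "p h = 0" if h: "h \<in> G" for h
    proof -
      have "p \<in> local_vanish h" using p all[OF h] by simp
      then show ?thesis using h by (auto simp: local_vanish_def vanish_def)
    qed
    then show "p \<in> vanish" using p by (auto simp: vanish_def s(3) Q_def)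
  qed
  moreover have "a \<in> q \<or> b \<in> q" using q_prime[OF a b] ab vanish_q by blast
  ultimately show ?thesis by blast
qed

end

subsection \<open>Powers of the maximal ideal at the identity\<close>

definition coord :: "'n::finite \<Rightarrow> 'n \<Rightarrow> 'n cmat \<Rightarrow> complex" where
  "coord i j A = (A - mat 1) $ i $ j"

lemma coord_polys: "coord i j \<in> matrix_polys"
  unfolding coord_def[abs_def] vector_minus_component by (intro matrix_polys_intros)

text \<open>Membership in the \<open>k\<close>-th power of the maximal ideal of
  \<open>matrix_polys\<close> at the identity.\<close>

inductive mpow :: "nat \<Rightarrow> ('n::finite cmat \<Rightarrow> complex) \<Rightarrow> bool" where
  base: "p \<in> matrix_polys \<Longrightarrow> mpow 0 p"
| step: "mpow k p \<Longrightarrow> mpow (Suc k) (\<lambda>A. coord i j A * p A)"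
| add: "mpow k p \<Longrightarrow> mpow k q \<Longrightarrow> mpow k (\<lambda>A. p A + q A)"
| mul: "p \<in> matrix_polys \<Longrightarrow> mpow k q \<Longrightarrow> mpow k (\<lambda>A. p A * q A)"

lemma mpow_polys: "mpow k p \<Longrightarrow> p \<in> matrix_polys"
  by (induction rule: mpow.induct) (auto intro!: matrix_polys_intros coord_polys)

lemma mpow_pred: "mpow (Suc k) p \<Longrightarrow> mpow k p"
proof -
  have "mpow n p \<Longrightarrow> n = Suc k \<Longrightarrow> mpow k p" for n
    by (induction rule: mpow.induct) (auto intro: mpow.intros coord_polys)
  then show "mpow (Suc k) p \<Longrightarrow> mpow k p" by blast
qed

lemma mpow_zero: "mpow k (\<lambda>_. 0)"
proof (induction k)
  case 0 then show ?case by (auto intro!: mpow.base matrix_polys_intros)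
next
  case (Suc k) then show ?case using mpow.step[of k "\<lambda>_. 0" undefined undefined] by simp
qed

lemma mpow_cmul: "mpow k p \<Longrightarrow> mpow k (\<lambda>A. c * p A)"
  by (rule mpow.mul) (auto intro: matrix_polys_intros)

lemma mpow_sum: "(\<And>i. i \<in> S \<Longrightarrow> mpow k (f i)) \<Longrightarrow> mpow k (\<lambda>A. \<Sum>i\<in>S. f i A)"
  by (induction S rule: infinite_finite_induct) (auto intro: mpow_zero mpow.add)

lemma mpow_mult: "mpow j p \<Longrightarrow> mpow k q \<Longrightarrow> mpow (j + k) (\<lambda>A. p A * q A)"
proof (induction rule: mpow.induct)
  case (step j p i l)
  then have "mpow (Suc (j + k)) (\<lambda>A. coord i l A * (p A * q A))" by (intro mpow.step) blast
  then show ?case by (simp add: mult.assoc)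
next
  case (add j p p')
  then have "mpow (j + k) (\<lambda>A. p A * q A + p' A * q A)" by (intro mpow.add) blast+
  then show ?case by (simp add: distrib_right)
next
  case (mul r j p)
  have "mpow (j + k) (\<lambda>A. r A * (p A * q A))" by (rule mpow.mul[OF mul.hyps(1) mul.IH[OF mul.prems]])
  then show ?case by (simp add: mult.assoc)
qed (auto intro: mpow.mul)

lemma mpow_coord: "mpow 1 (coord i j)"
  using mpow.step[OF mpow.base, of "\<lambda>_. 1" i j] by (simp add: matrix_polys_intros)

lemma mpow_one: "p \<in> matrix_polys \<Longrightarrow> mpow 1 (\<lambda>A. p A - p (mat 1))"
proof (induction rule: matrix_polys_induct)
  case (const c)
  show ?case using mpow_zero by simp
next
  case (entry i j)
  show ?case using mpow_coord[of i j] by (simp add: coord_def[abs_def])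
next
  case (add p q)
  then show ?case using mpow.add[OF add.IH] by (simp add: algebra_simps)
next
  case (mult p q)
  have "mpow 1 (\<lambda>A. q A * (p A - p (mat 1)) + p (mat 1) * (q A - q (mat 1)))"
    using mult by (intro mpow.add mpow.mul mpow_cmul)
  then show ?case by (simp add: algebra_simps)
qed

lemma mpow_at_one: "mpow (Suc k) p \<Longrightarrow> p (mat 1) = 0"
proof -
  have "mpow n p \<Longrightarrow> n = Suc k \<Longrightarrow> p (mat 1) = 0" for n
    by (induction rule: mpow.induct) (auto simp: coord_def)
  then show "mpow (Suc k) p \<Longrightarrow> p (mat 1) = 0" by blast
qed

lemma vf_coord: "vf X (coord i j) = (\<lambda>A. X $ i $ j + (\<Sum>k\<in>UNIV. X $ i $ k * coord k j A))"
proof -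
  have "vf X (coord i j) = (\<lambda>A. (X ** A) $ i $ j)"
    unfolding coord_def[abs_def] vector_minus_component
    by (subst vf_diff) (auto simp: vf_entry vf_const intro: matrix_polys_intros)
  moreover have "(X ** A) $ i $ j = X $ i $ j + (\<Sum>k\<in>UNIV. X $ i $ k * coord k j A)" for A
  proof -
    have "X ** A = X + X ** (A - mat 1)"
      using matrix_add_ldistrib'[of X "mat 1" "A - mat 1"] by simp
    then show ?thesis by (simp add: matrix_matrix_mult_def coord_def)
  qed
  ultimately show ?thesis by simp
qed

text \<open>By the product rule at most one factor \<open>coord i j\<close> is lost.\<close>

lemma mpow_vf: "mpow (Suc k) p \<Longrightarrow> mpow k (vf X p)"
proof -
  have "mpow n p \<Longrightarrow> n = Suc k \<Longrightarrow> mpow k (vf X p)" for n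
  proof (induction arbitrary: k rule: mpow.induct)
    case (step n p i j)
    have p: "p \<in> matrix_polys" using step.hyps by (rule mpow_polys)
    have "mpow k (\<lambda>A. coord i j A * vf X p A)"
    proof (cases k)
      case 0
      then show ?thesis using p by (auto intro!: mpow.base matrix_polys_intros coord_polys vf_closed)
    next
      case (Suc l)
      then show ?thesis using step mpow.step by auto
    qed
    moreover have "mpow k (\<lambda>A. vf X (coord i j) A * p A)"
      using step by (auto intro!: mpow.mul vf_closed coord_polys)
    ultimately show ?case using vf_mult[OF coord_polys p] mpow.add by simp
  next
    case (add n p q)
    then show ?case using vf_add[OF mpow_polys[OF add.hyps(1)] mpow_polys[OF add.hyps(2)]] mpow.add by simp
  next
    case (mul p n q)
    have "mpow k q" using mul mpow_pred by blast
    then have "mpow k (\<lambda>A. vf X p A * q A + p A * vf X q A)"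
      using mul by (intro mpow.add mpow.mul vf_closed) auto
    then show ?case using vf_mult[OF mul.hyps(1) mpow_polys[OF mul.hyps(2)]] by simp
  qed simp
  then show "mpow (Suc k) p \<Longrightarrow> mpow k (vf X p)" by blast
qed

inductive hom :: "nat \<Rightarrow> ('n::finite cmat \<Rightarrow> complex) \<Rightarrow> bool" where
  const: "hom 0 (\<lambda>_. c)"
| step: "hom k F \<Longrightarrow> hom (Suc k) (\<lambda>Y. Y $ i $ j * F Y)"
| add: "hom k F \<Longrightarrow> hom k H \<Longrightarrow> hom k (\<lambda>Y. F Y + H Y)"

lemma hom_cmul: "hom k F \<Longrightarrow> hom k (\<lambda>Y. c * F Y)"
proof (induction rule: hom.induct)
  case (step k F i j)
  then show ?case using hom.step[OF step.IH, of i j] by (simp add: mult_ac)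
next
  case (add k F H)
  then show ?case using hom.add[OF add.IH] by (simp add: distrib_left)
qed (rule hom.const)

lemma hom_0: "hom 0 F \<Longrightarrow> \<exists>c. F = (\<lambda>_. c)"
proof -
  have "hom n F \<Longrightarrow> n = 0 \<Longrightarrow> \<exists>c. F = (\<lambda>_. c)" for n
    by (induction rule: hom.induct) auto
  then show "hom 0 F \<Longrightarrow> \<exists>c. F = (\<lambda>_. c)" by blast
qed

abbreviation at1 :: "('n::finite cmat \<Rightarrow> complex) \<Rightarrow> 'n cmat \<Rightarrow> complex" where
  "at1 F \<equiv> \<lambda>A. F (A - mat 1)"

lemma hom_mpow: "hom k F \<Longrightarrow> mpow k (at1 F)"
proof (induction rule: hom.induct)
  case (step k F i j)
  then show ?case using mpow.step[OF step.IH, of i j] by (simp add: coord_def)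
qed (auto intro: mpow.add mpow.base matrix_polys_intros)

text \<open>The Taylor term of degree \<open>k\<close> at the identity: a polynomial coefficient may
  be replaced by its value at the identity, since the difference has order one.\<close>

lemma leading_form: "mpow k p \<Longrightarrow> \<exists>F. hom k F \<and> mpow (Suc k) (\<lambda>A. p A - at1 F A)"
proof (induction rule: mpow.induct)
  case (base p)
  then show ?case using mpow_one[OF base] hom.const by fastforce
next
  case (step k p i j)
  then obtain F where F: "hom k F" "mpow (Suc k) (\<lambda>A. p A - at1 F A)" by blast
  have "mpow (Suc (Suc k)) (\<lambda>A. coord i j A * (p A - at1 F A))" by (rule mpow.step[OF F(2)])
  then have "mpow (Suc (Suc k)) (\<lambda>A. coord i j A * p A - at1 (\<lambda>Y. Y $ i $ j * F Y) A)"
    by (simp add: coord_def algebra_simps)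
  then show ?case using hom.step[OF F(1)] by blast
next
  case (add k p q)
  then obtain F H where F: "hom k F" "mpow (Suc k) (\<lambda>A. p A - at1 F A)"
    and H: "hom k H" "mpow (Suc k) (\<lambda>A. q A - at1 H A)" by blast
  have "mpow (Suc k) (\<lambda>A. p A + q A - at1 (\<lambda>Y. F Y + H Y) A)"
    using mpow.add[OF F(2) H(2)] by (simp add: algebra_simps)
  then show ?case using hom.add[OF F(1) H(1)] by blast
next
  case (mul p k q)
  then obtain F where F: "hom k F" "mpow (Suc k) (\<lambda>A. q A - at1 F A)" by blast
  have 1: "mpow (Suc k) (\<lambda>A. p A * (q A - at1 F A))" by (rule mpow.mul[OF mul.hyps(1) F(2)])
  have 2: "mpow (Suc k) (\<lambda>A. (p A - p (mat 1)) * at1 F A)"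
    using mpow_mult[OF mpow_one[OF mul.hyps(1)] hom_mpow[OF F(1)]] by simp
  have "mpow (Suc k) (\<lambda>A. p A * q A - at1 (\<lambda>Y. p (mat 1) * F Y) A)"
    using mpow.add[OF 1 2] by (simp add: algebra_simps)
  then show ?case using hom_cmul[OF F(1)] by blast
qed

lemma at1_polys: "hom k F \<Longrightarrow> at1 F \<in> matrix_polys"
  using mpow_polys[OF hom_mpow] .

text \<open>Euler's identity for the leading form of \<open>vf X F\<close>.\<close>

lemma vf_leading_form:
  "hom n F \<Longrightarrow> \<exists>F'. (n = 0 \<longrightarrow> F' = (\<lambda>_. 0)) \<and> (n > 0 \<longrightarrow> hom (n - 1) F') \<and>
    mpow n (\<lambda>A. vf X (at1 F) A - at1 F' A) \<and> F' X = of_nat n * F X"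
proof (induction rule: hom.induct)
  case (const c)
  show ?case by (intro exI[of _ "\<lambda>_. 0"]) (simp add: vf_const mpow_zero)
next
  case (step n F i j)
  then obtain F' where F': "n = 0 \<Longrightarrow> F' = (\<lambda>_. 0)" "n > 0 \<Longrightarrow> hom (n - 1) F'"
    "mpow n (\<lambda>A. vf X (at1 F) A - at1 F' A)" "F' X = of_nat n * F X" by blast
  \<comment> \<open>\<open>F'\<close> plays the derivative of \<open>F\<close> along the constant
    direction \<open>X\<close>. The field of \<open>X\<close> differs from this direction by
    \<open>X ** (A - mat 1)\<close>, which contributes only terms of higher order.\<close>
  define H where "H Y = X $ i $ j * F Y + Y $ i $ j * F' Y" for Y
  have "hom n H"
  proof (cases n)
    case 0
    then show ?thesis using hom_cmul[OF step.hyps, of "X $ i $ j"] F'(1) by (simp add: H_def[abs_def])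
  next
    case (Suc m)
    then show ?thesis unfolding H_def[abs_def]
      using hom.add[OF hom_cmul[OF step.hyps, of "X $ i $ j"], of "\<lambda>Y. Y $ i $ j * F' Y"] hom.step[of m F' i j] F'(2) by simp
  qed
  moreover have "mpow (Suc n) (\<lambda>A. vf X (at1 (\<lambda>Y. Y $ i $ j * F Y)) A - at1 H A)"
  proof -
    have v: "vf X (at1 (\<lambda>Y. Y $ i $ j * F Y)) = (\<lambda>A. vf X (coord i j) A * at1 F A + coord i j A * vf X (at1 F) A)"
      using vf_mult[OF coord_polys[of i j] at1_polys[OF step.hyps], of X] by (simp add: coord_def)
    have 1: "mpow (Suc n) (\<lambda>A. coord i j A * (vf X (at1 F) A - at1 F' A))" by (rule mpow.step[OF F'(3)])
    have 2: "mpow (Suc n) (\<lambda>A. (\<Sum>k\<in>UNIV. X $ i $ k * coord k j A) * at1 F A)"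
      using mpow_mult[OF mpow_sum[of UNIV 1 "\<lambda>k A. X $ i $ k * coord k j A"] hom_mpow[OF step.hyps]]
      by (simp add: mpow_cmul mpow_coord[unfolded One_nat_def])
    show ?thesis using mpow.add[OF 1 2] unfolding v vf_coord
      by (simp add: H_def coord_def algebra_simps)
  qed
  moreover have "H X = of_nat (Suc n) * (X $ i $ j * F X)" by (simp add: H_def F'(4) algebra_simps)
  ultimately show ?case by (intro exI[of _ H]) auto
next
  case (add n F1 F2)
  then obtain H1 H2 where H1: "n = 0 \<Longrightarrow> H1 = (\<lambda>_. 0)" "n > 0 \<Longrightarrow> hom (n - 1) H1"
    "mpow n (\<lambda>A. vf X (at1 F1) A - at1 H1 A)" "H1 X = of_nat n * F1 X"
    and H2: "n = 0 \<Longrightarrow> H2 = (\<lambda>_. 0)" "n > 0 \<Longrightarrow> hom (n - 1) H2"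
    "mpow n (\<lambda>A. vf X (at1 F2) A - at1 H2 A)" "H2 X = of_nat n * F2 X" by blast
  have v: "vf X (at1 (\<lambda>Y. F1 Y + F2 Y)) = (\<lambda>A. vf X (at1 F1) A + vf X (at1 F2) A)"
    using vf_add[OF at1_polys[OF add.hyps(1)] at1_polys[OF add.hyps(2)], of X] by simp
  have "mpow n (\<lambda>A. vf X (at1 (\<lambda>Y. F1 Y + F2 Y)) A - at1 (\<lambda>Y. H1 Y + H2 Y) A)"
    using mpow.add[OF H1(3) H2(3)] unfolding v by (simp add: algebra_simps)
  moreover have "n > 0 \<Longrightarrow> hom (n - 1) (\<lambda>Y. H1 Y + H2 Y)" using hom.add H1(2) H2(2) by blast
  moreover have "H1 X + H2 X = of_nat n * (F1 X + F2 X)" using H1(4) H2(4) by (simp add: algebra_simps)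
  ultimately show ?case using H1(1) H2(1) by (intro exI[of _ "\<lambda>Y. H1 Y + H2 Y"]) auto
qed

subsection \<open>Krull's intersection theorem at the identity\<close>

text \<open>The Rees algebra of the maximal ideal, as functions of \<open>(A, t)\<close>.\<close>

definition rees :: "('n::finite cmat \<times> complex \<Rightarrow> complex) set" where
  "rees = polyfuns UNIV ((\<lambda>l (A, t). l A) ` entries \<union> (\<lambda>(i, j) (A, t). t * coord i j A) ` UNIV)"

lemma noeth_rees: "noeth (rees :: ('n::finite cmat \<times> complex \<Rightarrow> complex) set)"
  unfolding rees_def by (intro noeth_polyfuns) (simp add: finite_entries)

lemma mpow_rees: "mpow k p \<Longrightarrow> (\<lambda>(A, t). p A * t ^ k) \<in> rees"
proof -
  have poly: "(\<lambda>(A, t). p A) \<in> rees" if "p \<in> matrix_polys" for p :: "'a cmat \<Rightarrow> complex"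
  proof -
    have "(\<lambda>x. p (fst x)) \<in> rees"
      unfolding rees_def by (rule polyfuns_compose[OF that]) (force simp: entries_def case_prod_unfold intro: polyfuns_coord)
    then show ?thesis by (simp add: case_prod_unfold)
  qed
  show "mpow k p \<Longrightarrow> (\<lambda>(A, t). p A * t ^ k) \<in> rees"
  proof (induction rule: mpow.induct)
    case (base p)
    then show ?case using poly by simp
  next
    case (step k p i j)
    have "(\<lambda>(A, t). t * coord i j A) \<in> rees"
      unfolding rees_def by (rule polyfuns_coord) force
    from polyfuns_mult[OF this[unfolded rees_def] step.IH[unfolded rees_def]]
    show ?case by (simp add: rees_def case_prod_unfold mult_ac)
  next
    case (add k p q)
    from polyfuns_add[OF add.IH[unfolded rees_def]] show ?case
      by (simp add: rees_def case_prod_unfold distrib_right)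
  next
    case (mul p k q)
    from polyfuns_mult[OF poly[OF mul.hyps(1), unfolded rees_def] mul.IH[unfolded rees_def]] show ?case
      by (simp add: rees_def case_prod_unfold mult_ac)
  qed
qed

text \<open>In the generators \<open>t\<close> occurs only next to some \<open>coord i j\<close>,
  which is zero at the identity; so the coefficients of positive degree in \<open>t\<close> vanish
  there.\<close>

lemma rees_repr:
  assumes "f \<in> rees"
  shows "\<exists>P. (\<forall>j. (\<lambda>A. coeff (P A) j) \<in> matrix_polys) \<and> (\<forall>j>0. coeff (P (mat 1)) j = 0) \<and> (\<forall>A t. f (A, t) = poly (P A) t)"
  using assms unfolding rees_def
proof (induction rule: polyfuns_UNIV_induct)
  case (const c)
  have "coeff [:c:] j = (if j = 0 then c else 0)" for j by (cases j) auto
  then show ?case by (intro exI[of _ "\<lambda>_. [:c:]"]) (auto intro: matrix_polys_intros)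
next
  case (coord l)
  then consider i j where "l = (\<lambda>(A, t). A $ i $ j)" | i j where "l = (\<lambda>(A, t). t * coord i j A)"
    by (auto simp: entries_def)
  then show ?case
  proof cases
    case 1
    have "(\<lambda>A. coeff [:A $ i $ j:] k) \<in> matrix_polys" for k by (cases k) (auto intro: matrix_polys_intros)
    moreover have "coeff [:mat 1 $ i $ j :: complex:] k = 0" if "k > 0" for k using that by (cases k) auto
    ultimately show ?thesis using 1 by (intro exI[of _ "\<lambda>A. [:A $ i $ j:]"]) auto
  next
    case 2
    have c: "coeff [:0, a:] k = (if k = 1 then a else 0)" for k and a :: complex
      by (auto simp: coeff_pCons split: nat.split)
    have "(\<lambda>A. coeff [:0, coord i j A:] k) \<in> matrix_polys" for k
      unfolding c by (cases "k = 1") (auto simp: coord_polys intro: matrix_polys_intros)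
    moreover have "coord i j (mat 1) = 0" by (simp add: coord_def)
    ultimately show ?thesis unfolding 2
      by (intro exI[of _ "\<lambda>A. [:0, coord i j A:]"]) auto
  qed
next
  case (add p q)
  from add.IH(1) obtain P where "\<forall>j. (\<lambda>A. coeff (P A) j) \<in> matrix_polys" "\<forall>j>0. coeff (P (mat 1)) j = 0" "\<forall>A t. p (A, t) = poly (P A) t"
    by blast
  moreover from add.IH(2) obtain Q where "\<forall>j. (\<lambda>A. coeff (Q A) j) \<in> matrix_polys" "\<forall>j>0. coeff (Q (mat 1)) j = 0" "\<forall>A t. q (A, t) = poly (Q A) t" by blast
  ultimately show ?case by (intro exI[of _ "\<lambda>A. P A + Q A"]) (auto intro: matrix_polys_intros)
next
  case (mult p q)
  from mult.IH(1) obtain P where P: "\<forall>j. (\<lambda>A. coeff (P A) j) \<in> matrix_polys" "\<forall>j>0. coeff (P (mat 1)) j = 0" "\<forall>A t. p (A, t) = poly (P A) t"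
    by blast
  from mult.IH(2) obtain Q where Q: "\<forall>j. (\<lambda>A. coeff (Q A) j) \<in> matrix_polys" "\<forall>j>0. coeff (Q (mat 1)) j = 0" "\<forall>A t. q (A, t) = poly (Q A) t" by blast
  have "coeff (P (mat 1) * Q (mat 1)) j = 0" if "j > 0" for j
    unfolding coeff_mult using P(2) Q(2) that by (intro sum.neutral) (metis diff_zero mult_eq_0_iff neq0_conv)
  then show ?case using P Q by (intro exI[of _ "\<lambda>A. P A * Q A"]) (auto simp: coeff_mult intro!: matrix_polys_intros)
qed

context alg_group
begin

text \<open>Order at least \<open>k\<close> at the identity as a function on \<open>G\<close>, that
  is, modulo \<open>vanish\<close>.\<close>

definition mord :: "nat \<Rightarrow> ('n cmat \<Rightarrow> complex) \<Rightarrow> bool" where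
  "mord k p \<longleftrightarrow> (\<exists>q i. mpow k q \<and> i \<in> vanish \<and> p = (\<lambda>A. q A + i A))"

text \<open>The functions \<open>q k\<close> are representatives of \<open>p\<close> on
  \<open>G\<close> of order \<open>k\<close>. In the Rees algebra the chain condition writes
  \<open>q n\<close> times \<open>t^n\<close> as a combination of the earlier \<open>q k\<close>
  times \<open>t^k\<close>; on \<open>G\<close> the coefficient of \<open>t^n\<close> reads
  \<open>p = s p\<close>.\<close>

lemma krull:
  assumes "\<And>k. mord k p"
  obtains s where "s \<in> matrix_polys" "s (mat 1) = 0" "\<And>A. A \<in> G \<Longrightarrow> p A = s A * p A"
proof -
  have "\<exists>q. mpow k q \<and> (\<forall>A\<in>G. q A = p A)" for k
    using assms[of k] by (auto simp: mord_def vanish_def)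
  then obtain q where q: "\<And>k. mpow k (q k)" "\<And>k A. A \<in> G \<Longrightarrow> q k A = p A" by metis
  define h where "h k = (\<lambda>(A, t). q k A * t ^ k)" for k
  have "\<forall>k. h k \<in> rees" unfolding h_def using q(1) by (auto intro: mpow_rees)
  from noeth_rees[unfolded noeth_def, rule_format, of h, OF this[rule_format]]
  obtain n r where nr: "\<And>k. r k \<in> rees" "h n = (\<Sum>k<n. r k * h k)" by blast
  have "\<exists>P. (\<forall>j. (\<lambda>A. coeff (P A) j) \<in> matrix_polys) \<and> (\<forall>j>0. coeff (P (mat 1)) j = 0) \<and> (\<forall>A t. r k (A, t) = poly (P A) t)" for k
    by (rule rees_repr[OF nr(1)])
  then have "\<forall>k. \<exists>P. (\<forall>j. (\<lambda>A. coeff (P A) j) \<in> matrix_polys) \<and> (\<forall>j>0. coeff (P (mat 1)) j = 0) \<and> (\<forall>A t. r k (A, t) = poly (P A) t)"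
    by blast
  from choice[OF this] obtain P where P': "\<forall>k. (\<forall>j. (\<lambda>A. coeff (P k A) j) \<in> matrix_polys) \<and>
    (\<forall>j>0. coeff (P k (mat 1)) j = 0) \<and> (\<forall>A t. r k (A, t) = poly (P k A) t)" by blast
  have P: "(\<lambda>A. coeff (P k A) j) \<in> matrix_polys" "j > 0 \<Longrightarrow> coeff (P k (mat 1)) j = 0" "r k (A, t) = poly (P k A) t"
    for k j A t using P' by simp_all
  \<comment> \<open>Since \<open>k < n\<close>, only coefficients of positive degree occur; these
    are zero at the identity.\<close>
  define s where "s A = (\<Sum>k<n. coeff (P k A) (n - k))" for A
  have "p A = s A * p A" if A: "A \<in> G" for A
  proof -
    have "poly (monom (q n A) n) t = poly (\<Sum>k<n. monom (q k A) k * P k A) t" for t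
    proof -
      have "h n (A, t) = (\<Sum>k<n. r k (A, t) * h k (A, t))" unfolding nr(2) by (simp add: sum_fun_apply)
      then show ?thesis by (simp add: h_def P(3) poly_sum poly_monom mult_ac)
    qed
    then have "monom (q n A) n = (\<Sum>k<n. monom (q k A) k * P k A)"
      unfolding poly_eq_poly_eq_iff[symmetric] by (rule ext)
    then have "coeff (monom (q n A) n) n = coeff (\<Sum>k<n. monom (q k A) k * P k A) n" by simp
    then have "q n A = (\<Sum>k<n. q k A * coeff (P k A) (n - k))"
      by (simp add: coeff_sum coeff_monom_mult)
    then show ?thesis using q(2)[OF A] by (simp add: s_def sum_distrib_left mult.commute)
  qed
  moreover have "s \<in> matrix_polys" unfolding s_def[abs_def] by (intro matrix_polys_intros P)
  moreover have "s (mat 1) = 0" unfolding s_def by (intro sum.neutral ballI P(2)) simp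
  ultimately show ?thesis using that by blast
qed

end

subsection \<open>Linear algebra on matrices\<close>

definition clin :: "('n::finite cmat \<Rightarrow> complex) \<Rightarrow> bool" where
  "clin \<phi> \<longleftrightarrow> (\<forall>X Y. \<phi> (X + Y) = \<phi> X + \<phi> Y) \<and> (\<forall>c X. \<phi> (cscale c X) = c * \<phi> X)"

definition unit_mat :: "'n::finite \<Rightarrow> 'n \<Rightarrow> 'n cmat" where
  "unit_mat i j = (\<chi> a b. if a = i \<and> b = j then 1 else 0)"

lemma unit_mat_expand: "(\<Sum>i\<in>UNIV. \<Sum>j\<in>UNIV. cscale (Y $ i $ j) (unit_mat i j)) = Y"
proof -
  have "(\<Sum>i\<in>UNIV. \<Sum>j\<in>UNIV. cscale (Y $ i $ j) (unit_mat i j)) $ a $ b = Y $ a $ b" for a b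
  proof -
    have "(\<Sum>j\<in>UNIV. cscale (Y $ i $ j) (unit_mat i j)) $ a $ b = (if i = a then Y $ a $ b else 0)" for i
    proof -
      have "(\<Sum>j\<in>UNIV. cscale (Y $ i $ j) (unit_mat i j)) $ a $ b = (\<Sum>j\<in>UNIV. if j = b then (if i = a then Y $ a $ b else 0) else 0)"
        by (simp only: sum_component cscale_simps) (intro sum.cong refl, auto simp: unit_mat_def)
      then show ?thesis by simp
    qed
    then show ?thesis by (simp add: sum_component)
  qed
  then show ?thesis by (simp add: vec_eq_iff)
qed

lemma clin_expand:
  assumes "clin \<phi>"
  shows "\<phi> Y = (\<Sum>i\<in>UNIV. \<Sum>j\<in>UNIV. Y $ i $ j * \<phi> (unit_mat i j))"
proof -
  have z: "\<phi> 0 = 0" using assms unfolding clin_def by (metis add_cancel_right_right)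
  have s: "\<phi> (sum f S) = (\<Sum>i\<in>S. \<phi> (f i))" for f :: "'b \<Rightarrow> 'a cmat" and S
    using assms z by (induction S rule: infinite_finite_induct) (auto simp: clin_def)
  have "\<phi> Y = \<phi> (\<Sum>i\<in>UNIV. \<Sum>j\<in>UNIV. cscale (Y $ i $ j) (unit_mat i j))" by (simp only: unit_mat_expand)
  also have "\<dots> = (\<Sum>i\<in>UNIV. \<Sum>j\<in>UNIV. Y $ i $ j * \<phi> (unit_mat i j))"
    using assms by (simp only: s) (simp add: clin_def)
  finally show ?thesis .
qed

lemma clin_entry: "clin (\<lambda>Y. Y $ i $ j)" by (simp add: clin_def)

lemma clin_diff: "clin \<phi> \<Longrightarrow> clin \<psi> \<Longrightarrow> clin (\<lambda>Y. \<phi> Y - \<psi> Y)"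
  by (simp add: clin_def algebra_simps)

lemma clin_hom: "clin \<phi> \<Longrightarrow> hom 1 \<phi>"
proof -
  assume \<phi>: "clin \<phi>"
  have h0: "hom 1 (\<lambda>_. 0)" using hom_cmul[OF hom.step[OF hom.const], of 0] by simp
  have hs: "hom 1 (\<lambda>Y. \<Sum>i\<in>S. f i Y)" if "\<And>i. hom 1 (f i)" for f :: "'b \<Rightarrow> 'a cmat \<Rightarrow> complex" and S
    by (induction S rule: infinite_finite_induct) (auto intro: hom.add h0[unfolded One_nat_def] that[unfolded One_nat_def])
  have "hom 1 (\<lambda>Y. \<Sum>i\<in>UNIV. \<Sum>j\<in>UNIV. Y $ i $ j * \<phi> (unit_mat i j))"
    by (intro hs) (use hom.step[OF hom.const] in auto)
  moreover have "(\<lambda>Y. \<Sum>i\<in>UNIV. \<Sum>j\<in>UNIV. Y $ i $ j * \<phi> (unit_mat i j)) = \<phi>"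
    by (rule ext) (rule clin_expand[OF \<phi>, symmetric])
  ultimately show "hom 1 \<phi>" by simp
qed

lemma vector_space_cscale: "vector_space (cscale :: complex \<Rightarrow> 'n::finite cmat \<Rightarrow> 'n cmat)"
  by unfold_locales (auto simp: cscale_ops)

lemma grad_add: "p \<in> matrix_polys \<Longrightarrow> q \<in> matrix_polys \<Longrightarrow> grad (\<lambda>A. p A + q A) A Y = grad p A Y + grad q A Y"
  by (rule grad_eq) (intro DERIV_add grad_DERIV)

lemma grad_cmul: "p \<in> matrix_polys \<Longrightarrow> grad (\<lambda>A. c * p A) A Y = c * grad p A Y"
  by (rule grad_eq) (intro DERIV_cmult grad_DERIV)

context alg_group
begin

lemma projection_exists:
  "\<exists>\<pi>. (\<forall>X. \<pi> X \<in> Lie G) \<and> (\<forall>X\<in>Lie G. \<pi> X = X) \<and> (\<forall>X Y. \<pi> (X + Y) = \<pi> X + \<pi> Y) \<and>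
    (\<forall>c X. \<pi> (cscale c X) = cscale c (\<pi> X))"
proof -
  interpret V: vector_space "cscale :: complex \<Rightarrow> 'n cmat \<Rightarrow> 'n cmat" by (rule vector_space_cscale)
  interpret P: vector_space_pair "cscale :: complex \<Rightarrow> 'n cmat \<Rightarrow> 'n cmat" "cscale :: complex \<Rightarrow> 'n cmat \<Rightarrow> 'n cmat"
    by unfold_locales
  have "V.subspace (Lie G)" unfolding V.subspace_def using Lie_subspace by blast
  from P.linear_exists_left_inverse_on[OF V.linear_id this]
  obtain g where g: "g ` UNIV \<subseteq> Lie G" "Vector_Spaces.linear cscale cscale g" "\<forall>v\<in>Lie G. g (id v) = v"
    by auto
  interpret g: Vector_Spaces.linear "cscale :: complex \<Rightarrow> 'n cmat \<Rightarrow> 'n cmat" "cscale :: complex \<Rightarrow> 'n cmat \<Rightarrow> 'n cmat" g by (rule g(2))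
  show ?thesis using g(1,3) g.add g.scale by (intro exI[of _ g]) auto
qed

text \<open>A chosen linear retraction onto the Lie algebra; it extends elements of the dual to
  functionals of all matrices.\<close>

definition proj :: "'n cmat \<Rightarrow> 'n cmat" where
  "proj = (SOME \<pi>. (\<forall>X. \<pi> X \<in> Lie G) \<and> (\<forall>X\<in>Lie G. \<pi> X = X) \<and> (\<forall>X Y. \<pi> (X + Y) = \<pi> X + \<pi> Y) \<and>
    (\<forall>c X. \<pi> (cscale c X) = cscale c (\<pi> X)))"

lemma proj: "proj X \<in> Lie G" "X \<in> Lie G \<Longrightarrow> proj X = X" "proj (X + Y) = proj X + proj Y"
  "proj (cscale c X) = cscale c (proj X)"
proof -
  note * = someI_ex[OF projection_exists, folded proj_def]
  show "proj X \<in> Lie G" "X \<in> Lie G \<Longrightarrow> proj X = X" "proj (X + Y) = proj X + proj Y"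
    "proj (cscale c X) = cscale c (proj X)"
    using * by blast+
qed

lemma clin_proj: "clin \<phi> \<Longrightarrow> clin (\<lambda>Y. \<phi> (proj Y))"
  by (simp add: clin_def proj)

text \<open>Biduality. \<open>Lie G\<close> is the common kernel of the differentials at the
  identity of members of \<open>vanish\<close>; these differentials form a subspace, and a
  functional outside it would be detected by some \<open>X\<close> in \<open>Lie G\<close>.\<close>

lemma functional_vanishing_on_Lie:
  assumes \<phi>: "clin \<phi>" and L: "\<And>X. X \<in> Lie G \<Longrightarrow> \<phi> X = 0"
  obtains q where "q \<in> vanish" "\<And>Y. grad q (mat 1) Y = \<phi> Y"
proof -
  define pair where "pair B Y = (\<Sum>i\<in>UNIV. \<Sum>j\<in>UNIV. B $ i $ j * Y $ i $ j)" for B Y :: "'n cmat"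
  have pair_add: "pair (B + C) Y = pair B Y + pair C Y" for B C Y
    by (simp add: pair_def sum.distrib distrib_right)
  have pair_c: "pair (cscale c B) Y = c * pair B Y" for c B Y
    by (simp add: pair_def sum_distrib_left mult.assoc)
  define S where "S = {B. \<exists>q\<in>vanish. \<forall>Y. grad q (mat 1) Y = pair B Y}"
  have vm: "q \<in> vanish \<Longrightarrow> q \<in> matrix_polys" for q by (simp add: vanish_def)
  have Sc: "cscale c B \<in> S" if "B \<in> S" for c B
  proof -
    from that obtain q where q: "q \<in> vanish" "\<And>Y. grad q (mat 1) Y = pair B Y" by (auto simp: S_def)
    have "(\<lambda>A. c * q A) \<in> vanish" using q(1) by (auto simp: vanish_def intro: matrix_polys_intros)
    then show ?thesis using grad_cmul[OF vm[OF q(1)], of c "mat 1"] q(2) by (auto simp: S_def pair_c)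
  qed
  have "subspace S"
    unfolding subspace_def
  proof (intro conjI ballI allI)
    have "(\<lambda>_. 0) \<in> vanish" by (auto simp: vanish_def intro: matrix_polys_intros)
    moreover have "grad (\<lambda>_. 0) (mat 1) Y = pair 0 Y" for Y by (rule grad_eq) (simp add: pair_def)
    ultimately show "0 \<in> S" unfolding S_def by blast
    show "B + C \<in> S" if "B \<in> S" "C \<in> S" for B C
    proof -
      from that obtain q r where q: "q \<in> vanish" "\<And>Y. grad q (mat 1) Y = pair B Y"
        and r: "r \<in> vanish" "\<And>Y. grad r (mat 1) Y = pair C Y" by (auto simp: S_def)
      have "(\<lambda>A. q A + r A) \<in> vanish" using q(1) r(1) by (auto simp: vanish_def intro: matrix_polys_intros)
      then show ?thesis using grad_add[OF vm[OF q(1)] vm[OF r(1)], of "mat 1"] q(2) r(2) by (auto simp: S_def pair_add)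
    qed
    show "t *\<^sub>R B \<in> S" if "B \<in> S" for t B
    proof -
      have "t *\<^sub>R B = cscale (of_real t) B" by (simp add: vec_eq_iff) (simp add: scaleR_conv_of_real)
      then show ?thesis using Sc[OF that] by simp
    qed
  qed
  then have span: "span S = S" by (simp add: span_eq_iff)
  define B where "B = (\<chi> i j. \<phi> (unit_mat i j))"
  have B: "\<phi> Y = pair B Y" for Y using clin_expand[OF \<phi>, of Y] by (simp add: pair_def B_def mult.commute)
  obtain y z where yz: "y \<in> span S" "\<And>w. w \<in> span S \<Longrightarrow> orthogonal z w" "B = y + z"
    using orthogonal_subspace_decomp_exists[of S B] by blast
  \<comment> \<open>Complex conjugation turns the real inner product with \<open>z\<close> into the
    real part of the bilinear \<open>pair\<close>.\<close>
  define X where "X = (\<chi> i j. cnj (z $ i $ j))"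
  have re: "inner z C = Re (pair C X)" for C
    by (simp add: pair_def X_def inner_vec_def inner_complex_def mult.commute)
  have pair0: "pair C X = 0" if C: "C \<in> S" for C
  proof -
    have "Re (pair C X) = 0" using yz(2)[of C] C span re by (simp add: orthogonal_def)
    \<comment> \<open>\<open>S\<close> is closed under multiplication by \<open>\<i>\<close>, which
      recovers the imaginary part.\<close>
    moreover have "Re (pair (cscale \<i> C) X) = 0" using yz(2)[of "cscale \<i> C"] Sc[OF C] span re by (simp add: orthogonal_def)
    ultimately show ?thesis by (simp add: pair_c complex_eq_iff)
  qed
  have "X \<in> Lie G" unfolding Lie_iff
  proof
    fix p assume p: "p \<in> vanish"
    obtain r where r: "\<And>i j. r i j \<in> matrix_polys" "\<And>A Y. grad p A Y = (\<Sum>i\<in>UNIV. \<Sum>j\<in>UNIV. r i j A * Y $ i $ j)"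
    proof -
      from grad_repr[OF vm[OF p]] show ?thesis using that .
    qed
    define C where "C = (\<chi> i j. r i j (mat 1))"
    have C: "grad p (mat 1) Y = pair C Y" for Y by (simp add: r(2) pair_def C_def)
    then have "C \<in> S" using p by (auto simp: S_def)
    then show "grad p (mat 1) X = 0" using C pair0 by simp
  qed
  then have "pair B X = 0" using L B by simp
  then have "pair z X = 0" using pair0[of y] yz(1) span by (simp add: yz(3) pair_add)
  then have "inner z z = 0" using re[of z] by simp
  then have "B \<in> S" using yz(1) span by (simp add: yz(3))
  then show ?thesis using that B by (auto simp: S_def)
qed

section \<open>Leading forms modulo the ideal of \<open>G\<close>\<close>

lemma mpow_mord: "mpow k p \<Longrightarrow> mord k p"
proof -
  have "(\<lambda>_. 0) \<in> vanish" by (auto simp: vanish_def intro: matrix_polys_intros)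
  then show "mpow k p \<Longrightarrow> mord k p" unfolding mord_def by (intro exI[of _ p] exI[of _ "\<lambda>_. 0"]) auto
qed

lemma vanish_ops: "i \<in> vanish \<Longrightarrow> j \<in> vanish \<Longrightarrow> (\<lambda>A. i A + j A) \<in> vanish"
  "i \<in> vanish \<Longrightarrow> p \<in> matrix_polys \<Longrightarrow> (\<lambda>A. i A * p A) \<in> vanish"
  "i \<in> vanish \<Longrightarrow> p \<in> matrix_polys \<Longrightarrow> (\<lambda>A. p A * i A) \<in> vanish"
  by (auto simp: vanish_def intro: matrix_polys_intros)

lemma mord_add: "mord k p \<Longrightarrow> mord k q \<Longrightarrow> mord k (\<lambda>A. p A + q A)"
proof -
  assume "mord k p" "mord k q"
  then obtain p' i q' j where "mpow k p'" "i \<in> vanish" "p = (\<lambda>A. p' A + i A)" "mpow k q'" "j \<in> vanish" "q = (\<lambda>A. q' A + j A)"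
    by (auto simp: mord_def)
  then show ?thesis unfolding mord_def
    by (intro exI[of _ "\<lambda>A. p' A + q' A"] exI[of _ "\<lambda>A. i A + j A"]) (auto intro: mpow.add vanish_ops)
qed

lemma mord_mult: "mord k p \<Longrightarrow> mpow l q \<Longrightarrow> mord (k + l) (\<lambda>A. p A * q A)"
proof -
  assume "mord k p" and q: "mpow l q"
  then obtain p' i where "mpow k p'" "i \<in> vanish" "p = (\<lambda>A. p' A + i A)" by (auto simp: mord_def)
  then show ?thesis unfolding mord_def using mpow_mult[of k p' l q] q mpow_polys[OF q]
    by (intro exI[of _ "\<lambda>A. p' A * q A"] exI[of _ "\<lambda>A. i A * q A"]) (auto intro: vanish_ops simp: distrib_right)
qed

text \<open>Some \<open>q\<close> in \<open>vanish\<close> has differential \<open>\<phi>\<close> at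
  the identity, so \<open>q\<close> and \<open>at1 \<phi>\<close> differ by order two.\<close>

lemma mord_linear:
  assumes \<phi>: "clin \<phi>" and L: "\<And>X. X \<in> Lie G \<Longrightarrow> \<phi> X = 0"
  shows "mord 2 (at1 \<phi>)"
proof -
  obtain q where q: "q \<in> vanish" "\<And>Y. grad q (mat 1) Y = \<phi> Y"
    using functional_vanishing_on_Lie[OF \<phi> L] by blast
  have qm: "q \<in> matrix_polys" "q (mat 1) = 0" using q(1) G_one by (auto simp: vanish_def)
  have "mpow 1 q" using mpow_one[OF qm(1)] qm(2) by simp
  then obtain F where F: "hom 1 F" "mpow 2 (\<lambda>A. q A - at1 F A)" using leading_form[of 1 q] by (auto simp: numeral_2_eq_2)
  \<comment> \<open>The linear leading form of \<open>q\<close> is its differential, as both have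
    the same derivatives at the identity.\<close>
  have "F Y = \<phi> Y" for Y
  proof -
    obtain F' where F': "hom 0 F'" "mpow 1 (\<lambda>A. vf Y (at1 F) A - at1 F' A)" "F' Y = F Y"
      using vf_leading_form[OF F(1), of Y] by auto
    obtain c where c: "F' = (\<lambda>_. c)" using hom_0[OF F'(1)] by blast
    have "vf Y (at1 F) (mat 1) - at1 F' (mat 1) = 0"
      by (rule mpow_at_one[of 0 "\<lambda>A. vf Y (at1 F) A - at1 F' A"]) (use F'(2) in simp)
    then have "vf Y (at1 F) (mat 1) = F Y" using F'(3) by (simp add: c)
    moreover have "mpow 1 (vf Y (\<lambda>A. q A - at1 F A))" using F(2) by (intro mpow_vf) (simp add: numeral_2_eq_2)
    then have "vf Y (\<lambda>A. q A - at1 F A) (mat 1) = 0" using mpow_at_one[of 0] by simp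
    then have "vf Y q (mat 1) = vf Y (at1 F) (mat 1)" using vf_diff[OF qm(1) at1_polys[OF F(1)]] by simp
    ultimately show ?thesis using q(2)[of Y] by (simp add: vf_def)
  qed
  then have F\<phi>: "F = \<phi>" by (rule ext)
  have "mpow 2 (\<lambda>A. - 1 * (q A - at1 \<phi> A))" using F(2) unfolding F\<phi> by (rule mpow_cmul)
  then show ?thesis unfolding mord_def using q(1)
    by (intro exI[of _ "\<lambda>A. - 1 * (q A - at1 \<phi> A)"] exI[of _ q]) auto
qed

text \<open>Replacing an entry of \<open>Y\<close> by that of \<open>proj Y\<close> changes a linear
  factor by something of order two on \<open>G\<close>, by \<open>mord_linear\<close>. Hence modulo
  higher order a form depends only on its values on \<open>Lie G\<close>.\<close>

lemma mord_proj: "hom k F \<Longrightarrow> mord (Suc k) (\<lambda>A. at1 F A - at1 (\<lambda>Y. F (proj Y)) A)"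
proof (induction rule: hom.induct)
  case (const c)
  show ?case using mpow_mord[OF mpow_zero] by simp
next
  case (step k F i j)
  define \<phi> where "\<phi> Y = Y $ i $ j - proj Y $ i $ j" for Y
  have \<phi>: "clin \<phi>" unfolding \<phi>_def[abs_def] by (intro clin_diff clin_entry clin_proj[OF clin_entry])
  have "mord 2 (at1 \<phi>)" by (rule mord_linear[OF \<phi>]) (simp add: \<phi>_def proj(2))
  then have 1: "mord (2 + k) (\<lambda>A. at1 \<phi> A * at1 F A)" by (rule mord_mult[OF _ hom_mpow[OF step.hyps]])
  have "mpow 1 (at1 (\<lambda>Y. proj Y $ i $ j))"
    by (rule hom_mpow[OF clin_hom[OF clin_proj[OF clin_entry]]])
  from mord_mult[OF step.IH this]
  have 2: "mord (2 + k) (\<lambda>A. (at1 F A - at1 (\<lambda>Y. F (proj Y)) A) * at1 (\<lambda>Y. proj Y $ i $ j) A)" by simp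
  show ?case using mord_add[OF 1 2] by (simp add: \<phi>_def algebra_simps)
next
  case (add k F H)
  then show ?case using mord_add[OF add.IH] by (simp add: algebra_simps)
qed

section \<open>Polynomials whose iterated invariant derivatives vanish at the identity\<close>

definition killed :: "('n cmat \<Rightarrow> complex) \<Rightarrow> bool" where
  "killed p \<longleftrightarrow> p \<in> matrix_polys \<and> (\<forall>Xs\<in>lists (Lie G). foldr vf Xs p (mat 1) = 0)"

lemma killed_vf: "killed p \<Longrightarrow> X \<in> Lie G \<Longrightarrow> killed (vf X p)"
  unfolding killed_def
proof (intro conjI ballI)
  assume p: "p \<in> matrix_polys \<and> (\<forall>Xs\<in>lists (Lie G). foldr vf Xs p (mat 1) = 0)" and X: "X \<in> Lie G"
  show "vf X p \<in> matrix_polys" using p vf_closed by blast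
  fix Xs assume "Xs \<in> lists (Lie G)"
  then have "Xs @ [X] \<in> lists (Lie G)" using X by simp
  then have "foldr vf (Xs @ [X]) p (mat 1) = 0" using p by blast
  then show "foldr vf Xs (vf X p) (mat 1) = 0" by simp
qed

text \<open>\<open>vf X\<close> keeps \<open>p\<close> killed and lowers the degree of the leading
  form, and by Euler's identity it multiplies the value at \<open>X\<close> by the degree, which is
  nonzero in \<open>\<complex>\<close>. The induction ends with the value
  \<open>p (mat 1) = 0\<close>.\<close>

lemma killed_leading_form:
  "hom k F \<Longrightarrow> killed p \<Longrightarrow> mord (Suc k) (\<lambda>A. p A - at1 F A) \<Longrightarrow> X \<in> Lie G \<Longrightarrow> F X = 0"
proof (induction k arbitrary: F p)
  case 0
  obtain c where c: "F = (\<lambda>_. c)" using hom_0[OF 0(1)] by blast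
  obtain q i where q: "mpow (Suc 0) q" "i \<in> vanish" "(\<lambda>A. p A - at1 F A) = (\<lambda>A. q A + i A)"
    using 0(3) by (auto simp: mord_def)
  have "p (mat 1) = 0" using 0(2) unfolding killed_def by (metis foldr_Nil id_apply lists.Nil)
  then have "0 - c = q (mat 1) + i (mat 1)" using fun_cong[OF q(3), of "mat 1"] by (simp add: c)
  then show ?case using mpow_at_one[OF q(1)] q(2) G_one by (simp add: vanish_def c)
next
  case (Suc k)
  have pm: "p \<in> matrix_polys" using Suc.prems by (simp add: killed_def)
  have Fm: "at1 F \<in> matrix_polys" by (rule at1_polys[OF Suc.prems(1)])
  obtain F' where F': "hom k F'" "mpow (Suc k) (\<lambda>A. vf X (at1 F) A - at1 F' A)" "F' X = of_nat (Suc k) * F X"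
    using vf_leading_form[OF Suc.prems(1), of X] by auto
  obtain q i where q: "mpow (Suc (Suc k)) q" "i \<in> vanish" "(\<lambda>A. p A - at1 F A) = (\<lambda>A. q A + i A)"
    using Suc.prems(3) by (auto simp: mord_def)
  have "vf X (\<lambda>A. p A - at1 F A) = (\<lambda>A. vf X q A + vf X i A)"
    unfolding q(3) using q(1,2) mpow_polys by (intro vf_add) (auto simp: vanish_def)
  then have e: "vf X p A - vf X (at1 F) A = vf X q A + vf X i A" for A
    unfolding vf_diff[OF pm Fm] by (rule fun_cong)
  have "mord (Suc k) (\<lambda>A. vf X q A + vf X i A)"
    unfolding mord_def using mpow_vf[OF q(1)] vf_vanish[OF q(2) Suc.prems(4)] by blast
  then have "mord (Suc k) (\<lambda>A. (vf X q A + vf X i A) + (vf X (at1 F) A - at1 F' A))"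
    using mpow_mord[OF F'(2)] by (rule mord_add)
  then have "mord (Suc k) (\<lambda>A. vf X p A - at1 F' A)" by (simp add: e[symmetric])
  then have "F' X = 0" using Suc.IH[OF F'(1) killed_vf[OF Suc.prems(2,4)] _ Suc.prems(4)] by blast
  then show ?case using F'(3) by (metis mult_eq_0_iff of_nat_neq_0)
qed

text \<open>The leading form vanishes on \<open>Lie G\<close>, so as a function on \<open>G\<close>
  it has higher order than its degree.\<close>

lemma killed_mord: "killed p \<Longrightarrow> mord k p"
proof (induction k)
  case 0
  then show ?case by (intro mpow_mord mpow.base) (simp add: killed_def)
next
  case (Suc k)
  then obtain q i where q: "mpow k q" "i \<in> vanish" "p = (\<lambda>A. q A + i A)" by (auto simp: mord_def)
  obtain F where F: "hom k F" "mpow (Suc k) (\<lambda>A. q A - at1 F A)" using leading_form[OF q(1)] by blast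
  have 1: "mord (Suc k) (\<lambda>A. p A - at1 F A)"
    unfolding mord_def using F(2) q(2) by (intro exI[of _ "\<lambda>A. q A - at1 F A"] exI[of _ i]) (auto simp: q(3))
  have "F (proj Y) = 0" for Y
    using killed_leading_form[OF F(1) Suc.prems 1 proj(1)] .
  then have 2: "mord (Suc k) (at1 F)" using mord_proj[OF F(1)] by simp
  show ?case using mord_add[OF 1 2] by simp
qed

text \<open>Krull's theorem gives \<open>(1 - s) * p = 0\<close> on \<open>G\<close>; as
  \<open>1 - s\<close> is 1 at the identity, primality of \<open>vanish\<close> leaves only
  \<open>p\<close>.\<close>

theorem killed_vanish:
  assumes conn: "connectedin zariski G" and p: "killed p"
  shows "p \<in> vanish"
proof -
  obtain s where s: "s \<in> matrix_polys" "s (mat 1) = 0" "\<And>A. A \<in> G \<Longrightarrow> p A = s A * p A"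
    using krull[OF killed_mord[OF p]] by blast
  have pm: "p \<in> matrix_polys" using p by (simp add: killed_def)
  have "(\<lambda>A. (1 - s A) * p A) \<in> vanish"
    unfolding vanish_def using s pm by (auto simp: left_diff_distrib intro!: matrix_polys_intros)
  then have "(\<lambda>A. 1 - s A) \<in> vanish \<or> p \<in> vanish"
    using s pm by (intro vanish_prime[OF conn]) (auto intro!: matrix_polys_intros)
  moreover have "(\<lambda>A. 1 - s A) \<notin> vanish" using s(2) G_one unfolding vanish_def by force
  ultimately show ?thesis by blast
qed

end

subsection \<open>Coadjoint orbits and Poisson ideals\<close>

context poisson_algebra
begin

lemma br_one_right:
  assumes x: "x \<in> carrier Z"
  shows "br x \<one> = \<zero>"
proof -
  have "br x \<one> = br x \<one> \<oplus> br x \<one>"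
    using br_leibniz_right[OF x one_closed one_closed] x by (simp add: br_closed)
  then show ?thesis using x by (simp add: br_closed)
qed

end

text \<open>The coadjoint action on functionals of all matrices and for arbitrary \<open>a\<close>:
  conjugation by \<open>mat 1 + cscale t X\<close>, which need not lie in \<open>G\<close>, may
  leave \<open>Lie G\<close>, so functionals on \<open>Lie G\<close> alone would not
  suffice.\<close>

definition act :: "'n::finite cmat \<Rightarrow> ('n cmat \<Rightarrow> complex) \<Rightarrow> 'n cmat \<Rightarrow> complex" where
  "act a \<Psi> = (\<lambda>X. \<Psi> (matrix_inv a ** X ** a))"

lemma act_clin: "clin \<Psi> \<Longrightarrow> clin (act a \<Psi>)"
  by (simp add: clin_def act_def matrix_add_ldistrib' matrix_add_rdistrib' cscale_ops)

lemma act_mult: "invertible a \<Longrightarrow> invertible b \<Longrightarrow> act (a ** b) \<Psi> = act a (act b \<Psi>)"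
  by (simp add: act_def matrix_inv_mult matrix_mul_assoc)

lemma matrix_inv_mat1: "matrix_inv (mat 1 :: 'n::finite cmat) = mat 1"
  by (rule matrix_inv_unique') auto

lemma act_one: "act (mat 1) \<Psi> = \<Psi>"
  by (simp add: act_def matrix_inv_mat1)

lemma act_zero: "act (mat 1 + cscale 0 X) \<Psi> = \<Psi>"
  by (simp add: cscale_ops act_one)

locale poisson_group = alg_group G for G :: "'n::finite cmat set" +
  fixes br :: "(('n cmat \<Rightarrow> complex) \<Rightarrow> complex) \<Rightarrow> (('n cmat \<Rightarrow> complex) \<Rightarrow> complex) \<Rightarrow>
      (('n cmat \<Rightarrow> complex) \<Rightarrow> complex)"
  assumes conn: "connectedin zariski G"
    and lie_br: "lie_poisson_bracket (Lie G) br"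
begin

abbreviation D :: "('n cmat \<Rightarrow> complex) set" where "D \<equiv> dual (Lie G)"

abbreviation Z :: "(complex, ('n cmat \<Rightarrow> complex) \<Rightarrow> complex) module" where
  "Z \<equiv> polyfun_algebra D (lin (Lie G) ` Lie G)"

abbreviation rs :: "(('n cmat \<Rightarrow> complex) \<Rightarrow> complex) \<Rightarrow> (('n cmat \<Rightarrow> complex) \<Rightarrow> complex)" where
  "rs f \<equiv> restrict f D"

sublocale poisson_algebra Z br
  using lie_br by (simp add: lie_poisson_bracket_def coord_algebra_def)

lemma br_lin: "X \<in> Lie G \<Longrightarrow> Y \<in> Lie G \<Longrightarrow> br (lin (Lie G) X) (lin (Lie G) Y) = lin (Lie G) (commutator X Y)"
  using lie_br by (simp add: lie_poisson_bracket_def)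

text \<open>Coordinates on the dual, finite in number but possibly linearly dependent there.\<close>

definition gens :: "(('n cmat \<Rightarrow> complex) \<Rightarrow> complex) set" where
  "gens = range (\<lambda>(i, j) \<phi>. \<phi> (proj (unit_mat i j)))"

abbreviation RZ :: "(('n cmat \<Rightarrow> complex) \<Rightarrow> complex) set" where "RZ \<equiv> polyfuns UNIV gens"

lemma finite_gens: "finite gens" by (simp add: gens_def)

definition ext_dual :: "('n cmat \<Rightarrow> complex) \<Rightarrow> 'n cmat \<Rightarrow> complex" where
  "ext_dual \<phi> = (\<lambda>X. \<phi> (proj X))"

lemma ext_dual_clin: "\<phi> \<in> D \<Longrightarrow> clin (ext_dual \<phi>)"
  by (simp add: clin_def ext_dual_def proj dual_def)

lemma restrict_dual: "clin \<Psi> \<Longrightarrow> restrict \<Psi> (Lie G) \<in> D"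
  by (auto simp: dual_def clin_def Lie_subspace)

lemma restrict_ext_dual: "\<phi> \<in> D \<Longrightarrow> restrict (ext_dual \<phi>) (Lie G) = \<phi>"
  by (auto simp: dual_def ext_dual_def fun_eq_iff proj extensional_def restrict_def)

lemma dual_expand: "\<phi> \<in> D \<Longrightarrow> X \<in> Lie G \<Longrightarrow> \<phi> X = (\<Sum>i\<in>UNIV. \<Sum>j\<in>UNIV. X $ i $ j * \<phi> (proj (unit_mat i j)))"
  using clin_expand[OF ext_dual_clin, of \<phi> X] by (simp add: ext_dual_def proj)

text \<open>For \<open>X\<close> in \<open>Lie G\<close>, a lift of \<open>lin (Lie G) X\<close> to
  the whole type.\<close>

definition ell :: "'n cmat \<Rightarrow> ('n cmat \<Rightarrow> complex) \<Rightarrow> complex" where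
  "ell X = (\<lambda>\<phi>. \<Sum>i\<in>UNIV. \<Sum>j\<in>UNIV. X $ i $ j * \<phi> (proj (unit_mat i j)))"

lemma ell_RZ: "ell X \<in> RZ"
  unfolding ell_def by (intro polyfuns_sum polyfuns_mult polyfuns_const polyfuns_coord) (force simp: gens_def)

lemma rs_ell: "X \<in> Lie G \<Longrightarrow> rs (ell X) = lin (Lie G) X"
  unfolding ell_def lin_def by (rule restrict_ext) (rule dual_expand[symmetric])

text \<open>The generators read a functional only at points of \<open>Lie G\<close>.\<close>

lemma RZ_value: "f \<in> RZ \<Longrightarrow> f (restrict \<Psi> (Lie G)) = f \<Psi>"
  by (induction rule: polyfuns_UNIV_induct) (auto simp: gens_def proj)

lemma restr: "polyfuns D (lin (Lie G) ` Lie G) = (\<lambda>f. rs f) ` RZ"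
proof (intro equalityI subsetI)
  fix f assume "f \<in> polyfuns D (lin (Lie G) ` Lie G)"
  then show "f \<in> (\<lambda>f. rs f) ` RZ"
  proof (induction rule: polyfuns.induct)
    case (const c)
    show ?case by (rule image_eqI[OF refl]) (rule polyfuns_const)
  next
    case (coord l)
    then obtain X where X: "X \<in> Lie G" "l = lin (Lie G) X" by blast
    have "(\<lambda>v\<in>D. l v) = rs (ell X)" unfolding rs_ell[OF X(1)] X(2) by (auto simp: lin_def fun_eq_iff)
    then show ?case using ell_RZ by blast
  next
    case (add p q)
    then obtain f g where fg: "f \<in> RZ" "g \<in> RZ" "p = rs f" "q = rs g" by blast
    have "(\<lambda>v\<in>D. p v + q v) = rs (\<lambda>v. f v + g v)" unfolding fg by (rule restrict_ext) simp
    then show ?case using polyfuns_add[OF fg(1,2)] by blast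
  next
    case (mult p q)
    then obtain f g where fg: "f \<in> RZ" "g \<in> RZ" "p = rs f" "q = rs g" by blast
    have "(\<lambda>v\<in>D. p v * q v) = rs (\<lambda>v. f v * g v)" unfolding fg by (rule restrict_ext) simp
    then show ?case using polyfuns_mult[OF fg(1,2)] by blast
  qed
next
  fix z assume "z \<in> (\<lambda>f. rs f) ` RZ"
  then obtain f where f: "f \<in> RZ" "z = rs f" by blast
  have "rs f \<in> polyfuns D (lin (Lie G) ` Lie G)" using f(1)
  proof (induction rule: polyfuns_UNIV_induct)
    case (const c)
    show ?case by (rule polyfuns.const)
  next
    case (coord l)
    then obtain i j where l: "l = (\<lambda>\<phi>. \<phi> (proj (unit_mat i j)))" by (auto simp: gens_def)
    have eq: "rs l = (\<lambda>v\<in>D. lin (Lie G) (proj (unit_mat i j)) v)"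
      unfolding l lin_def by (rule restrict_ext) simp
    show ?case unfolding eq by (rule polyfuns.coord) (use proj(1) in blast)
  next
    case (add p q)
    have eq: "rs (\<lambda>v. p v + q v) = (\<lambda>v\<in>D. rs p v + rs q v)" by (rule restrict_ext) simp
    show ?case unfolding eq by (rule polyfuns.add[OF add.IH])
  next
    case (mult p q)
    have eq: "rs (\<lambda>v. p v * q v) = (\<lambda>v\<in>D. rs p v * rs q v)" by (rule restrict_ext) simp
    show ?case unfolding eq by (rule polyfuns.mult[OF mult.IH])
  qed
  then show "z \<in> polyfuns D (lin (Lie G) ` Lie G)" using f by simp
qed

lemma carrier_Z: "carrier Z = (\<lambda>f. rs f) ` RZ"
  by (simp only: polyfun_algebra_simps restr)

lemma rs_Z: "f \<in> RZ \<Longrightarrow> rs f \<in> carrier Z"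
  unfolding carrier_Z by blast

lemma rs_add: "rs (\<lambda>v. f v + g v) = rs f \<oplus>\<^bsub>Z\<^esub> rs g"
  unfolding polyfun_algebra_simps by (rule restrict_ext) simp

lemma rs_mult: "rs (\<lambda>v. f v * g v) = rs f \<otimes>\<^bsub>Z\<^esub> rs g"
  unfolding polyfun_algebra_simps by (rule restrict_ext) simp

lemma rs_cmult: "rs (\<lambda>v. c * f v) = c \<odot>\<^bsub>Z\<^esub> rs f"
  unfolding polyfun_algebra_simps by (rule restrict_ext) simp

lemma rs_const: "rs (\<lambda>_. c) = c \<odot>\<^bsub>Z\<^esub> \<one>\<^bsub>Z\<^esub>"
  unfolding polyfun_algebra_simps by (rule restrict_ext) simp

lemma at_D:
  assumes "\<phi> \<in> D"
  shows "(x \<oplus>\<^bsub>Z\<^esub> y) \<phi> = x \<phi> + y \<phi>" "(x \<otimes>\<^bsub>Z\<^esub> y) \<phi> = x \<phi> * y \<phi>" "(c \<odot>\<^bsub>Z\<^esub> x) \<phi> = c * x \<phi>" "\<zero>\<^bsub>Z\<^esub> \<phi> = 0" "\<one>\<^bsub>Z\<^esub> \<phi> = 1"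
  using assms by (simp_all add: polyfun_algebra_def)

lemma rs_at: "\<phi> \<in> D \<Longrightarrow> rs f \<phi> = f \<phi>" by simp

lemma lin_Z: "X \<in> Lie G \<Longrightarrow> lin (Lie G) X \<in> carrier Z"
proof -
  assume X: "X \<in> Lie G"
  have "rs (ell X) \<in> carrier Z" by (rule rs_Z[OF ell_RZ])
  then show ?thesis by (simp only: rs_ell[OF X])
qed

text \<open>The values of \<open>\<eta>\<close> on the lifted linear functions define a functional,
  whose restriction is \<open>\<phi>\<close>. The generators may satisfy linear relations on
  \<open>D\<close>, and the second assumption makes \<open>\<eta>\<close> respect them.\<close>

lemma points:
  assumes \<eta>: "char_of RZ \<eta>" and van: "\<And>f. f \<in> RZ \<Longrightarrow> (\<And>v. v \<in> D \<Longrightarrow> f v = 0) \<Longrightarrow> \<eta> f = 0"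
  shows "\<exists>\<phi>\<in>D. \<forall>f\<in>RZ. \<eta> f = f \<phi>"
proof -
  note \<eta>s = char_ofD[OF \<eta>]
  define \<Psi> where "\<Psi> X = \<eta> (ell X)" for X
  have "clin \<Psi>"
    unfolding clin_def
  proof (intro conjI allI)
    show "\<Psi> (X + Y) = \<Psi> X + \<Psi> Y" for X Y
    proof -
      have "ell (X + Y) = ell X + ell Y" by (simp add: ell_def fun_eq_iff distrib_right sum.distrib)
      then show ?thesis unfolding \<Psi>_def by (simp only: \<eta>s(1)[OF ell_RZ ell_RZ])
    qed
    show "\<Psi> (cscale c X) = c * \<Psi> X" for c X
    proof -
      have "ell (cscale c X) = (\<lambda>_. c) * ell X" by (simp add: ell_def fun_eq_iff sum_distrib_left mult.assoc)
      then show ?thesis unfolding \<Psi>_def by (simp only: \<eta>s(2)[OF polyfuns_const ell_RZ] \<eta>s(3))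
    qed
  qed
  define \<phi> where "\<phi> = restrict \<Psi> (Lie G)"
  have \<phi>D: "\<phi> \<in> D" unfolding \<phi>_def by (rule restrict_dual[OF \<open>clin \<Psi>\<close>])
  have "\<eta> f = f \<phi>" if "f \<in> RZ" for f
    using that
  proof (induction rule: polyfuns_UNIV_induct)
    case (const c)
    show ?case by (rule \<eta>s(3))
  next
    case (coord l)
    then obtain i j where l: "l = (\<lambda>\<phi>. \<phi> (proj (unit_mat i j)))" by (auto simp: gens_def)
    let ?X = "proj (unit_mat i j)"
    have lR: "l \<in> RZ" using coord by (rule polyfuns_coord)
    have "(\<lambda>v. l v - ell ?X v) \<in> RZ" by (intro polyfuns_diff lR ell_RZ)
    moreover have "l v - ell ?X v = 0" if "v \<in> D" for v
      using dual_expand[OF that proj(1)[of "unit_mat i j"]] by (simp add: l ell_def)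
    ultimately have d0: "\<eta> (\<lambda>v. l v - ell ?X v) = 0" and dR: "(\<lambda>v. l v - ell ?X v) \<in> RZ" using van by blast+
    have "l = (\<lambda>v. l v - ell ?X v) + ell ?X" by (simp add: fun_eq_iff)
    then have "\<eta> l = \<eta> ((\<lambda>v. l v - ell ?X v) + ell ?X)" by (rule arg_cong)
    also have "\<dots> = \<Psi> ?X" unfolding \<eta>s(1)[OF dR ell_RZ] d0 \<Psi>_def by simp
    also have "\<dots> = l \<phi>" by (simp add: l \<phi>_def proj)
    finally show ?case .
  next
    case (add p q)
    then show ?case using \<eta>s(1)[OF add.hyps] by (simp add: plus_fun_def)
  next
    case (mult p q)
    then show ?case using \<eta>s(2)[OF mult.hyps] by (simp add: times_fun_def)
  qed
  then show ?thesis using \<phi>D by blast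
qed

lemma coadjoint_act:
  assumes "g \<in> G" "\<phi> \<in> D"
  shows "coadjoint (Lie G) g \<phi> = restrict (act g (ext_dual \<phi>)) (Lie G)"
  unfolding coadjoint_def by (rule restrict_ext) (simp add: act_def ext_dual_def proj(2) Ad_Lie assms)

lemma coadjoint_D: "g \<in> G \<Longrightarrow> \<phi> \<in> D \<Longrightarrow> coadjoint (Lie G) g \<phi> \<in> D"
  by (simp add: coadjoint_act restrict_dual act_clin ext_dual_clin)

lemma coadjoint_one: "\<phi> \<in> D \<Longrightarrow> coadjoint (Lie G) (mat 1) \<phi> = \<phi>"
  by (simp add: coadjoint_act G_one act_one restrict_ext_dual)

definition orb :: "('n cmat \<Rightarrow> complex) \<Rightarrow> ('n cmat \<Rightarrow> complex) set" where
  "orb \<phi> = {coadjoint (Lie G) g \<phi> | g. g \<in> G}"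

lemma coadjoint_orbits_eq: "coadjoint_orbits G = orb ` D"
  by (auto simp: coadjoint_orbits_def orbits_def orbit_def orb_def)

lemma vanishing_orb:
  assumes "\<phi> \<in> D" "f \<in> RZ"
  shows "rs f \<in> vanishing_ideal (Lie G) (orb \<phi>) \<longleftrightarrow> (\<forall>g\<in>G. f (act g (ext_dual \<phi>)) = 0)"
proof -
  have "rs f (coadjoint (Lie G) g \<phi>) = f (act g (ext_dual \<phi>))" if "g \<in> G" for g
    using that assms by (simp add: coadjoint_D) (simp add: coadjoint_act RZ_value)
  then show ?thesis using rs_Z[OF assms(2)]
    by (auto simp: vanishing_ideal_def coord_algebra_def orb_def simp del: restrict_apply)
qed

text \<open>The Hamiltonian vector field of a linear function is an infinitesimal coadjoint action.\<close>

lemma hamiltonian_DERIV: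
  assumes f: "f \<in> RZ" and \<Psi>: "clin \<Psi>" and X: "X \<in> Lie G"
  shows "((\<lambda>t. f (act (mat 1 + cscale t X) \<Psi>)) has_field_derivative
     - br (lin (Lie G) X) (rs f) (restrict \<Psi> (Lie G))) (at 0)"
  using f
proof (induction rule: polyfuns_UNIV_induct)
  case (const c)
  have "br (lin (Lie G) X) (rs (\<lambda>_. c)) = \<zero>\<^bsub>Z\<^esub>"
    unfolding rs_const using lin_Z[OF X] br_smult_right[OF lin_Z[OF X] one_closed, of c] br_one_right[OF lin_Z[OF X]] by simp
  then show ?case using at_D(4)[OF restrict_dual[OF \<Psi>]] by (simp del: restrict_apply)
next
  case (coord l)
  then obtain i j where l: "l = (\<lambda>\<phi>. \<phi> (proj (unit_mat i j)))" by (auto simp: gens_def)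
  define E where "E = proj (unit_mat i j)"
  have E: "E \<in> Lie G" by (simp add: E_def proj)
  have rl: "rs l = lin (Lie G) E" unfolding l lin_def E_def ..
  have comm: "commutator X E \<in> Lie G" by (rule commutator_Lie[OF E X])
  have v: "br (lin (Lie G) X) (rs l) (restrict \<Psi> (Lie G)) = \<Psi> (commutator X E)"
    unfolding rl br_lin[OF X E] using restrict_dual[OF \<Psi>] comm by (simp add: lin_def)
  \<comment> \<open>\<open>act\<close> puts the inverse on the left of the conjugated matrix, so
    differentiation gives \<open>commutator E X\<close> and not \<open>commutator X E\<close>; this
    is the origin of the minus sign in the statement.\<close>
  have "\<Psi> (commutator E X) = - \<Psi> (commutator X E)"
  proof -
    have "commutator E X = cscale (- 1) (commutator X E)" by (simp add: commutator_def vec_eq_iff)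
    then show ?thesis using \<Psi> by (simp add: clin_def)
  qed
  moreover have "((\<lambda>t. \<Sum>a\<in>UNIV. \<Sum>b\<in>UNIV. (matrix_inv (mat 1 + cscale t X) ** E ** (mat 1 + cscale t X)) $ a $ b * \<Psi> (unit_mat a b))
    has_field_derivative (\<Sum>a\<in>UNIV. \<Sum>b\<in>UNIV. commutator E X $ a $ b * \<Psi> (unit_mat a b))) (at 0)"
    by (intro DERIV_sum DERIV_cmult_right conjugation_DERIV)
  ultimately show ?case unfolding v clin_expand[OF \<Psi>, symmetric] by (simp add: l act_def E_def)
next
  case (add p q)
  have c: "rs p \<in> carrier Z" "rs q \<in> carrier Z" using add.hyps by (auto intro: rs_Z)
  show ?case using DERIV_add[OF add.IH] unfolding rs_add br_add_right[OF lin_Z[OF X] c] at_D[OF restrict_dual[OF \<Psi>]]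
    by (simp del: restrict_apply)
next
  case (mult p q)
  have c: "rs p \<in> carrier Z" "rs q \<in> carrier Z" using mult.hyps by (auto intro: rs_Z)
  have v: "rs p (restrict \<Psi> (Lie G)) = p \<Psi>" "rs q (restrict \<Psi> (Lie G)) = q \<Psi>"
    using restrict_dual[OF \<Psi>] mult.hyps by (simp_all only: rs_at RZ_value)
  show ?case using DERIV_mult[OF mult.IH]
    unfolding rs_mult br_leibniz_right[OF lin_Z[OF X] c] at_D[OF restrict_dual[OF \<Psi>]] v act_zero
    by (simp add: algebra_simps del: restrict_apply)
qed

text \<open>The power of \<open>det\<close> clears the denominators of the inverse.\<close>

lemma pullback_polynomial:
  assumes f: "f \<in> RZ" and \<Psi>: "clin \<Psi>"
  shows "\<exists>k p. p \<in> matrix_polys \<and> (\<forall>A. invertible A \<longrightarrow> p A = det A ^ k * f (act A \<Psi>))"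
  using f
proof (induction rule: polyfuns_UNIV_induct)
  case (const c)
  show ?case by (intro exI[of _ 0] exI[of _ "\<lambda>_. c"]) (auto intro: matrix_polys_intros)
next
  case (coord l)
  then obtain i j where l: "l = (\<lambda>\<phi>. \<phi> (proj (unit_mat i j)))" by (auto simp: gens_def)
  define E where "E = proj (unit_mat i j)"
  obtain c :: "'n \<Rightarrow> 'n \<Rightarrow> 'n cmat \<Rightarrow> complex" where c: "\<And>i j. c i j \<in> matrix_polys"
    "\<And>A i j. invertible A \<Longrightarrow> matrix_inv A $ i $ j = c i j A / det A"
  proof -
    from cofactors show ?thesis using that .
  qed
  define p where "p A = (\<Sum>a\<in>UNIV. \<Sum>b\<in>UNIV. (\<Sum>l\<in>UNIV. (\<Sum>k\<in>UNIV. c a k A * E $ k $ l) * A $ l $ b) * \<Psi> (unit_mat a b))" for A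
  have "p \<in> matrix_polys" unfolding p_def[abs_def] by (intro matrix_polys_intros c)
  moreover have "p A = det A ^ 1 * l (act A \<Psi>)" if A: "invertible A" for A
  proof -
    have "det A \<noteq> 0" using A by (simp add: invertible_det_nz)
    then have "c a k A = det A * matrix_inv A $ a $ k" for a k using c(2)[OF A, of a k] by simp
    then have "p A = det A * (\<Sum>a\<in>UNIV. \<Sum>b\<in>UNIV. (matrix_inv A ** E ** A) $ a $ b * \<Psi> (unit_mat a b))"
      by (simp add: p_def matrix_matrix_mult_def sum_distrib_left sum_distrib_right mult_ac)
    then show ?thesis by (simp add: clin_expand[OF \<Psi>, symmetric] l act_def E_def)
  qed
  ultimately show ?case by blast
next
  case (add f g)
  then obtain k p m q where p: "p \<in> matrix_polys" "\<And>A. invertible A \<Longrightarrow> p A = det A ^ k * f (act A \<Psi>)"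
    and q: "q \<in> matrix_polys" "\<And>A. invertible A \<Longrightarrow> q A = det A ^ m * g (act A \<Psi>)" by blast
  show ?case
    using p q by (intro exI[of _ "k + m"] exI[of _ "\<lambda>A. det A ^ m * p A + det A ^ k * q A"])
      (auto simp: power_add algebra_simps intro!: matrix_polys_intros det_matrix_polys)
next
  case (mult f g)
  then obtain k p m q where p: "p \<in> matrix_polys" "\<And>A. invertible A \<Longrightarrow> p A = det A ^ k * f (act A \<Psi>)"
    and q: "q \<in> matrix_polys" "\<And>A. invertible A \<Longrightarrow> q A = det A ^ m * g (act A \<Psi>)" by blast
  show ?case
    using p q by (intro exI[of _ "k + m"] exI[of _ "\<lambda>A. p A * q A"])
      (auto simp: power_add algebra_simps intro!: matrix_polys_intros)
qed

text \<open>Product rule: the factor \<open>det A ^ k\<close> contributes a constant multiple of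
  \<open>f\<close>, and the other term is the Hamiltonian field of the linear function.\<close>

lemma vf_pullback:
  assumes f: "f \<in> RZ" and \<Psi>: "clin \<Psi>" and X: "X \<in> Lie G"
    and p: "p \<in> matrix_polys" "\<And>A. invertible A \<Longrightarrow> p A = det A ^ k * f (act A \<Psi>)" and h: "invertible h"
  shows "vf X p h = det h ^ k * (of_nat k * grad det (mat 1) X * f (act h \<Psi>) -
     br (lin (Lie G) X) (rs f) (restrict (act h \<Psi>) (Lie G)))"
proof (rule vf_unique[OF p(1)])
  define E where "E t = mat 1 + cscale t X" for t
  have E0: "E 0 = mat 1" by (simp add: E_def cscale_ops)
  have d: "((\<lambda>t. det (E t)) has_field_derivative grad det (mat 1) X) (at 0)"
    unfolding E_def by (rule grad_DERIV[OF det_matrix_polys])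
  have "((\<lambda>t. det (E t) ^ k) has_field_derivative of_nat k * grad det (mat 1) X) (at 0)"
    using DERIV_power[OF d, of k] by (simp add: E0 mult.commute)
  from DERIV_cmult[OF DERIV_mult[OF this hamiltonian_DERIV[OF f act_clin[OF \<Psi>, of h] X, folded E_def]], of "det h ^ k"]
  have "((\<lambda>t. det h ^ k * (det (E t) ^ k * f (act (E t) (act h \<Psi>)))) has_field_derivative
     det h ^ k * (of_nat k * grad det (mat 1) X * f (act h \<Psi>) - br (lin (Lie G) X) (rs f) (restrict (act h \<Psi>) (Lie G)))) (at 0)"
    by (simp add: E0 act_one del: restrict_apply)
  moreover have "\<forall>\<^sub>F t in nhds 0. det h ^ k * (det (E t) ^ k * f (act (E t) (act h \<Psi>))) = p (E t ** h)"
    using near_identity_invertible[of X]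
  proof eventually_elim
    case (elim t)
    then have "invertible (E t)" "invertible (E t ** h)" using h by (auto simp: E_def invertible_mult)
    then show ?case using h by (simp add: p(2) act_mult det_mul power_mult_distrib)
  qed
  ultimately show "((\<lambda>t. p ((mat 1 + cscale t X) ** h)) has_field_derivative
     det h ^ k * (of_nat k * grad det (mat 1) X * f (act h \<Psi>) - br (lin (Lie G) X) (rs f) (restrict (act h \<Psi>) (Lie G)))) (at 0)"
    unfolding E_def by (rule DERIV_transform)
qed

text \<open>Since \<open>f\<close> is zero on the orbit, \<open>vf_pullback\<close> expresses the
  bracket with a linear function by \<open>vf X p\<close> for some \<open>p\<close> in
  \<open>vanish\<close>, and fields of \<open>Lie G\<close> preserve \<open>vanish\<close>. General
  \<open>x\<close> follow because \<open>br\<close> is a derivation in its first argument.\<close>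

lemma vanishing_ideal_br:
  assumes \<phi>: "\<phi> \<in> D" and x: "x \<in> carrier Z" and z: "z \<in> vanishing_ideal (Lie G) (orb \<phi>)"
  shows "br x z \<in> vanishing_ideal (Lie G) (orb \<phi>)"
proof -
  have zZ: "z \<in> carrier Z" using z by (simp add: vanishing_ideal_def coord_algebra_def)
  obtain f where f: "f \<in> RZ" "z = rs f" using zZ unfolding carrier_Z by blast
  define \<Psi> where "\<Psi> = ext_dual \<phi>"
  have \<Psi>: "clin \<Psi>" unfolding \<Psi>_def by (rule ext_dual_clin[OF \<phi>])
  have f0: "f (act g \<Psi>) = 0" if "g \<in> G" for g
    using z that unfolding f(2) vanishing_orb[OF \<phi> f(1)] \<Psi>_def by blast
  have orbD: "\<psi> \<in> D" if "\<psi> \<in> orb \<phi>" for \<psi> using that \<phi> coadjoint_D by (auto simp: orb_def)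
  have z0: "z \<psi> = 0" if "\<psi> \<in> orb \<phi>" for \<psi> using z that by (simp add: vanishing_ideal_def)
  have lin0: "br (lin (Lie G) X) z (coadjoint (Lie G) h \<phi>) = 0" if X: "X \<in> Lie G" and h: "h \<in> G" for X h
  proof -
    obtain k p where p: "p \<in> matrix_polys" "\<And>A. invertible A \<Longrightarrow> p A = det A ^ k * f (act A \<Psi>)"
      using pullback_polynomial[OF f(1) \<Psi>] by blast
    have "p \<in> vanish" using p f0 G_invertible by (auto simp: vanish_def)
    then have "vf X p h = 0" using vf_vanish[OF _ X] h by (simp add: vanish_def)
    then have "br (lin (Lie G) X) (rs f) (restrict (act h \<Psi>) (Lie G)) = 0"
      using vf_pullback[OF f(1) \<Psi> X p G_invertible[OF h]] f0[OF h] G_invertible[OF h]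
      by (simp add: invertible_det_nz del: restrict_apply)
    then show ?thesis unfolding f(2) coadjoint_act[OF h \<phi>] \<Psi>_def .
  qed
  have "\<forall>\<psi>\<in>orb \<phi>. br x z \<psi> = 0"
  proof -
    have "x \<in> polyfuns D (lin (Lie G) ` Lie G)" using x by (simp add: polyfun_algebra_simps)
    then show ?thesis
    proof (induction rule: polyfuns.induct)
      case (const c)
      have "br (c \<odot>\<^bsub>Z\<^esub> \<one>\<^bsub>Z\<^esub>) z = c \<odot>\<^bsub>Z\<^esub> br \<one>\<^bsub>Z\<^esub> z" using zZ by (intro br_smult one_closed)
      also have "br \<one>\<^bsub>Z\<^esub> z = \<zero>\<^bsub>Z\<^esub>" using br_antisym[OF one_closed zZ] br_one_right[OF zZ] by simp
      finally show ?case unfolding rs_const using orbD at_D by simp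
    next
      case (coord l)
      then obtain X where X: "X \<in> Lie G" "l = lin (Lie G) X" by blast
      have "(\<lambda>v\<in>D. l v) = lin (Lie G) X" by (auto simp: X(2) lin_def fun_eq_iff)
      then show ?case using lin0[OF X(1)] by (auto simp: orb_def)
    next
      case (add p q)
      have "p \<in> carrier Z" "q \<in> carrier Z" using add.hyps by (simp_all add: polyfun_algebra_simps)
      from br_add[OF this zZ] have "br (\<lambda>v\<in>D. p v + q v) z = br p z \<oplus>\<^bsub>Z\<^esub> br q z" by (simp only: polyfun_algebra_simps)
      then show ?case using add.IH orbD by (simp add: at_D del: restrict_apply)
    next
      case (mult p q)
      have "p \<in> carrier Z" "q \<in> carrier Z" using mult.hyps by (simp_all add: polyfun_algebra_simps)
      from br_leibniz[OF this zZ] have "br (\<lambda>v\<in>D. p v * q v) z = p \<otimes>\<^bsub>Z\<^esub> br q z \<oplus>\<^bsub>Z\<^esub> q \<otimes>\<^bsub>Z\<^esub> br p z"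
        by (simp only: polyfun_algebra_simps)
      then show ?case using mult.IH orbD by (simp add: at_D del: restrict_apply)
    qed
  qed
  then show ?thesis using br_closed[OF x zZ] by (simp add: vanishing_ideal_def coord_algebra_def)
qed

lemma brackets_vanish_closed:
  assumes \<phi>: "\<phi> \<in> D"
  shows "z \<in> brackets_vanish Z br \<phi> \<Longrightarrow> w \<in> brackets_vanish Z br \<phi> \<Longrightarrow> z \<oplus>\<^bsub>Z\<^esub> w \<in> brackets_vanish Z br \<phi>"
    "z \<in> brackets_vanish Z br \<phi> \<Longrightarrow> c \<odot>\<^bsub>Z\<^esub> z \<in> brackets_vanish Z br \<phi>"
    "z \<in> brackets_vanish Z br \<phi> \<Longrightarrow> x \<in> carrier Z \<Longrightarrow> br x z \<in> brackets_vanish Z br \<phi>"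
proof -
  show "z \<in> brackets_vanish Z br \<phi> \<Longrightarrow> w \<in> brackets_vanish Z br \<phi> \<Longrightarrow> z \<oplus>\<^bsub>Z\<^esub> w \<in> brackets_vanish Z br \<phi>"
    by (auto simp: brackets_vanish_def foldr_br_add at_D[OF \<phi>] simp del: in_lists_conv_set)
  show "z \<in> brackets_vanish Z br \<phi> \<Longrightarrow> c \<odot>\<^bsub>Z\<^esub> z \<in> brackets_vanish Z br \<phi>"
    by (auto simp: brackets_vanish_def foldr_br_smult at_D[OF \<phi>] simp del: in_lists_conv_set)
  show "z \<in> brackets_vanish Z br \<phi> \<Longrightarrow> x \<in> carrier Z \<Longrightarrow> br x z \<in> brackets_vanish Z br \<phi>"
  proof -
    assume z: "z \<in> brackets_vanish Z br \<phi>" and x: "x \<in> carrier Z"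
    have "foldr br us (br x z) \<phi> = 0" if "us \<in> lists (carrier Z)" for us
    proof -
      have "us @ [x] \<in> lists (carrier Z)" using that x by simp
      then have "foldr br (us @ [x]) z \<phi> = 0" using z unfolding brackets_vanish_def by blast
      then show ?thesis by simp
    qed
    then show ?thesis using z x br_closed by (auto simp: brackets_vanish_def)
  qed
qed

text \<open>Every \<open>vf X p\<close> is again the pullback, twisted by the same power of
  \<open>det\<close>, of a member of the core. Hence all iterated derivatives at the identity are
  values at \<open>\<phi>\<close> of members of the core, which are zero.\<close>

lemma brackets_vanish_killed:
  assumes \<phi>: "\<phi> \<in> D" and f: "f \<in> RZ" "rs f \<in> brackets_vanish Z br \<phi>"
    and p: "p \<in> matrix_polys" "\<And>A. invertible A \<Longrightarrow> p A = det A ^ k * f (act A (ext_dual \<phi>))"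
  shows "killed p"
proof -
  define \<Psi> where "\<Psi> = ext_dual \<phi>"
  have \<Psi>: "clin \<Psi>" unfolding \<Psi>_def by (rule ext_dual_clin[OF \<phi>])
  have "foldr vf Xs p (mat 1) = 0" if "Xs \<in> lists (Lie G)" "f \<in> RZ" "rs f \<in> brackets_vanish Z br \<phi>"
    "p \<in> matrix_polys" "\<And>A. invertible A \<Longrightarrow> p A = det A ^ k * f (act A \<Psi>)" for Xs f p
    using that
  \<comment> \<open>\<open>foldr\<close> applies the last field of the list first, hence the
    induction from the right.\<close>
  proof (induction Xs arbitrary: f p rule: rev_induct)
    case Nil
    have "[] \<in> lists (carrier Z)" by simp
    then have "foldr br [] (rs f) \<phi> = 0" using Nil.prems(3) unfolding brackets_vanish_def by blast
    then have "f \<phi> = 0" using \<phi> by simp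
    then have "f \<Psi> = 0" using RZ_value[OF Nil.prems(2), of \<Psi>] restrict_ext_dual[OF \<phi>] by (simp add: \<Psi>_def)
    moreover have "invertible (mat 1 :: 'n cmat)" using G_invertible G_one by blast
    ultimately show ?case using Nil.prems(5)[of "mat 1"] by (simp add: act_one)
  next
    case (snoc X Xs)
    have X: "X \<in> Lie G" using snoc.prems by simp
    define z where "z = br (lin (Lie G) X) (rs f)"
    have zZ: "z \<in> carrier Z" unfolding z_def by (rule br_closed[OF lin_Z[OF X] rs_Z[OF snoc.prems(2)]])
    obtain w where w: "w \<in> RZ" "z = rs w" using zZ unfolding carrier_Z by blast
    define \<tau> where "\<tau> = of_nat k * grad det (mat 1) X"
    \<comment> \<open>The function whose twisted pullback is \<open>vf X p\<close>; \<open>w\<close>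
      lifts the bracket of \<open>f\<close> with the linear function of \<open>X\<close>.\<close>
    define f' where "f' v = \<tau> * f v + (- 1) * w v" for v
    have f'R: "f' \<in> RZ" unfolding f'_def[abs_def] using snoc.prems(2) w(1)
      by (intro polyfuns_add polyfuns_mult polyfuns_const)
    have "rs f' = \<tau> \<odot>\<^bsub>Z\<^esub> rs f \<oplus>\<^bsub>Z\<^esub> (- 1) \<odot>\<^bsub>Z\<^esub> rs w"
      unfolding f'_def[abs_def] rs_add rs_cmult ..
    moreover have "rs w \<in> brackets_vanish Z br \<phi>" unfolding w(2)[symmetric] z_def
      by (rule brackets_vanish_closed(3)[OF \<phi> snoc.prems(3) lin_Z[OF X]])
    ultimately have f'v: "rs f' \<in> brackets_vanish Z br \<phi>"
      using brackets_vanish_closed[OF \<phi>] snoc.prems(3) by presburger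
    have "vf X p A = det A ^ k * f' (act A \<Psi>)" if A: "invertible A" for A
    proof -
      have c: "clin (act A \<Psi>)" by (rule act_clin[OF \<Psi>])
      have "br (lin (Lie G) X) (rs f) (restrict (act A \<Psi>) (Lie G)) = w (act A \<Psi>)"
        unfolding z_def[symmetric] w(2) rs_at[OF restrict_dual[OF c]] by (rule RZ_value[OF w(1)])
      then show ?thesis
        using vf_pullback[OF snoc.prems(2) \<Psi> X snoc.prems(4,5) A] by (simp add: f'_def \<tau>_def)
    qed
    then have "foldr vf Xs (vf X p) (mat 1) = 0"
      using snoc.IH[OF _ f'R f'v vf_closed[OF snoc.prems(4)]] snoc.prems(1) by simp
    then show ?case by simp
  qed
  then show ?thesis using f p unfolding killed_def \<Psi>_def by blast
qed

theorem brackets_vanish_orbit: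
  assumes \<phi>: "\<phi> \<in> D"
  shows "brackets_vanish Z br \<phi> = vanishing_ideal (Lie G) (orb \<phi>)"
proof (intro equalityI subsetI)
  fix z assume z: "z \<in> vanishing_ideal (Lie G) (orb \<phi>)"
  have "foldr br us z \<in> vanishing_ideal (Lie G) (orb \<phi>)" if "us \<in> lists (carrier Z)" for us
    using that by (induction us) (auto simp: z intro: vanishing_ideal_br[OF \<phi>])
  moreover have "\<phi> \<in> orb \<phi>" using coadjoint_one[OF \<phi>] G_one unfolding orb_def by force
  ultimately show "z \<in> brackets_vanish Z br \<phi>"
    using z by (auto simp: brackets_vanish_def vanishing_ideal_def coord_algebra_def)
next
  fix z assume z: "z \<in> brackets_vanish Z br \<phi>"
  then have "z \<in> carrier Z" by (simp add: brackets_vanish_def)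
  then obtain f where f: "f \<in> RZ" "z = rs f" unfolding carrier_Z by blast
  obtain k p where p: "p \<in> matrix_polys" "\<And>A. invertible A \<Longrightarrow> p A = det A ^ k * f (act A (ext_dual \<phi>))"
    using pullback_polynomial[OF f(1) ext_dual_clin[OF \<phi>]] by blast
  have "p \<in> vanish"
    using killed_vanish[OF conn brackets_vanish_killed[OF \<phi> f(1) z[unfolded f(2)] p]] .
  then have "f (act g (ext_dual \<phi>)) = 0" if "g \<in> G" for g
    using p(2)[OF G_invertible[OF that]] G_invertible[OF that] that by (simp add: vanish_def invertible_det_nz)
  then show "z \<in> vanishing_ideal (Lie G) (orb \<phi>)" unfolding f(2) vanishing_orb[OF \<phi> f(1)] by blast
qed

end

subsection \<open>Orbits are determined by their vanishing ideals\<close>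

definition inv_det :: "'n::finite cmat \<Rightarrow> complex" where "inv_det A = 1 / det A"

definition group_funs :: "('n::finite cmat \<Rightarrow> complex) set" where
  "group_funs = polyfuns UNIV (insert inv_det entries)"

lemma matrix_polys_group_funs: "p \<in> matrix_polys \<Longrightarrow> p \<in> group_funs"
  unfolding matrix_polys_eq group_funs_def by (rule polyfuns_mono[rotated]) auto

lemma inv_det_group_funs: "inv_det \<in> group_funs"
  unfolding group_funs_def by (rule polyfuns_coord) simp

lemma group_funs_intros:
  "(\<lambda>_. c) \<in> group_funs" "a \<in> group_funs \<Longrightarrow> b \<in> group_funs \<Longrightarrow> (\<lambda>A. a A + b A) \<in> group_funs"
  "a \<in> group_funs \<Longrightarrow> b \<in> group_funs \<Longrightarrow> (\<lambda>A. a A * b A) \<in> group_funs"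
  "a \<in> group_funs \<Longrightarrow> (\<lambda>A. a A ^ n) \<in> group_funs"
  unfolding group_funs_def by (auto intro: polyfuns_ops polyfuns_power)

lemma subring_group_funs: "is_subring group_funs"
  unfolding group_funs_def by (rule subring_polyfuns)

lemma clear_denominator:
  assumes "b \<in> group_funs"
  shows "\<exists>k p. p \<in> matrix_polys \<and> (\<forall>A. invertible A \<longrightarrow> p A = det A ^ k * b A)"
  using assms unfolding group_funs_def
proof (induction rule: polyfuns_UNIV_induct)
  case (const c)
  show ?case by (intro exI[of _ 0] exI[of _ "\<lambda>_. c"]) (auto intro: matrix_polys_intros)
next
  case (coord l)
  show ?case
  proof (cases "l = inv_det")
    case True
    show ?thesis
      by (intro exI[of _ 1] exI[of _ "\<lambda>_. 1"]) (auto simp: True inv_det_def invertible_det_nz intro: matrix_polys_intros)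
  next
    case False
    then have "l \<in> matrix_polys" using coord by (auto simp: matrix_polys_eq intro: polyfuns_coord)
    then show ?thesis by (intro exI[of _ 0] exI[of _ l]) auto
  qed
next
  case (add f g)
  then obtain k p m q where p: "p \<in> matrix_polys" "\<And>A. invertible A \<Longrightarrow> p A = det A ^ k * f A"
    and q: "q \<in> matrix_polys" "\<And>A. invertible A \<Longrightarrow> q A = det A ^ m * g A" by blast
  show ?case
    using p q by (intro exI[of _ "k + m"] exI[of _ "\<lambda>A. det A ^ m * p A + det A ^ k * q A"])
      (auto simp: power_add algebra_simps intro!: matrix_polys_intros det_matrix_polys)
next
  case (mult f g)
  then obtain k p m q where p: "p \<in> matrix_polys" "\<And>A. invertible A \<Longrightarrow> p A = det A ^ k * f A"
    and q: "q \<in> matrix_polys" "\<And>A. invertible A \<Longrightarrow> q A = det A ^ m * g A" by blast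
  show ?case
    using p q by (intro exI[of _ "k + m"] exI[of _ "\<lambda>A. p A * q A"])
      (auto simp: power_add algebra_simps intro!: matrix_polys_intros)
qed

context poisson_group
begin

definition gvanish :: "('n cmat \<Rightarrow> complex) set" where
  "gvanish = {b \<in> group_funs. \<forall>A\<in>G. b A = 0}"

lemma ideal_gvanish: "is_ideal group_funs gvanish"
  unfolding is_ideal_def
proof (intro conjI ballI)
  note S = is_subringD[OF subring_group_funs]
  show "gvanish \<subseteq> group_funs" by (auto simp: gvanish_def)
  show "0 \<in> gvanish" using S(1) by (simp add: gvanish_def)
  show "x + y \<in> gvanish" if "x \<in> gvanish" "y \<in> gvanish" for x y
    using that S(3)[of x y] by (simp add: gvanish_def)
  show "r * x \<in> gvanish" if "r \<in> group_funs" "x \<in> gvanish" for r x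
    using that S(4)[of r x] by (simp add: gvanish_def)
qed

text \<open>Powers of \<open>det\<close>, nonzero on \<open>G\<close>, clear the denominators and
  reduce the claim to \<open>vanish_prime\<close>.\<close>

lemma gvanish_prime:
  assumes "a \<in> group_funs" "b \<in> group_funs" "\<And>A. A \<in> G \<Longrightarrow> a A * b A = 0"
  shows "a \<in> gvanish \<or> b \<in> gvanish"
proof -
  obtain k p where p: "p \<in> matrix_polys" "\<And>A. invertible A \<Longrightarrow> p A = det A ^ k * a A"
    using clear_denominator[OF assms(1)] by blast
  obtain m q where q: "q \<in> matrix_polys" "\<And>A. invertible A \<Longrightarrow> q A = det A ^ m * b A"
    using clear_denominator[OF assms(2)] by blast
  have "p A * q A = 0" if "A \<in> G" for A
    using p(2)[OF G_invertible[OF that]] q(2)[OF G_invertible[OF that]] assms(3)[OF that] by auto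
  then have "(\<lambda>A. p A * q A) \<in> vanish" using p q by (auto simp: vanish_def intro!: matrix_polys_intros)
  then have "p \<in> vanish \<or> q \<in> vanish" by (rule vanish_prime[OF conn p(1) q(1)])
  then show ?thesis
    using assms(1,2) p(2) q(2) G_invertible by (auto simp: vanish_def gvanish_def invertible_det_nz)
qed

text \<open>The matrix \<open>g\<close> of values on the coordinates is invertible because of
  \<open>inv_det\<close>, and lies in \<open>G\<close> because \<open>G\<close> is closed in the
  invertible matrices.\<close>

lemma group_points:
  assumes \<eta>: "char_of group_funs \<eta>" and van: "\<And>b. b \<in> gvanish \<Longrightarrow> \<eta> b = 0"
  shows "\<exists>g\<in>G. \<forall>b\<in>group_funs. \<eta> b = b g"
proof -
  note \<eta>s = char_ofD[OF \<eta>]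
  define g where "g = (\<chi> i j. \<eta> (\<lambda>A. A $ i $ j))"
  have p: "\<eta> p = p g" if "p \<in> matrix_polys" for p
    using that
  proof (induction rule: matrix_polys_induct)
    case (const c) show ?case by (rule \<eta>s(3))
  next
    case (entry i j) show ?case by (simp add: g_def)
  next
    case (add p q)
    then show ?case using \<eta>s(1)[OF matrix_polys_group_funs matrix_polys_group_funs, of p q] by (simp add: plus_fun_def)
  next
    case (mult p q)
    then show ?case using \<eta>s(2)[OF matrix_polys_group_funs matrix_polys_group_funs, of p q] by (simp add: times_fun_def)
  qed
  have di: "det g * \<eta> inv_det = 1"
  proof -
    note dg = matrix_polys_group_funs[OF det_matrix_polys]
    \<comment> \<open>\<open>det * inv_det\<close> is 1 only on invertible matrices, as
      \<open>inv_det\<close> is 0 on singular ones; the relation is therefore used through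
      \<open>gvanish\<close>.\<close>
    define e where "e A = det A * inv_det A + (- 1)" for A :: "'n cmat"
    have "e \<in> group_funs" unfolding e_def[abs_def]
      by (intro group_funs_intros(1,2) group_funs_intros(3)[OF dg inv_det_group_funs])
    then have e: "e \<in> gvanish" using G_invertible by (simp add: gvanish_def e_def inv_det_def invertible_det_nz)
    have "det * inv_det = e + (\<lambda>_. 1)" by (simp add: fun_eq_iff e_def)
    then have "\<eta> (det * inv_det) = \<eta> (e + (\<lambda>_. 1))" by (rule arg_cong)
    also have "\<dots> = \<eta> e + \<eta> (\<lambda>_. 1)" using e by (intro \<eta>s(1) group_funs_intros) (simp add: gvanish_def)
    finally show ?thesis using van[OF e] \<eta>s(2)[OF dg inv_det_group_funs] \<eta>s(3)[of 1] p[OF det_matrix_polys] by simp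
  qed
  then have inv: "invertible g" by (auto simp: invertible_det_nz)
  have gG: "g \<in> G"
  proof -
    have "closedin (subtopology zariski (carrier GL)) G" using G by (simp add: linear_algebraic_group_def)
    then obtain T where T: "closedin zariski T" "G = T \<inter> carrier GL" by (auto simp: closedin_subtopology)
    have "openin zariski (UNIV :: 'n cmat set)"
      unfolding openin_zariski by (intro exI[of _ "{\<lambda>_. 1}"]) (auto intro: matrix_polys_intros)
    then have "topspace zariski = (UNIV :: 'n cmat set)" using openin_subset by blast
    then have "openin zariski (- T)" using T(1) by (simp add: closedin_def Compl_eq_Diff_UNIV)
    then obtain P where P: "P \<subseteq> matrix_polys" "- T = - {A. \<forall>p\<in>P. p A = 0}" unfolding openin_zariski by blast
    have "q g = 0" if q: "q \<in> P" for q
    proof -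
      have qm: "q \<in> matrix_polys" using q P(1) by blast
      have "q A = 0" if "A \<in> G" for A using that P(2) q T(2) by blast
      then have "q \<in> gvanish" using matrix_polys_group_funs[OF qm] by (simp add: gvanish_def)
      then show ?thesis using van p[OF qm] by simp
    qed
    then have "g \<in> T" using P(2) by blast
    then show ?thesis using T(2) inv by (simp add: GL_def)
  qed
  have "\<eta> b = b g" if "b \<in> group_funs" for b
    using that unfolding group_funs_def
  proof (induction rule: polyfuns_UNIV_induct)
    case (const c) show ?case by (rule \<eta>s(3))
  next
    case (coord l)
    show ?case
    proof (cases "l = inv_det")
      case True
      have "det g \<noteq> 0" using inv by (simp add: invertible_det_nz)
      then have "\<eta> inv_det = 1 / det g" using di by (metis nonzero_mult_div_cancel_left)
      then show ?thesis unfolding True inv_det_def[of g] .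
    next
      case False
      then have "l \<in> matrix_polys" using coord by (auto simp: matrix_polys_eq intro: polyfuns_coord)
      then show ?thesis by (rule p)
    qed
  next
    case (add p q)
    then show ?case using \<eta>s(1)[of p q] by (simp add: plus_fun_def group_funs_def)
  next
    case (mult p q)
    then show ?case using \<eta>s(2)[of p q] by (simp add: times_fun_def group_funs_def)
  qed
  then show ?thesis using gG by blast
qed

lemma pullback_group_funs:
  assumes f: "f \<in> RZ" and \<Psi>: "clin \<Psi>"
  shows "\<exists>b\<in>group_funs. \<forall>A\<in>G. b A = f (act A \<Psi>)"
proof -
  obtain k p where p: "p \<in> matrix_polys" "\<And>A. invertible A \<Longrightarrow> p A = det A ^ k * f (act A \<Psi>)"
    using pullback_polynomial[OF f \<Psi>] by blast
  have "inv_det A ^ k * p A = f (act A \<Psi>)" if "A \<in> G" for A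
    using p(2)[OF G_invertible[OF that]] G_invertible[OF that]
    by (simp add: inv_det_def invertible_det_nz power_divide)
  then show ?thesis
    by (intro bexI[of _ "\<lambda>A. inv_det A ^ k * p A"] ballI
        group_funs_intros(3)[OF group_funs_intros(4)[OF inv_det_group_funs] matrix_polys_group_funs[OF p(1)]])
qed

definition orbit_ideal :: "('n cmat \<Rightarrow> complex) \<Rightarrow> (('n cmat \<Rightarrow> complex) \<Rightarrow> complex) set" where
  "orbit_ideal \<Psi> = {f \<in> RZ. \<forall>g\<in>G. f (act g \<Psi>) = 0}"

text \<open>Pullback along the orbit map embeds the functions on the orbit closure in those on
  \<open>G\<close>, which form a domain.\<close>

lemma orbit_ideal_prime:
  assumes \<Psi>: "clin \<Psi>" and f: "f \<in> RZ" "h \<in> RZ" "(\<lambda>v. f v * h v) \<in> orbit_ideal \<Psi>"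
  shows "f \<in> orbit_ideal \<Psi> \<or> h \<in> orbit_ideal \<Psi>"
proof -
  obtain a where a: "a \<in> group_funs" "\<And>A. A \<in> G \<Longrightarrow> a A = f (act A \<Psi>)" using pullback_group_funs[OF f(1) \<Psi>] by blast
  obtain b where b: "b \<in> group_funs" "\<And>A. A \<in> G \<Longrightarrow> b A = h (act A \<Psi>)" using pullback_group_funs[OF f(2) \<Psi>] by blast
  have "a A * b A = 0" if "A \<in> G" for A using f(3) a(2) b(2) that by (simp add: orbit_ideal_def)
  then have "a \<in> gvanish \<or> b \<in> gvanish" by (rule gvanish_prime[OF a(1) b(1)])
  then show ?thesis using a(2) b(2) f by (auto simp: orbit_ideal_def gvanish_def)
qed

text \<open>A finitely generated submodule of the functions on \<open>G\<close> over the functions on the orbit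
  closure becomes free after inverting \<open>z\<close>; if the constant \<open>1\<close> is a basis vector,
  it is not in the maximal ideal of any point \<open>\<Xi>\<close> of the orbit closure with \<open>z \<Xi> \<noteq> 0\<close> times the submodule.\<close>

lemma generic_freeness:
  fixes e :: "nat \<Rightarrow> 'n cmat \<Rightarrow> complex"
  assumes \<Psi>: "clin \<Psi>" and e0: "e 0 = (\<lambda>_. 1)"
  shows "\<exists>z\<in>RZ. \<exists>I. z \<notin> orbit_ideal \<Psi> \<and> finite I \<and> 0 \<in> I \<and>
    (\<forall>r. (\<forall>i. r i \<in> RZ) \<longrightarrow> (\<forall>A\<in>G. (\<Sum>i\<in>I. r i (act A \<Psi>) * e i A) = 0) \<longrightarrow> (\<forall>i\<in>I. r i \<in> orbit_ideal \<Psi>)) \<and>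
    (\<forall>i<Suc n. \<exists>s. (\<forall>j. s j \<in> RZ) \<and> (\<forall>A\<in>G. z (act A \<Psi>) * e i A = (\<Sum>j\<in>I. s j (act A \<Psi>) * e j A)))"
proof (induction n)
  case 0
  have "(\<lambda>_. 1) \<in> RZ" by (rule polyfuns_const)
  moreover have "(\<lambda>_. 1) \<notin> orbit_ideal \<Psi>" using G_one by (auto simp: orbit_ideal_def)
  ultimately show ?case
    by (intro bexI[of _ "\<lambda>_. 1"] exI[of _ "{0}"]) (auto simp: e0 orbit_ideal_def intro!: exI[of _ "\<lambda>_ _. 1"])
next
  case (Suc n)
  then obtain z I where z: "z \<in> RZ" "z \<notin> orbit_ideal \<Psi>" and I: "finite I" "0 \<in> I"
    and ind: "\<And>r. (\<forall>i. r i \<in> RZ) \<Longrightarrow> (\<forall>A\<in>G. (\<Sum>i\<in>I. r i (act A \<Psi>) * e i A) = 0) \<Longrightarrow> (\<forall>i\<in>I. r i \<in> orbit_ideal \<Psi>)"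
    and span: "\<forall>i<Suc n. \<exists>s. (\<forall>j. s j \<in> RZ) \<and> (\<forall>A\<in>G. z (act A \<Psi>) * e i A = (\<Sum>j\<in>I. s j (act A \<Psi>) * e j A))"
    by blast
  have zero: "(\<lambda>_. 0) \<in> RZ" by (rule polyfuns_const)
  define m where "m = Suc n"
  show ?case
  proof (cases "m \<in> I")
    case True
    have "\<exists>s. (\<forall>j. s j \<in> RZ) \<and> (\<forall>A\<in>G. z (act A \<Psi>) * e m A = (\<Sum>j\<in>I. s j (act A \<Psi>) * e j A))"
    proof (intro exI[of _ "\<lambda>j. if j = m then z else (\<lambda>_. 0)"] conjI allI ballI)
      fix A
      have "(\<Sum>j\<in>I. (if j = m then z else (\<lambda>_. 0)) (act A \<Psi>) * e j A) = (\<Sum>j\<in>I. if j = m then z (act A \<Psi>) * e m A else 0)"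
        by (intro sum.cong) auto
      then show "z (act A \<Psi>) * e m A = (\<Sum>j\<in>I. (if j = m then z else (\<lambda>_. 0)) (act A \<Psi>) * e j A)"
        using True I by simp
    qed (use z zero in auto)
    then have "\<exists>s. (\<forall>j. s j \<in> RZ) \<and> (\<forall>A\<in>G. z (act A \<Psi>) * e i A = (\<Sum>j\<in>I. s j (act A \<Psi>) * e j A))" if i: "i < Suc m" for i
      using span i by (cases "i = m") (simp_all only: m_def less_Suc_eq simp_thms)
    then have "\<forall>i<Suc m. \<exists>s. (\<forall>j. s j \<in> RZ) \<and> (\<forall>A\<in>G. z (act A \<Psi>) * e i A = (\<Sum>j\<in>I. s j (act A \<Psi>) * e j A))"
      by blast
    then show ?thesis unfolding m_def using z I ind by blast
  next
    case mI: False
    let ?I = "insert m I"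
    show ?thesis
    proof (cases "\<forall>r. (\<forall>i. r i \<in> RZ) \<longrightarrow> (\<forall>A\<in>G. (\<Sum>i\<in>?I. r i (act A \<Psi>) * e i A) = 0) \<longrightarrow> (\<forall>i\<in>?I. r i \<in> orbit_ideal \<Psi>)")
      case True
      have "\<exists>s. (\<forall>j. s j \<in> RZ) \<and> (\<forall>A\<in>G. z (act A \<Psi>) * e i A = (\<Sum>j\<in>?I. s j (act A \<Psi>) * e j A))" if i: "i < Suc m" for i
      proof (cases "i = m")
        case True
        show ?thesis
        proof (intro exI[of _ "\<lambda>j. if j = m then z else (\<lambda>_. 0)"] conjI allI ballI)
          fix A
          have "(\<Sum>j\<in>?I. (if j = m then z else (\<lambda>_. 0)) (act A \<Psi>) * e j A) = (\<Sum>j\<in>?I. if j = m then z (act A \<Psi>) * e m A else 0)"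
            by (intro sum.cong) auto
          then show "z (act A \<Psi>) * e i A = (\<Sum>j\<in>?I. (if j = m then z else (\<lambda>_. 0)) (act A \<Psi>) * e j A)"
            using True I by simp
        qed (use z zero in auto)
      next
        case False
        then have "i < Suc n" using i by (simp add: m_def)
        then obtain s where s: "\<And>j. s j \<in> RZ" "\<And>A. A \<in> G \<Longrightarrow> z (act A \<Psi>) * e i A = (\<Sum>j\<in>I. s j (act A \<Psi>) * e j A)"
          using span by blast
        have "(\<Sum>j\<in>?I. (s(m := (\<lambda>_. 0))) j (act A \<Psi>) * e j A) = (\<Sum>j\<in>I. s j (act A \<Psi>) * e j A)" for A
        proof -
          have "(\<Sum>j\<in>I. (s(m := (\<lambda>_. 0))) j (act A \<Psi>) * e j A) = (\<Sum>j\<in>I. s j (act A \<Psi>) * e j A)"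
            using mI by (intro sum.cong) auto
          then show ?thesis using mI I by simp
        qed
        then show ?thesis using s zero by (intro exI[of _ "s(m := (\<lambda>_. 0))"]) auto
      qed
      then show ?thesis unfolding m_def[symmetric] using z True I by (intro bexI[of _ z] exI[of _ ?I]) auto
    next
      case False
      then obtain r where r: "\<And>i. r i \<in> RZ" "\<And>A. A \<in> G \<Longrightarrow> (\<Sum>i\<in>?I. r i (act A \<Psi>) * e i A) = 0"
        and rI: "\<exists>i\<in>?I. r i \<notin> orbit_ideal \<Psi>" by blast
      have split: "r m (act A \<Psi>) * e m A + (\<Sum>i\<in>I. r i (act A \<Psi>) * e i A) = 0" if "A \<in> G" for A
        using r(2)[OF that] mI I by simp
      \<comment> \<open>Otherwise the relation would already be one among the members of
        \<open>I\<close>.\<close>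
      have rm: "r m \<notin> orbit_ideal \<Psi>"
      proof
        assume m: "r m \<in> orbit_ideal \<Psi>"
        have "(\<Sum>i\<in>I. r i (act A \<Psi>) * e i A) = 0" if "A \<in> G" for A
          using split[OF that] m that by (simp add: orbit_ideal_def)
        then have "\<forall>i\<in>I. r i \<in> orbit_ideal \<Psi>" using ind[of r] r(1) by blast
        then show False using rI m by blast
      qed
      \<comment> \<open>After inverting \<open>r m\<close> the relation expresses \<open>e m\<close>
        by the basis, so \<open>r m\<close> joins the denominator.\<close>
      define z' where "z' v = z v * r m v" for v
      have z'R: "z' \<in> RZ" unfolding z'_def[abs_def] by (intro polyfuns_mult z r)
      have z'n: "z' \<notin> orbit_ideal \<Psi>" using orbit_ideal_prime[OF \<Psi> z(1) r(1)[of m]] z(2) rm unfolding z'_def[abs_def] by blast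
      have "\<exists>s. (\<forall>j. s j \<in> RZ) \<and> (\<forall>A\<in>G. z' (act A \<Psi>) * e i A = (\<Sum>j\<in>I. s j (act A \<Psi>) * e j A))" if i: "i < Suc m" for i
      proof (cases "i = m")
        case True
        show ?thesis
        proof (intro exI[of _ "\<lambda>j v. - (z v * r j v)"] conjI allI ballI)
          show "(\<lambda>v. - (z v * r j v)) \<in> RZ" for j by (intro polyfuns_minus polyfuns_mult z r)
          fix A assume A: "A \<in> G"
          have "z (act A \<Psi>) * (r m (act A \<Psi>) * e m A) = z (act A \<Psi>) * - (\<Sum>j\<in>I. r j (act A \<Psi>) * e j A)"
            using split[OF A] by (metis add_eq_0_iff2)
          then show "z' (act A \<Psi>) * e i A = (\<Sum>j\<in>I. - (z (act A \<Psi>) * r j (act A \<Psi>)) * e j A)"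
            by (simp add: True z'_def sum_distrib_left sum_negf mult.assoc)
        qed
      next
        case False
        then have "i < Suc n" using i by (simp add: m_def)
        then obtain s where s: "\<And>j. s j \<in> RZ" "\<And>A. A \<in> G \<Longrightarrow> z (act A \<Psi>) * e i A = (\<Sum>j\<in>I. s j (act A \<Psi>) * e j A)"
          using span by blast
        show ?thesis
        proof (intro exI[of _ "\<lambda>j v. r m v * s j v"] conjI allI ballI)
          show "(\<lambda>v. r m v * s j v) \<in> RZ" for j by (intro polyfuns_mult s r)
          fix A assume A: "A \<in> G"
          have "z' (act A \<Psi>) * e i A = r m (act A \<Psi>) * (z (act A \<Psi>) * e i A)" by (simp add: z'_def)
          then show "z' (act A \<Psi>) * e i A = (\<Sum>j\<in>I. r m (act A \<Psi>) * s j (act A \<Psi>) * e j A)"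
            by (simp add: s(2)[OF A] sum_distrib_left mult.assoc)
        qed
      qed
      then show ?thesis unfolding m_def[symmetric] using z'R z'n I ind by (intro bexI[of _ z'] exI[of _ I]) auto
    qed
  qed
qed

text \<open>Multiply a relation of the excluded kind by \<open>z\<close>, expand it in the basis and
  compare coefficients at \<open>e 0 = 1\<close>: modulo the orbit ideal, \<open>z\<close> is a
  combination of the \<open>\<mu> i\<close>, so \<open>z \<Xi> = 0\<close>.\<close>

lemma unit_not_generated:
  fixes e :: "nat \<Rightarrow> 'n cmat \<Rightarrow> complex"
  assumes \<Psi>: "clin \<Psi>" and e0: "e 0 = (\<lambda>_. 1)"
  shows "\<exists>z\<in>RZ. z \<notin> orbit_ideal \<Psi> \<and> (\<forall>\<Xi> \<mu>. (\<forall>f\<in>orbit_ideal \<Psi>. f \<Xi> = 0) \<longrightarrow> z \<Xi> \<noteq> 0 \<longrightarrow>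
    (\<forall>i. \<mu> i \<in> RZ \<and> \<mu> i \<Xi> = 0) \<longrightarrow> \<not> (\<forall>A\<in>G. (\<Sum>i<Suc n. \<mu> i (act A \<Psi>) * e i A) = 1))"
proof -
  obtain z I where z: "z \<in> RZ" "z \<notin> orbit_ideal \<Psi>" and I: "finite I" "0 \<in> I"
    and ind: "\<And>r. (\<forall>i. r i \<in> RZ) \<Longrightarrow> (\<forall>A\<in>G. (\<Sum>i\<in>I. r i (act A \<Psi>) * e i A) = 0) \<Longrightarrow> (\<forall>i\<in>I. r i \<in> orbit_ideal \<Psi>)"
    and span: "\<forall>i<Suc n. \<exists>s. (\<forall>j. s j \<in> RZ) \<and> (\<forall>A\<in>G. z (act A \<Psi>) * e i A = (\<Sum>j\<in>I. s j (act A \<Psi>) * e j A))"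
    using generic_freeness[where e = e and n = n, OF \<Psi> e0] by blast
  have "\<forall>i. \<exists>s. i < Suc n \<longrightarrow> (\<forall>j. s j \<in> RZ) \<and> (\<forall>A\<in>G. z (act A \<Psi>) * e i A = (\<Sum>j\<in>I. s j (act A \<Psi>) * e j A))"
    using span by blast
  from choice[OF this] obtain s where s': "\<forall>i. i < Suc n \<longrightarrow> (\<forall>j. s i j \<in> RZ) \<and>
     (\<forall>A\<in>G. z (act A \<Psi>) * e i A = (\<Sum>j\<in>I. s i j (act A \<Psi>) * e j A))" by blast
  have s: "s i j \<in> RZ" "A \<in> G \<Longrightarrow> z (act A \<Psi>) * e i A = (\<Sum>j\<in>I. s i j (act A \<Psi>) * e j A)" if "i < Suc n" for i j A
    using s' that by simp_all
  have False if \<Xi>: "\<forall>f\<in>orbit_ideal \<Psi>. f \<Xi> = 0" "z \<Xi> \<noteq> 0" and \<mu>: "\<forall>i. \<mu> i \<in> RZ \<and> \<mu> i \<Xi> = 0"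
    and one: "\<forall>A\<in>G. (\<Sum>i<Suc n. \<mu> i (act A \<Psi>) * e i A) = 1" for \<Xi> \<mu>
  proof -
    \<comment> \<open>Coefficient of the basis element \<open>e j\<close> in the expansion of
      \<open>z\<close> times the relation, minus that of \<open>z\<close> itself.\<close>
    define r where "r j v = (\<Sum>i<Suc n. \<mu> i v * s i j v) - (if j = 0 then 1 else 0) * z v" for j :: nat and v
    have rR: "r j \<in> RZ" for j
      unfolding r_def[abs_def] using \<mu> s(1) z by (intro polyfuns_diff polyfuns_sum polyfuns_mult polyfuns_const) auto
    have "(\<Sum>j\<in>I. r j (act A \<Psi>) * e j A) = 0" if A: "A \<in> G" for A
    proof -
      have "z (act A \<Psi>) = z (act A \<Psi>) * (\<Sum>i<Suc n. \<mu> i (act A \<Psi>) * e i A)" using one A by simp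
      also have "\<dots> = (\<Sum>i<Suc n. \<mu> i (act A \<Psi>) * (z (act A \<Psi>) * e i A))"
        by (simp only: sum_distrib_left mult_ac)
      also have "\<dots> = (\<Sum>i<Suc n. \<mu> i (act A \<Psi>) * (\<Sum>j\<in>I. s i j (act A \<Psi>) * e j A))"
        using s(2)[OF _ A] by (intro sum.cong) auto
      also have "\<dots> = (\<Sum>j\<in>I. (\<Sum>i<Suc n. \<mu> i (act A \<Psi>) * s i j (act A \<Psi>)) * e j A)"
        unfolding sum_distrib_left sum_distrib_right by (subst sum.swap) (simp only: mult.assoc)
      finally have 1: "z (act A \<Psi>) = (\<Sum>j\<in>I. (\<Sum>i<Suc n. \<mu> i (act A \<Psi>) * s i j (act A \<Psi>)) * e j A)" .
      have "(\<Sum>j\<in>I. (if j = 0 then 1 else 0) * z (act A \<Psi>) * e j A) = (\<Sum>j\<in>I. if j = 0 then z (act A \<Psi>) * e 0 A else 0)"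
        by (intro sum.cong) auto
      then have 2: "(\<Sum>j\<in>I. (if j = 0 then 1 else 0) * z (act A \<Psi>) * e j A) = z (act A \<Psi>)" using I by (simp add: e0)
      show ?thesis unfolding r_def left_diff_distrib sum_subtractf 2 1[symmetric] by simp
    qed
    then have "r 0 \<in> orbit_ideal \<Psi>" using ind[of r] rR I(2) by blast
    then have "r 0 \<Xi> = 0" using \<Xi>(1) by blast
    then show False using \<mu> \<Xi>(2) by (simp add: r_def)
  qed
  then show ?thesis using z by blast
qed

text \<open>A point \<open>\<Xi>\<close> of the second orbit is chosen off the exceptional functions
  of the first. Then the fibre over \<open>\<Xi>\<close> of the map from \<open>A\<close> to
  \<open>act A \<Phi>\<close> has a proper ideal, and a character of the quotient is a point of
  \<open>G\<close> that carries \<open>\<Phi>\<close> to \<open>\<Xi>\<close> on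
  \<open>Lie G\<close>.\<close>

theorem orbit_determined:
  assumes \<phi>: "\<phi> \<in> D" and \<psi>: "\<psi> \<in> D"
    and eq: "vanishing_ideal (Lie G) (orb \<phi>) = vanishing_ideal (Lie G) (orb \<psi>)"
  obtains g h where "g \<in> G" "h \<in> G" "coadjoint (Lie G) h \<phi> = coadjoint (Lie G) g \<psi>"
proof -
  define \<Phi> \<Psi> where "\<Phi> = ext_dual \<phi>" and "\<Psi> = ext_dual \<psi>"
  have lin: "clin \<Phi>" "clin \<Psi>" by (simp_all add: \<Phi>_def \<Psi>_def ext_dual_clin \<phi> \<psi>)
  have ideals: "orbit_ideal \<Phi> = orbit_ideal \<Psi>"
    using eq vanishing_orb[OF \<phi>] vanishing_orb[OF \<psi>] unfolding orbit_ideal_def \<Phi>_def \<Psi>_def by blast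
  have span: "countably_spanned (group_funs :: ('n cmat \<Rightarrow> complex) set)"
    unfolding group_funs_def by (rule countably_spanned_polyfuns) (simp add: countable_finite finite_entries)
  then obtain B where B: "B \<subseteq> group_funs" "countable B"
    "\<And>r :: 'n cmat \<Rightarrow> complex. r \<in> group_funs \<Longrightarrow> \<exists>xs. snd ` set xs \<subseteq> B \<and> r = lcomb xs"
    unfolding countably_spanned_def by blast
  have B0: "B \<noteq> {}"
  proof -
    obtain xs where "snd ` set xs \<subseteq> B" "(\<lambda>_. 1) = lcomb xs" using B(3)[OF group_funs_intros(1)] by blast
    then show ?thesis by (cases xs) (auto simp: fun_eq_iff)
  qed
  \<comment> \<open>The constant 1 is put in front of an enumeration of a spanning set, as
    \<open>unit_not_generated\<close> asks for it at index 0.\<close>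
  define e where "e i = (case i of 0 \<Rightarrow> (\<lambda>_. 1) | Suc j \<Rightarrow> from_nat_into B j)" for i
  have e0: "e 0 = (\<lambda>_. 1)" by (simp add: e_def)
  have eB: "\<exists>i. b = e i" if b: "b \<in> B" for b
  proof -
    obtain j where "from_nat_into B j = b" using from_nat_into_surj[OF B(2) b] by blast
    then show ?thesis by (intro exI[of _ "Suc j"]) (simp add: e_def)
  qed
  define good where "good n z \<longleftrightarrow> z \<in> RZ \<and> z \<notin> orbit_ideal \<Phi> \<and> (\<forall>\<Xi> \<mu>. (\<forall>f\<in>orbit_ideal \<Phi>. f \<Xi> = 0) \<longrightarrow> z \<Xi> \<noteq> 0 \<longrightarrow>
    (\<forall>i. \<mu> i \<in> RZ \<and> \<mu> i \<Xi> = 0) \<longrightarrow> \<not> (\<forall>A\<in>G. (\<Sum>i<Suc n. \<mu> i (act A \<Phi>) * e i A) = 1))" for n z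
  have "\<forall>n. \<exists>z. good n z" using unit_not_generated[where e = e, OF lin(1) e0] unfolding good_def by blast
  from choice[OF this] obtain z where z: "\<And>n. good n (z n)" by blast
  \<comment> \<open>The equality of the ideals enters: functions that do not vanish identically on
    the first orbit do not do so on the second.\<close>
  have zR: "z n \<in> RZ" "z n \<notin> orbit_ideal \<Psi>" for n using z[of n] ideals by (simp_all add: good_def)
  have "\<forall>n. \<exists>b. b \<in> group_funs \<and> (\<forall>A\<in>G. b A = z n (act A \<Psi>))" using pullback_group_funs[OF zR(1) lin(2)] by blast
  from choice[OF this] obtain b where b: "\<And>n. b n \<in> group_funs" "\<And>n A. A \<in> G \<Longrightarrow> b n A = z n (act A \<Psi>)" by blast
  have bn: "b n \<notin> gvanish" for n using zR b by (auto simp: gvanish_def orbit_ideal_def)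
  define S where "S = prod_list ` lists (range b)"
  have one: "1 \<notin> gvanish" using G_one by (auto simp: gvanish_def)
  have SR: "prod_list l \<in> group_funs \<and> prod_list l \<notin> gvanish" if "l \<in> lists (range b)" for l
    using that
  proof (induction l)
    case Nil show ?case using one is_subringD(2)[OF subring_group_funs] by (simp only: prod_list.Nil simp_thms)
  next
    case (Cons x l)
    then have x: "x \<in> group_funs" "x \<notin> gvanish" and l: "prod_list l \<in> group_funs" "prod_list l \<notin> gvanish"
      using b(1) bn by auto
    have "x * prod_list l \<in> group_funs" using x l is_subringD(4)[OF subring_group_funs] by blast
    moreover have "x * prod_list l \<notin> gvanish"
      using gvanish_prime[OF x(1) l(1)] x(2) l(2) by (auto simp: gvanish_def)
    ultimately show ?case by (simp only: prod_list.Cons simp_thms)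
  qed
  obtain \<eta> where \<eta>: "char_of group_funs \<eta>" "\<And>x. x \<in> gvanish \<Longrightarrow> \<eta> x = 0" "\<And>s. s \<in> S \<Longrightarrow> \<eta> s \<noteq> 0"
  proof (rule countable_nullstellensatz[OF subring_group_funs group_funs_intros(1) span ideal_gvanish, of S])
    show "countable S" unfolding S_def by (intro countable_image countable_lists) auto
    show "S \<subseteq> group_funs" "gvanish \<inter> S = {}" using SR by (auto simp: S_def)
    show "1 \<in> S" unfolding S_def by (rule image_eqI[of _ _ "[]"]) (simp_all only: prod_list.Nil lists.Nil)
    show "s * t \<in> S" if st: "s \<in> S" "t \<in> S" for s t
    proof -
      from st obtain k l where "s = prod_list k" "t = prod_list l" "k \<in> lists (range b)" "l \<in> lists (range b)"
        by (auto simp: S_def)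
      then show ?thesis unfolding S_def by (intro image_eqI[of _ _ "k @ l"]) (simp_all only: prod_list.append append_in_lists_conv simp_thms)
    qed
  qed (rule that)
  obtain g where g: "g \<in> G" "\<And>b. b \<in> group_funs \<Longrightarrow> \<eta> b = b g" using group_points[OF \<eta>(1,2)] by blast
  define \<Xi> where "\<Xi> = act g \<Psi>"
  have z\<Xi>: "z n \<Xi> \<noteq> 0" for n
  proof -
    have "b n \<in> S" unfolding S_def by (rule image_eqI[of _ _ "[b n]"]) simp_all
    then show ?thesis using \<eta>(3) g b by (metis \<Xi>_def)
  qed
  have ideal\<Xi>: "\<forall>f\<in>orbit_ideal \<Phi>. f \<Xi> = 0" unfolding ideals \<Xi>_def using g(1) by (simp add: orbit_ideal_def)
  \<comment> \<open>The ideal of the fibre over \<open>\<Xi>\<close>, generated on \<open>G\<close>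
    by pullbacks along the first orbit map of functions that vanish at \<open>\<Xi>\<close>.\<close>
  define J where "J = {b \<in> group_funs. \<exists>xs. (\<forall>(\<mu>, c)\<in>set xs. \<mu> \<in> RZ \<and> \<mu> \<Xi> = 0 \<and> c \<in> group_funs) \<and>
     (\<forall>A\<in>G. b A = (\<Sum>(\<mu>, c)\<leftarrow>xs. \<mu> (act A \<Phi>) * c A))}"
  have J: "is_ideal group_funs J"
    unfolding is_ideal_def
  proof (intro conjI ballI)
    note S = is_subringD[OF subring_group_funs]
    show "J \<subseteq> group_funs" by (auto simp: J_def)
    show "0 \<in> J" using S(1) by (auto simp: J_def intro!: exI[of _ "[]"])
    show "x + y \<in> J" if xy: "x \<in> J" "y \<in> J" for x y
    proof -
      from xy obtain xs ys where "\<forall>(\<mu>, c)\<in>set xs. \<mu> \<in> RZ \<and> \<mu> \<Xi> = 0 \<and> c \<in> group_funs"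
        "\<forall>A\<in>G. x A = (\<Sum>(\<mu>, c)\<leftarrow>xs. \<mu> (act A \<Phi>) * c A)" "\<forall>(\<mu>, c)\<in>set ys. \<mu> \<in> RZ \<and> \<mu> \<Xi> = 0 \<and> c \<in> group_funs"
        "\<forall>A\<in>G. y A = (\<Sum>(\<mu>, c)\<leftarrow>ys. \<mu> (act A \<Phi>) * c A)" unfolding J_def by blast
      moreover have "x \<in> group_funs" "y \<in> group_funs" using xy by (simp_all add: J_def)
      then have "x + y \<in> group_funs" by (rule S(3))
      ultimately show ?thesis unfolding J_def by (auto intro!: exI[of _ "xs @ ys"])
    qed
    show "r * x \<in> J" if rx: "r \<in> group_funs" "x \<in> J" for r x
    proof -
      from rx obtain xs where xs: "\<forall>(\<mu>, c)\<in>set xs. \<mu> \<in> RZ \<and> \<mu> \<Xi> = 0 \<and> c \<in> group_funs"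
        "\<forall>A\<in>G. x A = (\<Sum>(\<mu>, c)\<leftarrow>xs. \<mu> (act A \<Phi>) * c A)" unfolding J_def by blast
      have "(\<Sum>(\<mu>, c)\<leftarrow>map (\<lambda>(\<mu>, c). (\<mu>, \<lambda>A. r A * c A)) xs. \<mu> (act A \<Phi>) * c A) = r A * (\<Sum>(\<mu>, c)\<leftarrow>xs. \<mu> (act A \<Phi>) * c A)" for A
        by (induction xs) (auto simp: algebra_simps)
      moreover have "\<forall>(\<mu>, c)\<in>set (map (\<lambda>(\<mu>, c). (\<mu>, \<lambda>A. r A * c A)) xs). \<mu> \<in> RZ \<and> \<mu> \<Xi> = 0 \<and> c \<in> group_funs"
        using xs(1) rx(1) by (auto intro!: group_funs_intros)
      moreover have "x \<in> group_funs" using rx(2) by (simp add: J_def)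
      then have "r * x \<in> group_funs" by (rule S(4)[OF rx(1)])
      ultimately show ?thesis using xs(2) unfolding J_def
        by (intro CollectI conjI exI[of _ "map (\<lambda>(\<mu>, c). (\<mu>, \<lambda>A. r A * c A)) xs"]) auto
    qed
  qed
  have in_J: "b \<in> J" if "\<mu> \<in> RZ" "\<mu> \<Xi> = 0" "b \<in> group_funs" "\<And>A. A \<in> G \<Longrightarrow> b A = \<mu> (act A \<Phi>)" for \<mu> b
    using that unfolding J_def by (intro CollectI conjI exI[of _ "[(\<mu>, \<lambda>_. 1)]"]) (auto intro: group_funs_intros)
  have gv_J: "gvanish \<subseteq> J"
    unfolding J_def gvanish_def by (auto intro!: exI[of _ "[]"])
  \<comment> \<open>Normal form for members of \<open>J\<close>: the coefficients are collected
    along the family \<open>e\<close>, the shape in which the choice of \<open>\<Xi>\<close>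
    excludes the constant 1.\<close>
  define repr where "repr f \<longleftrightarrow> (\<exists>n \<mu>. (\<forall>i. \<mu> i \<in> RZ \<and> \<mu> i \<Xi> = 0) \<and>
    (\<forall>A\<in>G. f A = (\<Sum>i<Suc n. \<mu> i (act A \<Phi>) * e i A)))" for f :: "'n cmat \<Rightarrow> complex"
  have zero: "(\<lambda>_. 0) \<in> RZ" by (rule polyfuns_const)
  have repr_add: "repr (\<lambda>A. f A + h A)" if "repr f" "repr h" for f h
  proof -
    have pad: "(\<Sum>i<Suc (n + k). (if i < Suc n then \<mu> i else (\<lambda>_. 0)) v * w i) = (\<Sum>i<Suc n. \<mu> i v * w i)"
      for n k and \<mu> :: "nat \<Rightarrow> ('n cmat \<Rightarrow> complex) \<Rightarrow> complex" and v and w :: "nat \<Rightarrow> complex"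
      by (rule sum.mono_neutral_cong_right) auto
    from that obtain n \<mu> m \<nu> where \<mu>: "\<And>i. \<mu> i \<in> RZ \<and> \<mu> i \<Xi> = 0" "\<And>A. A \<in> G \<Longrightarrow> f A = (\<Sum>i<Suc n. \<mu> i (act A \<Phi>) * e i A)"
      and \<nu>: "\<And>i. \<nu> i \<in> RZ \<and> \<nu> i \<Xi> = 0" "\<And>A. A \<in> G \<Longrightarrow> h A = (\<Sum>i<Suc m. \<nu> i (act A \<Phi>) * e i A)"
      unfolding repr_def by blast
    define \<rho> where "\<rho> i v = (if i < Suc n then \<mu> i else (\<lambda>_. 0)) v + (if i < Suc m then \<nu> i else (\<lambda>_. 0)) v" for i v
    have "\<rho> i \<in> RZ \<and> \<rho> i \<Xi> = 0" for i
      unfolding \<rho>_def[abs_def] using \<mu>(1) \<nu>(1) zero by (auto intro!: polyfuns_add)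
    moreover have "f A + h A = (\<Sum>i<Suc (n + m). \<rho> i (act A \<Phi>) * e i A)" if "A \<in> G" for A
    proof -
      have "(\<Sum>i<Suc (n + m). \<rho> i (act A \<Phi>) * e i A) =
         (\<Sum>i<Suc (n + m). (if i < Suc n then \<mu> i else (\<lambda>_. 0)) (act A \<Phi>) * e i A) +
         (\<Sum>i<Suc (m + n). (if i < Suc m then \<nu> i else (\<lambda>_. 0)) (act A \<Phi>) * e i A)"
        unfolding \<rho>_def distrib_right sum.distrib by (simp only: add.commute[of n m])
      then show ?thesis unfolding pad using \<mu>(2) \<nu>(2) that by simp
    qed
    ultimately show ?thesis unfolding repr_def by blast
  qed
  have repr_zero: "repr (\<lambda>_. 0)" unfolding repr_def using zero by (intro exI[of _ 0] exI[of _ "\<lambda>_ _. 0"]) auto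
  have repr_one: "repr (\<lambda>A. \<mu> (act A \<Phi>) * c A)" if \<mu>: "\<mu> \<in> RZ" "\<mu> \<Xi> = 0" and c: "c \<in> group_funs" for \<mu> c
  proof -
    obtain xs where xs: "snd ` set xs \<subseteq> B" "c = lcomb xs" using B(3)[OF c] by blast
    have "repr (\<lambda>A. \<mu> (act A \<Phi>) * lcomb xs A)" using xs(1)
    proof (induction xs)
      case Nil then show ?case using repr_zero by simp
    next
      case (Cons x xs)
      have "snd x \<in> B" using Cons.prems by simp
      from eB[OF this] obtain i where i: "snd x = e i" ..
      define \<nu> where "\<nu> j = (if j = i then (\<lambda>v. fst x * \<mu> v) else (\<lambda>_. 0))" for j
      have "\<nu> j \<in> RZ \<and> \<nu> j \<Xi> = 0" for j
        using \<mu> zero by (auto simp: \<nu>_def intro!: polyfuns_mult polyfuns_const)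
      moreover have "\<mu> (act A \<Phi>) * (fst x * snd x A) = (\<Sum>j<Suc i. \<nu> j (act A \<Phi>) * e j A)" for A
      proof -
        have "(\<Sum>j<Suc i. \<nu> j (act A \<Phi>) * e j A) = (\<Sum>j<Suc i. if j = i then fst x * \<mu> (act A \<Phi>) * e i A else 0)"
          by (intro sum.cong) (auto simp: \<nu>_def)
        then show ?thesis by (simp add: i)
      qed
      ultimately have "repr (\<lambda>A. \<mu> (act A \<Phi>) * (fst x * snd x A))" unfolding repr_def by blast
      moreover have "repr (\<lambda>A. \<mu> (act A \<Phi>) * lcomb xs A)" using Cons by auto
      ultimately show ?case using repr_add by (simp add: distrib_left)
    qed
    then show ?thesis using xs(2) by simp
  qed
  have "1 \<notin> J"
  proof
    assume "1 \<in> J"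
    then obtain xs where xs: "\<forall>(\<mu>, c)\<in>set xs. \<mu> \<in> RZ \<and> \<mu> \<Xi> = 0 \<and> c \<in> group_funs"
      "\<forall>A\<in>G. 1 = (\<Sum>(\<mu>, c)\<leftarrow>xs. \<mu> (act A \<Phi>) * c A)" by (auto simp: J_def)
    have "repr (\<lambda>A. \<Sum>(\<mu>, c)\<leftarrow>xs. \<mu> (act A \<Phi>) * c A)" using xs(1)
    proof (induction xs)
      case Nil then show ?case using repr_zero by simp
    next
      case (Cons x xs)
      obtain \<mu> c where x: "x = (\<mu>, c)" by (cases x)
      have "repr (\<lambda>A. \<mu> (act A \<Phi>) * c A)" using Cons.prems x by (intro repr_one) auto
      moreover have "repr (\<lambda>A. \<Sum>(\<mu>, c)\<leftarrow>xs. \<mu> (act A \<Phi>) * c A)" using Cons by auto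
      ultimately show ?case using repr_add by (simp add: x)
    qed
    then obtain n \<mu> where \<mu>: "\<forall>i. \<mu> i \<in> RZ \<and> \<mu> i \<Xi> = 0"
      "\<forall>A\<in>G. (\<Sum>(\<mu>, c)\<leftarrow>xs. \<mu> (act A \<Phi>) * c A) = (\<Sum>i<Suc n. \<mu> i (act A \<Phi>) * e i A)"
      unfolding repr_def by (elim exE conjE)
    have "\<not> (\<forall>A\<in>G. (\<Sum>i<Suc n. \<mu> i (act A \<Phi>) * e i A) = 1)"
      using z[of n, unfolded good_def, THEN conjunct2, THEN conjunct2,
        THEN spec[of _ \<Xi>], THEN spec[of _ \<mu>], THEN mp, OF ideal\<Xi>, THEN mp, OF z\<Xi>, THEN mp, OF \<mu>(1)] .
    then show False using xs(2) \<mu>(2) by (simp del: sum.lessThan_Suc)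
  qed
  \<comment> \<open>With the multiplicative set \<open>{1}\<close> the theorem becomes the usual
    Nullstellensatz for a proper ideal.\<close>
  then have disj: "J \<inter> {1} = {}" by blast
  obtain \<theta> where \<theta>: "char_of group_funs \<theta>" "\<And>x. x \<in> J \<Longrightarrow> \<theta> x = 0"
  proof (rule countable_nullstellensatz[OF subring_group_funs group_funs_intros(1) span J _ _ _ _ disj])
    show "countable {1}" "{1} \<subseteq> group_funs" "1 \<in> {1}"
      using is_subringD(2)[OF subring_group_funs] by simp_all
    show "s * t \<in> {1}" if "s \<in> {1}" "t \<in> {1}" for s t :: "'n cmat \<Rightarrow> complex"
      using that by (simp only: singleton_iff mult_1)
  qed (rule that)
  obtain h where h: "h \<in> G" "\<And>b. b \<in> group_funs \<Longrightarrow> \<theta> b = b h" using group_points[OF \<theta>(1)] \<theta>(2) gv_J by blast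
  \<comment> \<open>A coordinate minus its value at \<open>\<Xi>\<close> pulls back into
    \<open>J\<close>, hence vanishes at \<open>h\<close>.\<close>
  have "act h \<Phi> (proj (unit_mat i j)) = \<Xi> (proj (unit_mat i j))" for i j
  proof -
    define \<mu> where "\<mu> v = v (proj (unit_mat i j)) - \<Xi> (proj (unit_mat i j))" for v :: "'n cmat \<Rightarrow> complex"
    have "\<mu> \<in> RZ" unfolding \<mu>_def[abs_def]
      by (intro polyfuns_diff polyfuns_const polyfuns_coord) (force simp: gens_def)
    moreover obtain a where a: "a \<in> group_funs" "\<And>A. A \<in> G \<Longrightarrow> a A = \<mu> (act A \<Phi>)"
      using pullback_group_funs[OF \<open>\<mu> \<in> RZ\<close> lin(1)] by blast
    ultimately have "a \<in> J" by (intro in_J[of \<mu>]) (auto simp: \<mu>_def)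
    then have "a h = 0" using \<theta>(2) h(2) a(1) by force
    then show ?thesis using a(2)[OF h(1)] by (simp add: \<mu>_def)
  qed
  then have "ell X (act h \<Phi>) = ell X \<Xi>" for X by (simp add: ell_def)
  moreover have "clin (act h \<Phi>)" "clin \<Xi>" by (simp_all add: \<Xi>_def act_clin lin)
  then have "ell X (act h \<Phi>) = act h \<Phi> X" "ell X \<Xi> = \<Xi> X" if "X \<in> Lie G" for X
    using dual_expand[OF restrict_dual that] that by (simp_all add: ell_def proj)
  ultimately have "act h \<Phi> X = \<Xi> X" if "X \<in> Lie G" for X using that by metis
  then have "restrict (act h \<Phi>) (Lie G) = restrict \<Xi> (Lie G)" by (rule restrict_ext)
  then have "coadjoint (Lie G) h \<phi> = coadjoint (Lie G) g \<psi>"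
    using coadjoint_act[OF h(1) \<phi>] coadjoint_act[OF g(1) \<psi>] by (simp only: \<Phi>_def \<Psi>_def \<Xi>_def)
  then show ?thesis using that g(1) h(1) by blast
qed

section \<open>The bijection between orbits and annihilators\<close>

lemma coadjoint_mult: "a \<in> G \<Longrightarrow> b \<in> G \<Longrightarrow> \<phi> \<in> D \<Longrightarrow>
    coadjoint (Lie G) (a ** b) \<phi> = coadjoint (Lie G) a (coadjoint (Lie G) b \<phi>)"
  unfolding coadjoint_def
  by (rule restrict_ext) (simp add: Ad_Lie matrix_inv_mult G_invertible matrix_mul_assoc)

lemma orb_coadjoint:
  assumes g: "g \<in> G" and \<phi>: "\<phi> \<in> D"
  shows "orb (coadjoint (Lie G) g \<phi>) = orb \<phi>"
proof (intro equalityI subsetI)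
  fix \<psi> assume "\<psi> \<in> orb (coadjoint (Lie G) g \<phi>)"
  then obtain a where "a \<in> G" "\<psi> = coadjoint (Lie G) (a ** g) \<phi>" using coadjoint_mult g \<phi> by (auto simp: orb_def)
  then show "\<psi> \<in> orb \<phi>" using G_mult g by (auto simp: orb_def)
next
  fix \<psi> assume "\<psi> \<in> orb \<phi>"
  then obtain a where a: "a \<in> G" "\<psi> = coadjoint (Lie G) a \<phi>" by (auto simp: orb_def)
  have e: "a = a ** matrix_inv g ** g"
    using matrix_inv(2)[OF G_invertible[OF g]] by (simp add: matrix_mul_assoc[symmetric])
  have "\<psi> = coadjoint (Lie G) (a ** matrix_inv g) (coadjoint (Lie G) g \<phi>)"
    unfolding a(2) by (subst e) (rule coadjoint_mult[OF G_mult[OF a(1) G_inv[OF g]] g \<phi>])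
  then show "\<psi> \<in> orb (coadjoint (Lie G) g \<phi>)" using G_mult[OF a(1) G_inv[OF g]] by (auto simp: orb_def)
qed

lemma simple_annihilator:
  fixes M :: "(('n cmat \<Rightarrow> complex) \<Rightarrow> complex, 'm) module"
  assumes "simple_poisson_module Z br M nabla"
  shows "\<exists>\<phi>\<in>D. annihilator Z M = vanishing_ideal (Lie G) (orb \<phi>)"
proof -
  have P: "poisson_module Z br M nabla" using assms by (simp add: simple_poisson_module_def)
  interpret A: affine_simple_module D "lin (Lie G) ` Lie G" br M nabla gens
    by (intro affine_simple_module.intro simple_module.intro simple_module_axioms.intro
        affine_simple_module_axioms.intro P assms finite_gens restr) (rule points, assumption, blast)
  show ?thesis using A.annihilator_is_core brackets_vanish_orbit by auto
qed

lemma orbit_annihilator: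
  assumes \<phi>: "\<phi> \<in> D"
  shows "\<exists>(M :: (('n cmat \<Rightarrow> complex) \<Rightarrow> complex, (('n cmat \<Rightarrow> complex) \<Rightarrow> complex) \<Rightarrow> complex) module) nabla.
    simple_poisson_module Z br M nabla \<and> annihilator Z M = vanishing_ideal (Lie G) (orb \<phi>)"
proof -
  interpret C: poisson_character Z br "\<lambda>f. f \<phi>"
    by (intro poisson_character.intro poisson_character_axioms.intro at_D[OF \<phi>]) (rule poisson_algebra_axioms)
  show ?thesis
    using C.delta_module_simple C.annihilator_delta_module brackets_vanish_orbit[OF \<phi>]
    unfolding brackets_vanish_def by blast
qed

lemma simple_annihilators_subset:
  "simple_annihilators TYPE('k) Z br \<subseteq> vanishing_ideal (Lie G) ` orb ` D"
proof
  fix P assume "P \<in> simple_annihilators TYPE('k) Z br"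
  then obtain M :: "(('n cmat \<Rightarrow> complex) \<Rightarrow> complex, 'k) module" and nabla
    where "P = annihilator Z M" "simple_poisson_module Z br M nabla" by (auto simp: simple_annihilators_def)
  then show "P \<in> vanishing_ideal (Lie G) ` orb ` D" using simple_annihilator by blast
qed

lemma orbit_ideals_subset:
  "vanishing_ideal (Lie G) ` orb ` D \<subseteq> simple_annihilators TYPE((('n cmat \<Rightarrow> complex) \<Rightarrow> complex) \<Rightarrow> complex) Z br"
unfolding image_image
proof (intro image_subsetI)
  fix \<phi> assume "\<phi> \<in> D"
  from orbit_annihilator[OF this] obtain M :: "(('n cmat \<Rightarrow> complex) \<Rightarrow> complex, (('n cmat \<Rightarrow> complex) \<Rightarrow> complex) \<Rightarrow> complex) module"
    and nabla where "simple_poisson_module Z br M nabla \<and> annihilator Z M = vanishing_ideal (Lie G) (orb \<phi>)"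
    by (elim exE)
  then show "vanishing_ideal (Lie G) (orb \<phi>) \<in> simple_annihilators TYPE((('n cmat \<Rightarrow> complex) \<Rightarrow> complex) \<Rightarrow> complex) Z br"
    unfolding simple_annihilators_def by (intro CollectI exI[of _ M] exI[of _ nabla]) simp
qed

lemma inj_vanishing_ideal: "inj_on (vanishing_ideal (Lie G)) (orb ` D)"
proof (rule inj_onI)
  fix O1 O2 assume "O1 \<in> orb ` D" "O2 \<in> orb ` D" and e: "vanishing_ideal (Lie G) O1 = vanishing_ideal (Lie G) O2"
  then obtain \<phi> \<psi> where \<phi>: "\<phi> \<in> D" "O1 = orb \<phi>" and \<psi>: "\<psi> \<in> D" "O2 = orb \<psi>" by (elim imageE)
  obtain g h where "g \<in> G" "h \<in> G" "coadjoint (Lie G) h \<phi> = coadjoint (Lie G) g \<psi>"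
    using orbit_determined[OF \<phi>(1) \<psi>(1) e[unfolded \<phi>(2) \<psi>(2)]] by blast
  then show "O1 = O2" using orb_coadjoint \<phi> \<psi> by metis
qed

end

text \<open>The delta modules consist of functionals on the coordinate algebra, so their element
  type already realises the annihilator belonging to every orbit. That each annihilator comes from
  an orbit holds for modules over an arbitrary element type, which gives the second
  conjunct.\<close>

theorem mainTheorem4:
  fixes G :: "'n::finite cmat set"
    and br :: "(('n cmat \<Rightarrow> complex) \<Rightarrow> complex) \<Rightarrow> (('n cmat \<Rightarrow> complex) \<Rightarrow> complex) \<Rightarrow>
      (('n cmat \<Rightarrow> complex) \<Rightarrow> complex)"
  assumes "linear_algebraic_group G"
    and "connectedin zariski G"
    and "lie_poisson_bracket (Lie G) br"
  shows "bij_betw (vanishing_ideal (Lie G)) (coadjoint_orbits G)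
      (simple_annihilators TYPE((('n cmat \<Rightarrow> complex) \<Rightarrow> complex) \<Rightarrow> complex)
        (coord_algebra (Lie G)) br)
    \<and> simple_annihilators TYPE('m) (coord_algebra (Lie G)) br
      \<subseteq> simple_annihilators TYPE((('n cmat \<Rightarrow> complex) \<Rightarrow> complex) \<Rightarrow> complex)
        (coord_algebra (Lie G)) br"
proof -
  interpret poisson_group G br using assms by (intro poisson_group.intro alg_group.intro poisson_group_axioms.intro)
  have Z: "coord_algebra (Lie G) = Z" by (simp add: coord_algebra_def)
  show ?thesis
    unfolding Z coadjoint_orbits_eq bij_betw_def
    by (intro conjI inj_vanishing_ideal subset_antisym simple_annihilators_subset orbit_ideals_subset
        subset_trans[OF simple_annihilators_subset orbit_ideals_subset])
qed

end
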